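(* Let $\nu$ be a Borel probability measure on $\mathbb{R}^2$. Then $\nu\in\mathcal{BID}$ if and only if there exists a weakly continuous $\boxplus\boxplus$-semigroup $\{\nu_t\}_{t\ge0}$ of probability measures on $\mathbb{R}^2$ satisfying $\nu_1=\nu$ and $R_{\nu_t}=t\,R_\nu$ in $(\mathbb{C}\setminus\mathbb{R})^2$.
   Context: For a Borel probability measure $\mu$ on $\mathbb{R}^2$, its marginals are $\mu^{(j)}=\mu\circ\pi_j^{-1}$, $j=1,2$, where $\pi_1(s,t)=s$, $\pi_2(s,t)=t$, and its Cauchy transform is $G_\mu(z,w)=\int_{\mathbb{R}^2}\frac{1}{(z-s)(w-t)}\,d\mu(s,t)$ for $z,w\in\mathbb{C}\setminus\mathbb{R}$. For a probability measure $m$ on $\mathbb{R}$, $G_m(z)=\int_{\mathbb{R}}\frac{1}{z-x}\,dm(x)$, $z\notin\mathbb{R}$. For $\alpha,\beta>0$ the Stolz angle is $\Delta=\Delta_{\alpha,\beta}=\{x+iy\in\mathbb{C}: y<0,\ |x|<-\alpha y,\ y>-\beta\}$, $\overline{\Delta}=\{\bar z:z\in\Delta\}$ is its reflection, and the associated product domain is $\Omega=(\Delta\cup\overline\Delta)\times(\Delta\cup\overline\Delta)$. The one-dimensional $R$-transform $R_m$ of a probability measure $m$ on $\mathbb{R}$ is the holomorphic function on $\Delta\cup\overline\Delta$ (for a sufficiently small Stolz angle $\Delta$) with $1/z+R_m(z)\notin\mathbb{R}$, $G_m(1/z+R_m(z))=z$, and $zR_m(z)\to0$ as $z\to0$ in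 $\Delta\cup\overline\Delta$. The bi-free partial $R$-transform of a probability measure $\mu$ on $\mathbb{R}^2$ is $$R_\mu(z,w)=zR_{\mu^{(1)}}(z)+wR_{\mu^{(2)}}(w)+\left[1-\frac{1}{h_\mu(z,w)}\right],\quad h_\mu(z,w)=\frac{G_\mu\left(1/z+R_{\mu^{(1)}}(z),\,1/w+R_{\mu^{(2)}}(w)\right)}{zw},$$ which is defined and holomorphic on a product domain $\Omega$ (with $\Delta$ small enough) on which $R_{\mu^{(1)}},R_{\mu^{(2)}}$ are defined and $h_\mu$ has no zeros; $R_\mu$ determines $\mu$. An identity between $R$-transforms "in $(\mathbb{C}\setminus\mathbb{R})^2$" refers to their holomorphic extensions from $\Omega$ to $(\mathbb{C}\setminus\mathbb{R})^2$. $\mathcal{BID}$ is the class of bi-freely infinitely divisible laws: probability measures $\nu$ on $\mathbb{R}^2$ such that for each integer $m\ge2$ there is a probability measure $\mu_m$ on $\mathbb{R}^2$ with $R_\nu=mR_{\mu_m}$ on the domain $\Omega$ of $R_\nu$. The (generalized) bi-free convolution $\mu_1\boxplus\boxplus\mu_2$ is the probability measure characterized by $R_{\mu_1\boxplus\boxplus\mu_2}=R_{\mu_1}+R_{\mu_2}$. A family $\{\nu_t\}_{t\ge0}$ of probability measures on $\mathbb{R}^2$ is a weakly continuous $\boxplus\boxplus$-semigroup if $\nu_{s+t}=\nu_s\boxplus\boxplus\nu_t$ for all $s,t\ge0$ and $\nu_t$ converges weakly to $\nu_0=\delta_{(0,0)}$ as $t\to0^+$. *)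

theory Defs
  imports "HOL-Probability.Probability" "HOL-Complex_Analysis.Complex_Analysis"
begin

definition borel_prob :: "'a::topological_space measure \<Rightarrow> bool" where
  "borel_prob M \<longleftrightarrow> prob_space M \<and> sets M = sets borel"

definition marginal1 :: "(real \<times> real) measure \<Rightarrow> real measure" where
  "marginal1 \<mu> = distr \<mu> borel fst"

definition marginal2 :: "(real \<times> real) measure \<Rightarrow> real measure" where
  "marginal2 \<mu> = distr \<mu> borel snd"

definition cauchy_transform :: "real measure \<Rightarrow> complex \<Rightarrow> complex" where
  "cauchy_transform m z = (\<integral>x. 1 / (z - complex_of_real x) \<partial>m)"

definition cauchy_transform2 :: "(real \<times> real) measure \<Rightarrow> complex \<Rightarrow> complex \<Rightarrow> complex" where
  "cauchy_transform2 \<mu> z w =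
     (\<integral>p. 1 / ((z - complex_of_real (fst p)) * (w - complex_of_real (snd p))) \<partial>\<mu>)"

definition stolz_angle :: "real \<Rightarrow> real \<Rightarrow> complex set" where
  "stolz_angle \<alpha> \<beta> = {z. Im z < 0 \<and> \<bar>Re z\<bar> < - \<alpha> * Im z \<and> Im z > - \<beta>}"

definition stolz_pair :: "real \<Rightarrow> real \<Rightarrow> complex set" where
  "stolz_pair \<alpha> \<beta> = stolz_angle \<alpha> \<beta> \<union> cnj ` stolz_angle \<alpha> \<beta>"

definition stolz_domain :: "real \<Rightarrow> real \<Rightarrow> (complex \<times> complex) set" where
  "stolz_domain \<alpha> \<beta> = stolz_pair \<alpha> \<beta> \<times> stolz_pair \<alpha> \<beta>"

text \<open>
  R-transforms are only defined on sufficiently small Stolz angles, with no canonical choice of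
  domain. They are therefore rendered as relations: \<open>R_transform_on m \<alpha> \<beta> R\<close> says that the
  R-transform of \<open>m\<close> is defined on the domain given by \<open>\<alpha>, \<beta>\<close> and that \<open>R\<close> represents it there;
  the values of \<open>R\<close> outside that domain are irrelevant.
\<close>

definition R_transform_on :: "real measure \<Rightarrow> real \<Rightarrow> real \<Rightarrow> (complex \<Rightarrow> complex) \<Rightarrow> bool" where
  "R_transform_on m \<alpha> \<beta> R \<longleftrightarrow>
     R holomorphic_on stolz_pair \<alpha> \<beta> \<and>
     (\<forall>z \<in> stolz_pair \<alpha> \<beta>.
        1 / z + R z \<notin> \<real> \<and> cauchy_transform m (1 / z + R z) = z) \<and>
     ((\<lambda>z. z * R z) \<longlongrightarrow> 0) (at 0 within stolz_pair \<alpha> \<beta>)"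

definition h_fun ::
  "(real \<times> real) measure \<Rightarrow> (complex \<Rightarrow> complex) \<Rightarrow> (complex \<Rightarrow> complex) \<Rightarrow> complex \<Rightarrow> complex \<Rightarrow> complex"
  where
  "h_fun \<mu> R1 R2 z w = cauchy_transform2 \<mu> (1 / z + R1 z) (1 / w + R2 w) / (z * w)"

definition bifree_R_transform_on ::
  "(real \<times> real) measure \<Rightarrow> real \<Rightarrow> real \<Rightarrow> (complex \<times> complex \<Rightarrow> complex) \<Rightarrow> bool" where
  "bifree_R_transform_on \<mu> \<alpha> \<beta> R \<longleftrightarrow>
     (\<exists>R1 R2. R_transform_on (marginal1 \<mu>) \<alpha> \<beta> R1 \<and>
              R_transform_on (marginal2 \<mu>) \<alpha> \<beta> R2 \<and>
              (\<forall>(z, w) \<in> stolz_domain \<alpha> \<beta>.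
                 h_fun \<mu> R1 R2 z w \<noteq> 0 \<and>
                 R (z, w) = z * R1 z + w * R2 w + (1 - 1 / h_fun \<mu> R1 R2 z w)))"

text \<open>Holomorphy in two variables: Frechet differentiability with complex linear derivative.\<close>

definition holomorphic2_on ::
  "(complex \<times> complex \<Rightarrow> complex) \<Rightarrow> (complex \<times> complex) set \<Rightarrow> bool" where
  "holomorphic2_on F D \<longleftrightarrow>
     (\<forall>p\<in>D. \<exists>a b. (F has_derivative (\<lambda>v. a * fst v + b * snd v)) (at p within D))"

text \<open>
  Every \<open>stolz_domain\<close> meets all four components of \<open>(- \<real>) \<times> (- \<real>)\<close>, so such an extension is
  unique on that set.
\<close>

definition bifree_R_extension ::
  "(real \<times> real) measure \<Rightarrow> (complex \<times> complex \<Rightarrow> complex) \<Rightarrow> bool" where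
  "bifree_R_extension \<mu> F \<longleftrightarrow>
     holomorphic2_on F ((- \<real>) \<times> (- \<real>)) \<and>
     (\<exists>\<alpha>>0. \<exists>\<beta>>0. bifree_R_transform_on \<mu> \<alpha> \<beta> F)"

text \<open>The third measure is the generalized bi-free convolution of the first two.\<close>

definition is_bifree_convolution ::
  "(real \<times> real) measure \<Rightarrow> (real \<times> real) measure \<Rightarrow> (real \<times> real) measure \<Rightarrow> bool" where
  "is_bifree_convolution \<mu>1 \<mu>2 \<mu> \<longleftrightarrow>
     borel_prob \<mu>1 \<and> borel_prob \<mu>2 \<and> borel_prob \<mu> \<and>
     (\<exists>\<alpha>>0. \<exists>\<beta>>0. \<exists>R1 R2 R.
        bifree_R_transform_on \<mu>1 \<alpha> \<beta> R1 \<and>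
        bifree_R_transform_on \<mu>2 \<alpha> \<beta> R2 \<and>
        bifree_R_transform_on \<mu> \<alpha> \<beta> R \<and>
        (\<forall>p \<in> stolz_domain \<alpha> \<beta>. R p = R1 p + R2 p))"

definition BID :: "(real \<times> real) measure set" where
  "BID = {\<nu>. borel_prob \<nu> \<and>
     (\<exists>\<alpha>>0. \<exists>\<beta>>0. \<exists>R.
        bifree_R_transform_on \<nu> \<alpha> \<beta> R \<and>
        (\<forall>m::nat. m \<ge> 2 \<longrightarrow>
           (\<exists>\<mu> Rm. borel_prob \<mu> \<and> bifree_R_transform_on \<mu> \<alpha> \<beta> Rm \<and>
              (\<forall>p \<in> stolz_domain \<alpha> \<beta>. R p = of_nat m * Rm p))))}"

definition weakly_converges ::
  "('b \<Rightarrow> 'a::topological_space measure) \<Rightarrow> 'a measure \<Rightarrow> 'b filter \<Rightarrow> bool" where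
  "weakly_converges N M F \<longleftrightarrow>
     (\<forall>f :: 'a \<Rightarrow> real. continuous_on UNIV f \<and> bounded (range f) \<longrightarrow>
        ((\<lambda>t. \<integral>x. f x \<partial>N t) \<longlongrightarrow> (\<integral>x. f x \<partial>M)) F)"

text \<open>The values of \<open>N\<close> at negative times are irrelevant.\<close>

definition bifree_semigroup :: "(real \<Rightarrow> (real \<times> real) measure) \<Rightarrow> bool" where
  "bifree_semigroup N \<longleftrightarrow>
     (\<forall>t\<ge>0. borel_prob (N t)) \<and>
     (\<forall>s\<ge>0. \<forall>t\<ge>0. is_bifree_convolution (N s) (N t) (N (s + t))) \<and>
     N 0 = return borel (0, 0) \<and>
     weakly_converges N (N 0) (at_right 0)"

end

theory Submission
  imports Defs
begin

text \<open>
  Let \<open>\<nu>\<close> be bi-freely infinitely divisible with roots \<open>\<mu>\<^sub>n\<close>, \<open>R\<^sub>\<nu> = n R\<^bsub>\<mu>\<^sub>n\<^esub>\<close>, and let \<open>F\<^sub>1, F\<^sub>2\<close> be the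
  reciprocals of the Cauchy transforms of the marginals of \<open>\<mu>\<^sub>n\<close>. By normal families, \<open>n (z - F\<^sub>j(z))\<close> and
  \<open>n (G\<^bsub>\<mu>\<^sub>n\<^esub> F\<^sub>1 F\<^sub>2 - 1)\<close> converge off the real axis to holomorphic functions \<open>\<phi>\<^sub>j\<close> and \<open>c\<close>; in the
  variables \<open>1/z\<close>, \<open>1/w\<close> they are \<open>R\<^bsub>\<nu>\<^sup>(\<^sup>j\<^sup>)\<^esub>\<close> and \<open>1 - 1/h\<^sub>\<nu>\<close>, which extends \<open>R\<^sub>\<nu>\<close>. The Cauchy-Schwarz
  inequalities for polynomials in the centred resolvents \<open>F\<^sub>1(z)/(z - s) - 1\<close> and \<open>F\<^sub>2(w)/(w - t) - 1\<close> in
  \<open>L\<^sup>2(\<mu>\<^sub>n)\<close>, multiplied by \<open>n\<close>, survive in the limit as inequalities between \<open>\<phi>\<^sub>1\<close>, \<open>\<phi>\<^sub>2\<close> and \<open>c\<close>.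
  For \<open>t \<ge> 0\<close> the equation \<open>u + t \<phi>\<^sub>j(u) = Z\<close> has
  a unique solution in the half-plane of \<open>Z\<close>; with its solutions \<open>z\<close> at \<open>Z\<close> and \<open>w\<close> at \<open>W\<close>, the function
  \<open>1 / (z w (1 - t c(z, w)))\<close> of \<open>(Z, W)\<close> has the positivity that characterises Cauchy transforms of
  probability measures on the plane, and that measure is \<open>\<nu>\<^sub>t\<close>.

  Conversely \<open>R\<close> of \<open>\<nu>\<^bsub>1/m\<^esub>\<close> is \<open>R\<^sub>\<nu> / m\<close> near the origin; the same functional equation, continued
  analytically along the Stolz angle, holds on the whole domain of \<open>R\<^sub>\<nu>\<close>.
\<close>

section \<open>Cauchy transforms\<close>

text \<open>The obstacle is that \<open>t R\<close> has to be the R-transform of a probability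
  measure for every real \<open>t \<ge> 0\<close>, so the measure must be built from its prospective
  Cauchy transform G. A positive measure is recognised by Re (G(cnj Z, W) - G(Z, W)) \<ge> 0 for Im
  Z, Im W > 0, because this is twice the integral of a product of two Poisson kernels. For the limit
  data this positivity involves moments of third and fourth order of the centred resolvents. They
  reduce to second order, since by the resolvent identity |1 + \<xi>|^2 is a linear combination of 1
  + \<xi> and its conjugate. The reduced inequality is homogeneous in the second moments, so it may
  be multiplied by n before the limit and by t after it. It is then used at points u where t times
  the slope -Im \<phi>(u) / Im u is below 1, and these are exactly the u for which u + t \<phi>(u)
  lies in the half-plane of u. From positive function to measure, values at height \<epsilon> above
  the real axes serve as densities; as mass could escape to infinity when \<epsilon> tends to 0, the
  total mass is verified afterwards from the growth of G.\<close>

lemma norm_diff_of_real_ge: "\<bar>Im z\<bar> \<le> norm (z - complex_of_real x)"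
  using abs_Im_le_cmod[of "z - of_real x"] by simp

lemma norm_inverse_diff_of_real_le:
  assumes "z \<notin> \<real>"
  shows "norm (1 / (z - complex_of_real x)) \<le> 1 / \<bar>Im z\<bar>"
proof -
  have "\<bar>Im z\<bar> > 0" using assms by (simp add: complex_is_Real_iff)
  then show ?thesis using norm_diff_of_real_ge[of z x]
    by (simp add: norm_divide frac_le)
qed

lemma diff_of_real_nonzero: "z \<notin> \<real> \<Longrightarrow> z - complex_of_real x \<noteq> 0"
  by auto

lemma open_compl_Reals: "open (- \<real> :: complex set)"
  by (simp add: closed_complex_Reals open_Compl)

lemma stieltjes_integrable:
  fixes g :: "'a \<Rightarrow> complex"
  assumes "finite_measure M" "X \<in> borel_measurable M" "g \<in> borel_measurable M"
    and "\<And>x. norm (g x) \<le> B" "z \<notin> \<real>"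
  shows "integrable M (\<lambda>x. g x / (z - of_real (X x)))"
proof -
  interpret finite_measure M by fact
  show ?thesis
  proof (rule integrable_const_bound[of _ "B * (1 / \<bar>Im z\<bar>)"])
    have "norm (g x) * norm (1 / (z - of_real (X x))) \<le> B * (1 / \<bar>Im z\<bar>)" for x
      using assms(4)[of x] norm_inverse_diff_of_real_le[OF assms(5), of "X x"] order_trans[OF norm_ge_zero assms(4)]
      by (intro mult_mono) auto
    then show "AE x in M. norm (g x / (z - of_real (X x))) \<le> B * (1 / \<bar>Im z\<bar>)"
      by (simp add: norm_divide)
  qed (use assms in measurable)
qed

text \<open>The second-order remainder of 1/(z - x) at z0 is (z - z0)^2 / ((z - x)(z0 - x)^2),
  bounded uniformly in x once z is within half the distance from z0 to the real axis; integrating it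
  yields the derivative. The bounded weight \<open>g\<close> makes one lemma serve the transform on
  the line (g = 1) and each variable of the plane transform, where \<open>g\<close> is the resolvent
  in the other variable.\<close>

lemma stieltjes_holomorphic:
  fixes g :: "'a \<Rightarrow> complex"
  assumes M: "finite_measure M" and X: "X \<in> borel_measurable M" and g: "g \<in> borel_measurable M"
    and gB: "\<And>x. norm (g x) \<le> B"
  shows "(\<lambda>z. \<integral>x. g x / (z - of_real (X x)) \<partial>M) holomorphic_on - \<real>"
proof (rule holomorphic_onI)
  interpret finite_measure M by fact
  fix z0 :: complex assume "z0 \<in> - \<real>"
  then have z0: "z0 \<notin> \<real>" by simp
  define d where "d = \<bar>Im z0\<bar>"
  have d: "d > 0" using z0 by (simp add: d_def complex_is_Real_iff)
  have B: "0 \<le> B" using gB[of undefined] norm_ge_zero order_trans by blast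
  let ?f = "\<lambda>z. \<integral>x. g x / (z - of_real (X x)) \<partial>M"
  note int = stieltjes_integrable[OF M X g gB]
  have int2: "integrable M (\<lambda>x. (g x / (z0 - of_real (X x))) / (z0 - of_real (X x)))"
  proof (rule stieltjes_integrable[OF M X _ _ z0])
    show "norm (g x / (z0 - of_real (X x))) \<le> B * (1 / d)" for x
    proof -
      have "norm (g x) * norm (1 / (z0 - of_real (X x))) \<le> B * (1 / d)"
        using gB[of x] norm_inverse_diff_of_real_le[OF z0, of "X x"] B unfolding d_def
        by (intro mult_mono) auto
      then show ?thesis by (simp add: norm_divide)
    qed
  qed (use X g in measurable)
  define D where "D = - (\<integral>x. (g x / (z0 - of_real (X x))) / (z0 - of_real (X x)) \<partial>M)"
  have ev: "\<forall>\<^sub>F z in at z0. z \<in> ball z0 (d / 2) \<and> z \<noteq> z0"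
    using d by (auto simp: eventually_at dist_commute intro!: exI[of _ "d/2"])
  have bound: "norm ((?f z - ?f z0) / (z - z0) - D) \<le> B * measure M (space M) * (2 / d ^ 3) * norm (z - z0)"
    if z: "z \<in> ball z0 (d/2)" "z \<noteq> z0" for z
  proof -
    have "\<bar>Im z - Im z0\<bar> \<le> norm (z - z0)"
      using abs_Im_le_cmod[of "z - z0"] by simp
    then have "\<bar>Im z\<bar> \<ge> d/2" using z by (simp add: d_def dist_norm norm_minus_commute)
    then have zR: "z \<notin> \<real>" and im: "1 / \<bar>Im z\<bar> \<le> 2 / d" using d by (auto simp: complex_is_Real_iff field_simps)
    let ?k = "\<lambda>x. g x / (z - of_real (X x)) - g x / (z0 - of_real (X x)) + (z - z0) * (g x / (z0 - of_real (X x)) / (z0 - of_real (X x)))"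
    have kint: "integrable M ?k"
      by (intro Bochner_Integration.integrable_add Bochner_Integration.integrable_diff
          Bochner_Integration.integrable_mult_right int[OF zR] int[OF z0] int2)
    have keq: "?k x = (z - z0)^2 * (g x * (1 / (z - of_real (X x))) * (1 / (z0 - of_real (X x))) * (1 / (z0 - of_real (X x))))" for x
    proof -
      define a where "a = z - of_real (X x)"
      define b where "b = z0 - of_real (X x)"
      have ab: "a \<noteq> 0" "b \<noteq> 0" using zR z0 by (auto simp: a_def b_def)
      have zz: "z - z0 = a - b" by (simp add: a_def b_def)
      show ?thesis unfolding zz a_def[symmetric] b_def[symmetric] using ab
        by (simp add: field_simps power2_eq_square)
    qed
    have kb: "norm (?k x) \<le> (norm (z - z0))^2 * (B * (2 / d) * (1 / d) * (1 / d))" for x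
      unfolding keq norm_mult norm_power
      using gB[of x] norm_inverse_diff_of_real_le[OF zR, of "X x"] norm_inverse_diff_of_real_le[OF z0, of "X x"] B im d
      by (intro mult_mono order.refl) (auto simp: d_def intro: order_trans)
    have "norm (\<integral>x. ?k x \<partial>M) \<le> (\<integral>x. norm (?k x) \<partial>M)" by simp
    also have "\<dots> \<le> (\<integral>x. (norm (z - z0))^2 * (B * (2 / d) * (1 / d) * (1 / d)) \<partial>M)"
      by (intro integral_mono integrable_norm[OF kint]) (use kb in auto)
    also have "\<dots> = (norm (z - z0))^2 * (B * (2 / d) * (1 / d) * (1 / d)) * measure M (space M)" by simp
    finally have n: "norm (\<integral>x. ?k x \<partial>M) \<le> (norm (z - z0))^2 * (B * (2 / d) * (1 / d) * (1 / d)) * measure M (space M)" .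
    have "(\<integral>x. ?k x \<partial>M) = ?f z - ?f z0 + (z - z0) * - D"
      unfolding D_def minus_minus integral_mult_right_zero[symmetric]
      by (subst Bochner_Integration.integral_add Bochner_Integration.integral_diff;
          (intro Bochner_Integration.integrable_diff
          Bochner_Integration.integrable_mult_right int[OF zR] int[OF z0] int2 refl)?)+
    then have "(?f z - ?f z0) / (z - z0) - D = (\<integral>x. ?k x \<partial>M) / (z - z0)"
      using z(2) by (simp add: field_simps)
    then have "norm ((?f z - ?f z0) / (z - z0) - D) = norm (\<integral>x. ?k x \<partial>M) / norm (z - z0)"
      by (simp add: norm_divide)
    also have "\<dots> \<le> (norm (z - z0))^2 * (B * (2 / d) * (1 / d) * (1 / d)) * measure M (space M) / norm (z - z0)"
      using n by (intro divide_right_mono) auto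
    also have "\<dots> = B * measure M (space M) * (2 / d ^ 3) * norm (z - z0)"
      using z(2) less_imp_neq[OF d] by (simp add: field_simps power2_eq_square power3_eq_cube)
    finally show ?thesis .
  qed
  have "((\<lambda>z. (?f z - ?f z0) / (z - z0) - D) \<longlongrightarrow> 0) (at z0)"
  proof (rule Lim_null_comparison)
    show "\<forall>\<^sub>F z in at z0. norm ((?f z - ?f z0) / (z - z0) - D) \<le> B * measure M (space M) * (2 / d ^ 3) * norm (z - z0)"
      using ev by eventually_elim (use bound in auto)
    show "((\<lambda>z. B * measure M (space M) * (2 / d ^ 3) * norm (z - z0)) \<longlongrightarrow> 0) (at z0)"
      using d by (auto intro!: tendsto_eq_intros)
  qed
  then have "((\<lambda>z. (?f z - ?f z0) / (z - z0)) \<longlongrightarrow> D) (at z0)"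
    using LIM_zero_iff by blast
  then have "(?f has_field_derivative D) (at z0)"
    by (simp add: has_field_derivative_iff)
  then show "?f field_differentiable (at z0 within - \<real>)"
    using field_differentiable_def field_differentiable_at_within by blast
qed

section \<open>Cauchy transforms of Borel probability measures on the line and the plane\<close>

lemma borel_probD:
  assumes "borel_prob M"
  shows "prob_space M" "sets M = sets borel" "space M = UNIV" "finite_measure M"
    "measurable M = measurable borel"
  using assms sets_eq_imp_space_eq[of M borel] prob_space.finite_measure[of M]
    measurable_cong_sets[of M borel]
  by (auto simp: borel_prob_def intro!: ext)

lemma measurable_fst_snd:
  assumes "borel_prob (\<mu> :: (real \<times> real) measure)"
  shows "fst \<in> borel_measurable \<mu>" "snd \<in> borel_measurable \<mu>"
proof -
  note [measurable_cong] = borel_probD(2)[OF assms]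
  have [measurable]: "fst \<in> borel_measurable (borel :: (real \<times> real) measure)"
    "snd \<in> borel_measurable (borel :: (real \<times> real) measure)"
    by (intro borel_measurable_continuous_onI continuous_intros)+
  show "fst \<in> borel_measurable \<mu>" "snd \<in> borel_measurable \<mu>" by measurable
qed

lemma borel_prob_marginal:
  assumes "borel_prob \<mu>"
  shows "borel_prob (marginal1 \<mu>)" "borel_prob (marginal2 \<mu>)"
  using prob_space.prob_space_distr[OF borel_probD(1)[OF assms]] measurable_fst_snd[OF assms]
  by (auto simp: borel_prob_def marginal1_def marginal2_def)

lemma cauchy_transform_marginal1:
  assumes "borel_prob \<mu>"
  shows "cauchy_transform (marginal1 \<mu>) z = (\<integral>p. 1 / (z - complex_of_real (fst p)) \<partial>\<mu>)"
  unfolding cauchy_transform_def marginal1_def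
  by (subst integral_distr) (use measurable_fst_snd[OF assms] in auto)

lemma cauchy_transform_marginal2:
  assumes "borel_prob \<mu>"
  shows "cauchy_transform (marginal2 \<mu>) z = (\<integral>p. 1 / (z - complex_of_real (snd p)) \<partial>\<mu>)"
  unfolding cauchy_transform_def marginal2_def
  by (subst integral_distr) (use measurable_fst_snd[OF assms] in auto)

lemma cauchy_integrable:
  assumes "borel_prob m" "z \<notin> \<real>"
  shows "integrable m (\<lambda>x. 1 / (z - complex_of_real x))"
  using stieltjes_integrable[of m "\<lambda>x. x" "\<lambda>_. 1" 1 z] borel_probD[OF assms(1)] assms(2) by simp

lemma cauchy_transform_holomorphic:
  assumes "borel_prob m"
  shows "cauchy_transform m holomorphic_on - \<real>"
  using stieltjes_holomorphic[of m "\<lambda>x. x" "\<lambda>_. 1" 1] borel_probD[OF assms]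
  unfolding cauchy_transform_def[abs_def] by simp

lemma cauchy_transform_Im:
  assumes "borel_prob m" "z \<notin> \<real>"
  shows "Im (cauchy_transform m z) = - Im z * (\<integral>x. 1 / (norm (z - complex_of_real x))^2 \<partial>m)"
proof -
  have "Im (cauchy_transform m z) = (\<integral>x. Im (1 / (z - complex_of_real x)) \<partial>m)"
    unfolding cauchy_transform_def using cauchy_integrable[OF assms] by simp
  also have "\<dots> = (\<integral>x. - Im z * (1 / (norm (z - complex_of_real x))^2) \<partial>m)"
    by (intro Bochner_Integration.integral_cong) (auto simp: Im_divide_Reals cmod_power2 Im_divide)
  also have "\<dots> = - Im z * (\<integral>x. 1 / (norm (z - complex_of_real x))^2 \<partial>m)"
    by (rule integral_mult_right_zero)
  finally show ?thesis .
qed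

text \<open>-Im G / Im z is the integral of a strictly positive function against a probability
  measure, hence positive: G maps each half-plane into the opposite one.\<close>

lemma cauchy_transform_nonzero:
  assumes "borel_prob m" "z \<notin> \<real>"
  shows "cauchy_transform m z \<noteq> 0" "Im (cauchy_transform m z) * Im z < 0"
proof -
  interpret prob_space m using borel_probD(1)[OF assms(1)] .
  let ?f = "\<lambda>x. 1 / (norm (z - complex_of_real x))^2"
  have z: "Im z \<noteq> 0" using assms(2) by (simp add: complex_is_Real_iff)
  note [measurable_cong] = borel_probD(2)[OF assms(1)]
  have [measurable]: "?f \<in> borel_measurable m" by measurable
  have "norm (?f x) \<le> 1 / (Im z)^2" for x
    using z norm_diff_of_real_ge[of z x] diff_of_real_nonzero[OF assms(2), of x]
    by (auto intro!: divide_left_mono simp: abs_le_square_iff[symmetric] zero_less_mult_iff)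
  then have int: "integrable m ?f" by (intro integrable_const_bound[of _ "1 / (Im z)^2"]) auto
  have "(\<integral>x. ?f x \<partial>m) > 0"
  proof (rule ccontr)
    assume "\<not> ?thesis"
    moreover have "(\<integral>x. ?f x \<partial>m) \<ge> 0" by (intro integral_nonneg_AE) auto
    ultimately have "(\<integral>x. ?f x \<partial>m) = 0" by simp
    then have "AE x in m. ?f x = 0" using int by (subst (asm) integral_nonneg_eq_0_iff_AE) auto
    then show False using diff_of_real_nonzero[OF assms(2)] by simp
  qed
  then have "Im z * Im z * (\<integral>x. ?f x \<partial>m) > 0" using z
    by (metis mult_pos_pos not_real_square_gt_zero)
  then show "Im (cauchy_transform m z) * Im z < 0"
    unfolding cauchy_transform_Im[OF assms] by (simp add: algebra_simps)
  then show "cauchy_transform m z \<noteq> 0" by auto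
qed

lemma cauchy_transform_cnj:
  "cauchy_transform m (cnj z) = cnj (cauchy_transform m z)"
  using Bochner_Integration.integral_cnj[of m "\<lambda>x. 1 / (z - complex_of_real x)"] by (simp add: cauchy_transform_def)

lemma cauchy_transform2_cnj:
  "cauchy_transform2 m (cnj z) (cnj w) = cnj (cauchy_transform2 m z w)"
  using Bochner_Integration.integral_cnj[of m "\<lambda>p. 1 / ((z - complex_of_real (fst p)) * (w - complex_of_real (snd p)))"]
  by (simp add: cauchy_transform2_def)

lemma cauchy_transform2_holomorphic:
  assumes "borel_prob \<mu>"
  shows "w \<notin> \<real> \<Longrightarrow> (\<lambda>z. cauchy_transform2 \<mu> z w) holomorphic_on - \<real>"
    and "z \<notin> \<real> \<Longrightarrow> (\<lambda>w. cauchy_transform2 \<mu> z w) holomorphic_on - \<real>"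
proof -
  note m [measurable] = measurable_fst_snd[OF assms]
  show "(\<lambda>z. cauchy_transform2 \<mu> z w) holomorphic_on - \<real>" if "w \<notin> \<real>"
    using stieltjes_holomorphic[of \<mu> fst "\<lambda>p. 1 / (w - of_real (snd p))" "1 / \<bar>Im w\<bar>"]
      borel_probD(4)[OF assms] norm_inverse_diff_of_real_le[OF that]
    by (simp add: cauchy_transform2_def mult.commute)
  show "(\<lambda>w. cauchy_transform2 \<mu> z w) holomorphic_on - \<real>" if "z \<notin> \<real>"
    using stieltjes_holomorphic[of \<mu> snd "\<lambda>p. 1 / (z - of_real (fst p))" "1 / \<bar>Im z\<bar>"]
      borel_probD(4)[OF assms] norm_inverse_diff_of_real_le[OF that]
    by (simp add: cauchy_transform2_def)
qed

lemma cauchy_transform2_norm_le: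
  assumes "borel_prob \<mu>" "z \<notin> \<real>" "w \<notin> \<real>"
  shows "norm (cauchy_transform2 \<mu> z w) \<le> 1 / (\<bar>Im z\<bar> * \<bar>Im w\<bar>)"
proof -
  interpret prob_space \<mu> using borel_probD(1)[OF assms(1)] .
  note m [measurable] = measurable_fst_snd[OF assms(1)]
  let ?f = "\<lambda>p. 1 / ((z - complex_of_real (fst p)) * (w - complex_of_real (snd p)))"
  have b: "norm (?f p) \<le> 1 / (\<bar>Im z\<bar> * \<bar>Im w\<bar>)" for p
  proof -
    have "norm (1 / (z - complex_of_real (fst p))) * norm (1 / (w - complex_of_real (snd p))) \<le> (1 / \<bar>Im z\<bar>) * (1 / \<bar>Im w\<bar>)"
      using norm_inverse_diff_of_real_le assms by (intro mult_mono) auto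
    then show ?thesis by (simp add: norm_divide norm_mult)
  qed
  then have "integrable \<mu> ?f" by (intro integrable_const_bound[of _ "1 / (\<bar>Im z\<bar> * \<bar>Im w\<bar>)"]) auto
  then have "norm (integral\<^sup>L \<mu> ?f) \<le> (\<integral>p. 1 / (\<bar>Im z\<bar> * \<bar>Im w\<bar>) \<partial>\<mu>)"
    using b by (intro order_trans[OF integral_norm_bound] integral_mono) auto
  then show ?thesis by (simp add: cauchy_transform2_def prob_space)
qed

text \<open>After division by \<omega> the integrand is g / (\<omega> W - \<omega> X), which tends
  to g. Hypothesis \<open>C\<close> says that W goes to infinity non-tangentially, and it supplies
  the dominating constant. \<omega> is kept apart from 1/W because W will later be 1/\<omega> +
  R(\<omega>).\<close>

lemma stieltjes_tendsto_mass:
  fixes g :: "'a \<Rightarrow> complex" and \<omega> W :: "nat \<Rightarrow> complex"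
  assumes M: "finite_measure M" and X[measurable]: "X \<in> borel_measurable M"
    and g[measurable]: "g \<in> borel_measurable M"
    and gB: "\<And>x. norm (g x) \<le> B"
    and \<omega>: "\<omega> \<longlonglongrightarrow> 0" and \<omega>W: "(\<lambda>k. \<omega> k * W k) \<longlonglongrightarrow> 1"
    and C: "\<And>k. 1 \<le> C * (norm (\<omega> k) * \<bar>Im (W k)\<bar>)"
  shows "(\<lambda>k. (\<integral>x. g x / (W k - of_real (X x)) \<partial>M) / \<omega> k) \<longlonglongrightarrow> (\<integral>x. g x \<partial>M)"
proof -
  interpret finite_measure M by fact
  have B: "0 \<le> B" using gB[of undefined] norm_ge_zero order_trans by blast
  have eq: "(\<integral>x. g x / (W k - of_real (X x)) \<partial>M) / \<omega> k = (\<integral>x. g x / (W k - of_real (X x)) / \<omega> k \<partial>M)" for k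
    by (rule integral_divide_zero[symmetric])
  show ?thesis unfolding eq
  proof (rule integral_dominated_convergence)
    show "integrable M (\<lambda>_. B * C)" by simp
    show "AE x in M. (\<lambda>k. g x / (W k - of_real (X x)) / \<omega> k) \<longlonglongrightarrow> g x"
    proof (rule AE_I2)
      fix x
      have "(\<lambda>k. g x / (\<omega> k * W k - of_real (X x) * \<omega> k)) \<longlonglongrightarrow> g x / (1 - of_real (X x) * 0)"
        by (intro tendsto_intros \<omega> \<omega>W) simp
      then show "(\<lambda>k. g x / (W k - of_real (X x)) / \<omega> k) \<longlonglongrightarrow> g x"
        by (simp add: algebra_simps)
    qed
    show "AE x in M. norm (g x / (W k - of_real (X x)) / \<omega> k) \<le> B * C" for k
    proof (rule AE_I2)
      fix x
      have pos: "norm (\<omega> k) * \<bar>Im (W k)\<bar> > 0"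
      proof (rule ccontr)
        assume "\<not> ?thesis"
        then have "norm (\<omega> k) * \<bar>Im (W k)\<bar> = 0"
          by (metis abs_ge_zero less_eq_real_def mult_nonneg_nonneg norm_ge_zero)
        then show False using C[of k] by (metis mult_zero_right not_one_le_zero)
      qed
      have "norm (\<omega> k) * \<bar>Im (W k)\<bar> \<le> norm (\<omega> k) * norm (W k - of_real (X x))"
        using norm_diff_of_real_ge by (intro mult_left_mono) auto
      then have "1 / (norm (\<omega> k) * norm (W k - of_real (X x))) \<le> 1 / (norm (\<omega> k) * \<bar>Im (W k)\<bar>)"
        using pos by (intro divide_left_mono) (auto intro!: mult_pos_pos simp: zero_less_mult_iff)
      also have "\<dots> \<le> C" using C[of k] pos by (simp add: field_simps)
      finally have c: "1 / (norm (\<omega> k) * norm (W k - of_real (X x))) \<le> C" .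
      have "norm (g x) * (1 / (norm (\<omega> k) * norm (W k - of_real (X x)))) \<le> B * C"
        using c gB B by (intro mult_mono) auto
      then show "norm (g x / (W k - of_real (X x)) / \<omega> k) \<le> B * C"
        by (simp add: norm_divide norm_mult mult.commute)
    qed
  qed auto
qed

text \<open>The rescaled resolvent of the variable sent to infinity tends to 1, so only the
  resolvent of the other coordinate is left under the integral.\<close>

lemma cauchy_transform2_tendsto_marginal:
  fixes \<omega> W :: "nat \<Rightarrow> complex"
  assumes \<mu>: "borel_prob \<mu>" and z: "z \<notin> \<real>"
    and \<omega>: "\<omega> \<longlonglongrightarrow> 0" and \<omega>W: "(\<lambda>k. \<omega> k * W k) \<longlonglongrightarrow> 1"
    and C: "\<And>k. 1 \<le> C * (norm (\<omega> k) * \<bar>Im (W k)\<bar>)"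
  shows "(\<lambda>k. cauchy_transform2 \<mu> z (W k) / \<omega> k) \<longlonglongrightarrow> cauchy_transform (marginal1 \<mu>) z"
    and "(\<lambda>k. cauchy_transform2 \<mu> (W k) z / \<omega> k) \<longlonglongrightarrow> cauchy_transform (marginal2 \<mu>) z"
proof -
  note m [measurable] = measurable_fst_snd[OF \<mu>]
  show "(\<lambda>k. cauchy_transform2 \<mu> z (W k) / \<omega> k) \<longlonglongrightarrow> cauchy_transform (marginal1 \<mu>) z"
    using stieltjes_tendsto_mass[of \<mu> snd "\<lambda>p. 1 / (z - of_real (fst p))" "1 / \<bar>Im z\<bar>", OF _ _ _ _ \<omega> \<omega>W C]
      borel_probD(4)[OF \<mu>] norm_inverse_diff_of_real_le[OF z]
    by (simp add: cauchy_transform2_def cauchy_transform_marginal1[OF \<mu>])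
  show "(\<lambda>k. cauchy_transform2 \<mu> (W k) z / \<omega> k) \<longlonglongrightarrow> cauchy_transform (marginal2 \<mu>) z"
    using stieltjes_tendsto_mass[of \<mu> fst "\<lambda>p. 1 / (z - of_real (snd p))" "1 / \<bar>Im z\<bar>", OF _ _ _ _ \<omega> \<omega>W C]
      borel_probD(4)[OF \<mu>] norm_inverse_diff_of_real_le[OF z]
    by (simp add: cauchy_transform2_def cauchy_transform_marginal2[OF \<mu>] mult.commute)
qed

section \<open>Normal families of holomorphic functions\<close>

lemma holomorphic_deriv_and_Lipschitz_bound:
  assumes f: "f holomorphic_on S" "open S" and r: "r > 0" "cball a (2*r) \<subseteq> S"
    and B: "\<And>x. x \<in> cball a (2*r) \<Longrightarrow> norm (f x) \<le> B"
  shows "x \<in> cball a r \<Longrightarrow> norm (deriv f x) \<le> B / r"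
    and "x \<in> cball a r \<Longrightarrow> y \<in> cball a r \<Longrightarrow> norm (f x - f y) \<le> B / r * norm (x - y)"
proof -
  show 1: "norm (deriv f x) \<le> B / r" if x: "x \<in> cball a r" for x
  proof -
    have sub: "cball x r \<subseteq> cball a (2*r)"
    proof
      fix y assume "y \<in> cball x r"
      then show "y \<in> cball a (2*r)" using x dist_triangle[of a y x] by auto
    qed
    have hol: "f holomorphic_on cball x r" using f(1) sub r(2) holomorphic_on_subset by blast
    have "norm ((deriv ^^ 1) f x) \<le> fact 1 * B / r ^ 1"
    proof (rule Cauchy_inequality)
      show "f holomorphic_on ball x r" using hol ball_subset_cball holomorphic_on_subset by blast
      show "continuous_on (cball x r) f" using hol holomorphic_on_imp_continuous_on by blast
      show "norm (f y) \<le> B" if "norm (x - y) = r" for y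
        using that B sub by (auto simp: dist_norm)
    qed (use r in auto)
    then show ?thesis by simp
  qed
  show "norm (f x - f y) \<le> B / r * norm (x - y)" if "x \<in> cball a r" "y \<in> cball a r"
  proof (rule field_differentiable_bound)
    show "convex (cball a r)" by simp
    show "(f has_field_derivative deriv f z) (at z within cball a r)" if "z \<in> cball a r" for z
    proof -
      have "cball a r \<subseteq> cball a (2*r)" using r by auto
      then have "z \<in> S" using that r by auto
      then show ?thesis using f holomorphic_derivI has_field_derivative_at_within by blast
    qed
  qed (use 1 that in auto)
qed

text \<open>Osgood's lemma. With local bounds, Cauchy estimates make the partial derivative in w
  jointly continuous; together with the existence of the partial derivative in z at the point
  itself, this gives the total derivative.\<close>

lemma separately_holomorphic_imp_holomorphic2_on:
  fixes F :: "complex \<times> complex \<Rightarrow> complex"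
  assumes D: "open D" and E: "open E"
    and hz: "\<And>w. w \<in> E \<Longrightarrow> (\<lambda>z. F (z, w)) holomorphic_on D"
    and hw: "\<And>z. z \<in> D \<Longrightarrow> (\<lambda>w. F (z, w)) holomorphic_on E"
    and bdd: "\<And>K L. compact K \<Longrightarrow> compact L \<Longrightarrow> K \<subseteq> D \<Longrightarrow> L \<subseteq> E \<Longrightarrow>
        \<exists>B. \<forall>z\<in>K. \<forall>w\<in>L. norm (F (z, w)) \<le> B"
  shows "holomorphic2_on F (D \<times> E)"
  unfolding holomorphic2_on_def
proof
  fix p assume "p \<in> D \<times> E"
  then obtain z0 w0 where p: "p = (z0, w0)" and z0: "z0 \<in> D" and w0: "w0 \<in> E" by auto
  obtain r1 where r1: "r1 > 0" "cball z0 r1 \<subseteq> D" using D z0 open_contains_cball by blast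
  obtain r2 where r2: "r2 > 0" "cball w0 r2 \<subseteq> E" using E w0 open_contains_cball by blast
  define r where "r = min r1 r2 / 2"
  have r: "r > 0" "cball z0 (2*r) \<subseteq> D" "cball w0 (2*r) \<subseteq> E" using r1 r2 by (auto simp: r_def)
  obtain B where B: "\<And>z w. z \<in> cball z0 (2*r) \<Longrightarrow> w \<in> cball w0 (2*r) \<Longrightarrow> norm (F (z, w)) \<le> B"
  proof -
    have "\<exists>B. \<forall>z\<in>cball z0 (2*r). \<forall>w\<in>cball w0 (2*r). norm (F (z, w)) \<le> B"
      by (rule bdd[OF compact_cball compact_cball r(2) r(3)])
    then show thesis using that by metis
  qed
  have "norm (F (z0, w0)) \<le> B" using r(1) by (intro B) auto
  then have B0: "B \<ge> 0" using norm_ge_zero order_trans by blast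
  define d where "d z w = deriv (\<lambda>w. F (z, w)) w" for z w
  \<comment> \<open>The increment in w comes from a Cauchy estimate applied to the derivative
    itself. The increment in z comes from a Cauchy estimate for F(z, .) - F(z0, .), which is O(|z -
    z0|) on the whole ball by the Lipschitz bound in z.\<close>
  have dbound: "norm (d z w - d z0 w0) \<le> 2 * B / (r*r) * (norm (z - z0) + norm (w - w0))"
    if z: "z \<in> cball z0 r" and w: "w \<in> cball w0 (r/2)" for z w
  proof -
    have zD: "z \<in> D" "z \<in> cball z0 (2*r)" using z r by auto
    have hol: "(\<lambda>w. F (z, w)) holomorphic_on E" using hw zD by auto
    have "norm (d z w - d z w0) \<le> (B / r) / (r/2) * norm (w - w0)"
      unfolding d_def
    proof (rule holomorphic_deriv_and_Lipschitz_bound(2))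
      show "deriv (\<lambda>w. F (z, w)) holomorphic_on E" by (intro holomorphic_deriv hol E)
      show "norm (deriv (\<lambda>w. F (z, w)) x) \<le> B / r" if "x \<in> cball w0 (2 * (r / 2))" for x
        by (rule holomorphic_deriv_and_Lipschitz_bound(1)[OF hol E r(1) r(3)]) (use B zD that in auto)
      show "cball w0 (2 * (r / 2)) \<subseteq> E" using r by auto
    qed (use r w E in auto)
    moreover have "norm (d z w0 - d z0 w0) \<le> (B / r * norm (z - z0)) / r"
    proof -
      have h1: "(\<lambda>w. F (z, w)) holomorphic_on E" "(\<lambda>w. F (z0, w)) holomorphic_on E" using hw zD z0 by auto
      have "d z w0 - d z0 w0 = deriv (\<lambda>w. F (z, w) - F (z0, w)) w0"
        unfolding d_def using h1 w0 E
        by (subst deriv_diff) (auto simp: holomorphic_on_imp_differentiable_at)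
      also have "norm \<dots> \<le> (B / r * norm (z - z0)) / r"
      proof (rule holomorphic_deriv_and_Lipschitz_bound(1))
        show "(\<lambda>w. F (z, w) - F (z0, w)) holomorphic_on E" by (intro holomorphic_intros h1)
        show "norm (F (z, x) - F (z0, x)) \<le> B / r * norm (z - z0)" if "x \<in> cball w0 (2 * r)" for x
          by (rule holomorphic_deriv_and_Lipschitz_bound(2)[where f="\<lambda>z. F (z, x)", OF hz D r(1) r(2)])
             (use B that r z in auto)
      qed (use E r in auto)
      finally show ?thesis .
    qed
    ultimately have "norm (d z w - d z0 w0) \<le> (B / r) / (r/2) * norm (w - w0) + (B / r * norm (z - z0)) / r"
      using norm_triangle_ineq[of "d z w - d z w0" "d z w0 - d z0 w0"] by simp
    also have "\<dots> \<le> 2 * B / (r*r) * (norm (z - z0) + norm (w - w0))"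
    proof -
      have "(B / r * norm (z - z0)) / r = B / (r*r) * norm (z - z0)" by simp
      also have "\<dots> \<le> 2 * B / (r*r) * norm (z - z0)" using B0 r by (intro mult_right_mono divide_right_mono) auto
      finally have "(B / r * norm (z - z0)) / r \<le> 2 * B / (r*r) * norm (z - z0)" .
      moreover have "(B / r) / (r/2) * norm (w - w0) = 2 * B / (r*r) * norm (w - w0)" by simp
      ultimately show ?thesis unfolding distrib_left by linarith
    qed
    finally show ?thesis .
  qed
  let ?X = "ball z0 (r/2)" and ?Y = "ball w0 (r/2)"
  have "((\<lambda>(x, y). F (x, y)) has_derivative (\<lambda>(tx, ty). deriv (\<lambda>z. F (z, w0)) z0 * tx +
      blinfun_apply (blinfun_mult_right (d z0 w0)) ty)) (at (z0, w0) within ?X \<times> ?Y)"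
  proof (rule has_derivative_partialsI)
    show "((\<lambda>x. F (x, w0)) has_derivative (*) (deriv (\<lambda>z. F (z, w0)) z0)) (at z0 within ?X)"
      using holomorphic_derivI[OF hz[OF w0] D z0, of ?X] by (simp add: has_field_derivative_def)
    show "((\<lambda>y. F (x, y)) has_derivative blinfun_apply (blinfun_mult_right (d x y))) (at y within ?Y)"
      if "x \<in> ?X" "y \<in> ?Y" for x y
    proof -
      have "x \<in> D" "y \<in> E" using that r by auto
      then show ?thesis using holomorphic_derivI[OF hw E, of x y ?Y]
        by (simp add: has_field_derivative_def d_def)
    qed
    have "((\<lambda>q. d (fst q) (snd q)) \<longlongrightarrow> d z0 w0) (at (z0, w0) within ?X \<times> ?Y)"
    proof (rule LIM_zero_cancel)
      show "((\<lambda>q. d (fst q) (snd q) - d z0 w0) \<longlongrightarrow> 0) (at (z0, w0) within ?X \<times> ?Y)"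
      proof (rule Lim_null_comparison)
        have "\<forall>\<^sub>F q in at (z0, w0) within ?X \<times> ?Y. q \<in> ?X \<times> ?Y"
          by (auto simp: eventually_at_filter)
        then show "\<forall>\<^sub>F q in at (z0, w0) within ?X \<times> ?Y. norm (d (fst q) (snd q) - d z0 w0) \<le>
            2 * B / (r*r) * (norm (fst q - z0) + norm (snd q - w0))"
          by eventually_elim (rule dbound, use r in auto)
        have "((\<lambda>q. 2 * B / (r*r) * (norm (fst q - z0) + norm (snd q - w0))) \<longlongrightarrow>
            2 * B / (r*r) * (norm (fst (z0, w0) - z0) + norm (snd (z0, w0) - w0))) (at (z0, w0) within ?X \<times> ?Y)"
          by (intro tendsto_intros)
        then show "((\<lambda>q. 2 * B / (r*r) * (norm (fst q - z0) + norm (snd q - w0))) \<longlongrightarrow> 0) (at (z0, w0) within ?X \<times> ?Y)"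
          by simp
      qed
    qed
    then show "continuous (at (z0, w0) within ?X \<times> ?Y) (\<lambda>(x, y). blinfun_mult_right (d x y))"
      unfolding continuous_within split_beta
      by (auto intro!: bounded_linear.tendsto[OF bounded_linear_blinfun_mult_right])
  qed (use r in auto)
  then have "(F has_derivative (\<lambda>v. deriv (\<lambda>z. F (z, w0)) z0 * fst v + d z0 w0 * snd v)) (at (z0, w0) within ?X \<times> ?Y)"
    by (simp add: case_prod_unfold)
  moreover have "at (z0, w0) within ?X \<times> ?Y = at (z0, w0)"
    using r by (intro at_within_open) (auto intro: open_Times)
  ultimately have "(F has_derivative (\<lambda>v. deriv (\<lambda>z. F (z, w0)) z0 * fst v + d z0 w0 * snd v)) (at p within D \<times> E)"
    using p has_derivative_at_withinI by metis
  then show "\<exists>a b. (F has_derivative (\<lambda>v. a * fst v + b * snd v)) (at p within D \<times> E)" by blast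
qed

text \<open>Montel applies to every subsequence. Any two subsequential limits agree with
  \<open>l\<close> on the open set U, hence with each other on the connected set S, so a subsequence
  staying away from g(z) is impossible.\<close>

lemma Vitali_pointwise:
  fixes f :: "nat \<Rightarrow> complex \<Rightarrow> complex"
  assumes S: "open S" "connected S"
    and hol: "\<And>n. f n holomorphic_on S"
    and bdd: "\<And>K. compact K \<Longrightarrow> K \<subseteq> S \<Longrightarrow> \<exists>B. \<forall>n. \<forall>z\<in>K. norm (f n z) \<le> B"
    and U: "open U" "U \<noteq> {}" "U \<subseteq> S" and lim: "\<And>u. u \<in> U \<Longrightarrow> (\<lambda>n. f n u) \<longlonglongrightarrow> l u"
  obtains g where "g holomorphic_on S" "\<And>z. z \<in> S \<Longrightarrow> (\<lambda>n. f n z) \<longlonglongrightarrow> g z"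
proof -
  have Mon: "\<exists>g r. g holomorphic_on S \<and> strict_mono (r :: nat \<Rightarrow> nat) \<and> (\<forall>x\<in>S. (\<lambda>n. f (s (r n)) x) \<longlonglongrightarrow> g x) \<and> (\<forall>u\<in>U. g u = l u)"
    if s: "strict_mono s" for s :: "nat \<Rightarrow> nat"
  proof -
    obtain g r where gr: "g holomorphic_on S" "strict_mono (r :: nat \<Rightarrow> nat)"
      "\<And>x. x \<in> S \<Longrightarrow> ((\<lambda>n. (\<lambda>n. f (s n)) (r n) x) \<longlongrightarrow> g x) sequentially"
      by (rule Montel[OF S(1), of "range (\<lambda>n. f (s n))" "\<lambda>n. f (s n)"])
         (use hol bdd in \<open>auto, meson\<close>)
    have "g u = l u" if "u \<in> U" for u
    proof (rule LIMSEQ_unique)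
      show "(\<lambda>n. f (s (r n)) u) \<longlonglongrightarrow> g u" using gr(3) U that by auto
      show "(\<lambda>n. f (s (r n)) u) \<longlonglongrightarrow> l u"
        using LIMSEQ_subseq_LIMSEQ[OF lim[OF that] strict_mono_o[OF s gr(2)]] by (simp add: o_def)
    qed
    then show ?thesis using gr by blast
  qed
  obtain g where g: "g holomorphic_on S" "\<forall>u\<in>U. g u = l u" using Mon[OF strict_mono_id] by blast
  obtain u0 where u0: "u0 \<in> U" using U by auto
  have "(\<lambda>n. f n z) \<longlonglongrightarrow> g z" if z: "z \<in> S" for z
  proof (rule ccontr)
    assume "\<not> ?thesis"
    then obtain e where e: "e > 0" "\<And>N. \<exists>n\<ge>N. dist (f n z) (g z) \<ge> e"
      unfolding lim_sequentially by (meson not_less)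
    then have "infinite {n. dist (f n z) (g z) \<ge> e}"
      by (auto simp: infinite_nat_iff_unbounded_le)
    then obtain s where s: "strict_mono (s :: nat \<Rightarrow> nat)" "\<And>n. dist (f (s n) z) (g z) \<ge> e"
      using infinite_enumerate by blast
    obtain g' r where g': "g' holomorphic_on S" "strict_mono (r :: nat \<Rightarrow> nat)"
      "\<forall>x\<in>S. (\<lambda>n. f (s (r n)) x) \<longlonglongrightarrow> g' x" "\<forall>u\<in>U. g' u = l u"
      using Mon[OF s(1)] by blast
    have "g' z = g z"
      by (rule analytic_continuation_open[OF U(1) S(1) U(2) S(2) U(3) g'(1) g(1)]) (use g g' z in auto)
    then have "(\<lambda>n. f (s (r n)) z) \<longlonglongrightarrow> g z" using g'(3) z by auto
    then obtain N where "\<forall>n\<ge>N. dist (f (s (r n)) z) (g z) < e"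
      using e(1) unfolding lim_sequentially by blast
    then show False using s(2)[of "r N"] by fastforce
  qed
  then show thesis using that g(1) by blast
qed

text \<open>Convergence spreads one variable at a time: for fixed v in V from U to all of D, then
  for fixed z in D from V to all of E. One more application in z, for fixed w in E, shows that the
  limit is holomorphic in z as well.\<close>

lemma Vitali_pointwise2:
  fixes f :: "nat \<Rightarrow> complex \<Rightarrow> complex \<Rightarrow> complex"
  assumes D: "open D" "connected D" and E: "open E" "connected E"
    and hz: "\<And>n w. w \<in> E \<Longrightarrow> (\<lambda>z. f n z w) holomorphic_on D"
    and hw: "\<And>n z. z \<in> D \<Longrightarrow> (\<lambda>w. f n z w) holomorphic_on E"
    and bdd: "\<And>K L. compact K \<Longrightarrow> compact L \<Longrightarrow> K \<subseteq> D \<Longrightarrow> L \<subseteq> E \<Longrightarrow>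
        \<exists>B. \<forall>n. \<forall>z\<in>K. \<forall>w\<in>L. norm (f n z w) \<le> B"
    and U: "open U" "U \<noteq> {}" "U \<subseteq> D" and V: "open V" "V \<noteq> {}" "V \<subseteq> E"
    and lim: "\<And>u v. u \<in> U \<Longrightarrow> v \<in> V \<Longrightarrow> (\<lambda>n. f n u v) \<longlonglongrightarrow> l u v"
  obtains g where "\<And>w. w \<in> E \<Longrightarrow> (\<lambda>z. g z w) holomorphic_on D"
    "\<And>z. z \<in> D \<Longrightarrow> (\<lambda>w. g z w) holomorphic_on E"
    "\<And>z w. z \<in> D \<Longrightarrow> w \<in> E \<Longrightarrow> (\<lambda>n. f n z w) \<longlonglongrightarrow> g z w"
proof -
  have bz: "\<exists>B. \<forall>n. \<forall>z\<in>K. norm (f n z w) \<le> B" if "compact K" "K \<subseteq> D" "w \<in> E" for K w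
    using bdd[of K "{w}"] that by auto
  have bw: "\<exists>B. \<forall>n. \<forall>w\<in>L. norm (f n z w) \<le> B" if "compact L" "L \<subseteq> E" "z \<in> D" for L z
    using bdd[of "{z}" L] that by auto
  have 1: "\<exists>g. g holomorphic_on D \<and> (\<forall>z\<in>D. (\<lambda>n. f n z v) \<longlonglongrightarrow> g z)" if "v \<in> V" for v
    by (rule Vitali_pointwise[OF D hz bz U lim[OF _ that]]) (use that V in auto)
  then obtain g1 where g1: "\<And>z v. z \<in> D \<Longrightarrow> v \<in> V \<Longrightarrow> (\<lambda>n. f n z v) \<longlonglongrightarrow> g1 v z"
    by metis
  have "\<exists>g. g holomorphic_on E \<and> (\<forall>w\<in>E. (\<lambda>n. f n z w) \<longlonglongrightarrow> g w)" if "z \<in> D" for z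
    by (rule Vitali_pointwise[OF E hw bw V g1[OF that]]) (use that in auto)
  then obtain g where g: "\<And>z. z \<in> D \<Longrightarrow> g z holomorphic_on E"
    "\<And>z w. z \<in> D \<Longrightarrow> w \<in> E \<Longrightarrow> (\<lambda>n. f n z w) \<longlonglongrightarrow> g z w"
    by metis
  have "(\<lambda>z. g z w) holomorphic_on D" if w: "w \<in> E" for w
  proof -
    obtain h where h: "h holomorphic_on D" "\<And>z. z \<in> D \<Longrightarrow> (\<lambda>n. f n z w) \<longlonglongrightarrow> h z"
      by (rule Vitali_pointwise[OF D hz[OF w] bz[OF _ _ w] U g(2)[OF _ w]]) (use U in auto)
    have "h z = g z w" if "z \<in> D" for z
      using LIMSEQ_unique[OF h(2)[OF that] g(2)[OF that w]] .
    then show ?thesis using h(1) holomorphic_cong[of D D h "\<lambda>z. g z w"] by auto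
  qed
  then show thesis using that[of g] g by auto
qed

text \<open>Local bounds make the sequence equi-Lipschitz near a. This serves situations where the
  values of f n are known only at points A n that move with n, while the limit is wanted at the
  fixed point a.\<close>

lemma holomorphic_sequence_equicontinuous:
  fixes f :: "nat \<Rightarrow> complex \<Rightarrow> complex"
  assumes S: "open S" and hol: "\<And>n. f n holomorphic_on S"
    and bdd: "\<And>K. compact K \<Longrightarrow> K \<subseteq> S \<Longrightarrow> \<exists>B. \<forall>n. \<forall>z\<in>K. norm (f n z) \<le> B"
    and a: "a \<in> S" "A \<longlonglongrightarrow> a"
  shows "(\<lambda>n. f n (A n) - f n a) \<longlonglongrightarrow> 0"
proof -
  obtain r0 where r0: "r0 > 0" "cball a r0 \<subseteq> S" using S a(1) open_contains_cball by blast
  define r where "r = r0 / 2"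
  have r: "r > 0" "cball a (2*r) \<subseteq> S" using r0 by (auto simp: r_def)
  obtain B where B: "\<And>n z. z \<in> cball a (2*r) \<Longrightarrow> norm (f n z) \<le> B"
    using bdd[OF compact_cball r(2)] by blast
  show ?thesis
  proof (rule Lim_null_comparison)
    have "\<forall>\<^sub>F n in sequentially. dist (A n) a < r" using a(2) r(1) by (rule tendstoD)
    then show "\<forall>\<^sub>F n in sequentially. norm (f n (A n) - f n a) \<le> B / r * norm (A n - a)"
    proof eventually_elim
      case (elim n)
      then show ?case
        by (intro holomorphic_deriv_and_Lipschitz_bound(2)[OF hol S r B])
           (use r in \<open>auto simp: dist_commute\<close>)
    qed
    have "(\<lambda>n. B / r * norm (A n - a)) \<longlonglongrightarrow> B / r * norm (a - a)"
      by (intro tendsto_intros a)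
    then show "(\<lambda>n. B / r * norm (A n - a)) \<longlonglongrightarrow> 0" by simp
  qed
qed

text \<open>The two variables are moved in turn. While z moves, the second argument still depends on
  n; the bound is uniform because the points \<beta> n together with their limit b form a compact
  subset of E.\<close>

lemma holomorphic_sequence_equicontinuous2:
  fixes f :: "nat \<Rightarrow> complex \<Rightarrow> complex \<Rightarrow> complex"
  assumes D: "open D" and E: "open E"
    and hz: "\<And>n w. w \<in> E \<Longrightarrow> (\<lambda>z. f n z w) holomorphic_on D"
    and hw: "\<And>n z. z \<in> D \<Longrightarrow> (\<lambda>w. f n z w) holomorphic_on E"
    and bdd: "\<And>K L. compact K \<Longrightarrow> compact L \<Longrightarrow> K \<subseteq> D \<Longrightarrow> L \<subseteq> E \<Longrightarrow>
        \<exists>B. \<forall>n. \<forall>z\<in>K. \<forall>w\<in>L. norm (f n z w) \<le> B"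
    and a: "a \<in> D" "A \<longlonglongrightarrow> a" and b: "b \<in> E" "\<beta> \<longlonglongrightarrow> b" "\<And>n. \<beta> n \<in> E"
  shows "(\<lambda>n. f n (A n) (\<beta> n) - f n a b) \<longlonglongrightarrow> 0"
proof -
  have K: "compact (insert b (range \<beta>))" using compact_sequence_with_limit[OF b(2)] .
  have "(\<lambda>n. f n (A n) (\<beta> n) - f n a (\<beta> n)) \<longlonglongrightarrow> 0"
  proof (rule holomorphic_sequence_equicontinuous[where f="\<lambda>n z. f n z (\<beta> n)", OF D hz[OF b(3)] _ a])
    fix L assume L: "compact L" "L \<subseteq> D"
    have "insert b (range \<beta>) \<subseteq> E" using b by auto
    then show "\<exists>B. \<forall>n. \<forall>z\<in>L. norm (f n z (\<beta> n)) \<le> B"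
      using bdd[OF L(1) K L(2)] by blast
  qed
  moreover have "(\<lambda>n. f n a (\<beta> n) - f n a b) \<longlonglongrightarrow> 0"
  proof (rule holomorphic_sequence_equicontinuous[where f="\<lambda>n w. f n a w", OF E hw[OF a(1)] _ b(1,2)])
    fix L assume L: "compact L" "L \<subseteq> E"
    then show "\<exists>B. \<forall>n. \<forall>w\<in>L. norm (f n a w) \<le> B"
      using bdd[of "{a}" L] a by auto
  qed
  ultimately show ?thesis using tendsto_add by fastforce
qed

section \<open>Centred resolvents and the Gram inequality\<close>

lemma (in finite_measure) integrable_bounded:
  fixes f :: "'a \<Rightarrow> 'b :: {banach, second_countable_topology}"
  assumes "f \<in> borel_measurable M" "\<And>x. norm (f x) \<le> B"
  shows "integrable M f"
  using assms by (intro integrable_const_bound[of _ B]) auto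

text \<open>With I the inner product of f and g, the integral of |f - r I g|^2 is nonnegative for
  every real r; the inequality follows by a suitable r.\<close>

lemma Cauchy_Schwarz_complex_integral:
  fixes f g :: "'a \<Rightarrow> complex"
  assumes f: "integrable M (\<lambda>x. (norm (f x))\<^sup>2)" and g: "integrable M (\<lambda>x. (norm (g x))\<^sup>2)"
    and fg: "integrable M (\<lambda>x. f x * cnj (g x))"
  shows "(norm (\<integral>x. f x * cnj (g x) \<partial>M))\<^sup>2 \<le> (\<integral>x. (norm (f x))\<^sup>2 \<partial>M) * (\<integral>x. (norm (g x))\<^sup>2 \<partial>M)"
proof -
  define I where "I = (\<integral>x. f x * cnj (g x) \<partial>M)"
  define A where "A = (\<integral>x. (norm (f x))\<^sup>2 \<partial>M)"
  define B where "B = (\<integral>x. (norm (g x))\<^sup>2 \<partial>M)"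
  have B0: "B \<ge> 0" unfolding B_def by (intro integral_nonneg_AE) auto
  have q: "0 \<le> A - 2 * r * (norm I)\<^sup>2 + r\<^sup>2 * (norm I)\<^sup>2 * B" for r :: real
  proof -
    have pt: "(norm (f x - of_real r * I * g x))\<^sup>2 =
        (norm (f x))\<^sup>2 - 2 * r * Re (cnj I * (f x * cnj (g x))) + r\<^sup>2 * (norm I)\<^sup>2 * (norm (g x))\<^sup>2" for x
      unfolding cmod_power2 by (simp add: power2_eq_square algebra_simps)
    have "0 \<le> (\<integral>x. (norm (f x - of_real r * I * g x))\<^sup>2 \<partial>M)"
      by (intro integral_nonneg_AE) auto
    also have "\<dots> = (\<integral>x. (norm (f x))\<^sup>2 \<partial>M) - (\<integral>x. 2 * r * Re (cnj I * (f x * cnj (g x))) \<partial>M)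
        + (\<integral>x. r\<^sup>2 * (norm I)\<^sup>2 * (norm (g x))\<^sup>2 \<partial>M)"
      unfolding pt
      by (subst Bochner_Integration.integral_add Bochner_Integration.integral_diff;
          (intro Bochner_Integration.integrable_diff Bochner_Integration.integrable_mult_right integrable_Re f g fg refl)?)+
    also have "(\<integral>x. 2 * r * Re (cnj I * (f x * cnj (g x))) \<partial>M) = 2 * r * Re (cnj I * I)"
    proof -
      have "(\<integral>x. 2 * r * Re (cnj I * (f x * cnj (g x))) \<partial>M) = 2 * r * (\<integral>x. Re (cnj I * (f x * cnj (g x))) \<partial>M)"
        by (rule integral_mult_right_zero)
      also have "(\<integral>x. Re (cnj I * (f x * cnj (g x))) \<partial>M) = Re (\<integral>x. cnj I * (f x * cnj (g x)) \<partial>M)"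
        using fg by (intro integral_Re Bochner_Integration.integrable_mult_right)
      also have "(\<integral>x. cnj I * (f x * cnj (g x)) \<partial>M) = cnj I * I"
        unfolding I_def by (rule integral_mult_right_zero)
      finally show ?thesis .
    qed
    also have "(\<integral>x. r\<^sup>2 * (norm I)\<^sup>2 * (norm (g x))\<^sup>2 \<partial>M) = r\<^sup>2 * (norm I)\<^sup>2 * B"
      unfolding B_def by (rule integral_mult_right_zero)
    also have "Re (cnj I * I) = (norm I)\<^sup>2" unfolding cmod_power2 by (simp add: power2_eq_square)
    finally show ?thesis by (simp add: A_def)
  qed
  have "(norm I)\<^sup>2 \<le> A * B"
  proof (cases "B = 0")
    case True
    have "norm I = 0"
    proof (rule ccontr)
      assume n: "norm I \<noteq> 0"
      \<comment> \<open>If B = 0 the expression is affine in r, and this r turns it into A - 2 (A +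
        1), which is negative.\<close>
      have "0 \<le> A - 2 * ((A + 1) / (norm I)\<^sup>2) * (norm I)\<^sup>2" using q[of "(A + 1) / (norm I)\<^sup>2"] True by simp
      then have "0 \<le> A - 2 * (A + 1)" using n by simp
      moreover have "A \<ge> 0" unfolding A_def by (intro integral_nonneg_AE) auto
      ultimately show False by simp
    qed
    then show ?thesis using True by simp
  next
    case False
    then have B: "B > 0" using B0 by simp
    have "0 \<le> (A - 2 * (1/B) * (norm I)\<^sup>2 + (1/B)\<^sup>2 * (norm I)\<^sup>2 * B) * B"
      using q[of "1/B"] B by (intro mult_nonneg_nonneg) auto
    also have "\<dots> = A * B - (norm I)\<^sup>2" using B by (simp add: field_simps power2_eq_square)
    finally show ?thesis by simp
  qed
  then show ?thesis by (simp add: I_def A_def B_def)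
qed

text \<open>The F-transform of free probability. It preserves each half-plane, and Im F(z) / Im z -
  1 will be the variance of a centred resolvent.\<close>

definition recip_cauchy :: "real measure \<Rightarrow> complex \<Rightarrow> complex" where
  "recip_cauchy m z = 1 / cauchy_transform m z"

lemma recip_cauchy_holomorphic: "borel_prob m \<Longrightarrow> recip_cauchy m holomorphic_on - \<real>"
  unfolding recip_cauchy_def[abs_def]
  by (intro holomorphic_intros cauchy_transform_holomorphic) (use cauchy_transform_nonzero in auto)

lemma recip_cauchy_cnj: "recip_cauchy m (cnj z) = cnj (recip_cauchy m z)"
  by (simp add: recip_cauchy_def cauchy_transform_cnj)

text \<open>Normalised so that 1 + \<xi> = F(z) / (z - X) has mean 1. The random variable X is a
  parameter because both coordinates of one plane measure occur together.\<close>

definition centred_resolvent :: "'a measure \<Rightarrow> ('a \<Rightarrow> real) \<Rightarrow> complex \<Rightarrow> 'a \<Rightarrow> complex" where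
  "centred_resolvent M X z x = recip_cauchy (distr M borel X) z / (z - of_real (X x)) - 1"

lemma centred_resolvent_cnj: "centred_resolvent M X (cnj z) x = cnj (centred_resolvent M X z x)"
  by (simp add: centred_resolvent_def recip_cauchy_cnj)

lemma centred_resolvent_measurable [measurable]:
  assumes [measurable]: "X \<in> borel_measurable M"
  shows "centred_resolvent M X z \<in> borel_measurable M"
proof -
  have "(\<lambda>x. recip_cauchy (distr M borel X) z / (z - of_real (X x)) - 1) \<in> borel_measurable M" by measurable
  then show ?thesis unfolding centred_resolvent_def[abs_def] .
qed

lemma centred_resolvent_bounded:
  assumes "z \<notin> \<real>"
  obtains B where "\<And>x. norm (centred_resolvent M X z x) \<le> B"
proof
  fix x
  let ?F = "recip_cauchy (distr M borel X) z"
  have "norm ?F * norm (1 / (z - of_real (X x))) \<le> norm ?F * (1 / \<bar>Im z\<bar>)"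
    using norm_inverse_diff_of_real_le[OF assms] by (intro mult_left_mono) auto
  then have "norm (?F / (z - of_real (X x))) \<le> norm ?F * (1 / \<bar>Im z\<bar>)"
    by (simp add: norm_divide)
  then show "norm (centred_resolvent M X z x) \<le> norm ?F * (1 / \<bar>Im z\<bar>) + 1"
    unfolding centred_resolvent_def
    using norm_triangle_ineq4[of "?F / (z - of_real (X x))" 1] by simp
qed

context prob_space
begin

lemma borel_prob_distr: "X \<in> borel_measurable M \<Longrightarrow> borel_prob (distr M borel X)"
  by (simp add: borel_prob_def prob_space_distr)

lemma cauchy_transform_distr:
  assumes [measurable]: "X \<in> borel_measurable M"
  shows "cauchy_transform (distr M borel X) z = (\<integral>x. 1 / (z - of_real (X x)) \<partial>M)"
  unfolding cauchy_transform_def by (subst integral_distr) auto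

lemma resolvent_integrable:
  assumes "X \<in> borel_measurable M" "z \<notin> \<real>"
  shows "integrable M (\<lambda>x. 1 / (z - complex_of_real (X x)))"
  using stieltjes_integrable[of M X "\<lambda>_. 1" 1 z] assms finite_measure_axioms by simp

lemma integral_centred_resolvent:
  assumes X: "X \<in> borel_measurable M" and z: "z \<notin> \<real>"
  shows "(\<integral>x. centred_resolvent M X z x \<partial>M) = 0"
proof -
  let ?F = "recip_cauchy (distr M borel X) z"
  have "(\<integral>x. centred_resolvent M X z x \<partial>M) = (\<integral>x. ?F * (1 / (z - of_real (X x))) - 1 \<partial>M)"
    by (simp add: centred_resolvent_def)
  also have "\<dots> = (\<integral>x. ?F * (1 / (z - of_real (X x))) \<partial>M) - (\<integral>x. 1 \<partial>M)"
    using resolvent_integrable[OF X z] by (intro Bochner_Integration.integral_diff Bochner_Integration.integrable_mult_right) auto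
  also have "(\<integral>x. ?F * (1 / (z - of_real (X x))) \<partial>M) = ?F * (\<integral>x. (1 / (z - of_real (X x))) \<partial>M)"
    by (rule integral_mult_right_zero)
  also have "\<dots> = 1"
    using cauchy_transform_nonzero(1)[OF borel_prob_distr[OF X] z]
    by (simp add: recip_cauchy_def cauchy_transform_distr[OF X])
  finally show ?thesis by (simp add: prob_space)
qed

text \<open>A product of two resolvents is a divided difference of resolvents, so the second moments
  of centred resolvents are divided differences of F(z) - z.\<close>

lemma integral_centred_resolvent_mult:
  assumes X: "X \<in> borel_measurable M" and z: "z1 \<notin> \<real>" "z2 \<notin> \<real>"
  shows "(z1 - z2) * (1 + (\<integral>x. centred_resolvent M X z1 x * centred_resolvent M X z2 x \<partial>M)) =
     recip_cauchy (distr M borel X) z1 - recip_cauchy (distr M borel X) z2"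
proof -
  note [measurable] = X
  let ?m = "distr M borel X"
  define r where "r z x = 1 / (z - complex_of_real (X x))" for z x
  let ?F1 = "recip_cauchy ?m z1" and ?F2 = "recip_cauchy ?m z2"
  have int: "integrable M (r z1)" "integrable M (r z2)"
    using resolvent_integrable[OF X] z by (simp_all add: r_def[abs_def])
  have F: "?F1 * (\<integral>x. r z1 x \<partial>M) = 1" "?F2 * (\<integral>x. r z2 x \<partial>M) = 1"
    using cauchy_transform_nonzero(1)[OF borel_prob_distr[OF X]] z
    by (simp_all add: recip_cauchy_def cauchy_transform_distr[OF X] r_def[abs_def])
  have pt: "(z1 - z2) * (centred_resolvent M X z1 x * centred_resolvent M X z2 x) =
      (?F1 * ?F2 * r z2 x - ?F1 * ?F2 * r z1 x) - (z1 - z2) * (?F1 * r z1 x) - (z1 - z2) * (?F2 * r z2 x) + (z1 - z2)" for x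
  proof -
    define a b where "a = z1 - complex_of_real (X x)" and "b = z2 - complex_of_real (X x)"
    have ab: "a \<noteq> 0" "b \<noteq> 0" using z by (auto simp: a_def b_def)
    have e: "z1 - z2 = a - b" by (simp add: a_def b_def)
    show ?thesis
      unfolding centred_resolvent_def r_def e a_def[symmetric] b_def[symmetric]
      using ab by (simp add: field_simps)
  qed
  have "(z1 - z2) * (\<integral>x. centred_resolvent M X z1 x * centred_resolvent M X z2 x \<partial>M) =
      (\<integral>x. (z1 - z2) * (centred_resolvent M X z1 x * centred_resolvent M X z2 x) \<partial>M)"
    by (rule integral_mult_right_zero[symmetric])
  also have "\<dots> = (\<integral>x. ?F1 * ?F2 * r z2 x \<partial>M) - (\<integral>x. ?F1 * ?F2 * r z1 x \<partial>M) -
      (\<integral>x. (z1 - z2) * (?F1 * r z1 x) \<partial>M) - (\<integral>x. (z1 - z2) * (?F2 * r z2 x) \<partial>M) + (\<integral>x. z1 - z2 \<partial>M)"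
    unfolding pt
    by (subst Bochner_Integration.integral_add Bochner_Integration.integral_diff;
        (intro Bochner_Integration.integrable_diff Bochner_Integration.integrable_mult_right int integrable_const refl)?)+
  also have "\<dots> = ?F1 * ?F2 * (\<integral>x. r z2 x \<partial>M) - ?F1 * ?F2 * (\<integral>x. r z1 x \<partial>M) -
      (z1 - z2) * (?F1 * (\<integral>x. r z1 x \<partial>M)) - (z1 - z2) * (?F2 * (\<integral>x. r z2 x \<partial>M)) + (z1 - z2)"
    by (simp only: integral_mult_right_zero lebesgue_integral_const prob_space scaleR_one)
  also have "\<dots> = ?F1 - ?F2 - (z1 - z2)"
  proof -
    have "?F1 * ?F2 * (\<integral>x. r z2 x \<partial>M) = ?F1" using F(2) by (simp add: mult.assoc)
    moreover have "?F1 * ?F2 * (\<integral>x. r z1 x \<partial>M) = ?F2" using F(1) by (metis mult.commute mult.left_commute mult.right_neutral)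
    ultimately show ?thesis by (simp only: F mult_1_right diff_add_eq) (simp add: algebra_simps)
  qed
  finally show ?thesis by (simp add: algebra_simps)
qed

lemma integrable_centred_resolvent_products:
  assumes X: "X \<in> borel_measurable M" and Y: "Y \<in> borel_measurable M" and z: "z \<notin> \<real>" "w \<notin> \<real>"
  shows "integrable M (\<lambda>x. centred_resolvent M X z x * centred_resolvent M Y w x)"
    and "integrable M (centred_resolvent M X z)"
    and "integrable M (\<lambda>x. (norm (centred_resolvent M X z x))\<^sup>2)"
proof -
  note [measurable] = X Y
  obtain A where A: "\<And>x. norm (centred_resolvent M X z x) \<le> A" using centred_resolvent_bounded[OF z(1)] by blast
  obtain B where B: "\<And>x. norm (centred_resolvent M Y w x) \<le> B" using centred_resolvent_bounded[OF z(2)] by blast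
  have 0: "0 \<le> A" using A norm_ge_zero order_trans by blast
  show "integrable M (\<lambda>x. centred_resolvent M X z x * centred_resolvent M Y w x)"
    using A B 0 by (intro integrable_bounded[of _ "A * B"]) (auto simp: norm_mult intro!: mult_mono)
  show "integrable M (centred_resolvent M X z)" using A by (intro integrable_bounded[of _ A]) auto
  show "integrable M (\<lambda>x. (norm (centred_resolvent M X z x))\<^sup>2)"
    using A 0 by (intro integrable_bounded[of _ "A\<^sup>2"]) auto
qed

text \<open>The divided difference at z and its conjugate; the imaginary part isolates the real
  second moment.\<close>

lemma integral_norm_centred_resolvent:
  assumes X: "X \<in> borel_measurable M" and z: "z \<notin> \<real>"
  shows "(\<integral>x. (norm (centred_resolvent M X z x))\<^sup>2 \<partial>M) = Im (recip_cauchy (distr M borel X) z) / Im z - 1"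
proof -
  have zc: "cnj z \<notin> \<real>" using z by (simp add: complex_is_Real_iff)
  have y: "Im z \<noteq> 0" using z by (simp add: complex_is_Real_iff)
  let ?I = "\<integral>x. (norm (centred_resolvent M X z x))\<^sup>2 \<partial>M"
  have "(\<integral>x. centred_resolvent M X z x * centred_resolvent M X (cnj z) x \<partial>M) = complex_of_real ?I"
    unfolding centred_resolvent_cnj integral_complex_of_real[symmetric]
    by (simp only: complex_norm_square)
  then have "(z - cnj z) * (1 + complex_of_real ?I) = recip_cauchy (distr M borel X) z - cnj (recip_cauchy (distr M borel X) z)"
    using integral_centred_resolvent_mult[OF X z zc] by (simp add: recip_cauchy_cnj)
  then have "Im ((z - cnj z) * (1 + complex_of_real ?I)) = Im (recip_cauchy (distr M borel X) z - cnj (recip_cauchy (distr M borel X) z))"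
    by simp
  then have "2 * Im z * (1 + ?I) = 2 * Im (recip_cauchy (distr M borel X) z)" by simp
  then show ?thesis using y by (simp add: field_simps)
qed

text \<open>Cauchy-Schwarz for the centred resolvents at z1 and at the conjugate of z2. This is the
  two-point Nevanlinna-Pick determinant of F(z) - z, for points in the same or in opposite
  half-planes.\<close>

lemma recip_cauchy_Pick:
  assumes X: "X \<in> borel_measurable M" and z: "z1 \<notin> \<real>" "z2 \<notin> \<real>"
  defines "F \<equiv> recip_cauchy (distr M borel X)"
  shows "(norm (F z1 - z1 - (F z2 - z2)))\<^sup>2 \<le> (norm (z1 - z2))\<^sup>2 * ((Im (F z1) / Im z1 - 1) * (Im (F z2) / Im z2 - 1))"
    and "0 \<le> Im (F z1) / Im z1 - 1"
proof -
  let ?I = "\<integral>x. centred_resolvent M X z1 x * centred_resolvent M X z2 x \<partial>M"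
  have e: "F z1 - z1 - (F z2 - z2) = (z1 - z2) * ?I"
    using integral_centred_resolvent_mult[OF X z] by (simp add: F_def algebra_simps)
  have zc: "cnj z2 \<notin> \<real>" using z(2) by (simp add: complex_is_Real_iff)
  have "(norm ?I)\<^sup>2 \<le> (Im (F z1) / Im z1 - 1) * (Im (F z2) / Im z2 - 1)"
    using Cauchy_Schwarz_complex_integral[of M "centred_resolvent M X z1" "centred_resolvent M X (cnj z2)"]
      integrable_centred_resolvent_products[OF X X] z zc
      integral_norm_centred_resolvent[OF X] 
    by (simp add: centred_resolvent_cnj F_def)
  then show "(norm (F z1 - z1 - (F z2 - z2)))\<^sup>2 \<le> (norm (z1 - z2))\<^sup>2 * ((Im (F z1) / Im z1 - 1) * (Im (F z2) / Im z2 - 1))"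
    unfolding e norm_mult power_mult_distrib by (intro mult_left_mono) auto
  show "0 \<le> Im (F z1) / Im z1 - 1"
    unfolding F_def integral_norm_centred_resolvent[OF X z(1), symmetric] by (intro integral_nonneg_AE) auto
qed

text \<open>The resolvent identity at z and cnj z, multiplied by |F|^2. Every factor |1 + \<xi>|^2
  in a higher moment can thus be traded for terms of first order in \<xi>.\<close>

lemma norm_one_plus_centred_resolvent:
  fixes X :: "'a \<Rightarrow> real" and z F :: complex
  assumes z: "z \<notin> \<real>"
  defines "F \<equiv> recip_cauchy (distr M borel X) z"
  shows "(1 + centred_resolvent M X z x) * (1 + cnj (centred_resolvent M X z x)) =
    (F * (1 + cnj (centred_resolvent M X z x)) - cnj F * (1 + centred_resolvent M X z x)) / (2 * \<i> * Im z)"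
proof -
  define a where "a = z - complex_of_real (X x)"
  have "a \<noteq> 0" using z by (auto simp: a_def)
  then have a: "a \<noteq> 0" "cnj a \<noteq> 0" by simp_all
  have i: "2 * \<i> * complex_of_real (Im z) = a - cnj a" by (auto simp: a_def complex_eq_iff)
  have nz: "a - cnj a \<noteq> 0" unfolding i[symmetric] using z by (simp add: complex_is_Real_iff)
  show ?thesis unfolding i unfolding centred_resolvent_def F_def[symmetric] a_def[symmetric]
    using a nz by (simp add: field_simps)
qed

end

text \<open>For centred resolvents \<open>\<xi>\<close> at \<open>z\<close> and \<open>\<eta>\<close> at \<open>w\<close> with second moments \<open>P = E|\<xi>|\<^sup>2\<close>, \<open>Q = E|\<eta>|\<^sup>2\<close>, \<open>C = E \<xi>\<eta>\<close>,
  \<open>C' = E cnj(\<xi>)\<eta>\<close>, the numbers \<open>K\<close>, \<open>L\<close>, \<open>X\<close> are the moments \<open>E \<xi>|\<eta>|\<^sup>2\<close>, \<open>E |\<xi>|\<^sup>2\<eta>\<close>, \<open>E |1+\<xi>|\<^sup>2|\<eta>|\<^sup>2\<close>, and the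
  inequality is Cauchy-Schwarz for \<open>(1 + \<xi>)\<eta> + \<rho>\<xi>\<close> against \<open>\<eta>\<close>. Expressed through \<open>P, Q, C, C'\<close> it is
  homogeneous, hence passes to scaled limits.\<close>
definition gram_ineq :: "complex \<Rightarrow> complex \<Rightarrow> complex \<Rightarrow> complex \<Rightarrow> real \<Rightarrow> real \<Rightarrow> complex \<Rightarrow> complex \<Rightarrow> complex \<Rightarrow> bool" where
  "gram_ineq F E z w P Q C C' \<rho> \<longleftrightarrow>
    (let K = (E * cnj C' - cnj E * C) / (2 * \<i> * Im w) - C - cnj C';
         L = (F * C' - cnj F * C) / (2 * \<i> * Im z) - C - C';
         X = (Im F * Q - Im (cnj F * K)) / Im z
     in (norm (Q + K + \<rho> * cnj C'))\<^sup>2 \<le> (X + 2 * Re (\<rho> * (cnj C' + cnj L)) + (norm \<rho>)\<^sup>2 * P) * Q)"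

text \<open>For fixed \<open>F\<close>, \<open>E\<close>, the quantities K, L, X are real-linear in
  the tuple of P, Q, C, C', so both sides are multiplied by r^2. The scaling is used with r = n
  before the limit and with r = t after it.\<close>

lemma gram_ineq_scale:
  assumes "gram_ineq F E z w P Q C C' \<rho>"
  shows "gram_ineq F E z w (r * P) (r * Q) (of_real r * C) (of_real r * C') \<rho>"
proof -
  define K where "K = (E * cnj C' - cnj E * C) / (2 * \<i> * Im w) - C - cnj C'"
  define L where "L = (F * C' - cnj F * C) / (2 * \<i> * Im z) - C - C'"
  define X where "X = (Im F * Q - Im (cnj F * K)) / Im z"
  have K: "(E * cnj (of_real r * C') - cnj E * (of_real r * C)) / (2 * \<i> * Im w) - of_real r * C - cnj (of_real r * C') = of_real r * K"
    by (simp add: K_def algebra_simps diff_divide_distrib)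
  have L: "(F * (of_real r * C') - cnj F * (of_real r * C)) / (2 * \<i> * Im z) - of_real r * C - of_real r * C' = of_real r * L"
    by (simp add: L_def algebra_simps diff_divide_distrib)
  have X: "(Im F * (r * Q) - Im (cnj F * (of_real r * K))) / Im z = r * X"
    by (simp add: X_def algebra_simps diff_divide_distrib add_divide_distrib)
  have "(norm (of_real (r * Q) + of_real r * K + \<rho> * cnj (of_real r * C')))\<^sup>2 =
    (norm (of_real r * (of_real Q + K + \<rho> * cnj C')))\<^sup>2" by (simp add: algebra_simps)
  also have "\<dots> = r\<^sup>2 * (norm (of_real Q + K + \<rho> * cnj C'))\<^sup>2" by (simp add: norm_mult power_mult_distrib)
  also have "\<dots> \<le> r\<^sup>2 * ((X + 2 * Re (\<rho> * (cnj C' + cnj L)) + (norm \<rho>)\<^sup>2 * P) * Q)"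
    using assms unfolding gram_ineq_def Let_def K_def[symmetric] L_def[symmetric] X_def[symmetric]
    by (intro mult_left_mono) auto
  also have "\<dots> = (r * X + 2 * Re (\<rho> * (cnj (of_real r * C') + cnj (of_real r * L))) + (norm \<rho>)\<^sup>2 * (r * P)) * (r * Q)"
    by (simp add: algebra_simps power2_eq_square)
  finally show ?thesis unfolding gram_ineq_def Let_def K L X .
qed

lemma gram_ineq_limit:
  assumes "\<And>n::nat. gram_ineq (F n) (E n) z w (P n) (Q n) (C n) (C' n) \<rho>"
    and z: "z \<notin> \<real>" "w \<notin> \<real>"
    and lims: "F \<longlonglongrightarrow> F0" "E \<longlonglongrightarrow> E0" "P \<longlonglongrightarrow> P0" "Q \<longlonglongrightarrow> Q0" "C \<longlonglongrightarrow> C0" "C' \<longlonglongrightarrow> C0'"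
  shows "gram_ineq F0 E0 z w P0 Q0 C0 C0' \<rho>"
proof -
  have nz: "2 * \<i> * complex_of_real (Im z) \<noteq> 0" "2 * \<i> * complex_of_real (Im w) \<noteq> 0" "Im z \<noteq> 0"
    using z by (auto simp: complex_is_Real_iff)
  let ?K = "\<lambda>E C C'. (E * cnj C' - cnj E * C) / (2 * \<i> * Im w) - C - cnj C'"
  let ?L = "\<lambda>F C C'. (F * C' - cnj F * C) / (2 * \<i> * Im z) - C - C'"
  let ?X = "\<lambda>F E Q C C'. (Im F * Q - Im (cnj F * ?K E C C')) / Im z"
  have "(\<lambda>n. (norm (Q n + ?K (E n) (C n) (C' n) + \<rho> * cnj (C' n)))\<^sup>2) \<longlonglongrightarrow>
      (norm (Q0 + ?K E0 C0 C0' + \<rho> * cnj C0'))\<^sup>2"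
    by (intro tendsto_intros lims nz)
  moreover have "(\<lambda>n. (?X (F n) (E n) (Q n) (C n) (C' n) + 2 * Re (\<rho> * (cnj (C' n) + cnj (?L (F n) (C n) (C' n)))) + (norm \<rho>)\<^sup>2 * P n) * Q n) \<longlonglongrightarrow>
      (?X F0 E0 Q0 C0 C0' + 2 * Re (\<rho> * (cnj C0' + cnj (?L F0 C0 C0'))) + (norm \<rho>)\<^sup>2 * P0) * Q0"
    by (intro tendsto_intros lims nz)
  ultimately show ?thesis
    using assms(1) unfolding gram_ineq_def Let_def by (intro LIMSEQ_le) auto
qed

lemma (in prob_space) centred_resolvents_gram:
  assumes X: "X \<in> borel_measurable M" and Y: "Y \<in> borel_measurable M" and z: "z \<notin> \<real>" "w \<notin> \<real>"
  defines "F \<equiv> recip_cauchy (distr M borel X) z" and "E \<equiv> recip_cauchy (distr M borel Y) w"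
    and "C \<equiv> (\<integral>x. centred_resolvent M X z x * centred_resolvent M Y w x \<partial>M)"
    and "C' \<equiv> (\<integral>x. centred_resolvent M X (cnj z) x * centred_resolvent M Y w x \<partial>M)"
  shows "gram_ineq F E z w (Im F / Im z - 1) (Im E / Im w - 1) C C' \<rho>"
    and "(norm C)\<^sup>2 \<le> (Im F / Im z - 1) * (Im E / Im w - 1)"
proof -
  note [measurable] = X Y
  have zc: "cnj z \<notin> \<real>" "cnj w \<notin> \<real>" using z by (simp_all add: complex_is_Real_iff)
  have nz: "2 * \<i> * complex_of_real (Im z) \<noteq> 0" "2 * \<i> * complex_of_real (Im w) \<noteq> 0" "Im z \<noteq> 0"
    using z by (auto simp: complex_is_Real_iff)
  define f g where "f = centred_resolvent M X z" and "g = centred_resolvent M Y w"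
  have fc: "centred_resolvent M X (cnj z) x = cnj (f x)" "centred_resolvent M Y (cnj w) x = cnj (g x)" for x
    by (simp_all add: f_def g_def centred_resolvent_cnj)
  have [measurable]: "f \<in> borel_measurable M" "g \<in> borel_measurable M" by (auto simp: f_def g_def)
  obtain A where A: "\<And>x. norm (f x) \<le> A" using centred_resolvent_bounded[OF z(1), of M X] unfolding f_def by metis
  obtain B where B: "\<And>x. norm (g x) \<le> B" using centred_resolvent_bounded[OF z(2), of M Y] unfolding g_def by metis
  have A0: "A \<ge> 0" by (rule order_trans[OF norm_ge_zero A])
  define P where "P = Im F / Im z - 1"
  define Q where "Q = Im E / Im w - 1"
  have P: "P = (\<integral>x. (norm (f x))\<^sup>2 \<partial>M)" and Q: "Q = (\<integral>x. (norm (g x))\<^sup>2 \<partial>M)"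
    unfolding P_def Q_def f_def g_def F_def E_def using integral_norm_centred_resolvent[OF X z(1)] integral_norm_centred_resolvent[OF Y z(2)] by simp_all
  have i2: "integrable M (\<lambda>x. (norm (f x))\<^sup>2)" "integrable M (\<lambda>x. (norm (g x))\<^sup>2)"
    unfolding f_def g_def using integrable_centred_resolvent_products(3)[OF X X z(1) z(1)] integrable_centred_resolvent_products(3)[OF Y Y z(2) z(2)] by simp_all
  have hP: "has_bochner_integral M (\<lambda>x. f x * cnj (f x)) P"
    unfolding P integral_complex_of_real[symmetric] complex_norm_square[symmetric]
    using i2 by (intro has_bochner_integral_integrable integrable_of_real)
  have hQ: "has_bochner_integral M (\<lambda>x. g x * cnj (g x)) Q"
    unfolding Q integral_complex_of_real[symmetric] complex_norm_square[symmetric]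
    using i2 by (intro has_bochner_integral_integrable integrable_of_real)
  have hf: "has_bochner_integral M f 0" and hg: "has_bochner_integral M g 0"
    using integral_centred_resolvent[OF X z(1)] integral_centred_resolvent[OF Y z(2)]
      integrable_centred_resolvent_products(2)[OF X X z(1) z(1)] integrable_centred_resolvent_products(2)[OF Y Y z(2) z(2)]
    by (simp_all add: f_def g_def has_bochner_integral_iff)
  have hC: "has_bochner_integral M (\<lambda>x. f x * g x) C"
    unfolding C_def f_def g_def by (intro has_bochner_integral_integrable integrable_centred_resolvent_products X Y z)
  have hC': "has_bochner_integral M (\<lambda>x. cnj (f x) * g x) C'"
    unfolding C'_def fc g_def[symmetric] unfolding fc[symmetric] g_def
    by (intro has_bochner_integral_integrable integrable_centred_resolvent_products X Y z zc)
  have hC'c: "has_bochner_integral M (\<lambda>x. f x * cnj (g x)) (cnj C')"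
    using has_bochner_integral_cnj[OF hC'] by simp
  note arith = has_bochner_integral_add has_bochner_integral_diff has_bochner_integral_mult_right has_bochner_integral_divide
  define K where "K = (E * cnj C' - cnj E * C) / (2 * \<i> * Im w) - C - cnj C'"
  define L where "L = (F * C' - cnj F * C) / (2 * \<i> * Im z) - C - C'"
  define S where "S = (Im F * Q - Im (cnj F * K)) / Im z"
  have gg: "g x * cnj (g x) = (E * (1 + cnj (g x)) - cnj E * (1 + g x)) / (2 * \<i> * Im w) - 1 - g x - cnj (g x)" for x
    using norm_one_plus_centred_resolvent[OF z(2), where X=Y and x=x]
    unfolding g_def[symmetric] E_def[symmetric] by (simp add: algebra_simps)
  have ff1: "(1 + f x) * (1 + cnj (f x)) = (F * (1 + cnj (f x)) - cnj F * (1 + f x)) / (2 * \<i> * Im z)" for x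
    using norm_one_plus_centred_resolvent[OF z(1), where X=X and x=x]
    unfolding f_def[symmetric] F_def[symmetric] .
  then have ff: "f x * cnj (f x) = (F * (1 + cnj (f x)) - cnj F * (1 + f x)) / (2 * \<i> * Im z) - 1 - f x - cnj (f x)" for x
    unfolding ff1[symmetric] by (simp add: algebra_simps)
  \<comment> \<open>Replacing |g|^2 by its first-order expression leaves only f, f g and f cnj(g),
    with means 0, C and the conjugate of C'.\<close>
  have hK: "has_bochner_integral M (\<lambda>x. f x * (g x * cnj (g x))) K"
  proof -
    have "has_bochner_integral M (\<lambda>x. (E * (f x + f x * cnj (g x)) - cnj E * (f x + f x * g x)) / (2 * \<i> * Im w) - f x - f x * g x - f x * cnj (g x))
      ((E * (0 + cnj C') - cnj E * (0 + C)) / (2 * \<i> * Im w) - 0 - C - cnj C')"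
      by (intro arith hf hC hC'c nz)
    moreover have "(E * (f x + f x * cnj (g x)) - cnj E * (f x + f x * g x)) / (2 * \<i> * Im w) - f x - f x * g x - f x * cnj (g x) = f x * (g x * cnj (g x))" for x
      unfolding gg by (simp add: algebra_simps diff_divide_distrib add_divide_distrib)
    ultimately show ?thesis by (simp add: K_def)
  qed
  have hL: "has_bochner_integral M (\<lambda>x. (f x * cnj (f x)) * g x) L"
  proof -
    have "has_bochner_integral M (\<lambda>x. (F * (g x + cnj (f x) * g x) - cnj F * (g x + f x * g x)) / (2 * \<i> * Im z) - g x - f x * g x - cnj (f x) * g x)
      ((F * (0 + C') - cnj F * (0 + C)) / (2 * \<i> * Im z) - 0 - C - C')"
      by (intro arith hg hC hC' nz)
    moreover have "(F * (g x + cnj (f x) * g x) - cnj F * (g x + f x * g x)) / (2 * \<i> * Im z) - g x - f x * g x - cnj (f x) * g x = (f x * cnj (f x)) * g x" for x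
      unfolding ff by (simp add: algebra_simps diff_divide_distrib add_divide_distrib)
    ultimately show ?thesis by (simp add: L_def)
  qed
  have hKc: "has_bochner_integral M (\<lambda>x. cnj (f x) * (g x * cnj (g x))) (cnj K)"
    using has_bochner_integral_cnj[OF hK] by (simp add: mult.commute mult.left_commute)
  have hLc: "has_bochner_integral M (\<lambda>x. (f x * cnj (f x)) * cnj (g x)) (cnj L)"
    using has_bochner_integral_cnj[OF hL] by (simp add: mult.commute mult.left_commute)
  \<comment> \<open>Here |1 + f|^2 is the factor made linear; what remains is the moment of |g|^2
    with weights 1, f and cnj(f), that is Q, K and the conjugate of K.\<close>
  have hS: "has_bochner_integral M (\<lambda>x. ((1 + f x) * (1 + cnj (f x))) * (g x * cnj (g x))) S"
  proof -
    have "has_bochner_integral M (\<lambda>x. (F * (g x * cnj (g x) + cnj (f x) * (g x * cnj (g x))) - cnj F * (g x * cnj (g x) + f x * (g x * cnj (g x)))) / (2 * \<i> * Im z))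
      ((F * (Q + cnj K) - cnj F * (Q + K)) / (2 * \<i> * Im z))"
      by (intro arith hQ hK hKc nz)
    moreover have "(F * (g x * cnj (g x) + cnj (f x) * (g x * cnj (g x))) - cnj F * (g x * cnj (g x) + f x * (g x * cnj (g x)))) / (2 * \<i> * Im z)
        = ((1 + f x) * (1 + cnj (f x))) * (g x * cnj (g x))" for x
      unfolding ff1 by (simp add: algebra_simps diff_divide_distrib add_divide_distrib)
    moreover have "(F * (Q + cnj K) - cnj F * (Q + K)) / (2 * \<i> * Im z) = S"
    proof -
      have e: "F * (Q + cnj K) - cnj F * (Q + K) = 2 * \<i> * (Im F * Q - Im (cnj F * K))"
        by (simp add: complex_eq_iff algebra_simps)
      show ?thesis unfolding e using nz by (simp add: S_def)
    qed
    ultimately show ?thesis by simp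
  qed
  \<comment> \<open>\<rho> stays free, since the useful value depends on the moments themselves. The
    cross term of |h|^2 is \<rho> times f (1 + cnj f) cnj g, whose mean involves only C' and
    L.\<close>
  define h where "h x = (1 + f x) * g x + \<rho> * f x" for x
  have [measurable]: "h \<in> borel_measurable M" unfolding h_def[abs_def] by measurable
  have hb: "norm (h x) \<le> (1 + A) * B + norm \<rho> * A" for x
  proof -
    have "norm (1 + f x) \<le> 1 + A" using norm_triangle_ineq[of 1 "f x"] A[of x] by simp
    then have "norm ((1 + f x) * g x) \<le> (1 + A) * B" unfolding norm_mult using B A0 by (intro mult_mono) auto
    moreover have "norm (\<rho> * f x) \<le> norm \<rho> * A" unfolding norm_mult using A by (intro mult_left_mono) auto
    ultimately show ?thesis unfolding h_def by (rule order_trans[OF norm_triangle_ineq add_mono])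
  qed
  have ih: "integrable M (\<lambda>x. (norm (h x))\<^sup>2)"
  proof (rule integrable_bounded)
    show "norm ((norm (h x))\<^sup>2) \<le> ((1 + A) * B + norm \<rho> * A)\<^sup>2" for x
      using power_mono[OF hb norm_ge_zero, of x 2] by simp
  qed simp
  have hhg: "has_bochner_integral M (\<lambda>x. h x * cnj (g x)) (Q + K + \<rho> * cnj C')"
  proof -
    have "has_bochner_integral M (\<lambda>x. g x * cnj (g x) + f x * (g x * cnj (g x)) + \<rho> * (f x * cnj (g x))) (Q + K + \<rho> * cnj C')"
      by (intro arith hQ hK hC'c)
    then show ?thesis by (simp add: h_def algebra_simps)
  qed
  have hhh: "has_bochner_integral M (\<lambda>x. h x * cnj (h x)) (of_real (S + 2 * Re (\<rho> * (cnj C' + cnj L)) + (norm \<rho>)\<^sup>2 * P))"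
  proof -
    have c1: "has_bochner_integral M (\<lambda>x. \<rho> * (f x * cnj (g x) + (f x * cnj (f x)) * cnj (g x))) (\<rho> * (cnj C' + cnj L))"
      by (intro arith hC'c hLc)
    have "has_bochner_integral M (\<lambda>x. ((1 + f x) * (1 + cnj (f x))) * (g x * cnj (g x)) +
        \<rho> * (f x * cnj (g x) + (f x * cnj (f x)) * cnj (g x)) + cnj (\<rho> * (f x * cnj (g x) + (f x * cnj (f x)) * cnj (g x)))
         + (\<rho> * cnj \<rho>) * (f x * cnj (f x)))
       (S + \<rho> * (cnj C' + cnj L) + cnj (\<rho> * (cnj C' + cnj L)) + (\<rho> * cnj \<rho>) * P)"
      by (intro has_bochner_integral_add hS c1 has_bochner_integral_cnj has_bochner_integral_mult_right hP)
    moreover have "S + \<rho> * (cnj C' + cnj L) + cnj (\<rho> * (cnj C' + cnj L)) + (\<rho> * cnj \<rho>) * P =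
        of_real (S + 2 * Re (\<rho> * (cnj C' + cnj L)) + (norm \<rho>)\<^sup>2 * P)"
      unfolding complex_norm_square[symmetric] by (simp add: complex_eq_iff algebra_simps)
    moreover have "((1 + f x) * (1 + cnj (f x))) * (g x * cnj (g x)) +
        \<rho> * (f x * cnj (g x) + (f x * cnj (f x)) * cnj (g x)) + cnj (\<rho> * (f x * cnj (g x) + (f x * cnj (f x)) * cnj (g x)))
         + (\<rho> * cnj \<rho>) * (f x * cnj (f x)) = h x * cnj (h x)" for x
      by (simp add: h_def algebra_simps)
    ultimately show ?thesis by (simp only:)
  qed
  have "complex_of_real (\<integral>x. (norm (h x))\<^sup>2 \<partial>M) = (\<integral>x. h x * cnj (h x) \<partial>M)"
    unfolding integral_complex_of_real[symmetric] complex_norm_square ..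
  also have "\<dots> = of_real (S + 2 * Re (\<rho> * (cnj C' + cnj L)) + (norm \<rho>)\<^sup>2 * P)"
    using hhh by (rule has_bochner_integral_integral_eq)
  finally have nh: "(\<integral>x. (norm (h x))\<^sup>2 \<partial>M) = S + 2 * Re (\<rho> * (cnj C' + cnj L)) + (norm \<rho>)\<^sup>2 * P"
    using of_real_eq_iff by blast
  have "(norm (Q + K + \<rho> * cnj C'))\<^sup>2 \<le> (S + 2 * Re (\<rho> * (cnj C' + cnj L)) + (norm \<rho>)\<^sup>2 * P) * Q"
    using Cauchy_Schwarz_complex_integral[OF ih i2(2)] hhg nh Q by (simp add: has_bochner_integral_iff)
  then show "gram_ineq F E z w (Im F / Im z - 1) (Im E / Im w - 1) C C' \<rho>"
    unfolding gram_ineq_def Let_def P_def[symmetric] Q_def[symmetric] K_def[symmetric] L_def[symmetric] S_def[symmetric] .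
  have "integrable M (\<lambda>x. f x * cnj (cnj (g x)))" using hC by (simp add: has_bochner_integral_iff)
  from Cauchy_Schwarz_complex_integral[OF i2(1) _ this] i2(2)
  show "(norm C)\<^sup>2 \<le> (Im F / Im z - 1) * (Im E / Im w - 1)"
    unfolding P_def[symmetric] Q_def[symmetric] P Q using hC by (simp add: has_bochner_integral_iff)
qed

text \<open>(1 + \<xi>)(1 + \<eta>) equals F E times the kernel of the plane transform, and \<xi>,
  \<eta> have mean zero; hence F E G - 1 is exactly the covariance of the two centred
  resolvents.\<close>

lemma integral_centred_resolvents_marginals:
  assumes \<mu>: "borel_prob \<mu>" and z: "z \<notin> \<real>" "w \<notin> \<real>"
  shows "(\<integral>p. centred_resolvent \<mu> fst z p * centred_resolvent \<mu> snd w p \<partial>\<mu>) =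
     recip_cauchy (marginal1 \<mu>) z * recip_cauchy (marginal2 \<mu>) w * cauchy_transform2 \<mu> z w - 1"
proof -
  interpret prob_space \<mu> using borel_probD(1)[OF \<mu>] .
  note m [measurable] = measurable_fst_snd[OF \<mu>]
  let ?F = "recip_cauchy (marginal1 \<mu>) z" and ?E = "recip_cauchy (marginal2 \<mu>) w"
  let ?f = "centred_resolvent \<mu> fst z" and ?g = "centred_resolvent \<mu> snd w"
  have h: "has_bochner_integral \<mu> (\<lambda>p. ?f p * ?g p) (\<integral>p. ?f p * ?g p \<partial>\<mu>)" "has_bochner_integral \<mu> ?f 0" "has_bochner_integral \<mu> ?g 0"
    using integrable_centred_resolvent_products(1,2)[OF m z] integrable_centred_resolvent_products(2)[OF m(2) m(1) z(2) z(1)]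
      integral_centred_resolvent[OF m(1) z(1)] integral_centred_resolvent[OF m(2) z(2)]
    by (simp_all add: has_bochner_integral_iff)
  have "has_bochner_integral \<mu> (\<lambda>_. 1::complex) (measure \<mu> (space \<mu>) *\<^sub>R 1)"
    by (simp add: has_bochner_integral_iff)
  then have h1: "has_bochner_integral \<mu> (\<lambda>_. 1::complex) 1" by (simp add: prob_space)
  have "has_bochner_integral \<mu> (\<lambda>p. ?f p * ?g p + ?f p + ?g p + 1) ((\<integral>p. ?f p * ?g p \<partial>\<mu>) + 0 + 0 + 1)"
    by (intro has_bochner_integral_add h h1)
  moreover have "?f p * ?g p + ?f p + ?g p + 1 = (?F * ?E) * (1 / ((z - complex_of_real (fst p)) * (w - complex_of_real (snd p))))" for p
    by (simp add: centred_resolvent_def marginal1_def marginal2_def algebra_simps)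
  ultimately have "(\<integral>p. (?F * ?E) * (1 / ((z - complex_of_real (fst p)) * (w - complex_of_real (snd p)))) \<partial>\<mu>) = (\<integral>p. ?f p * ?g p \<partial>\<mu>) + 1"
    by (simp add: has_bochner_integral_iff)
  then have "?F * ?E * cauchy_transform2 \<mu> z w = (\<integral>p. ?f p * ?g p \<partial>\<mu>) + 1"
    unfolding integral_mult_right_zero cauchy_transform2_def .
  then show ?thesis by simp
qed

section \<open>Stolz angles and R-transforms\<close>

lemma stolz_pair_iff:
  "z \<in> stolz_pair \<alpha> \<beta> \<longleftrightarrow> Im z \<noteq> 0 \<and> \<bar>Re z\<bar> < \<alpha> * \<bar>Im z\<bar> \<and> \<bar>Im z\<bar> < \<beta>"
proof -
  have "z \<in> cnj ` stolz_angle \<alpha> \<beta> \<longleftrightarrow> cnj z \<in> stolz_angle \<alpha> \<beta>"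
    by (metis complex_cnj_cnj image_eqI imageE)
  then show ?thesis by (auto simp: stolz_pair_def stolz_angle_def abs_if)
qed

lemma stolz_pair_notin_Reals: "z \<in> stolz_pair \<alpha> \<beta> \<Longrightarrow> z \<notin> \<real>"
  by (simp add: stolz_pair_iff complex_is_Real_iff)

lemma stolz_pair_nonzero: "z \<in> stolz_pair \<alpha> \<beta> \<Longrightarrow> z \<noteq> 0"
  by (auto simp: stolz_pair_iff)

lemma open_stolz_pair: "open (stolz_pair \<alpha> \<beta>)"
proof -
  have "stolz_pair \<alpha> \<beta> = {z. Im z \<noteq> 0} \<inter> {z. \<bar>Re z\<bar> < \<alpha> * \<bar>Im z\<bar>} \<inter> {z. \<bar>Im z\<bar> < \<beta>}"
    by (auto simp: stolz_pair_iff)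
  then show ?thesis
    by (simp add: open_Int open_Collect_neq open_Collect_less continuous_intros)
qed

lemma stolz_pair_mono: "\<alpha> \<le> \<alpha>' \<Longrightarrow> \<beta> \<le> \<beta>' \<Longrightarrow> stolz_pair \<alpha> \<beta> \<subseteq> stolz_pair \<alpha>' \<beta>'"
  unfolding stolz_pair_iff subset_iff
  by (meson abs_ge_zero less_le_trans mult_right_mono)

lemma stolz_domain_mono: "\<alpha> \<le> \<alpha>' \<Longrightarrow> \<beta> \<le> \<beta>' \<Longrightarrow> stolz_domain \<alpha> \<beta> \<subseteq> stolz_domain \<alpha>' \<beta>'"
  unfolding stolz_domain_def using stolz_pair_mono by blast

text \<open>The two components of \<open>stolz_pair\<close>, indexed by the sign \<sigma> of the
  imaginary part. They are convex, so identity-theorem and sign arguments are made on each of them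
  separately.\<close>

definition stolz_half :: "real \<Rightarrow> real \<Rightarrow> real \<Rightarrow> complex set" where
  "stolz_half \<sigma> \<alpha> \<beta> = {z \<in> stolz_pair \<alpha> \<beta>. 0 < \<sigma> * Im z}"

lemma open_stolz_half: "open (stolz_half \<sigma> \<alpha> \<beta>)"
proof -
  have "stolz_half \<sigma> \<alpha> \<beta> = stolz_pair \<alpha> \<beta> \<inter> {z. 0 < \<sigma> * Im z}"
    by (auto simp: stolz_half_def)
  then show ?thesis using open_stolz_pair
    by (simp add: open_Int open_Collect_less continuous_intros)
qed

lemma convex_stolz_half:
  assumes "\<sigma> = 1 \<or> \<sigma> = -1"
  shows "convex (stolz_half \<sigma> \<alpha> \<beta>)"
proof -
  have "stolz_half \<sigma> \<alpha> \<beta> = {z. 0 < \<sigma> * Im z} \<inter> {z. Re z - \<alpha> * \<sigma> * Im z < 0} \<inter> {z. - Re z - \<alpha> * \<sigma> * Im z < 0} \<inter> {z. \<sigma> * Im z < \<beta>}"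
    using assms by (auto simp: stolz_half_def stolz_pair_iff abs_if)
  moreover have "convex {z. f z < b}" if "linear f" for f :: "complex \<Rightarrow> real" and b
  proof -
    have "{z. f z < b} = f -` {..<b}" by auto
    then show ?thesis using convex_linear_vimage[OF that, of "{..<b}"] by simp
  qed
  note lin = this
  have "convex {z. 0 < \<sigma> * Im z}"
  proof -
    have "linear (\<lambda>z. - (\<sigma> * Im z))" by (auto intro!: linearI simp: algebra_simps)
    from lin[OF this, of 0] show ?thesis by simp
  qed
  moreover have "convex {z. Re z - \<alpha> * \<sigma> * Im z < 0}" "convex {z. - Re z - \<alpha> * \<sigma> * Im z < 0}" "convex {z. \<sigma> * Im z < \<beta>}"
  proof -
    have "linear (\<lambda>z. Re z - \<alpha> * \<sigma> * Im z)" "linear (\<lambda>z. - Re z - \<alpha> * \<sigma> * Im z)" "linear (\<lambda>z. \<sigma> * Im z)"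
      by (auto intro!: linearI simp: algebra_simps)
    then show "convex {z. Re z - \<alpha> * \<sigma> * Im z < 0}" "convex {z. - Re z - \<alpha> * \<sigma> * Im z < 0}" "convex {z. \<sigma> * Im z < \<beta>}"
      using lin by blast+
  qed
  ultimately show ?thesis by (simp add: convex_Int)
qed

text \<open>Points of the imaginary axis tending to 0. The offset 2 keeps their heights strictly
  below \<beta> already for k = 0.\<close>

definition stolz_axis :: "real \<Rightarrow> real \<Rightarrow> nat \<Rightarrow> complex" where
  "stolz_axis \<sigma> \<beta> k = of_real (\<sigma> * \<beta> / (of_nat k + 2)) * \<i>"

lemma stolz_axis_in:
  assumes "\<sigma> = 1 \<or> \<sigma> = -1" "\<alpha> > 0" "\<beta> > 0"
  shows "stolz_axis \<sigma> \<beta> k \<in> stolz_half \<sigma> \<alpha> \<beta>"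
proof -
  define y where "y = \<beta> / (of_nat k + 2)"
  have "y > 0" "y < \<beta>" using assms by (simp_all add: y_def field_simps add_strict_increasing)
  moreover have "stolz_axis \<sigma> \<beta> k = of_real (\<sigma> * y) * \<i>" by (simp add: stolz_axis_def y_def)
  ultimately show ?thesis using assms by (auto simp: stolz_half_def stolz_pair_iff)
qed

lemma stolz_axis_tendsto: "stolz_axis \<sigma> \<beta> \<longlonglongrightarrow> 0"
proof -
  have "(\<lambda>k. \<sigma> * \<beta> / (of_nat k + 2)) \<longlonglongrightarrow> 0" by real_asymp
  from tendsto_mult_left[OF tendsto_of_real[OF this], of \<i>]
  show ?thesis unfolding stolz_axis_def[abs_def] by (simp add: mult.commute)
qed

lemma stolz_half_nonempty:
  assumes "\<sigma> = 1 \<or> \<sigma> = -1" "\<alpha> > 0" "\<beta> > 0"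
  shows "stolz_half \<sigma> \<alpha> \<beta> \<noteq> {}"
  using stolz_axis_in[OF assms] by blast

lemma stolz_pair_in_half:
  assumes "z \<in> stolz_pair \<alpha> \<beta>"
  obtains \<sigma> where "\<sigma> = 1 \<or> \<sigma> = -1" "z \<in> stolz_half \<sigma> \<alpha> \<beta>"
proof (cases "Im z > 0")
  case True
  then show ?thesis using assms that[of 1] by (simp add: stolz_half_def)
next
  case False
  then show ?thesis using assms that[of "-1"] by (auto simp: stolz_half_def stolz_pair_iff)
qed

text \<open>Because \<omega> R(\<omega>) tends to 0, W = 1/\<omega> + R(\<omega>) behaves like
  1/\<omega> on the axis. Eventually Re (\<omega> W) > 1/2; as \<omega> is purely imaginary this
  bounds |\<omega>| |Im W| below and fixes the half-plane of W. These are the hypotheses under which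
  the marginal limits hold.\<close>

lemma R_transform_axis:
  assumes R: "R_transform_on m \<alpha> \<beta> R" and ab: "\<alpha> > 0" "\<beta> > 0" and \<sigma>: "\<sigma> = 1 \<or> \<sigma> = -1"
  defines "\<omega> \<equiv> stolz_axis \<sigma> \<beta>"
  shows "(\<lambda>k. \<omega> k * R (\<omega> k)) \<longlonglongrightarrow> 0"
    and "(\<lambda>k. \<omega> k * (1 / \<omega> k + R (\<omega> k))) \<longlonglongrightarrow> 1"
    and "\<exists>N. \<forall>k. 1 \<le> 2 * (norm (\<omega> (k + N)) * \<bar>Im (1 / \<omega> (k + N) + R (\<omega> (k + N)))\<bar>) \<and>
            \<sigma> * Im (1 / \<omega> (k + N) + R (\<omega> (k + N))) < 0"
proof -
  have in': "\<omega> k \<in> stolz_pair \<alpha> \<beta>" for k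
    using stolz_axis_in[OF \<sigma> ab, of k] by (simp add: \<omega>_def stolz_half_def)
  have nz: "\<omega> k \<noteq> 0" for k using in' stolz_pair_nonzero by blast
  have "filterlim \<omega> (at 0 within stolz_pair \<alpha> \<beta>) sequentially"
    using stolz_axis_tendsto[of \<sigma> \<beta>] in' nz by (auto simp: filterlim_at \<omega>_def)
  then show 1: "(\<lambda>k. \<omega> k * R (\<omega> k)) \<longlonglongrightarrow> 0"
    using R unfolding R_transform_on_def by (auto intro: filterlim_compose)
  have e: "\<omega> k * (1 / \<omega> k + R (\<omega> k)) = 1 + \<omega> k * R (\<omega> k)" for k
    using nz[of k] by (simp add: field_simps)
  show 2: "(\<lambda>k. \<omega> k * (1 / \<omega> k + R (\<omega> k))) \<longlonglongrightarrow> 1"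
    unfolding e using tendsto_add[OF tendsto_const 1] by simp
  from tendstoD[OF 1, of "1/2"] obtain N where N: "\<And>k. k \<ge> N \<Longrightarrow> norm (\<omega> k * R (\<omega> k)) < 1/2"
    unfolding eventually_sequentially by auto
  show "\<exists>N. \<forall>k. 1 \<le> 2 * (norm (\<omega> (k + N)) * \<bar>Im (1 / \<omega> (k + N) + R (\<omega> (k + N)))\<bar>) \<and>
            \<sigma> * Im (1 / \<omega> (k + N) + R (\<omega> (k + N))) < 0"
  proof (intro exI[of _ N] allI)
    fix k
    define j where "j = k + N"
    define y where "y = \<beta> / (of_nat j + 2)"
    have y: "y > 0" using ab by (simp add: y_def)
    define W where "W = 1 / \<omega> j + R (\<omega> j)"
    have om: "\<omega> j = of_real (\<sigma> * y) * \<i>" by (simp add: \<omega>_def stolz_axis_def y_def)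
    have "\<bar>Re (\<omega> j * R (\<omega> j))\<bar> < 1/2" using N[of j] abs_Re_le_cmod[of "\<omega> j * R (\<omega> j)"] by (simp add: j_def)
    then have "1 + Re (\<omega> j * R (\<omega> j)) > 1/2" by (simp only: abs_less_iff) linarith
    then have "Re (\<omega> j * W) > 1/2" unfolding W_def e by (simp only: plus_complex.sel one_complex.sel)
    then have a: "- (\<sigma> * y * Im W) > 1/2" unfolding om by simp
    have n: "norm (\<omega> j) = y" unfolding om using y \<sigma> by (auto simp: norm_mult)
    from a have "y * (\<sigma> * Im W) < 0" by (simp add: algebra_simps)
    then have "\<sigma> * Im W < 0" using y by (simp add: mult_less_0_iff)
    moreover from this \<sigma> have "\<bar>Im W\<bar> = - (\<sigma> * Im W)" by auto
    then have "1 \<le> 2 * (y * \<bar>Im W\<bar>)" using a by (simp add: algebra_simps)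
    ultimately show "1 \<le> 2 * (norm (\<omega> (k + N)) * \<bar>Im (1 / \<omega> (k + N) + R (\<omega> (k + N)))\<bar>) \<and>
            \<sigma> * Im (1 / \<omega> (k + N) + R (\<omega> (k + N))) < 0"
      unfolding j_def[symmetric] W_def[symmetric] n by blast
  qed
qed

text \<open>1/z + R(z) never meets the real axis, so the sign of its imaginary part is constant on
  each connected half; far along the axis it is the sign of Im (1/z).\<close>

lemma R_transform_Im:
  assumes R: "R_transform_on m \<alpha> \<beta> R" and ab: "\<alpha> > 0" "\<beta> > 0" and z: "z \<in> stolz_pair \<alpha> \<beta>"
  shows "Im z * Im (1 / z + R z) < 0"
proof -
  obtain \<sigma> where \<sigma>: "\<sigma> = 1 \<or> \<sigma> = -1" and zs: "z \<in> stolz_half \<sigma> \<alpha> \<beta>" by (rule stolz_pair_in_half[OF z])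
  obtain N where "\<sigma> * Im (1 / stolz_axis \<sigma> \<beta> (0 + N) + R (stolz_axis \<sigma> \<beta> (0 + N))) < 0"
    using R_transform_axis(3)[OF R ab \<sigma>] by blast
  then obtain z0 where z0: "z0 \<in> stolz_half \<sigma> \<alpha> \<beta>" "\<sigma> * Im (1 / z0 + R z0) < 0"
    using stolz_axis_in[OF \<sigma> ab] by blast
  let ?f = "\<lambda>z. \<sigma> * Im (1 / z + R z)"
  have sub: "stolz_half \<sigma> \<alpha> \<beta> \<subseteq> stolz_pair \<alpha> \<beta>" by (auto simp: stolz_half_def)
  have "continuous_on (stolz_half \<sigma> \<alpha> \<beta>) R"
    using R sub holomorphic_on_imp_continuous_on continuous_on_subset unfolding R_transform_on_def by blast
  then have cont: "continuous_on (stolz_half \<sigma> \<alpha> \<beta>) ?f"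
    using sub stolz_pair_nonzero by (intro continuous_intros) blast+
  have nz: "?f x \<noteq> 0" if "x \<in> stolz_half \<sigma> \<alpha> \<beta>" for x
    using R sub that \<sigma> unfolding R_transform_on_def by (auto simp: complex_is_Real_iff)
  have "connected (?f ` stolz_half \<sigma> \<alpha> \<beta>)"
    by (intro connected_continuous_image cont convex_connected convex_stolz_half \<sigma>)
  then have "?f z < 0"
  proof (rule_tac ccontr)
    assume c: "connected (?f ` stolz_half \<sigma> \<alpha> \<beta>)" and "\<not> ?f z < 0"
    then have "0 \<in> ?f ` stolz_half \<sigma> \<alpha> \<beta>"
      using zs z0 unfolding connected_iff_interval by (meson image_eqI less_imp_le not_le)
    then show False using nz by force
  qed
  moreover have "0 < \<sigma> * Im z" using zs by (simp add: stolz_half_def)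
  ultimately show ?thesis using \<sigma> by (auto simp: mult_less_0_iff)
qed

text \<open>As w tends to 0 on the axis, w R2(w) vanishes, and h(z, w) tends to G1(1/z + R1(z)) / z
  = 1 with G1 the transform of the first marginal; only z R1(z) survives. The marginal R-transforms
  can therefore be read off from the bi-free one.\<close>

lemma bifree_R_tendsto_axis:
  fixes R :: "complex \<times> complex \<Rightarrow> complex"
  assumes \<mu>: "borel_prob \<mu>" and R1: "R_transform_on (marginal1 \<mu>) \<alpha> \<beta> R1"
    and R2: "R_transform_on (marginal2 \<mu>) \<alpha> \<beta> R2" and ab: "\<alpha> > 0" "\<beta> > 0"
    and R: "\<forall>(z, w) \<in> stolz_domain \<alpha> \<beta>. R (z, w) = z * R1 z + w * R2 w + (1 - 1 / h_fun \<mu> R1 R2 z w)"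
    and z: "z \<in> stolz_pair \<alpha> \<beta>"
  shows "(\<lambda>k. R (z, stolz_axis 1 \<beta> k)) \<longlonglongrightarrow> z * R1 z"
    and "(\<lambda>k. R (stolz_axis 1 \<beta> k, z)) \<longlonglongrightarrow> z * R2 z"
proof -
  let ?\<omega> = "stolz_axis 1 \<beta>"
  have in': "?\<omega> k \<in> stolz_pair \<alpha> \<beta>" for k
    using stolz_axis_in[of 1, OF _ ab, of k] by (simp add: stolz_half_def)
  have z0: "z \<noteq> 0" using z stolz_pair_nonzero by blast
  have Z: "1 / z + R1 z \<notin> \<real>" "cauchy_transform (marginal1 \<mu>) (1 / z + R1 z) = z"
     "1 / z + R2 z \<notin> \<real>" "cauchy_transform (marginal2 \<mu>) (1 / z + R2 z) = z"
    using R1 R2 z unfolding R_transform_on_def by blast+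
  note ax1 = R_transform_axis[OF R1 ab disjI1[OF refl]] and ax2 = R_transform_axis[OF R2 ab disjI1[OF refl]]
  obtain N where N: "\<And>k. 1 \<le> 2 * (norm (?\<omega> (k + N)) * \<bar>Im (1 / ?\<omega> (k + N) + R2 (?\<omega> (k + N)))\<bar>)"
    using ax2(3) by blast
  have "(\<lambda>k. cauchy_transform2 \<mu> (1 / z + R1 z) (1 / ?\<omega> (k + N) + R2 (?\<omega> (k + N))) / ?\<omega> (k + N)) \<longlonglongrightarrow> z"
    using cauchy_transform2_tendsto_marginal(1)[OF \<mu> Z(1) LIMSEQ_ignore_initial_segment[where k=N, OF stolz_axis_tendsto]
         LIMSEQ_ignore_initial_segment[where k=N, OF ax2(2)] N] Z(2) by simp
  then have 1: "(\<lambda>k. cauchy_transform2 \<mu> (1 / z + R1 z) (1 / ?\<omega> k + R2 (?\<omega> k)) / ?\<omega> k) \<longlonglongrightarrow> z"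
    by (rule LIMSEQ_offset)
  have "(\<lambda>k. z * R1 z + ?\<omega> k * R2 (?\<omega> k) + (1 - 1 / (cauchy_transform2 \<mu> (1 / z + R1 z) (1 / ?\<omega> k + R2 (?\<omega> k)) / ?\<omega> k / z))) \<longlonglongrightarrow> z * R1 z + 0 + (1 - 1 / (z / z))"
    using z0 by (intro tendsto_intros 1 ax2) auto
  then show "(\<lambda>k. R (z, stolz_axis 1 \<beta> k)) \<longlonglongrightarrow> z * R1 z"
    using R z in' z0 by (simp add: stolz_domain_def h_fun_def mult.commute)
  obtain N' where N': "\<And>k. 1 \<le> 2 * (norm (?\<omega> (k + N')) * \<bar>Im (1 / ?\<omega> (k + N') + R1 (?\<omega> (k + N')))\<bar>)"
    using ax1(3) by blast
  have "(\<lambda>k. cauchy_transform2 \<mu> (1 / ?\<omega> (k + N') + R1 (?\<omega> (k + N'))) (1 / z + R2 z) / ?\<omega> (k + N')) \<longlonglongrightarrow> z"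
    using cauchy_transform2_tendsto_marginal(2)[OF \<mu> Z(3) LIMSEQ_ignore_initial_segment[where k=N', OF stolz_axis_tendsto]
         LIMSEQ_ignore_initial_segment[where k=N', OF ax1(2)] N'] Z(4) by simp
  then have 2: "(\<lambda>k. cauchy_transform2 \<mu> (1 / ?\<omega> k + R1 (?\<omega> k)) (1 / z + R2 z) / ?\<omega> k) \<longlonglongrightarrow> z"
    by (rule LIMSEQ_offset)
  have "(\<lambda>k. ?\<omega> k * R1 (?\<omega> k) + z * R2 z + (1 - 1 / (cauchy_transform2 \<mu> (1 / ?\<omega> k + R1 (?\<omega> k)) (1 / z + R2 z) / ?\<omega> k / z))) \<longlonglongrightarrow> 0 + z * R2 z + (1 - 1 / (z / z))"
    using z0 by (intro tendsto_intros 2 ax1) auto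
  then show "(\<lambda>k. R (stolz_axis 1 \<beta> k, z)) \<longlonglongrightarrow> z * R2 z"
    using R z in' z0 by (simp add: stolz_domain_def h_fun_def)
qed

text \<open>Axis limits of both sides of R' = s R: a scaling of the bi-free R-transforms is
  inherited by the two marginals.\<close>

lemma bifree_R_scaled_marginals:
  fixes R R' :: "complex \<times> complex \<Rightarrow> complex"
  assumes \<mu>: "borel_prob \<mu>" and R1: "R_transform_on (marginal1 \<mu>) \<alpha> \<beta> R1"
    and R2: "R_transform_on (marginal2 \<mu>) \<alpha> \<beta> R2" and ab: "\<alpha> > 0" "\<beta> > 0"
    and R: "\<forall>(z, w) \<in> stolz_domain \<alpha> \<beta>. R (z, w) = z * R1 z + w * R2 w + (1 - 1 / h_fun \<mu> R1 R2 z w)"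
    and \<mu>': "borel_prob \<mu>'" and R1': "R_transform_on (marginal1 \<mu>') \<alpha> \<beta> R1'"
    and R2': "R_transform_on (marginal2 \<mu>') \<alpha> \<beta> R2'"
    and R': "\<forall>(z, w) \<in> stolz_domain \<alpha> \<beta>. R' (z, w) = z * R1' z + w * R2' w + (1 - 1 / h_fun \<mu>' R1' R2' z w)"
    and eq: "\<And>p. p \<in> stolz_domain \<alpha> \<beta> \<Longrightarrow> R' p = s * R p"
    and z: "z \<in> stolz_pair \<alpha> \<beta>"
  shows "R1' z = s * R1 z" "R2' z = s * R2 z"
proof -
  have in': "stolz_axis 1 \<beta> k \<in> stolz_pair \<alpha> \<beta>" for k
    using stolz_axis_in[of 1, OF _ ab, of k] by (simp add: stolz_half_def)
  have z0: "z \<noteq> 0" using z stolz_pair_nonzero by blast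
  note l = bifree_R_tendsto_axis[OF \<mu> R1 R2 ab R z] and l' = bifree_R_tendsto_axis[OF \<mu>' R1' R2' ab R' z]
  have "(\<lambda>k. R' (z, stolz_axis 1 \<beta> k)) \<longlonglongrightarrow> s * (z * R1 z)"
    using tendsto_mult_left[OF l(1), of s] eq z in' by (simp add: stolz_domain_def)
  from LIMSEQ_unique[OF this l'(1)] show "R1' z = s * R1 z" using z0 by simp
  have "(\<lambda>k. R' (stolz_axis 1 \<beta> k, z)) \<longlonglongrightarrow> s * (z * R2 z)"
    using tendsto_mult_left[OF l(2), of s] eq z in' by (simp add: stolz_domain_def)
  from LIMSEQ_unique[OF this l'(2)] show "R2' z = s * R2 z" using z0 by simp
qed

section \<open>Continuation of scaled R-transforms to a larger Stolz domain\<close>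

lemma R_transform_on_mono:
  assumes "R_transform_on m \<alpha>' \<beta>' R" "\<alpha> \<le> \<alpha>'" "\<beta> \<le> \<beta>'"
  shows "R_transform_on m \<alpha> \<beta> R"
  using assms stolz_pair_mono[OF assms(2,3)] holomorphic_on_subset tendsto_within_subset
  unfolding R_transform_on_def by blast

lemma bifree_R_transform_on_mono:
  assumes "bifree_R_transform_on \<mu> \<alpha>' \<beta>' R" "\<alpha> \<le> \<alpha>'" "\<beta> \<le> \<beta>'"
  shows "bifree_R_transform_on \<mu> \<alpha> \<beta> R"
  using assms R_transform_on_mono[OF _ assms(2,3)] stolz_domain_mono[OF assms(2,3)]
  unfolding bifree_R_transform_on_def by blast

lemma stolz_half_continuation:
  assumes \<sigma>: "\<sigma> = 1 \<or> \<sigma> = -1" and ab: "\<alpha> > 0" "\<beta> > 0" "\<alpha>' > 0" "\<beta>' > 0" "\<alpha>' \<le> \<alpha>" "\<beta>' \<le> \<beta>"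
    and hol: "f holomorphic_on stolz_half \<sigma> \<alpha> \<beta>" "g holomorphic_on stolz_half \<sigma> \<alpha> \<beta>"
    and eq: "\<And>z. z \<in> stolz_pair \<alpha>' \<beta>' \<Longrightarrow> f z = g z" and z: "z \<in> stolz_half \<sigma> \<alpha> \<beta>"
  shows "f z = g z"
proof (rule analytic_continuation_open[where f=f and g=g and s="stolz_half \<sigma> \<alpha>' \<beta>'" and s'="stolz_half \<sigma> \<alpha> \<beta>"])
  show "stolz_half \<sigma> \<alpha>' \<beta>' \<subseteq> stolz_half \<sigma> \<alpha> \<beta>"
    using stolz_pair_mono[of \<alpha>' \<alpha> \<beta>' \<beta>] ab by (auto simp: stolz_half_def)
  show "connected (stolz_half \<sigma> \<alpha> \<beta>)" using convex_stolz_half[OF \<sigma>] convex_connected by blast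
  show "stolz_half \<sigma> \<alpha>' \<beta>' \<noteq> {}" using stolz_half_nonempty \<sigma> ab by blast
  show "f z = g z" if "z \<in> stolz_half \<sigma> \<alpha>' \<beta>'" for z using eq that by (simp add: stolz_half_def)
qed (use open_stolz_half hol z in auto)

lemma stolz_pair_continuation:
  assumes ab: "\<alpha> > 0" "\<beta> > 0" "\<alpha>' > 0" "\<beta>' > 0" "\<alpha>' \<le> \<alpha>" "\<beta>' \<le> \<beta>"
    and hol: "f holomorphic_on stolz_pair \<alpha> \<beta>" "g holomorphic_on stolz_pair \<alpha> \<beta>"
    and eq: "\<And>z. z \<in> stolz_pair \<alpha>' \<beta>' \<Longrightarrow> f z = g z" and z: "z \<in> stolz_pair \<alpha> \<beta>"
  shows "f z = g z"
proof -
  obtain \<sigma> where \<sigma>: "\<sigma> = 1 \<or> \<sigma> = -1" "z \<in> stolz_half \<sigma> \<alpha> \<beta>" by (rule stolz_pair_in_half[OF z])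
  have "stolz_half \<sigma> \<alpha> \<beta> \<subseteq> stolz_pair \<alpha> \<beta>" by (auto simp: stolz_half_def)
  then show ?thesis
    by (intro stolz_half_continuation[OF \<sigma>(1) ab _ _ eq \<sigma>(2)] hol[THEN holomorphic_on_subset])
qed

text \<open>1/z + s R(z) is a convex combination of 1/z and 1/z + R(z), which both lie in the open
  half-plane opposite to that of z.\<close>

lemma Im_scaled_R_transform:
  assumes R: "R_transform_on m \<alpha> \<beta> R" and ab: "\<alpha> > 0" "\<beta> > 0" and s: "0 \<le> s" "s \<le> 1"
    and z: "z \<in> stolz_pair \<alpha> \<beta>"
  shows "1 / z + of_real s * R z \<notin> \<real>"
proof -
  have Imz: "Im z \<noteq> 0" "z \<noteq> 0" using z by (auto simp: stolz_pair_iff)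
  have a: "Im z * Im (1 / z) < 0"
  proof -
    have "Im z * Im (1 / z) = - ((Im z)\<^sup>2 / (norm z)\<^sup>2)"
      unfolding cmod_power2 by (simp add: Im_divide power2_eq_square)
    also have "\<dots> < 0" using Imz by (simp add: divide_pos_pos)
    finally show ?thesis .
  qed
  have b: "Im z * Im (1 / z + R z) < 0" by (rule R_transform_Im[OF R ab z])
  have "Im z * Im (1 / z + of_real s * R z) = (1 - s) * (Im z * Im (1 / z)) + s * (Im z * Im (1 / z + R z))"
    by (simp add: algebra_simps)
  also have "\<dots> < 0"
  proof (cases "s = 1")
    case True then show ?thesis using b by simp
  next
    case False
    then have "(1 - s) * (Im z * Im (1 / z)) < 0" using a s by (simp add: mult_pos_neg)
    moreover have "s * (Im z * Im (1 / z + R z)) \<le> 0" using b s by (simp add: mult_nonneg_nonpos)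
    ultimately show ?thesis by simp
  qed
  finally show ?thesis by (auto simp: complex_is_Real_iff)
qed

text \<open>\<open>BID\<close> demands the R-transforms of all roots on one domain, whereas the
  domain coming with the law at time 1/m may shrink as m grows. Since 1/z + s R(z) stays off the
  real axis wherever R lives, both sides of G(1/z + s R(z)) = z are holomorphic there and the
  equation continues.\<close>

lemma R_transform_on_scale_extend:
  assumes R: "R_transform_on m0 \<alpha> \<beta> R" and ab: "\<alpha> > 0" "\<beta> > 0" "\<alpha>' > 0" "\<beta>' > 0" "\<alpha>' \<le> \<alpha>" "\<beta>' \<le> \<beta>"
    and s: "0 \<le> s" "s \<le> 1" and m: "borel_prob m"
    and R': "R_transform_on m \<alpha>' \<beta>' R'" and eq: "\<And>z. z \<in> stolz_pair \<alpha>' \<beta>' \<Longrightarrow> R' z = of_real s * R z"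
  shows "R_transform_on m \<alpha> \<beta> (\<lambda>z. of_real s * R z)"
proof -
  have hR: "R holomorphic_on stolz_pair \<alpha> \<beta>" and lim: "((\<lambda>z. z * R z) \<longlongrightarrow> 0) (at 0 within stolz_pair \<alpha> \<beta>)"
    using R unfolding R_transform_on_def by blast+
  have nr: "1 / z + of_real s * R z \<notin> \<real>" if "z \<in> stolz_pair \<alpha> \<beta>" for z
    by (rule Im_scaled_R_transform[OF R ab(1,2) s that])
  have "((\<lambda>z. of_real s * (z * R z)) \<longlongrightarrow> of_real s * 0) (at 0 within stolz_pair \<alpha> \<beta>)"
    by (intro tendsto_intros lim)
  then have l: "((\<lambda>z. z * (of_real s * R z)) \<longlongrightarrow> 0) (at 0 within stolz_pair \<alpha> \<beta>)"
    by (simp add: mult.left_commute)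
  have "cauchy_transform m (1 / z + of_real s * R z) = z" if z: "z \<in> stolz_pair \<alpha> \<beta>" for z
  proof (rule stolz_pair_continuation[OF ab _ _ _ z])
    have "(cauchy_transform m \<circ> (\<lambda>z. 1 / z + of_real s * R z)) holomorphic_on stolz_pair \<alpha> \<beta>"
      by (rule holomorphic_on_compose_gen[OF _ cauchy_transform_holomorphic[OF m]])
         (use nr stolz_pair_nonzero hR in \<open>auto intro!: holomorphic_intros\<close>)
    then show "(\<lambda>z. cauchy_transform m (1 / z + of_real s * R z)) holomorphic_on stolz_pair \<alpha> \<beta>"
      by (simp add: o_def)
    show "cauchy_transform m (1 / z + of_real s * R z) = z" if "z \<in> stolz_pair \<alpha>' \<beta>'" for z
      using R' eq[OF that] that unfolding R_transform_on_def by auto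
  qed (auto intro!: holomorphic_intros)
  then show ?thesis
    unfolding R_transform_on_def using nr l hR by (auto intro!: holomorphic_intros)
qed

lemma h_fun_holomorphic:
  assumes \<mu>: "borel_prob \<mu>" and R: "R_transform_on m1 \<alpha> \<beta> R1" "R_transform_on m2 \<alpha> \<beta> R2"
  shows "w \<in> stolz_pair \<alpha> \<beta> \<Longrightarrow> (\<lambda>z. h_fun \<mu> R1 R2 z w) holomorphic_on stolz_pair \<alpha> \<beta>"
    and "z \<in> stolz_pair \<alpha> \<beta> \<Longrightarrow> (\<lambda>w. h_fun \<mu> R1 R2 z w) holomorphic_on stolz_pair \<alpha> \<beta>"
proof -
  have h: "R1 holomorphic_on stolz_pair \<alpha> \<beta>" "R2 holomorphic_on stolz_pair \<alpha> \<beta>"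
    and nr: "\<And>z. z \<in> stolz_pair \<alpha> \<beta> \<Longrightarrow> 1 / z + R1 z \<notin> \<real>" "\<And>z. z \<in> stolz_pair \<alpha> \<beta> \<Longrightarrow> 1 / z + R2 z \<notin> \<real>"
    using R unfolding R_transform_on_def by blast+
  have nz: "0 \<notin> stolz_pair \<alpha> \<beta>" by (simp add: stolz_pair_iff)
  show "(\<lambda>z. h_fun \<mu> R1 R2 z w) holomorphic_on stolz_pair \<alpha> \<beta>" if w: "w \<in> stolz_pair \<alpha> \<beta>"
  proof -
    have "((\<lambda>z. cauchy_transform2 \<mu> z (1 / w + R2 w)) \<circ> (\<lambda>z. 1 / z + R1 z)) holomorphic_on stolz_pair \<alpha> \<beta>"
      by (rule holomorphic_on_compose_gen[OF _ cauchy_transform2_holomorphic(1)[OF \<mu> nr(2)[OF w]]])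
         (use nr nz h in \<open>auto intro!: holomorphic_intros\<close>)
    then show ?thesis unfolding h_fun_def o_def
      using nz w by (intro holomorphic_intros) auto
  qed
  show "(\<lambda>w. h_fun \<mu> R1 R2 z w) holomorphic_on stolz_pair \<alpha> \<beta>" if z: "z \<in> stolz_pair \<alpha> \<beta>"
  proof -
    have "((\<lambda>w. cauchy_transform2 \<mu> (1 / z + R1 z) w) \<circ> (\<lambda>w. 1 / w + R2 w)) holomorphic_on stolz_pair \<alpha> \<beta>"
      by (rule holomorphic_on_compose_gen[OF _ cauchy_transform2_holomorphic(2)[OF \<mu> nr(1)[OF z]]])
         (use nr nz h in \<open>auto intro!: holomorphic_intros\<close>)
    then show ?thesis unfolding h_fun_def o_def
      using nz z by (intro holomorphic_intros) auto
  qed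
qed

text \<open>On the larger domain it is not known beforehand that h of \<mu> has no zeros, so the
  relation is continued as the product h_\<mu> (1 - s (1 - 1/h_\<nu>)) = 1, in which only the
  zero-free h of \<nu> is inverted. Once continued, the identity itself excludes zeros of
  h_\<mu>.\<close>

lemma bifree_R_transform_on_scale_extend:
  assumes \<nu>: "borel_prob \<nu>" and \<mu>: "borel_prob \<mu>" and s: "0 \<le> s" "s \<le> 1"
    and ab: "\<alpha> > 0" "\<beta> > 0" "\<alpha>' > 0" "\<beta>' > 0"
    and R: "bifree_R_transform_on \<nu> \<alpha> \<beta> R" and R': "bifree_R_transform_on \<mu> \<alpha>' \<beta>' R'"
    and eq: "\<And>p. p \<in> stolz_domain \<alpha> \<beta> \<Longrightarrow> p \<in> stolz_domain \<alpha>' \<beta>' \<Longrightarrow> R' p = of_real s * R p"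
  shows "bifree_R_transform_on \<mu> \<alpha> \<beta> (\<lambda>p. of_real s * R p)"
proof -
  define a b where "a = min \<alpha> \<alpha>'" and "b = min \<beta> \<beta>'"
  have ab': "a > 0" "b > 0" "a \<le> \<alpha>" "b \<le> \<beta>" "a \<le> \<alpha>'" "b \<le> \<beta>'" using ab by (auto simp: a_def b_def)
  have dom: "stolz_domain a b \<subseteq> stolz_domain \<alpha> \<beta>" "stolz_domain a b \<subseteq> stolz_domain \<alpha>' \<beta>'"
    using stolz_domain_mono ab' by auto
  obtain R1 R2 where R1: "R_transform_on (marginal1 \<nu>) \<alpha> \<beta> R1" and R2: "R_transform_on (marginal2 \<nu>) \<alpha> \<beta> R2"
    and Req: "\<forall>(z, w) \<in> stolz_domain \<alpha> \<beta>. h_fun \<nu> R1 R2 z w \<noteq> 0 \<and>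
                 R (z, w) = z * R1 z + w * R2 w + (1 - 1 / h_fun \<nu> R1 R2 z w)"
    using R unfolding bifree_R_transform_on_def by blast
  obtain S1 S2 where S1: "R_transform_on (marginal1 \<mu>) a b S1" and S2: "R_transform_on (marginal2 \<mu>) a b S2"
    and Seq: "\<forall>(z, w) \<in> stolz_domain a b. h_fun \<mu> S1 S2 z w \<noteq> 0 \<and>
                 R' (z, w) = z * S1 z + w * S2 w + (1 - 1 / h_fun \<mu> S1 S2 z w)"
    using bifree_R_transform_on_mono[OF R' ab'(5,6)] unfolding bifree_R_transform_on_def by blast
  note R1' = R_transform_on_mono[OF R1 ab'(3,4)] and R2' = R_transform_on_mono[OF R2 ab'(3,4)]
  have eq': "R' p = of_real s * R p" if "p \<in> stolz_domain a b" for p using eq that dom by blast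
  have Req': "\<forall>(z, w) \<in> stolz_domain a b. R (z, w) = z * R1 z + w * R2 w + (1 - 1 / h_fun \<nu> R1 R2 z w)"
    and Seq': "\<forall>(z, w) \<in> stolz_domain a b. R' (z, w) = z * S1 z + w * S2 w + (1 - 1 / h_fun \<mu> S1 S2 z w)"
    using Req Seq dom by blast+
  note marg = bifree_R_scaled_marginals[OF \<nu> R1' R2' ab'(1,2) Req' \<mu> S1 S2 Seq' eq']
  define T1 T2 where "T1 = (\<lambda>z. of_real s * R1 z)" and "T2 = (\<lambda>z. of_real s * R2 z)"
  have T1: "R_transform_on (marginal1 \<mu>) \<alpha> \<beta> T1" and T2: "R_transform_on (marginal2 \<mu>) \<alpha> \<beta> T2"
    unfolding T1_def T2_def
    using R_transform_on_scale_extend[OF R1 ab(1,2) ab'(1-4) s _ S1 marg(1)]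
      R_transform_on_scale_extend[OF R2 ab(1,2) ab'(1-4) s _ S2 marg(2)] borel_prob_marginal[OF \<mu>] by auto
  note hh = h_fun_holomorphic[OF \<nu> R1 R2] and hT = h_fun_holomorphic[OF \<mu> T1 T2]
  \<comment> \<open>Known to be 1 on the small domain; it is continued first in z with w small, then
    in w with z arbitrary.\<close>
  let ?f = "\<lambda>z w. h_fun \<mu> T1 T2 z w * (1 - of_real s * (1 - 1 / h_fun \<nu> R1 R2 z w))"
  have hne: "h_fun \<nu> R1 R2 z w \<noteq> 0" if "z \<in> stolz_pair \<alpha> \<beta>" "w \<in> stolz_pair \<alpha> \<beta>" for z w
    using Req that by (auto simp: stolz_domain_def)
  have small: "?f z w = 1" if "z \<in> stolz_pair a b" "w \<in> stolz_pair a b" for z w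
  proof -
    have p: "(z, w) \<in> stolz_domain a b" using that by (simp add: stolz_domain_def)
    have "h_fun \<mu> T1 T2 z w = h_fun \<mu> S1 S2 z w" using that marg by (simp add: h_fun_def T1_def T2_def)
    then have h: "h_fun \<mu> T1 T2 z w \<noteq> 0" and r': "R' (z, w) = z * S1 z + w * S2 w + (1 - 1 / h_fun \<mu> T1 T2 z w)"
      using Seq p by auto
    have r: "R (z, w) = z * R1 z + w * R2 w + (1 - 1 / h_fun \<nu> R1 R2 z w)" using Req p dom by blast
    have "1 / h_fun \<mu> T1 T2 z w = 1 - of_real s * (1 - 1 / h_fun \<nu> R1 R2 z w)"
    proof -
      have "1 / h_fun \<mu> T1 T2 z w = 1 + of_real s * (z * R1 z + w * R2 w) - of_real s * R (z, w)"
        using r' eq'[OF p] marg that by (simp add: algebra_simps)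
      then show ?thesis unfolding r by (simp add: algebra_simps)
    qed
    then show ?thesis using h by (simp add: divide_eq_eq mult.commute)
  qed
  have f1: "?f z w = 1" if "z \<in> stolz_pair \<alpha> \<beta>" "w \<in> stolz_pair a b" for z w
  proof (rule stolz_pair_continuation[OF ab(1,2) ab'(1-4) _ _ _ that(1)])
    have w: "w \<in> stolz_pair \<alpha> \<beta>" using that stolz_pair_mono ab' by blast
    show "(\<lambda>z. ?f z w) holomorphic_on stolz_pair \<alpha> \<beta>"
      by (intro holomorphic_on_mult holomorphic_on_diff holomorphic_on_const
          holomorphic_on_divide[OF holomorphic_on_const hh(1)] hT(1) hne w)
  qed (use small that in \<open>simp_all\<close>)
  have f2: "?f z w = 1" if "z \<in> stolz_pair \<alpha> \<beta>" "w \<in> stolz_pair \<alpha> \<beta>" for z w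
  proof (rule stolz_pair_continuation[OF ab(1,2) ab'(1-4) _ _ _ that(2)])
    show "(\<lambda>w. ?f z w) holomorphic_on stolz_pair \<alpha> \<beta>"
      by (intro holomorphic_on_mult holomorphic_on_diff holomorphic_on_const
          holomorphic_on_divide[OF holomorphic_on_const hh(2)] hT(2) hne that(1))
  qed (use f1 that in \<open>simp_all\<close>)
  have "\<forall>(z, w) \<in> stolz_domain \<alpha> \<beta>. h_fun \<mu> T1 T2 z w \<noteq> 0 \<and>
                 of_real s * R (z, w) = z * T1 z + w * T2 w + (1 - 1 / h_fun \<mu> T1 T2 z w)"
  proof safe
    fix z w assume p: "(z, w) \<in> stolz_domain \<alpha> \<beta>"
    then have f: "?f z w = 1" using f2 by (simp add: stolz_domain_def)
    show "h_fun \<mu> T1 T2 z w = 0 \<Longrightarrow> False" using f by simp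
    have "1 / h_fun \<mu> T1 T2 z w = 1 - of_real s * (1 - 1 / h_fun \<nu> R1 R2 z w)"
    proof -
      have "h_fun \<mu> T1 T2 z w \<noteq> 0" using f by auto
      then show ?thesis using f by (simp only: divide_eq_eq) (simp add: mult.commute)
    qed
    then have inv: "1 - 1 / h_fun \<mu> T1 T2 z w = of_real s * (1 - 1 / h_fun \<nu> R1 R2 z w)" by simp
    have r: "R (z, w) = z * R1 z + w * R2 w + (1 - 1 / h_fun \<nu> R1 R2 z w)" using Req p by blast
    show "of_real s * R (z, w) = z * T1 z + w * T2 w + (1 - 1 / h_fun \<mu> T1 T2 z w)"
      unfolding inv r by (simp add: T1_def T2_def algebra_simps)
  qed
  then show ?thesis unfolding bifree_R_transform_on_def using T1 T2 by blast
qed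

text \<open>The m-th root is the law at time 1/m, with its R-transform continued to the fixed domain
  on which that of \<nu> is given.\<close>

lemma bifree_semigroup_imp_BID:
  assumes \<nu>: "borel_prob \<nu>" and N: "bifree_semigroup N" and F: "bifree_R_extension \<nu> F"
    and Ft: "\<And>t. t \<ge> 0 \<Longrightarrow> \<exists>Ft. bifree_R_extension (N t) Ft \<and>
          (\<forall>z w. z \<notin> \<real> \<and> w \<notin> \<real> \<longrightarrow> Ft (z, w) = complex_of_real t * F (z, w))"
  shows "\<nu> \<in> BID"
proof -
  obtain \<alpha> \<beta> where ab: "\<alpha> > 0" "\<beta> > 0" and R: "bifree_R_transform_on \<nu> \<alpha> \<beta> F"
    using F unfolding bifree_R_extension_def by blast
  have "\<exists>\<mu> Rm. borel_prob \<mu> \<and> bifree_R_transform_on \<mu> \<alpha> \<beta> Rm \<and> (\<forall>p \<in> stolz_domain \<alpha> \<beta>. F p = of_nat m * Rm p)"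
    if m: "m \<ge> 2" for m :: nat
  proof -
    define s where "s = 1 / real m"
    have s: "0 \<le> s" "s \<le> 1" using m by (auto simp: s_def)
    obtain G \<alpha>' \<beta>' where ab': "\<alpha>' > 0" "\<beta>' > 0" and G: "bifree_R_transform_on (N s) \<alpha>' \<beta>' G"
      and Geq: "\<And>z w. z \<notin> \<real> \<Longrightarrow> w \<notin> \<real> \<Longrightarrow> G (z, w) = of_real s * F (z, w)"
      using Ft[OF s(1)] unfolding bifree_R_extension_def by blast
    have Ns: "borel_prob (N s)" using N s unfolding bifree_semigroup_def by blast
    have "bifree_R_transform_on (N s) \<alpha> \<beta> (\<lambda>p. of_real s * F p)"
    proof (rule bifree_R_transform_on_scale_extend[OF \<nu> Ns s ab ab' R G])
      fix p assume "p \<in> stolz_domain \<alpha> \<beta>"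
      then show "G p = of_real s * F p"
        using Geq stolz_pair_notin_Reals by (cases p) (auto simp: stolz_domain_def)
    qed
    moreover have "F p = of_nat m * (of_real s * F p)" for p
      using m by (simp add: s_def)
    ultimately show ?thesis using Ns by blast
  qed
  then show ?thesis unfolding BID_def using \<nu> ab R by blast
qed

section \<open>Limits of Pick functions\<close>

text \<open>For \<phi> = n (z - F) this is n times the variance of the centred resolvent at
  z.\<close>

definition pick_slope :: "(complex \<Rightarrow> complex) \<Rightarrow> complex \<Rightarrow> real" where
  "pick_slope \<phi> z = - Im (\<phi> z) / Im z"

text \<open>Such a \<phi> maps the upper half-plane into the closed lower one. The two-point Pick
  inequality is made part of the definition because, unlike the measure it comes from, it passes to
  pointwise limits at once.\<close>

definition pick_function :: "(complex \<Rightarrow> complex) \<Rightarrow> bool" where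
  "pick_function \<phi> \<longleftrightarrow> \<phi> holomorphic_on - \<real> \<and>
     (\<forall>z. z \<notin> \<real> \<longrightarrow> \<phi> (cnj z) = cnj (\<phi> z) \<and> 0 \<le> pick_slope \<phi> z) \<and>
     (\<forall>z1 z2. z1 \<notin> \<real> \<longrightarrow> z2 \<notin> \<real> \<longrightarrow>
        (norm (\<phi> z1 - \<phi> z2))\<^sup>2 \<le> (norm (z1 - z2))\<^sup>2 * (pick_slope \<phi> z1 * pick_slope \<phi> z2))"

lemma pick_functionD:
  assumes "pick_function \<phi>"
  shows "\<phi> holomorphic_on - \<real>" "z \<notin> \<real> \<Longrightarrow> \<phi> (cnj z) = cnj (\<phi> z)" "z \<notin> \<real> \<Longrightarrow> 0 \<le> pick_slope \<phi> z"
    "z1 \<notin> \<real> \<Longrightarrow> z2 \<notin> \<real> \<Longrightarrow> (norm (\<phi> z1 - \<phi> z2))\<^sup>2 \<le> (norm (z1 - z2))\<^sup>2 * (pick_slope \<phi> z1 * pick_slope \<phi> z2)"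
  using assms unfolding pick_function_def by auto

lemma pick_slope_le: "z \<notin> \<real> \<Longrightarrow> pick_slope \<phi> z \<le> norm (\<phi> z) / \<bar>Im z\<bar>"
proof -
  assume z: "z \<notin> \<real>"
  have "pick_slope \<phi> z \<le> \<bar>pick_slope \<phi> z\<bar>" by simp
  also have "\<dots> = \<bar>Im (\<phi> z)\<bar> / \<bar>Im z\<bar>" by (simp add: pick_slope_def abs_divide)
  also have "\<dots> \<le> norm (\<phi> z) / \<bar>Im z\<bar>" using abs_Im_le_cmod by (intro divide_right_mono) auto
  finally show ?thesis .
qed

lemma pick_function_scaled_recip_cauchy:
  assumes m: "borel_prob m" and r: "r \<ge> 0"
  shows "pick_function (\<lambda>z. of_real r * (z - recip_cauchy m z))"
    and "z \<notin> \<real> \<Longrightarrow> pick_slope (\<lambda>z. of_real r * (z - recip_cauchy m z)) z = r * (Im (recip_cauchy m z) / Im z - 1)"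
proof -
  interpret prob_space m using borel_probD(1)[OF m] .
  note [measurable_cong] = borel_probD(2)[OF m]
  have id: "(\<lambda>x. x) \<in> borel_measurable m" by measurable
  have d: "distr m borel (\<lambda>x. x) = m" by (rule distr_id2) (use borel_probD(2)[OF m] in simp)
  let ?\<phi> = "\<lambda>z. of_real r * (z - recip_cauchy m z)"
  show sl: "pick_slope ?\<phi> z = r * (Im (recip_cauchy m z) / Im z - 1)" if "z \<notin> \<real>" for z
    using that by (simp add: pick_slope_def complex_is_Real_iff field_simps)
  show "pick_function ?\<phi>"
    unfolding pick_function_def
  proof (intro conjI allI impI)
    show "?\<phi> holomorphic_on - \<real>" by (intro holomorphic_intros recip_cauchy_holomorphic m)
    show "?\<phi> (cnj z) = cnj (?\<phi> z)" for z by (simp add: recip_cauchy_cnj)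
    show "0 \<le> pick_slope ?\<phi> z" if "z \<notin> \<real>" for z
      unfolding sl[OF that] using recip_cauchy_Pick(2)[OF id that that] r by (simp add: d)
    show "(norm (?\<phi> z1 - ?\<phi> z2))\<^sup>2 \<le> (norm (z1 - z2))\<^sup>2 * (pick_slope ?\<phi> z1 * pick_slope ?\<phi> z2)"
      if "z1 \<notin> \<real>" "z2 \<notin> \<real>" for z1 z2
    proof -
      have "?\<phi> z1 - ?\<phi> z2 = - (of_real r * (recip_cauchy m z1 - z1 - (recip_cauchy m z2 - z2)))"
        by (simp add: algebra_simps)
      then have "(norm (?\<phi> z1 - ?\<phi> z2))\<^sup>2 = r\<^sup>2 * (norm (recip_cauchy m z1 - z1 - (recip_cauchy m z2 - z2)))\<^sup>2"
        by (simp add: norm_mult power_mult_distrib)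
      also have "\<dots> \<le> r\<^sup>2 * ((norm (z1 - z2))\<^sup>2 * ((Im (recip_cauchy m z1) / Im z1 - 1) * (Im (recip_cauchy m z2) / Im z2 - 1)))"
        using recip_cauchy_Pick(1)[OF id that] by (intro mult_left_mono) (simp_all add: d)
      finally show ?thesis unfolding sl[OF that(1)] sl[OF that(2)] by (simp add: power2_eq_square mult_ac)
    qed
  qed
qed

text \<open>x (x - 2 r) \<le> (x - r)^2, and a positive x can be cancelled. It is applied to x =
  |\<phi>(z)|, bounded through a Pick inequality whose right side is itself linear in x.\<close>

lemma quadratic_bound:
  fixes x :: real
  assumes "(x - r)\<^sup>2 \<le> A * x" "0 \<le> A" "0 \<le> x"
  shows "x \<le> 2 * r + A"
proof (cases "x = 0")
  case True
  then have "r = 0" using assms by simp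
  then show ?thesis using True assms by simp
next
  case False
  then have x: "x > 0" using assms by simp
  have "x * (x - 2 * r) = (x - r)\<^sup>2 - r\<^sup>2" by (simp add: power2_eq_square algebra_simps)
  also have "\<dots> \<le> (x - r)\<^sup>2" by simp
  also have "\<dots> \<le> x * A" using assms(1) by (simp add: mult.commute)
  finally have "x - 2 * r \<le> A" using x by simp
  then show ?thesis by simp
qed

section \<open>The two half-planes, and locally uniform limits of Pick functions\<close>

definition upper_half :: "real \<Rightarrow> complex set" where
  "upper_half \<sigma> = {z. 0 < \<sigma> * Im z}"

lemma upper_half: 
  assumes "\<sigma> = 1 \<or> \<sigma> = -1"
  shows "open (upper_half \<sigma>)" "convex (upper_half \<sigma>)" "connected (upper_half \<sigma>)" "upper_half \<sigma> \<subseteq> - \<real>"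
proof -
  show "open (upper_half \<sigma>)" unfolding upper_half_def by (intro open_Collect_less continuous_intros)
  show c: "convex (upper_half \<sigma>)"
  proof (cases "\<sigma> = 1")
    case True then show ?thesis using convex_halfspace_Im_gt[of 0] by (simp add: upper_half_def)
  next
    case False
    then have "\<sigma> = -1" using assms by simp
    then show ?thesis using convex_halfspace_Im_lt[of 0] by (simp add: upper_half_def)
  qed
  then show "connected (upper_half \<sigma>)" by (rule convex_connected)
  show "upper_half \<sigma> \<subseteq> - \<real>" by (auto simp: upper_half_def complex_is_Real_iff)
qed

lemma notin_Reals_upper_half:
  assumes "z \<notin> \<real>"
  obtains \<sigma> where "\<sigma> = 1 \<or> \<sigma> = -1" "z \<in> upper_half \<sigma>"
proof (cases "Im z > 0")
  case True then show ?thesis using that[of 1] by (simp add: upper_half_def)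
next
  case False
  then have "Im z < 0" using assms by (simp add: complex_is_Real_iff)
  then show ?thesis using that[of "-1"] by (simp add: upper_half_def)
qed

lemma holomorphic_on_compl_Reals:
  assumes "\<And>\<sigma>. \<sigma> = 1 \<or> \<sigma> = -1 \<Longrightarrow> f holomorphic_on upper_half \<sigma>"
  shows "f holomorphic_on - \<real>"
proof -
  have "f holomorphic_on (upper_half 1 \<union> upper_half (-1))"
    using assms upper_half by (intro holomorphic_on_Un) auto
  moreover have "upper_half 1 \<union> upper_half (-1) = - \<real>"
    by (auto simp: upper_half_def complex_is_Real_iff)
  ultimately show ?thesis by simp
qed

text \<open>The part in one half-plane of the neighbourhood of infinity into which inversion carries
  a Stolz domain. It is the open set where limits are known explicitly and from which they
  spread.\<close>

definition inv_stolz :: "real \<Rightarrow> real \<Rightarrow> real \<Rightarrow> complex set" where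
  "inv_stolz \<sigma> \<alpha> \<beta> = {z \<in> upper_half \<sigma>. 1 / z \<in> stolz_pair \<alpha> \<beta>}"

lemma inv_stolz:
  assumes "\<sigma> = 1 \<or> \<sigma> = -1" "\<alpha> > 0" "\<beta> > 0"
  shows "open (inv_stolz \<sigma> \<alpha> \<beta>)" "inv_stolz \<sigma> \<alpha> \<beta> \<noteq> {}" "inv_stolz \<sigma> \<alpha> \<beta> \<subseteq> upper_half \<sigma>"
proof -
  have "continuous_on (upper_half \<sigma>) (\<lambda>z. 1 / z)"
    by (intro continuous_on_divide continuous_on_const continuous_on_id) (auto simp: upper_half_def)
  then have "open (upper_half \<sigma> \<inter> (\<lambda>z. 1 / z) -` stolz_pair \<alpha> \<beta>)"
    using upper_half(1)[OF assms(1)] open_stolz_pair by (rule continuous_open_preimage)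
  moreover have "upper_half \<sigma> \<inter> (\<lambda>z. 1 / z) -` stolz_pair \<alpha> \<beta> = inv_stolz \<sigma> \<alpha> \<beta>"
    by (auto simp: inv_stolz_def)
  ultimately show "open (inv_stolz \<sigma> \<alpha> \<beta>)" by simp
  \<comment> \<open>Inversion exchanges the half-planes, so the witness is taken from the opposite
    half of the Stolz domain.\<close>
  have "- \<sigma> = 1 \<or> - \<sigma> = -1" using assms by auto
  then obtain z where z: "z \<in> stolz_half (- \<sigma>) \<alpha> \<beta>" using stolz_half_nonempty assms by blast
  then have "\<sigma> * Im z < 0" "z \<in> stolz_pair \<alpha> \<beta>" "z \<noteq> 0" by (auto simp: stolz_half_def stolz_pair_iff)
  moreover have "\<sigma> * Im (1 / z) = - (\<sigma> * Im z) / (norm z)\<^sup>2" unfolding cmod_power2 by (simp add: Im_divide)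
  ultimately have "1 / z \<in> inv_stolz \<sigma> \<alpha> \<beta>" by (simp add: inv_stolz_def upper_half_def divide_neg_pos)
  then show "inv_stolz \<sigma> \<alpha> \<beta> \<noteq> {}" by blast
  show "inv_stolz \<sigma> \<alpha> \<beta> \<subseteq> upper_half \<sigma>" by (auto simp: inv_stolz_def)
qed

text \<open>The only exact information is \<phi> n = r(z) at the moving point 1/z + r(z)/(n + 2).
  One such point, inserted in the two-point inequality, bounds the whole sequence locally;
  equicontinuity then replaces the moving points by 1/z, and Vitali spreads the convergence to each
  half-plane.\<close>

lemma pick_sequence_limit:
  fixes \<phi> :: "nat \<Rightarrow> complex \<Rightarrow> complex"
  assumes \<phi>: "\<And>n. pick_function (\<phi> n)" and ab: "\<alpha> > 0" "\<beta> > 0"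
    and r: "\<And>n z. z \<in> stolz_pair \<alpha> \<beta> \<Longrightarrow> 1 / z + r z / of_nat (n + 2) \<notin> \<real>"
      "\<And>n z. z \<in> stolz_pair \<alpha> \<beta> \<Longrightarrow> \<phi> n (1 / z + r z / of_nat (n + 2)) = r z"
  shows "\<exists>\<psi>. pick_function \<psi> \<and> (\<forall>z. z \<notin> \<real> \<longrightarrow> (\<lambda>n. \<phi> n z) \<longlonglongrightarrow> \<psi> z) \<and>
    (\<forall>z \<in> stolz_pair \<alpha> \<beta>. \<psi> (1 / z) = r z)"
    and "\<And>K. compact K \<Longrightarrow> K \<subseteq> - \<real> \<Longrightarrow> \<exists>B. \<forall>n. \<forall>z\<in>K. norm (\<phi> n z) \<le> B"
proof -
  define A where "A n z = 1 / z + r z / of_nat (n + 2)" for n z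
  have hol: "\<phi> n holomorphic_on - \<real>" for n using pick_functionD[OF \<phi>] by blast
  have Alim: "(\<lambda>n. A n z) \<longlonglongrightarrow> 1 / z" for z
  proof -
    have "(\<lambda>n. r z * of_real (1 / real (n + 2))) \<longlonglongrightarrow> r z * of_real 0"
      by (intro tendsto_intros) real_asymp
    from tendsto_add[OF tendsto_const this, of "1 / z"] show ?thesis by (simp add: A_def)
  qed
  show bdd: "\<exists>B. \<forall>n. \<forall>z\<in>K. norm (\<phi> n z) \<le> B" if K: "compact K" "K \<subseteq> - \<real>" for K
  proof -
    obtain z0 where z0: "z0 \<in> stolz_pair \<alpha> \<beta>"
      using stolz_half_nonempty[of 1, OF _ ab] by (auto simp: stolz_half_def)
    have im0: "Im (1 / z0) \<noteq> 0" using z0 by (auto simp: stolz_pair_iff Im_divide)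
    \<comment> \<open>Both the point and the value of \<phi> n there are explicit, so this slope
      converges and is bounded in n.\<close>
    define s where "s n = pick_slope (\<phi> n) (A n z0)" for n
    have "s = (\<lambda>n. - Im (r z0) / Im (A n z0))"
      using r(2)[OF z0] by (simp add: s_def pick_slope_def A_def fun_eq_iff)
    moreover have "(\<lambda>n. - Im (r z0) / Im (A n z0)) \<longlonglongrightarrow> - Im (r z0) / Im (1 / z0)"
      using im0 by (intro tendsto_intros Alim)
    ultimately have "s \<longlonglongrightarrow> - Im (r z0) / Im (1 / z0)" by simp
    from convergent_imp_Bseq[OF convergentI[OF this]]
    obtain S where S: "S > 0" "\<And>n. norm (s n) \<le> S" unfolding Bseq_def by blast
    from convergent_imp_Bseq[OF convergentI[OF Alim[of z0]]]
    obtain A0 where A0: "A0 > 0" "\<And>n. norm (A n z0) \<le> A0" unfolding Bseq_def by blast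
    let ?b = "\<lambda>z. 2 * norm (r z0) + (norm z + A0)\<^sup>2 * S / \<bar>Im z\<bar>"
    have "continuous_on K ?b" using K by (intro continuous_intros) (auto simp: complex_is_Real_iff)
    then have "bounded (?b ` K)" by (intro compact_imp_bounded compact_continuous_image K)
    then obtain B where B: "\<And>z. z \<in> K \<Longrightarrow> norm (?b z) \<le> B" unfolding bounded_iff by auto
    have "norm (\<phi> n z) \<le> B" if z: "z \<in> K" for n z
    proof -
      have zR: "z \<notin> \<real>" using K z by auto
      have AR: "A n z0 \<notin> \<real>" using r(1)[OF z0] by (simp add: A_def)
      have "\<bar>norm (\<phi> n z) - norm (r z0)\<bar> \<le> norm (\<phi> n z - \<phi> n (A n z0))"
        using r(2)[OF z0] norm_triangle_ineq3 by (simp add: A_def)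
      \<comment> \<open>The Pick inequality between z and the moving point. The unknown slope at z
        is at most |\<phi> n z| / |Im z|, so the result is a quadratic inequality for |\<phi> n z|
        alone.\<close>
      then have "(norm (\<phi> n z) - norm (r z0))\<^sup>2 \<le> (norm (\<phi> n z - \<phi> n (A n z0)))\<^sup>2"
        by (metis abs_le_square_iff abs_norm_cancel)
      also have "\<dots> \<le> (norm (z - A n z0))\<^sup>2 * (pick_slope (\<phi> n) z * s n)"
        unfolding s_def by (rule pick_functionD(4)[OF \<phi> zR AR])
      also have "\<dots> \<le> (norm z + A0)\<^sup>2 * ((norm (\<phi> n z) / \<bar>Im z\<bar>) * S)"
      proof (intro mult_mono power_mono)
        show "norm (z - A n z0) \<le> norm z + A0" using norm_triangle_ineq4[of z "A n z0"] A0(2)[of n] by simp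
        show "pick_slope (\<phi> n) z \<le> norm (\<phi> n z) / \<bar>Im z\<bar>" by (rule pick_slope_le[OF zR])
        show "s n \<le> S" using S(2)[of n] by simp
        show "0 \<le> s n" unfolding s_def by (rule pick_functionD(3)[OF \<phi> AR])
        show "0 \<le> pick_slope (\<phi> n) z * s n"
          unfolding s_def by (intro mult_nonneg_nonneg pick_functionD(3)[OF \<phi>] AR zR)
      qed auto
      also have "\<dots> = ((norm z + A0)\<^sup>2 * S / \<bar>Im z\<bar>) * norm (\<phi> n z)" by simp
      finally have "norm (\<phi> n z) \<le> ?b z" using S A0 by (intro quadratic_bound) auto
      then show ?thesis using B[OF z] by simp
    qed
    then show ?thesis by blast
  qed
  have limU: "(\<lambda>n. \<phi> n (1 / z)) \<longlonglongrightarrow> r z" if z: "z \<in> stolz_pair \<alpha> \<beta>" for z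
  proof -
    have z': "1 / z \<in> - \<real>" using z by (auto simp: complex_is_Real_iff stolz_pair_iff Im_divide)
    have "(\<lambda>n. \<phi> n (A n z) - \<phi> n (1 / z)) \<longlonglongrightarrow> 0"
      by (rule holomorphic_sequence_equicontinuous[OF open_compl_Reals hol bdd z' Alim])
    then have "(\<lambda>n. r z - \<phi> n (1 / z)) \<longlonglongrightarrow> 0" using r(2)[OF z] by (simp add: A_def)
    from tendsto_diff[OF tendsto_const this, of "r z"] show ?thesis by simp
  qed
  have ex: "\<exists>g. g holomorphic_on upper_half \<sigma> \<and> (\<forall>z\<in>upper_half \<sigma>. (\<lambda>n. \<phi> n z) \<longlonglongrightarrow> g z)"
    if \<sigma>: "\<sigma> = 1 \<or> \<sigma> = -1" for \<sigma>
  proof -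
    note uh = upper_half[OF \<sigma>] and ivs = inv_stolz[OF \<sigma> ab]
    have h1: "\<phi> n holomorphic_on upper_half \<sigma>" for n by (rule holomorphic_on_subset[OF hol uh(4)])
    have h2: "\<exists>B. \<forall>n. \<forall>z\<in>K. norm (\<phi> n z) \<le> B" if "compact K" "K \<subseteq> upper_half \<sigma>" for K
      by (rule bdd[OF that(1) order_trans[OF that(2) uh(4)]])
    have h3: "(\<lambda>n. \<phi> n u) \<longlonglongrightarrow> r (1 / u)" if "u \<in> inv_stolz \<sigma> \<alpha> \<beta>" for u
      using limU[of "1 / u"] that by (simp add: inv_stolz_def)
    show ?thesis by (rule Vitali_pointwise[OF uh(1,3) h1 h2 ivs h3]) blast+
  qed
  \<comment> \<open>Taking the limit pointwise glues the functions obtained separately on the two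
    half-planes.\<close>
  define \<psi> where "\<psi> z = lim (\<lambda>n. \<phi> n z)" for z
  have lim: "(\<lambda>n. \<phi> n z) \<longlonglongrightarrow> \<psi> z" if z: "z \<notin> \<real>" for z
  proof -
    obtain \<sigma> where \<sigma>: "\<sigma> = 1 \<or> \<sigma> = -1" "z \<in> upper_half \<sigma>" by (rule notin_Reals_upper_half[OF z])
    then obtain l where "(\<lambda>n. \<phi> n z) \<longlonglongrightarrow> l" using ex[OF \<sigma>(1)] by blast
    then show ?thesis unfolding \<psi>_def using limI by metis
  qed
  have hol\<psi>: "\<psi> holomorphic_on - \<real>"
  proof (rule holomorphic_on_compl_Reals)
    fix \<sigma> :: real assume \<sigma>: "\<sigma> = 1 \<or> \<sigma> = -1"
    obtain g where g: "g holomorphic_on upper_half \<sigma>" "\<forall>z\<in>upper_half \<sigma>. (\<lambda>n. \<phi> n z) \<longlonglongrightarrow> g z" using ex[OF \<sigma>] by blast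
    have "g z = \<psi> z" if "z \<in> upper_half \<sigma>" for z
      using g(2) that unfolding \<psi>_def by (metis limI)
    then show "\<psi> holomorphic_on upper_half \<sigma>" using g(1) holomorphic_cong[OF refl, of "upper_half \<sigma>" g \<psi>] by simp
  qed
  have limslope: "(\<lambda>n. pick_slope (\<phi> n) z) \<longlonglongrightarrow> pick_slope \<psi> z" if "z \<notin> \<real>" for z
    unfolding pick_slope_def using that by (intro tendsto_intros lim) (auto simp: complex_is_Real_iff)
  have pick: "pick_function \<psi>"
    unfolding pick_function_def
  proof (intro conjI allI impI)
    fix z :: complex assume z: "z \<notin> \<real>"
    have zc: "cnj z \<notin> \<real>" using z by (simp add: complex_is_Real_iff)
    have "(\<lambda>n. \<phi> n (cnj z)) \<longlonglongrightarrow> cnj (\<psi> z)"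
      using tendsto_cnj[OF lim[OF z]] pick_functionD(2)[OF \<phi> z] by simp
    from LIMSEQ_unique[OF lim[OF zc] this] show "\<psi> (cnj z) = cnj (\<psi> z)" .
    show "0 \<le> pick_slope \<psi> z"
      by (intro LIMSEQ_le_const[OF limslope[OF z]]) (use pick_functionD(3)[OF \<phi> z] in auto)
  next
    fix z1 z2 :: complex assume z: "z1 \<notin> \<real>" "z2 \<notin> \<real>"
    have "(\<lambda>n. (norm (\<phi> n z1 - \<phi> n z2))\<^sup>2) \<longlonglongrightarrow> (norm (\<psi> z1 - \<psi> z2))\<^sup>2"
      by (intro tendsto_intros lim z)
    moreover have "(\<lambda>n. (norm (z1 - z2))\<^sup>2 * (pick_slope (\<phi> n) z1 * pick_slope (\<phi> n) z2)) \<longlonglongrightarrow> (norm (z1 - z2))\<^sup>2 * (pick_slope \<psi> z1 * pick_slope \<psi> z2)"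
      by (intro tendsto_intros limslope z)
    ultimately show "(norm (\<psi> z1 - \<psi> z2))\<^sup>2 \<le> (norm (z1 - z2))\<^sup>2 * (pick_slope \<psi> z1 * pick_slope \<psi> z2)"
      by (rule LIMSEQ_le) (use pick_functionD(4)[OF \<phi> z] in auto)
  qed (rule hol\<psi>)
  have val: "\<psi> (1 / z) = r z" if z: "z \<in> stolz_pair \<alpha> \<beta>" for z
  proof -
    have z': "1 / z \<notin> \<real>" using z by (auto simp: complex_is_Real_iff stolz_pair_iff Im_divide)
    show ?thesis by (rule LIMSEQ_unique[OF lim[OF z'] limU[OF z]])
  qed
  show "\<exists>\<psi>. pick_function \<psi> \<and> (\<forall>z. z \<notin> \<real> \<longrightarrow> (\<lambda>n. \<phi> n z) \<longlonglongrightarrow> \<psi> z) \<and>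
      (\<forall>z \<in> stolz_pair \<alpha> \<beta>. \<psi> (1 / z) = r z)"
    using pick lim val by (intro exI[of _ \<psi>]) simp
qed

text \<open>The properties kept of the limits \<phi>1, \<phi>2 of n (z - F) and c of n (F1 F2 G -
  1). In \<open>gram_ineq\<close> the reciprocal transforms have become z and w, because F tends to
  the identity when n (z - F) converges. The growth condition on the axis encodes z R(z) tending to
  0.\<close>

definition levy_pair :: "(complex \<Rightarrow> complex) \<Rightarrow> (complex \<Rightarrow> complex) \<Rightarrow> (complex \<Rightarrow> complex \<Rightarrow> complex) \<Rightarrow> bool" where
  "levy_pair \<phi>1 \<phi>2 c \<longleftrightarrow> pick_function \<phi>1 \<and> pick_function \<phi>2 \<and>
     ((\<lambda>y. \<phi>1 (\<i> * of_real y) / of_real y) \<longlongrightarrow> 0) at_top \<and>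
     ((\<lambda>y. \<phi>2 (\<i> * of_real y) / of_real y) \<longlongrightarrow> 0) at_top \<and>
     (\<forall>z. z \<notin> \<real> \<longrightarrow> (\<lambda>w. c z w) holomorphic_on - \<real>) \<and>
     (\<forall>w. w \<notin> \<real> \<longrightarrow> (\<lambda>z. c z w) holomorphic_on - \<real>) \<and>
     (\<forall>z w. z \<notin> \<real> \<longrightarrow> w \<notin> \<real> \<longrightarrow> c (cnj z) (cnj w) = cnj (c z w) \<and>
        (norm (c z w))\<^sup>2 \<le> pick_slope \<phi>1 z * pick_slope \<phi>2 w \<and>
        (\<forall>\<rho>. gram_ineq z w z w (pick_slope \<phi>1 z) (pick_slope \<phi>2 w) (c z w) (c (cnj z) w) \<rho>))"

text \<open>The substitution \<omega> = -\<i>/y, that is 1/\<omega> = \<i> y, turns \<phi>(\<i> y)/y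
  into \<i> \<omega> R(\<omega>).\<close>

lemma pick_asymptotics:
  assumes R: "R_transform_on m \<alpha> \<beta> R" and ab: "\<alpha> > 0" "\<beta> > 0"
    and \<phi>: "\<And>z. z \<in> stolz_pair \<alpha> \<beta> \<Longrightarrow> \<phi> (1 / z) = R z"
  shows "((\<lambda>y. \<phi> (\<i> * of_real y) / of_real y) \<longlongrightarrow> 0) at_top"
proof -
  define \<omega> where "\<omega> y = of_real (- (1 / y)) * \<i>" for y :: real
  have ev: "\<forall>\<^sub>F y in at_top. \<omega> y \<in> stolz_pair \<alpha> \<beta> \<and> y > 0"
    using eventually_gt_at_top[of "max 0 (1 / \<beta>)"]
  proof eventually_elim
    case (elim y)
    then have y: "y > 0" "1 / \<beta> < y" by simp_all
    then have "1 / y < \<beta>" using ab by (simp add: field_simps)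
    then show ?case using ab y by (simp add: \<omega>_def stolz_pair_iff)
  qed
  have "((\<lambda>y. - (1 / y)) \<longlongrightarrow> (0::real)) at_top" by real_asymp
  from tendsto_mult_left[OF tendsto_of_real[OF this], of \<i>]
  have "(\<omega> \<longlongrightarrow> 0) at_top" unfolding \<omega>_def[abs_def] by (simp add: mult.commute)
  then have "filterlim \<omega> (at 0 within stolz_pair \<alpha> \<beta>) at_top"
    unfolding filterlim_at using ev stolz_pair_nonzero by (auto elim!: eventually_mono)
  then have "((\<lambda>y. \<omega> y * R (\<omega> y)) \<longlongrightarrow> 0) at_top"
    using R unfolding R_transform_on_def by (auto intro: filterlim_compose)
  from tendsto_mult_left[OF this, of \<i>] have "((\<lambda>y. \<i> * (\<omega> y * R (\<omega> y))) \<longlongrightarrow> 0) at_top" by simp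
  moreover have "\<forall>\<^sub>F y in at_top. \<i> * (\<omega> y * R (\<omega> y)) = \<phi> (\<i> * of_real y) / of_real y"
    using ev
  proof eventually_elim
    case (elim y)
    have "1 / \<omega> y = \<i> * of_real y" using elim by (simp add: \<omega>_def field_simps)
    then have "R (\<omega> y) = \<phi> (\<i> * of_real y)" using \<phi>[of "\<omega> y"] elim by simp
    moreover have "\<i> * \<omega> y = 1 / of_real y" by (simp add: \<omega>_def)
    ultimately show ?case by (simp add: mult.assoc[symmetric])
  qed
  ultimately show ?thesis using tendsto_cong by force
qed

lemma locally_bounded_pick_slope:
  assumes bdd: "\<exists>B. \<forall>n. \<forall>z\<in>K. norm (\<phi> n z) \<le> B" and K: "compact K" "K \<subseteq> - \<real>"
  shows "\<exists>B\<ge>0. \<forall>n. \<forall>z\<in>K. pick_slope (\<phi> n) z \<le> B"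
proof -
  obtain B where B: "\<And>n z. z \<in> K \<Longrightarrow> norm (\<phi> n z) \<le> B" using bdd by blast
  have "continuous_on K (\<lambda>z. 1 / \<bar>Im z\<bar>)" using K by (intro continuous_intros) (auto simp: complex_is_Real_iff)
  then have "bounded ((\<lambda>z. 1 / \<bar>Im z\<bar>) ` K)" by (intro compact_imp_bounded compact_continuous_image K)
  then obtain D where D: "\<And>z. z \<in> K \<Longrightarrow> 1 / \<bar>Im z\<bar> \<le> D" unfolding bounded_iff by auto
  have "pick_slope (\<phi> n) z \<le> \<bar>B\<bar> * \<bar>D\<bar>" if z: "z \<in> K" for n z
  proof -
    have zR: "z \<notin> \<real>" using K z by auto
    have "pick_slope (\<phi> n) z \<le> norm (\<phi> n z) * (1 / \<bar>Im z\<bar>)" using pick_slope_le[OF zR, of "\<phi> n"] by simp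
    also have "\<dots> \<le> \<bar>B\<bar> * \<bar>D\<bar>" using B[OF z, of n] D[OF z] by (intro mult_mono) auto
    finally show ?thesis .
  qed
  then show ?thesis by (intro exI[of _ "\<bar>B\<bar> * \<bar>D\<bar>"]) auto
qed

text \<open>All analytic information about \<nu> needed to build the semigroup is extracted here.
  The function c extends 1 - 1/h, the part of the R-transform that measures dependence between the
  two coordinates.\<close>

lemma BID_imp_levy_pair:
  assumes "\<nu> \<in> BID"
  obtains \<alpha> \<beta> R1 R2 \<phi>1 \<phi>2 c where "\<alpha> > 0" "\<beta> > 0"
    "R_transform_on (marginal1 \<nu>) \<alpha> \<beta> R1" "R_transform_on (marginal2 \<nu>) \<alpha> \<beta> R2"
    "\<And>z. z \<in> stolz_pair \<alpha> \<beta> \<Longrightarrow> \<phi>1 (1 / z) = R1 z" "\<And>z. z \<in> stolz_pair \<alpha> \<beta> \<Longrightarrow> \<phi>2 (1 / z) = R2 z"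
    "\<And>z w. z \<in> stolz_pair \<alpha> \<beta> \<Longrightarrow> w \<in> stolz_pair \<alpha> \<beta> \<Longrightarrow> h_fun \<nu> R1 R2 z w \<noteq> 0"
    "\<And>z w. z \<in> stolz_pair \<alpha> \<beta> \<Longrightarrow> w \<in> stolz_pair \<alpha> \<beta> \<Longrightarrow> c (1 / z) (1 / w) = 1 - 1 / h_fun \<nu> R1 R2 z w"
    "levy_pair \<phi>1 \<phi>2 c"
proof -
  obtain \<alpha> \<beta> R where \<nu>: "borel_prob \<nu>" and ab: "\<alpha> > 0" "\<beta> > 0" and R: "bifree_R_transform_on \<nu> \<alpha> \<beta> R"
    and ex: "\<And>m::nat. m \<ge> 2 \<Longrightarrow> \<exists>\<mu> Rm. borel_prob \<mu> \<and> bifree_R_transform_on \<mu> \<alpha> \<beta> Rm \<and>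
              (\<forall>p \<in> stolz_domain \<alpha> \<beta>. R p = of_nat m * Rm p)"
    using assms unfolding BID_def by blast
  obtain R1 R2 where R1: "R_transform_on (marginal1 \<nu>) \<alpha> \<beta> R1" and R2: "R_transform_on (marginal2 \<nu>) \<alpha> \<beta> R2"
    and Req: "\<forall>(z, w) \<in> stolz_domain \<alpha> \<beta>. h_fun \<nu> R1 R2 z w \<noteq> 0 \<and>
                 R (z, w) = z * R1 z + w * R2 w + (1 - 1 / h_fun \<nu> R1 R2 z w)"
    using R unfolding bifree_R_transform_on_def by blast
  have "\<exists>\<mu> S1 S2. borel_prob \<mu> \<and> R_transform_on (marginal1 \<mu>) \<alpha> \<beta> S1 \<and> R_transform_on (marginal2 \<mu>) \<alpha> \<beta> S2 \<and>
      (\<forall>z \<in> stolz_pair \<alpha> \<beta>. \<forall>w \<in> stolz_pair \<alpha> \<beta>. h_fun \<mu> S1 S2 z w \<noteq> 0 \<and>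
         of_nat (n + 2) * (z * S1 z + w * S2 w + (1 - 1 / h_fun \<mu> S1 S2 z w)) = R (z, w))" for n
  proof -
    obtain \<mu> Rm where \<mu>: "borel_prob \<mu>" "bifree_R_transform_on \<mu> \<alpha> \<beta> Rm"
      "\<forall>p \<in> stolz_domain \<alpha> \<beta>. R p = of_nat (n + 2) * Rm p" using ex[of "n + 2"] by auto
    obtain S1 S2 where S: "R_transform_on (marginal1 \<mu>) \<alpha> \<beta> S1" "R_transform_on (marginal2 \<mu>) \<alpha> \<beta> S2"
      "\<forall>(z, w) \<in> stolz_domain \<alpha> \<beta>. h_fun \<mu> S1 S2 z w \<noteq> 0 \<and>
                 Rm (z, w) = z * S1 z + w * S2 w + (1 - 1 / h_fun \<mu> S1 S2 z w)"
      using \<mu>(2) unfolding bifree_R_transform_on_def by blast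
    have "h_fun \<mu> S1 S2 z w \<noteq> 0 \<and>
         of_nat (n + 2) * (z * S1 z + w * S2 w + (1 - 1 / h_fun \<mu> S1 S2 z w)) = R (z, w)"
      if "z \<in> stolz_pair \<alpha> \<beta>" "w \<in> stolz_pair \<alpha> \<beta>" for z w
    proof -
      have p: "(z, w) \<in> stolz_domain \<alpha> \<beta>" using that by (simp add: stolz_domain_def)
      have "R (z, w) = of_nat (n + 2) * Rm (z, w)" by (rule bspec[OF \<mu>(3) p])
      moreover have "h_fun \<mu> S1 S2 z w \<noteq> 0 \<and> Rm (z, w) = z * S1 z + w * S2 w + (1 - 1 / h_fun \<mu> S1 S2 z w)"
        using bspec[OF S(3) p] by simp
      ultimately show ?thesis by simp
    qed
    then show ?thesis using \<mu>(1) S(1,2) by (intro exI[of _ \<mu>] exI[of _ S1] exI[of _ S2]) blast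
  qed
  then obtain \<mu> S1 S2 where \<mu>: "\<And>n. borel_prob (\<mu> n)" and S1: "\<And>n. R_transform_on (marginal1 (\<mu> n)) \<alpha> \<beta> (S1 n)"
    and S2: "\<And>n. R_transform_on (marginal2 (\<mu> n)) \<alpha> \<beta> (S2 n)"
    and Seq: "\<And>n z w. z \<in> stolz_pair \<alpha> \<beta> \<Longrightarrow> w \<in> stolz_pair \<alpha> \<beta> \<Longrightarrow> h_fun (\<mu> n) (S1 n) (S2 n) z w \<noteq> 0 \<and>
         of_nat (n + 2) * (z * S1 n z + w * S2 n w + (1 - 1 / h_fun (\<mu> n) (S1 n) (S2 n) z w)) = R (z, w)"
    by metis
  \<comment> \<open>Roots exist from order 2 on, so the n-th member of the sequence is the root of
    order n + 2.\<close>
  define N where "N n = real (n + 2)" for n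
  have N: "N n > 0" "of_nat (n + 2) = complex_of_real (N n)" for n by (simp_all add: N_def)
  have Scaled: "S1 n z = R1 z / of_nat (n + 2)" "S2 n z = R2 z / of_nat (n + 2)" if z: "z \<in> stolz_pair \<alpha> \<beta>" for n z
  proof -
    define R' where "R' = (\<lambda>(z, w). z * S1 n z + w * S2 n w + (1 - 1 / h_fun (\<mu> n) (S1 n) (S2 n) z w))"
    have a: "\<forall>(z, w) \<in> stolz_domain \<alpha> \<beta>. R (z, w) = z * R1 z + w * R2 w + (1 - 1 / h_fun \<nu> R1 R2 z w)"
      using Req by auto
    have b: "\<forall>(z, w) \<in> stolz_domain \<alpha> \<beta>. R' (z, w) = z * S1 n z + w * S2 n w + (1 - 1 / h_fun (\<mu> n) (S1 n) (S2 n) z w)"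
      by (simp add: R'_def)
    have c: "R' p = (1 / of_nat (n + 2)) * R p" if "p \<in> stolz_domain \<alpha> \<beta>" for p
    proof -
      obtain u v where p: "p = (u, v)" "u \<in> stolz_pair \<alpha> \<beta>" "v \<in> stolz_pair \<alpha> \<beta>"
        using \<open>p \<in> stolz_domain \<alpha> \<beta>\<close> by (cases p) (auto simp: stolz_domain_def)
      then have "R p = of_nat (n + 2) * R' p" using Seq[OF p(2,3), of n] by (simp only: R'_def p(1) prod.case)
      moreover have "(of_nat (n + 2) :: complex) \<noteq> 0" by (simp only: of_nat_eq_0_iff)
      ultimately show ?thesis by (simp add: divide_simps del: of_nat_add)
    qed
    show "S1 n z = R1 z / of_nat (n + 2)" "S2 n z = R2 z / of_nat (n + 2)"
      using bifree_R_scaled_marginals[OF \<nu> R1 R2 ab a \<mu> S1 S2 b c z] by simp_all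
  qed
  define F1 F2 where "F1 n = recip_cauchy (marginal1 (\<mu> n))" and "F2 n = recip_cauchy (marginal2 (\<mu> n))" for n
  define p1 p2 where "p1 n z = of_real (N n) * (z - F1 n z)" and "p2 n z = of_real (N n) * (z - F2 n z)" for n z
  note bm = borel_prob_marginal[OF \<mu>]
  have pick: "pick_function (p1 n)" "pick_function (p2 n)" for n
    unfolding p1_def[abs_def] p2_def[abs_def] F1_def F2_def
    using pick_function_scaled_recip_cauchy(1)[OF bm(1) less_imp_le[OF N(1)]]
      pick_function_scaled_recip_cauchy(1)[OF bm(2) less_imp_le[OF N(1)]] by auto
  have slope: "pick_slope (p1 n) z = N n * (Im (F1 n z) / Im z - 1)" "pick_slope (p2 n) z = N n * (Im (F2 n z) / Im z - 1)"
    if "z \<notin> \<real>" for n z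
    unfolding p1_def[abs_def] p2_def[abs_def] F1_def F2_def
    using pick_function_scaled_recip_cauchy(2)[OF bm(1) less_imp_le[OF N(1)] that]
      pick_function_scaled_recip_cauchy(2)[OF bm(2) less_imp_le[OF N(1)] that] by auto
  \<comment> \<open>The points where the reciprocal Cauchy transforms of the root's marginals take
    the value 1/z, by the functional equation and the scaling of the marginals.\<close>
  define a1 a2 where "a1 n z = 1 / z + R1 z / of_nat (n + 2)" and "a2 n z = 1 / z + R2 z / of_nat (n + 2)" for n z
  have a: "a1 n z \<notin> \<real>" "F1 n (a1 n z) = 1 / z" "a2 n z \<notin> \<real>" "F2 n (a2 n z) = 1 / z" if z: "z \<in> stolz_pair \<alpha> \<beta>" for n z
    using S1[of n] S2[of n] z Scaled[OF z, of n] unfolding R_transform_on_def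
    by (auto simp: a1_def a2_def F1_def F2_def recip_cauchy_def)
  have pa: "p1 n (a1 n z) = R1 z" "p2 n (a2 n z) = R2 z" if z: "z \<in> stolz_pair \<alpha> \<beta>" for n z
    using a[OF z, of n] N[of n] by (simp_all add: p1_def p2_def a1_def a2_def)
  note seq1 = pick_sequence_limit[where r=R1, OF pick(1) ab a(1)[unfolded a1_def] pa(1)[unfolded a1_def]]
  obtain \<phi>1 where p1: "pick_function \<phi>1 \<and> (\<forall>z. z \<notin> \<real> \<longrightarrow> (\<lambda>n. p1 n z) \<longlonglongrightarrow> \<phi>1 z) \<and>
    (\<forall>z \<in> stolz_pair \<alpha> \<beta>. \<phi>1 (1 / z) = R1 z)"
    by (rule exE[OF seq1(1)])
  have bd1: "\<exists>B. \<forall>n. \<forall>z\<in>K. norm (p1 n z) \<le> B" if "compact K" "K \<subseteq> - \<real>" for K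
    by (rule seq1(2)[OF _ _ that])
  from p1 have \<phi>1: "pick_function \<phi>1" "\<And>z. z \<notin> \<real> \<Longrightarrow> (\<lambda>n. p1 n z) \<longlonglongrightarrow> \<phi>1 z"
    "\<And>z. z \<in> stolz_pair \<alpha> \<beta> \<Longrightarrow> \<phi>1 (1 / z) = R1 z"
    by simp_all
  note seq2 = pick_sequence_limit[where r=R2, OF pick(2) ab a(3)[unfolded a2_def] pa(2)[unfolded a2_def]]
  obtain \<phi>2 where p2: "pick_function \<phi>2 \<and> (\<forall>z. z \<notin> \<real> \<longrightarrow> (\<lambda>n. p2 n z) \<longlonglongrightarrow> \<phi>2 z) \<and>
    (\<forall>z \<in> stolz_pair \<alpha> \<beta>. \<phi>2 (1 / z) = R2 z)"
    by (rule exE[OF seq2(1)])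
  have bd2: "\<exists>B. \<forall>n. \<forall>z\<in>K. norm (p2 n z) \<le> B" if "compact K" "K \<subseteq> - \<real>" for K
    by (rule seq2(2)[OF _ _ that])
  from p2 have \<phi>2: "pick_function \<phi>2" "\<And>z. z \<notin> \<real> \<Longrightarrow> (\<lambda>n. p2 n z) \<longlonglongrightarrow> \<phi>2 z"
    "\<And>z. z \<in> stolz_pair \<alpha> \<beta> \<Longrightarrow> \<phi>2 (1 / z) = R2 z"
    by simp_all
  \<comment> \<open>N n times the covariance of the two centred resolvents, so the Gram and
    Cauchy-Schwarz inequalities hold for it with the slopes as variances.\<close>
  define f where "f n z w = of_real (N n) * (F1 n z * F2 n w * cauchy_transform2 (\<mu> n) z w - 1)" for n z w
  have fint: "f n z w = of_real (N n) * (\<integral>p. centred_resolvent (\<mu> n) fst z p * centred_resolvent (\<mu> n) snd w p \<partial>\<mu> n)"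
    if "z \<notin> \<real>" "w \<notin> \<real>" for n z w
    using integral_centred_resolvents_marginals[OF \<mu> that] by (simp add: f_def F1_def F2_def)
  have cR: "cnj z \<notin> \<real>" if "z \<notin> \<real>" for z using that by (simp add: complex_is_Real_iff)
  have gram: "gram_ineq (F1 n z) (F2 n w) z w (pick_slope (p1 n) z) (pick_slope (p2 n) w) (f n z w) (f n (cnj z) w) \<rho>"
    and fb: "(norm (f n z w))\<^sup>2 \<le> pick_slope (p1 n) z * pick_slope (p2 n) w"
    if zw: "z \<notin> \<real>" "w \<notin> \<real>" for n z w \<rho>
  proof -
    interpret prob_space "\<mu> n" using borel_probD(1)[OF \<mu>] .
    note g = centred_resolvents_gram[OF measurable_fst_snd[OF \<mu>[of n]] zw, folded marginal1_def marginal2_def, folded F1_def F2_def]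
    show "gram_ineq (F1 n z) (F2 n w) z w (pick_slope (p1 n) z) (pick_slope (p2 n) w) (f n z w) (f n (cnj z) w) \<rho>"
      using gram_ineq_scale[OF g(1), of "N n"] by (simp add: slope zw fint cR)
    have "(norm (f n z w))\<^sup>2 = (N n)\<^sup>2 * (norm (\<integral>p. centred_resolvent (\<mu> n) fst z p * centred_resolvent (\<mu> n) snd w p \<partial>\<mu> n))\<^sup>2"
      by (simp add: fint[OF zw] norm_mult power_mult_distrib)
    also have "\<dots> \<le> (N n)\<^sup>2 * ((Im (F1 n z) / Im z - 1) * (Im (F2 n w) / Im w - 1))"
      by (intro mult_left_mono g(2)) auto
    also have "\<dots> = pick_slope (p1 n) z * pick_slope (p2 n) w" by (simp add: slope zw power2_eq_square)
    finally show "(norm (f n z w))\<^sup>2 \<le> pick_slope (p1 n) z * pick_slope (p2 n) w" .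
  qed
  have fhol: "w \<notin> \<real> \<Longrightarrow> (\<lambda>z. f n z w) holomorphic_on - \<real>" "z \<notin> \<real> \<Longrightarrow> (\<lambda>w. f n z w) holomorphic_on - \<real>" for n z w
    unfolding f_def F1_def F2_def
    by (intro holomorphic_on_mult holomorphic_on_diff holomorphic_on_const recip_cauchy_holomorphic bm cauchy_transform2_holomorphic \<mu>; assumption)+
  have fbdd: "\<exists>B. \<forall>n. \<forall>z\<in>K. \<forall>w\<in>L. norm (f n z w) \<le> B"
    if K: "compact K" "compact L" "K \<subseteq> - \<real>" "L \<subseteq> - \<real>" for K L
  proof -
    obtain B1 where B1: "B1 \<ge> 0" "\<And>n z. z \<in> K \<Longrightarrow> pick_slope (p1 n) z \<le> B1"
      using locally_bounded_pick_slope[OF bd1[OF K(1,3)] K(1,3)] by blast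
    obtain B2 where B2: "B2 \<ge> 0" "\<And>n z. z \<in> L \<Longrightarrow> pick_slope (p2 n) z \<le> B2"
      using locally_bounded_pick_slope[OF bd2[OF K(2,4)] K(2,4)] by blast
    have "norm (f n z w) \<le> sqrt (B1 * B2)" if zw: "z \<in> K" "w \<in> L" for n z w
    proof (rule real_le_rsqrt)
      have zR: "z \<notin> \<real>" "w \<notin> \<real>" using K zw by auto
      have "(norm (f n z w))\<^sup>2 \<le> pick_slope (p1 n) z * pick_slope (p2 n) w" by (rule fb[OF zR])
      also have "\<dots> \<le> B1 * B2"
        using B1 B2 zw pick_functionD(3)[OF pick(2) zR(2)] by (intro mult_mono) auto
      finally show "(norm (f n z w))\<^sup>2 \<le> B1 * B2" .
    qed
    then show ?thesis by blast
  qed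
  define C where "C z w = 1 - 1 / h_fun \<nu> R1 R2 z w" for z w
  have Ninf: "(\<lambda>n. complex_of_real (1 / N n)) \<longlonglongrightarrow> of_real 0"
    unfolding N_def by (intro tendsto_of_real) real_asymp
  have alim: "(\<lambda>n. a1 n z) \<longlonglongrightarrow> 1 / z" "(\<lambda>n. a2 n z) \<longlonglongrightarrow> 1 / z" for z
  proof -
    have "(\<lambda>n. 1 / z + R1 z * complex_of_real (1 / N n)) \<longlonglongrightarrow> 1 / z + R1 z * of_real 0"
      "(\<lambda>n. 1 / z + R2 z * complex_of_real (1 / N n)) \<longlonglongrightarrow> 1 / z + R2 z * of_real 0"
      by (intro tendsto_intros Ninf)+
    then show "(\<lambda>n. a1 n z) \<longlonglongrightarrow> 1 / z" "(\<lambda>n. a2 n z) \<longlonglongrightarrow> 1 / z"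
      by (simp_all add: a1_def a2_def N_def)
  qed
  have invR: "1 / z \<in> - \<real>" if "z \<in> stolz_pair \<alpha> \<beta>" for z
    using that by (auto simp: complex_is_Real_iff stolz_pair_iff Im_divide)
  have flim: "(\<lambda>n. f n (1 / z) (1 / w)) \<longlonglongrightarrow> C z w" if zw: "z \<in> stolz_pair \<alpha> \<beta>" "w \<in> stolz_pair \<alpha> \<beta>" for z w
  proof -
    have nz: "z \<noteq> 0" "w \<noteq> 0" using zw stolz_pair_nonzero by blast+
    define h where "h n = h_fun (\<mu> n) (S1 n) (S2 n) z w" for n
    \<comment> \<open>Exact for each n: after the marginal terms, which scale by 1/N, are removed,
      the remaining term 1 - 1/h must scale by 1/N too.\<close>
    have inv: "1 / h n = 1 - C z w * of_real (1 / N n)" and hn: "h n \<noteq> 0" for n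
    proof -
      define T where "T = z * R1 z + w * R2 w"
      have e1: "R (z, w) = T + C z w"
        using Req zw by (auto simp: C_def stolz_domain_def T_def)
      have e2: "of_real (N n) * (z * S1 n z + w * S2 n w + (1 - 1 / h n)) = R (z, w)"
        using Seq[OF zw, of n] unfolding h_def N(2)[symmetric] by blast
      have e3: "z * S1 n z + w * S2 n w = T / of_real (N n)"
        unfolding Scaled[OF zw(1)] Scaled[OF zw(2)] N(2) T_def by (simp add: add_divide_distrib)
      have "T + of_real (N n) * (1 - 1 / h n) = T + C z w"
        using e2[unfolded e1 e3 distrib_left] N(1)[of n] by simp
      then have "of_real (N n) * (1 - 1 / h n) = C z w" by (rule add_left_imp_eq)
      then show "1 / h n = 1 - C z w * of_real (1 / N n)" using N(1)[of n] by (simp add: field_simps)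
      show "h n \<noteq> 0" using Seq[OF zw, of n] by (simp add: h_def)
    qed
    \<comment> \<open>N (h - 1) = N (1 - 1/h) h = C h, and h tends to 1. The limit is thus found
      along the moving points a1 n z, a2 n w and afterwards transferred to 1/z, 1/w.\<close>
    have fa: "f n (a1 n z) (a2 n w) = C z w * h n" for n
    proof -
      have "a1 n z = 1 / z + S1 n z" "a2 n w = 1 / w + S2 n w" using zw by (simp_all add: a1_def a2_def Scaled)
      then have "cauchy_transform2 (\<mu> n) (a1 n z) (a2 n w) = h n * (z * w)"
        using nz by (simp add: h_def h_fun_def)
      then have "f n (a1 n z) (a2 n w) = of_real (N n) * (h n - 1)"
        using nz by (simp add: f_def a zw)
      also have "\<dots> = (of_real (N n) * (1 - 1 / h n)) * h n" using hn[of n] by (simp add: field_simps)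
      also have "of_real (N n) * (1 - 1 / h n) = C z w" unfolding inv using N(1)[of n] by simp
      finally show ?thesis .
    qed
    have "(\<lambda>n. 1 / (1 - C z w * of_real (1 / N n))) \<longlonglongrightarrow> 1 / (1 - C z w * of_real 0)"
      by (intro tendsto_intros Ninf) simp
    then have "h \<longlonglongrightarrow> 1" unfolding inv[symmetric] using hn by simp
    then have l: "(\<lambda>n. f n (a1 n z) (a2 n w)) \<longlonglongrightarrow> C z w"
      unfolding fa using tendsto_mult_left[of h 1 sequentially "C z w"] by simp
    have aR: "a2 n w \<in> - \<real>" for n using a(3)[OF zw(2)] by simp
    have "(\<lambda>n. f n (a1 n z) (a2 n w) - f n (1 / z) (1 / w)) \<longlonglongrightarrow> 0"
      by (rule holomorphic_sequence_equicontinuous2[OF open_compl_Reals open_compl_Reals _ _ fbdd invR[OF zw(1)] alim(1) invR[OF zw(2)] alim(2) aR])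
         (use fhol in auto)
    from tendsto_diff[OF l this] show ?thesis by simp
  qed
  have exg: "\<exists>g. (\<forall>w\<in>upper_half \<tau>. (\<lambda>z. g z w) holomorphic_on upper_half \<sigma>) \<and>
      (\<forall>z\<in>upper_half \<sigma>. (\<lambda>w. g z w) holomorphic_on upper_half \<tau>) \<and>
      (\<forall>z\<in>upper_half \<sigma>. \<forall>w\<in>upper_half \<tau>. (\<lambda>n. f n z w) \<longlonglongrightarrow> g z w)"
    if \<sigma>: "\<sigma> = 1 \<or> \<sigma> = -1" and \<tau>: "\<tau> = 1 \<or> \<tau> = -1" for \<sigma> \<tau>
  proof -
    note uh = upper_half[OF \<sigma>] and uk = upper_half[OF \<tau>]
    have h1: "(\<lambda>z. f n z w) holomorphic_on upper_half \<sigma>" if "w \<in> upper_half \<tau>" for n w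
      by (rule holomorphic_on_subset[OF fhol(1) uh(4)]) (use that uk in auto)
    have h2: "(\<lambda>w. f n z w) holomorphic_on upper_half \<tau>" if "z \<in> upper_half \<sigma>" for n z
      by (rule holomorphic_on_subset[OF fhol(2) uk(4)]) (use that uh in auto)
    have h3: "\<exists>B. \<forall>n. \<forall>z\<in>K. \<forall>w\<in>L. norm (f n z w) \<le> B"
      if K: "compact K" "compact L" "K \<subseteq> upper_half \<sigma>" "L \<subseteq> upper_half \<tau>" for K L
      by (rule fbdd[OF K(1,2) order_trans[OF K(3) uh(4)] order_trans[OF K(4) uk(4)]])
    have h4: "(\<lambda>n. f n u v) \<longlonglongrightarrow> C (1 / u) (1 / v)" if "u \<in> inv_stolz \<sigma> \<alpha> \<beta>" "v \<in> inv_stolz \<tau> \<alpha> \<beta>" for u v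
      using flim[of "1 / u" "1 / v"] that by (simp add: inv_stolz_def)
    show ?thesis
      by (rule Vitali_pointwise2[OF uh(1,3) uk(1,3) h1 h2 h3 inv_stolz[OF \<sigma> ab] inv_stolz[OF \<tau> ab] h4]) blast+
  qed
  \<comment> \<open>One function for all four products of half-planes, on each of which convergence
    is known.\<close>
  define c where "c z w = lim (\<lambda>n. f n z w)" for z w
  have clim: "(\<lambda>n. f n z w) \<longlonglongrightarrow> c z w" if zw: "z \<notin> \<real>" "w \<notin> \<real>" for z w
  proof -
    obtain \<sigma> where \<sigma>: "\<sigma> = 1 \<or> \<sigma> = -1" "z \<in> upper_half \<sigma>" by (rule notin_Reals_upper_half[OF zw(1)])
    obtain \<tau> where \<tau>: "\<tau> = 1 \<or> \<tau> = -1" "w \<in> upper_half \<tau>" by (rule notin_Reals_upper_half[OF zw(2)])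
    obtain l where "(\<lambda>n. f n z w) \<longlonglongrightarrow> l" using exg[OF \<sigma>(1) \<tau>(1)] \<sigma>(2) \<tau>(2) by blast
    then show ?thesis unfolding c_def using limI by metis
  qed
  have chol1: "(\<lambda>z. c z w) holomorphic_on - \<real>" if w: "w \<notin> \<real>" for w
  proof (rule holomorphic_on_compl_Reals)
    fix \<sigma> :: real assume \<sigma>: "\<sigma> = 1 \<or> \<sigma> = -1"
    obtain \<tau> where \<tau>: "\<tau> = 1 \<or> \<tau> = -1" "w \<in> upper_half \<tau>" by (rule notin_Reals_upper_half[OF w])
    obtain g where g: "(\<lambda>z. g z w) holomorphic_on upper_half \<sigma>" "\<And>z. z \<in> upper_half \<sigma> \<Longrightarrow> (\<lambda>n. f n z w) \<longlonglongrightarrow> g z w"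
      using exg[OF \<sigma> \<tau>(1)] \<tau>(2) by blast
    have "g z w = c z w" if "z \<in> upper_half \<sigma>" for z
      unfolding c_def using limI[OF g(2)[OF that]] by simp
    then show "(\<lambda>z. c z w) holomorphic_on upper_half \<sigma>"
      using g(1) holomorphic_cong[OF refl, of "upper_half \<sigma>" "\<lambda>z. g z w" "\<lambda>z. c z w"] by simp
  qed
  have chol2: "(\<lambda>w. c z w) holomorphic_on - \<real>" if z: "z \<notin> \<real>" for z
  proof (rule holomorphic_on_compl_Reals)
    fix \<tau> :: real assume \<tau>: "\<tau> = 1 \<or> \<tau> = -1"
    obtain \<sigma> where \<sigma>: "\<sigma> = 1 \<or> \<sigma> = -1" "z \<in> upper_half \<sigma>" by (rule notin_Reals_upper_half[OF z])
    obtain g where g: "(\<lambda>w. g z w) holomorphic_on upper_half \<tau>" "\<And>w. w \<in> upper_half \<tau> \<Longrightarrow> (\<lambda>n. f n z w) \<longlonglongrightarrow> g z w"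
      using exg[OF \<sigma>(1) \<tau>] \<sigma>(2) by blast
    have "g z w = c z w" if "w \<in> upper_half \<tau>" for w
      unfolding c_def using limI[OF g(2)[OF that]] by simp
    then show "(\<lambda>w. c z w) holomorphic_on upper_half \<tau>"
      using g(1) holomorphic_cong[OF refl, of "upper_half \<tau>" "\<lambda>w. g z w" "\<lambda>w. c z w"] by simp
  qed
  have limslope: "(\<lambda>n. pick_slope (p1 n) z) \<longlonglongrightarrow> pick_slope \<phi>1 z" "(\<lambda>n. pick_slope (p2 n) z) \<longlonglongrightarrow> pick_slope \<phi>2 z"
    if "z \<notin> \<real>" for z
    unfolding pick_slope_def using that
    by (auto intro!: tendsto_intros \<phi>1(2) \<phi>2(2) simp: complex_is_Real_iff)
  have Flim: "(\<lambda>n. F1 n z) \<longlonglongrightarrow> z" "(\<lambda>n. F2 n z) \<longlonglongrightarrow> z" if z: "z \<notin> \<real>" for z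
  proof -
    have "F1 n z = z - p1 n z * of_real (1 / N n)" "F2 n z = z - p2 n z * of_real (1 / N n)" for n
      using N(1)[of n] by (simp_all add: p1_def p2_def)
    moreover have "(\<lambda>n. z - p1 n z * of_real (1 / N n)) \<longlonglongrightarrow> z - \<phi>1 z * of_real 0"
      "(\<lambda>n. z - p2 n z * of_real (1 / N n)) \<longlonglongrightarrow> z - \<phi>2 z * of_real 0"
      by (intro tendsto_intros Ninf \<phi>1(2) \<phi>2(2) z)+
    ultimately show "(\<lambda>n. F1 n z) \<longlonglongrightarrow> z" "(\<lambda>n. F2 n z) \<longlonglongrightarrow> z" by simp_all
  qed
  have lp: "levy_pair \<phi>1 \<phi>2 c"
    unfolding levy_pair_def
  proof (intro conjI allI impI)
    show "((\<lambda>y. \<phi>1 (\<i> * of_real y) / of_real y) \<longlongrightarrow> 0) at_top"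
      by (rule pick_asymptotics[OF R1 ab \<phi>1(3)])
    show "((\<lambda>y. \<phi>2 (\<i> * of_real y) / of_real y) \<longlongrightarrow> 0) at_top"
      by (rule pick_asymptotics[OF R2 ab \<phi>2(3)])
  next
    fix z w :: complex assume zw: "z \<notin> \<real>" "w \<notin> \<real>"
    have "f n (cnj z) (cnj w) = cnj (f n z w)" for n
      by (simp add: f_def F1_def F2_def recip_cauchy_cnj cauchy_transform2_cnj)
    then have "(\<lambda>n. f n (cnj z) (cnj w)) \<longlonglongrightarrow> cnj (c z w)" using tendsto_cnj[OF clim[OF zw]] by simp
    from LIMSEQ_unique[OF clim[OF cR[OF zw(1)] cR[OF zw(2)]] this]
    show "c (cnj z) (cnj w) = cnj (c z w)" .
    have "(\<lambda>n. (norm (f n z w))\<^sup>2) \<longlonglongrightarrow> (norm (c z w))\<^sup>2" by (intro tendsto_intros clim zw)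
    moreover have "(\<lambda>n. pick_slope (p1 n) z * pick_slope (p2 n) w) \<longlonglongrightarrow> pick_slope \<phi>1 z * pick_slope \<phi>2 w"
      by (intro tendsto_intros limslope zw)
    ultimately show "(norm (c z w))\<^sup>2 \<le> pick_slope \<phi>1 z * pick_slope \<phi>2 w"
      by (rule LIMSEQ_le) (use fb[OF zw] in auto)
    show "gram_ineq z w z w (pick_slope \<phi>1 z) (pick_slope \<phi>2 w) (c z w) (c (cnj z) w) \<rho>" for \<rho>
      by (rule gram_ineq_limit[OF gram[OF zw] zw Flim(1)[OF zw(1)] Flim(2)[OF zw(2)] limslope(1)[OF zw(1)]
          limslope(2)[OF zw(2)] clim[OF zw] clim[OF cR[OF zw(1)] zw(2)]])
  qed (rule \<phi>1(1) \<phi>2(1) chol1 chol2; assumption?)+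
  have cval: "c (1 / z) (1 / w) = 1 - 1 / h_fun \<nu> R1 R2 z w" if zw: "z \<in> stolz_pair \<alpha> \<beta>" "w \<in> stolz_pair \<alpha> \<beta>" for z w
    using LIMSEQ_unique[OF clim flim[OF zw]] invR zw by (simp add: C_def)
  have hnz: "h_fun \<nu> R1 R2 z w \<noteq> 0" if zw: "z \<in> stolz_pair \<alpha> \<beta>" "w \<in> stolz_pair \<alpha> \<beta>" for z w
    using Req zw by (auto simp: stolz_domain_def)
  show thesis by (rule that[OF ab R1 R2 \<phi>1(3) \<phi>2(3) hnz cval lp])
qed

section \<open>The flow of a Pick function\<close>

text \<open>The factor Im (u + t \<phi>(u)) / Im u. It is at most 1, and it is positive exactly when
  u + t \<phi>(u) lies in the half-plane of u.\<close>

definition pick_contraction :: "(complex \<Rightarrow> complex) \<Rightarrow> real \<Rightarrow> complex \<Rightarrow> real" where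
  "pick_contraction \<phi> t u = 1 - t * pick_slope \<phi> u"

text \<open>Positivity of the contraction factor selects the solution in the half-plane of z. It is
  unique there, and exists for every non-real z under the hypotheses of the flow.\<close>

definition pick_inverse :: "(complex \<Rightarrow> complex) \<Rightarrow> real \<Rightarrow> complex \<Rightarrow> complex" where
  "pick_inverse \<phi> t z = (THE u. u \<notin> \<real> \<and> 0 < pick_contraction \<phi> t u \<and> u + of_real t * \<phi> u = z)"

locale pick_flow =
  fixes \<phi> :: "complex \<Rightarrow> complex" and t :: real
  assumes pick: "pick_function \<phi>" and t: "0 \<le> t"
    and asym: "((\<lambda>y. \<phi> (\<i> * of_real y) / of_real y) \<longlongrightarrow> 0) at_top"
begin

abbreviation "e \<equiv> pick_contraction \<phi> t"
abbreviation "H u \<equiv> u + of_real t * \<phi> u"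

lemma Im_H: "u \<notin> \<real> \<Longrightarrow> Im (H u) = Im u * e u"
  by (simp add: pick_contraction_def pick_slope_def complex_is_Real_iff field_simps)

lemma e_le_1: "u \<notin> \<real> \<Longrightarrow> e u \<le> 1"
  using pick_functionD(3)[OF pick, of u] t by (simp add: pick_contraction_def)

text \<open>The Pick inequality with the arithmetic-geometric mean gives t |\<phi>(u1) - \<phi>(u2)|
  \<le> |u1 - u2| (s1 + s2) / 2 with s = t times slope. Injectivity of H, boundedness of preimages
  and quantitative continuity of the inverse all follow from this one estimate.\<close>

lemma H_expansion:
  assumes u: "u1 \<notin> \<real>" "u2 \<notin> \<real>"
  shows "norm (u1 - u2) * (e u1 + e u2) \<le> 2 * norm (H u1 - H u2)"
proof -
  define s1 s2 where "s1 = t * pick_slope \<phi> u1" and "s2 = t * pick_slope \<phi> u2"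
  have s: "0 \<le> s1" "0 \<le> s2" using pick_functionD(3)[OF pick] u t by (simp_all add: s1_def s2_def)
  have "(t * norm (\<phi> u1 - \<phi> u2))\<^sup>2 \<le> t\<^sup>2 * ((norm (u1 - u2))\<^sup>2 * (pick_slope \<phi> u1 * pick_slope \<phi> u2))"
    unfolding power_mult_distrib by (intro mult_left_mono pick_functionD(4)[OF pick u]) auto
  also have "\<dots> = (norm (u1 - u2))\<^sup>2 * (s1 * s2)" by (simp add: s1_def s2_def power2_eq_square)
  also have "\<dots> \<le> (norm (u1 - u2))\<^sup>2 * ((s1 + s2) / 2)\<^sup>2"
    using sum_squares_bound[of s1 s2] by (intro mult_left_mono) (simp_all add: power2_eq_square algebra_simps)
  also have "\<dots> = (norm (u1 - u2) * ((s1 + s2) / 2))\<^sup>2" by (rule power_mult_distrib[symmetric])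
  finally have a: "t * norm (\<phi> u1 - \<phi> u2) \<le> norm (u1 - u2) * ((s1 + s2) / 2)"
    by (rule power2_le_imp_le) (use s in auto)
  have "u1 - u2 = (H u1 - H u2) - of_real t * (\<phi> u1 - \<phi> u2)" by (simp add: algebra_simps)
  then have "norm (u1 - u2) \<le> norm (H u1 - H u2) + norm (of_real t * (\<phi> u1 - \<phi> u2))"
    using norm_triangle_ineq4 by metis
  also have "norm (of_real t * (\<phi> u1 - \<phi> u2)) = t * norm (\<phi> u1 - \<phi> u2)" using t by (simp add: norm_mult)
  finally show ?thesis using a
    by (simp add: pick_contraction_def s1_def[symmetric] s2_def[symmetric] algebra_simps)
qed

definition D :: "complex set" where "D = {u. u \<notin> \<real> \<and> 0 < e u}"

lemma hol: "\<phi> holomorphic_on - \<real>" by (rule pick_functionD(1)[OF pick])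

lemma cont: "continuous_on (- \<real>) \<phi>" by (rule holomorphic_on_imp_continuous_on[OF hol])

lemma cont_e: "continuous_on (- \<real>) e"
  unfolding pick_contraction_def pick_slope_def
  by (intro continuous_intros cont) (auto simp: complex_is_Real_iff)

lemma open_D: "open D"
proof -
  have "open (- \<real> \<inter> e -` {0<..})"
    by (rule continuous_open_preimage[OF cont_e open_compl_Reals open_greaterThan])
  moreover have "- \<real> \<inter> e -` {0<..} = D" by (auto simp: D_def)
  ultimately show ?thesis by simp
qed

lemma H_inj: "inj_on H D"
proof (rule inj_onI)
  fix u1 u2 assume u: "u1 \<in> D" "u2 \<in> D" "H u1 = H u2"
  then have "norm (u1 - u2) * (e u1 + e u2) \<le> 0"
    using H_expansion[of u1 u2] by (simp add: D_def)
  moreover have "0 < e u1 + e u2" using u by (simp add: D_def)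
  ultimately have "norm (u1 - u2) \<le> 0" by (simp add: mult_le_0_iff)
  then show "u1 = u2" by simp
qed

lemma H_hol: "H holomorphic_on D"
  by (intro holomorphic_intros holomorphic_on_subset[OF hol]) (auto simp: D_def)

lemma cnj_D: "u \<in> D \<Longrightarrow> cnj u \<in> D" "u \<notin> \<real> \<Longrightarrow> H (cnj u) = cnj (H u)"
  using pick_functionD(2)[OF pick, of u]
  by (auto simp: D_def pick_contraction_def pick_slope_def complex_is_Real_iff)

lemma eventually_axis: "\<forall>\<^sub>F y in at_top. \<i> * of_real y \<in> D \<and> 1/2 < e (\<i> * of_real y) \<and> y > 0"
proof -
  have "((\<lambda>y. of_real t * (\<phi> (\<i> * of_real y) / of_real y)) \<longlongrightarrow> of_real t * 0) at_top"
    by (intro tendsto_intros asym)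
  then have "\<forall>\<^sub>F y in at_top. dist (of_real t * (\<phi> (\<i> * of_real y) / of_real y)) 0 < 1/2"
    by (intro tendstoD) auto
  then show ?thesis using eventually_gt_at_top[of "0::real"]
  proof eventually_elim
    case (elim y)
    have "t * pick_slope \<phi> (\<i> * of_real y) = - Im (of_real t * (\<phi> (\<i> * of_real y) / of_real y))"
      using elim by (simp add: pick_slope_def)
    also have "\<dots> \<le> norm (of_real t * (\<phi> (\<i> * of_real y) / of_real y))"
      using abs_Im_le_cmod[of "of_real t * (\<phi> (\<i> * of_real y) / of_real y)"] by linarith
    also have "\<dots> < 1/2" using elim by (simp add: dist_norm)
    finally show ?case using elim by (simp add: D_def pick_contraction_def complex_is_Real_iff)
  qed
qed

text \<open>In each half-plane the image is open, because H is injective and holomorphic, relatively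
  closed and nonempty, so it is everything. Closedness is a properness statement: preimages of a
  convergent sequence stay bounded by the expansion estimate, and they cannot approach the real axis
  because H does not increase |Im|.\<close>

lemma H_image: "H ` D = - \<real>"
proof
  show "H ` D \<subseteq> - \<real>"
  proof
    fix z assume "z \<in> H ` D"
    then obtain u where u: "u \<in> D" "z = H u" by blast
    then have "Im z = Im u * e u" using Im_H by (simp add: D_def)
    then have "Im z \<noteq> 0" using u by (simp add: D_def complex_is_Real_iff)
    then show "z \<in> - \<real>" by (simp add: complex_is_Real_iff)
  qed
next
  have main: "upper_half \<sigma> \<subseteq> H ` D" if \<sigma>: "\<sigma> = 1 \<or> \<sigma> = -1" for \<sigma>
  proof -
    note uh = upper_half[OF \<sigma>]
    define T where "T = H ` (D \<inter> upper_half \<sigma>)"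
    have sgn: "\<sigma> * Im u \<ge> \<sigma> * Im (H u)" "0 < \<sigma> * Im (H u)" if u: "u \<in> D" "u \<in> upper_half \<sigma>" for u
    proof -
      have uR: "u \<notin> \<real>" and eu: "0 < e u" using u by (auto simp: D_def)
      have eq: "\<sigma> * Im (H u) = (\<sigma> * Im u) * e u" using Im_H[OF uR] by simp
      have "0 < \<sigma> * Im u" using u by (simp add: upper_half_def)
      then show "\<sigma> * Im u \<ge> \<sigma> * Im (H u)" "0 < \<sigma> * Im (H u)"
        unfolding eq using eu e_le_1[OF uR] by (auto simp: mult_left_le)
    qed
    have sub: "T \<subseteq> upper_half \<sigma>" using sgn by (auto simp: T_def upper_half_def)
    have "open T" unfolding T_def
    proof (rule open_mapping_thm3)
      show "H holomorphic_on (D \<inter> upper_half \<sigma>)" by (rule holomorphic_on_subset[OF H_hol]) auto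
      show "inj_on H (D \<inter> upper_half \<sigma>)" by (rule inj_on_subset[OF H_inj]) auto
    qed (use open_D uh in auto)
    then have op: "openin (top_of_set (upper_half \<sigma>)) T"
      using sub uh(1) by (simp add: openin_open_eq)
    have cl: "closedin (top_of_set (upper_half \<sigma>)) T"
      unfolding closedin_limpt
    proof (intro conjI allI impI sub)
      fix l assume l: "l islimpt T \<and> l \<in> upper_half \<sigma>"
      then obtain x where x: "(\<forall>n. x n \<in> T) \<and> l \<in> upper_half \<sigma> \<and> x \<longlonglongrightarrow> l"
        unfolding islimpt_sequential by blast
      have "\<exists>u. u \<in> D \<and> u \<in> upper_half \<sigma> \<and> H u = x n" for n
      proof -
        have "x n \<in> H ` (D \<inter> upper_half \<sigma>)" using x by (simp add: T_def)
        then obtain v where "x n = H v" "v \<in> D \<inter> upper_half \<sigma>" by (rule imageE)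
        then show ?thesis by (intro exI[of _ v]) auto
      qed
      then have "\<exists>u. \<forall>n. u n \<in> D \<and> u n \<in> upper_half \<sigma> \<and> H (u n) = x n" by (intro choice allI)
      then obtain u where u: "\<And>n. u n \<in> D" "\<And>n. u n \<in> upper_half \<sigma>" "\<And>n. H (u n) = x n" by auto
      have uR: "u n \<notin> \<real>" "e (u n) > 0" for n using u(1) by (auto simp: D_def)
      have "Bseq x" using x convergent_imp_Bseq convergentI by blast
      then obtain B where B: "\<And>n. norm (x n) \<le> B" unfolding Bseq_def by blast
      \<comment> \<open>Comparison with the single preimage u 0, whose contraction factor is
        positive and independent of n.\<close>
      have "norm (u n) \<le> norm (u 0) + 4 * B / e (u 0)" for n
      proof -
        have "norm (u n - u 0) * e (u 0) \<le> norm (u n - u 0) * (e (u n) + e (u 0))"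
          using uR(2)[of n] by (intro mult_left_mono) auto
        also have "\<dots> \<le> 2 * norm (x n - x 0)" using H_expansion[OF uR(1) uR(1), of n 0] by (simp add: u(3))
        also have "\<dots> \<le> 4 * B" using B[of n] B[of 0] norm_triangle_ineq4[of "x n" "x 0"] by simp
        finally have "norm (u n - u 0) \<le> 4 * B / e (u 0)" using uR(2)[of 0] by (simp add: field_simps)
        then show ?thesis using norm_triangle_sub[of "u n" "u 0"] by simp
      qed
      then have "bounded (range u)" unfolding bounded_iff by blast
      then obtain v r where v: "strict_mono (r :: nat \<Rightarrow> nat)" "(u \<circ> r) \<longlonglongrightarrow> v"
        using bounded_imp_convergent_subsequence by blast
      have "x \<longlonglongrightarrow> l" using x by blast
      from LIMSEQ_subseq_LIMSEQ[OF this v(1)] have xr: "(\<lambda>n. x (r n)) \<longlonglongrightarrow> l" by (simp add: o_def)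
      have ur: "(\<lambda>n. u (r n)) \<longlonglongrightarrow> v" using v(2) by (simp add: o_def)
      \<comment> \<open>Keeps the limit v of the preimages strictly inside the half-plane.\<close>
      have "\<sigma> * Im l \<le> \<sigma> * Im v"
      proof (rule LIMSEQ_le)
        show "(\<lambda>n. \<sigma> * Im (x (r n))) \<longlonglongrightarrow> \<sigma> * Im l" by (intro tendsto_intros xr)
        show "(\<lambda>n. \<sigma> * Im (u (r n))) \<longlonglongrightarrow> \<sigma> * Im v" by (intro tendsto_intros ur)
        show "\<exists>N. \<forall>n\<ge>N. \<sigma> * Im (x (r n)) \<le> \<sigma> * Im (u (r n))" using sgn(1)[OF u(1,2)] u(3) by simp
      qed
      moreover have l: "0 < \<sigma> * Im l" using x by (simp add: upper_half_def)
      ultimately have vu: "v \<in> upper_half \<sigma>" by (simp add: upper_half_def)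
      then have vR: "v \<notin> \<real>" using uh by auto
      have "isCont \<phi> v" using cont open_compl_Reals vR by (simp add: continuous_on_eq_continuous_at)
      from isCont_tendsto_compose[OF this ur] have "(\<lambda>n. H (u (r n))) \<longlonglongrightarrow> H v" by (intro tendsto_intros ur)
      then have Hv: "H v = l" using LIMSEQ_unique[OF _ xr] u(3) by simp
      have "\<sigma> * Im l = (\<sigma> * Im v) * e v" using Im_H[OF vR] Hv by simp
      with l have "0 < (\<sigma> * Im v) * e v" by (simp only:)
      moreover have "0 < \<sigma> * Im v" using vu by (simp add: upper_half_def)
      ultimately have "0 < e v" by (rule zero_less_mult_pos)
      then have "v \<in> D" using vR by (simp add: D_def)
      then show "l \<in> T" using vu Hv unfolding T_def by blast
    qed
    obtain y where y: "\<i> * of_real y \<in> D" "y > 0"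
      using eventually_happens'[OF _ eventually_axis] by auto
    \<comment> \<open>High on the imaginary axis t times the slope is below 1/2 by the growth
      condition; conjugation serves the lower half-plane.\<close>
    have "\<exists>u. u \<in> D \<inter> upper_half \<sigma>"
    proof (cases "\<sigma> = 1")
      case True then show ?thesis using y by (intro exI[of _ "\<i> * of_real y"]) (simp add: upper_half_def)
    next
      case False
      then have "\<sigma> = -1" using \<sigma> by simp
      then show ?thesis using y cnj_D(1)[OF y(1)] by (intro exI[of _ "cnj (\<i> * of_real y)"]) (simp add: upper_half_def)
    qed
    then have "T \<noteq> {}" by (auto simp: T_def)
    then have "T = upper_half \<sigma>" using uh(3) op cl connected_clopen by blast
    then show ?thesis by (auto simp: T_def)
  qed
  show "- \<real> \<subseteq> H ` D"
  proof
    fix z :: complex assume "z \<in> - \<real>"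
    then have "z \<notin> \<real>" by simp
    then obtain \<sigma> where "\<sigma> = 1 \<or> \<sigma> = -1" "z \<in> upper_half \<sigma>" by (rule notin_Reals_upper_half)
    then show "z \<in> H ` D" using main by blast
  qed
qed

abbreviation "F \<equiv> pick_inverse \<phi> t"

lemma F_H:
  assumes "u \<in> D"
  shows "F (H u) = u"
  unfolding pick_inverse_def
proof (rule the_equality)
  show "u \<notin> \<real> \<and> 0 < e u \<and> H u = H u" using assms by (simp add: D_def)
next
  fix v assume "v \<notin> \<real> \<and> 0 < e v \<and> H v = H u"
  then have "v \<in> D" "H v = H u" by (simp_all add: D_def)
  then show "v = u" using inj_onD[OF H_inj _ _ assms, of v] by blast
qed

lemma F_D_and_H_F:
  assumes "z \<notin> \<real>"
  shows "F z \<in> D \<and> H (F z) = z"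
proof -
  have "z \<in> H ` D" using H_image assms by simp
  then obtain u where "z = H u" "u \<in> D" by (rule imageE)
  then show ?thesis using F_H by simp
qed

lemmas F_D = F_D_and_H_F[THEN conjunct1] and H_F = F_D_and_H_F[THEN conjunct2]

lemma F_notin_Reals: "z \<notin> \<real> \<Longrightarrow> F z \<notin> \<real>" and e_F_pos: "z \<notin> \<real> \<Longrightarrow> 0 < e (F z)"
  using F_D[of z] by (simp_all add: D_def)

lemma Im_F: "z \<notin> \<real> \<Longrightarrow> Im z = Im (F z) * e (F z)"
  using Im_H[OF F_notin_Reals, of z] H_F[of z] by simp

lemma F_holomorphic: "F holomorphic_on - \<real>"
proof -
  obtain g where g: "g holomorphic_on (H ` D)" "\<And>z. z \<in> D \<Longrightarrow> g (H z) = z"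
    using holomorphic_has_inverse[OF H_hol open_D H_inj] by metis
  have "g z = F z" if "z \<in> - \<real>" for z
    using g(2)[OF F_D, of z] H_F[of z] that by simp
  then show ?thesis using g(1) holomorphic_cong[OF refl, of "- \<real>" g F] by (simp add: H_image)
qed

lemma F_cnj: "z \<notin> \<real> \<Longrightarrow> F (cnj z) = cnj (F z)"
  using F_H[OF cnj_D(1)[OF F_D], of z] cnj_D(2)[OF F_notin_Reals, of z] H_F[of z] by simp

text \<open>An approximate solution u is close to the true one as soon as its own contraction factor
  is not small. Used with u = z, where the error is t \<phi>(z), both for z going to infinity and
  for t going to 0.\<close>

lemma F_near: 
  assumes "u \<notin> \<real>" "z \<notin> \<real>"
  shows "norm (u - F z) * e u \<le> 2 * norm (H u - z)"
proof -
  have "norm (u - F z) * e u \<le> norm (u - F z) * (e u + e (F z))"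
    using e_F_pos[OF assms(2)] by (intro mult_left_mono) auto
  also have "\<dots> \<le> 2 * norm (H u - z)" using H_expansion[OF assms(1) F_notin_Reals[OF assms(2)]] H_F[OF assms(2)] by simp
  finally show ?thesis .
qed

lemma F_asymptotics: "((\<lambda>y. F (\<i> * of_real y) / (\<i> * of_real y)) \<longlongrightarrow> 1) at_top"
proof -
  have "((\<lambda>y. F (\<i> * of_real y) / (\<i> * of_real y) - 1) \<longlongrightarrow> 0) at_top"
  proof (rule Lim_null_comparison)
    show "\<forall>\<^sub>F y in at_top. norm (F (\<i> * of_real y) / (\<i> * of_real y) - 1) \<le> 4 * t * norm (\<phi> (\<i> * of_real y) / of_real y)"
      using eventually_axis
    proof eventually_elim
      case (elim y)
      let ?u = "\<i> * complex_of_real y"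
      have uR: "?u \<notin> \<real>" using elim by (simp add: D_def)
      have "norm (?u - F ?u) * (1/2) \<le> norm (?u - F ?u) * e ?u" using elim by (intro mult_left_mono) auto
      also have "\<dots> \<le> 2 * norm (of_real t * \<phi> ?u)" using F_near[OF uR uR] by simp
      finally have "norm (F ?u - ?u) \<le> 4 * t * norm (\<phi> ?u)" using t by (simp add: norm_mult norm_minus_commute)
      moreover have "F ?u / ?u - 1 = (F ?u - ?u) / ?u" using elim by (simp add: field_simps)
      ultimately show ?case using elim by (simp add: norm_divide norm_mult divide_right_mono)
    qed
    have "((\<lambda>y. 4 * t * norm (\<phi> (\<i> * of_real y) / of_real y)) \<longlongrightarrow> 4 * t * norm (0::complex)) at_top"
      by (intro tendsto_intros asym)
    then show "((\<lambda>y. 4 * t * norm (\<phi> (\<i> * of_real y) / of_real y)) \<longlongrightarrow> 0) at_top" by simp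
  qed
  then show ?thesis by (rule LIM_zero_cancel)
qed

end

section \<open>Bi-free Cauchy transforms of the semigroup\<close>

lemma holomorphic2_on_imp_continuous_on:
  assumes "holomorphic2_on F S"
  shows "continuous_on S F"
  unfolding continuous_on_eq_continuous_within
proof
  fix p assume "p \<in> S"
  then obtain a b where "(F has_derivative (\<lambda>v. a * fst v + b * snd v)) (at p within S)"
    using assms unfolding holomorphic2_on_def by blast
  then show "continuous (at p within S) F" by (rule has_derivative_continuous)
qed

text \<open>At \<open>t = 1\<close> this is \<open>h\<^sub>\<nu> = 1 / (1 - c)\<close> solved for the Cauchy transform, with \<open>1/z + R(z) = Z\<close>.\<close>
definition levy_cauchy ::
  "(complex \<Rightarrow> complex) \<Rightarrow> (complex \<Rightarrow> complex) \<Rightarrow> (complex \<Rightarrow> complex \<Rightarrow> complex) \<Rightarrow> real \<Rightarrow> complex \<Rightarrow> complex \<Rightarrow> complex"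
  where "levy_cauchy \<phi>1 \<phi>2 c t Z W =
    1 / (pick_inverse \<phi>1 t Z * pick_inverse \<phi>2 t W * (1 - of_real t * c (pick_inverse \<phi>1 t Z) (pick_inverse \<phi>2 t W)))"

text \<open>On the Stolz domain \<phi>(1/z) is the marginal R-transform and c(1/z, 1/w) is 1 - 1/h,
  so this is the holomorphic extension of R to all non-real arguments.\<close>

definition levy_R :: "(complex \<Rightarrow> complex) \<Rightarrow> (complex \<Rightarrow> complex) \<Rightarrow> (complex \<Rightarrow> complex \<Rightarrow> complex) \<Rightarrow> complex \<times> complex \<Rightarrow> complex" where
  "levy_R \<phi>1 \<phi>2 c p = fst p * \<phi>1 (1 / fst p) + snd p * \<phi>2 (1 / snd p) + c (1 / fst p) (1 / snd p)"

text \<open>After multiplication by |z|^2 |w|^2 |1 - C|^2 the real part becomes 2 (Im z)(Im w) times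
  a quantity \<open>Dd\<close>. The Gram inequality for one particular \<rho>, combined with P < 1
  and 0 \<le> Q < 1, shows \<open>Dd \<ge> 0\<close>.\<close>

lemma positivity_algebra:
  assumes z: "0 < Im z" "0 < Im w" and nz: "1 - C \<noteq> 0" "1 - C' \<noteq> 0"
    and P: "0 \<le> P" "P < 1" and Q: "0 \<le> Q" "Q < 1"
    and CQ: "Q = 0 \<Longrightarrow> C = 0 \<and> C' = 0"
    and gr: "\<And>\<rho>. gram_ineq z w z w P Q C C' \<rho>"
  shows "0 \<le> Re (1 / (cnj z * w * (1 - C')) - 1 / (z * w * (1 - C)))"
proof -
  define y v where "y = Im z" and "v = Im w"
  have yv: "y > 0" "v > 0" using z by (simp_all add: y_def v_def)
  have zy: "z - cnj z = 2 * \<i> * y" "w - cnj w = 2 * \<i> * v" by (simp_all add: complex_eq_iff y_def v_def)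
  have nz0: "z \<noteq> 0" "w \<noteq> 0" using z by auto
  have iy: "2 * \<i> * complex_of_real y \<noteq> 0" "2 * \<i> * complex_of_real v \<noteq> 0" using yv by auto
  have nzc: "1 - cnj C \<noteq> 0" "1 - cnj C' \<noteq> 0" using nz by (metis complex_cnj_one complex_cnj_diff complex_cnj_zero_iff)+
  define K where "K = (w * cnj C' - cnj w * C) / (2 * \<i> * v) - C - cnj C'"
  define L where "L = (z * C' - cnj z * C) / (2 * \<i> * y) - C - C'"
  define X where "X = (Im z * Q - Im (cnj z * K)) / y"
  \<comment> \<open>The value for which Q + K + \<rho> cnj C' collapses to \<rho> - (1 - Q), so that
    the Gram inequality involves \<rho> only through |\<rho>|^2, Re \<rho> and
    \<open>Dd\<close>.\<close>
  define \<rho> where "\<rho> = (1 + K) / (1 - cnj C')"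
  have K1: "1 + K = (w * (1 - C) - cnj w * (1 - cnj C')) / (2 * \<i> * v)"
  proof -
    have "(1 + K) * (2 * \<i> * v) = w * cnj C' - cnj w * C + (1 - C - cnj C') * (2 * \<i> * v)"
      using iy by (simp add: K_def field_simps)
    also have "\<dots> = w * (1 - C) - cnj w * (1 - cnj C')"
      unfolding zy[symmetric] by (simp add: algebra_simps)
    finally show ?thesis using iy by (simp add: field_simps)
  qed
  have L1: "cnj C' + cnj L = cnj z * (cnj C - cnj C') / (2 * \<i> * y)"
  proof -
    have "C' + L = (z * (C' - C)) / (2 * \<i> * y)"
    proof -
      have "(C' + L) * (2 * \<i> * y) = z * C' - cnj z * C - C * (2 * \<i> * y)"
        using iy by (simp add: L_def field_simps)
      also have "\<dots> = z * (C' - C)" unfolding zy[symmetric] by (simp add: algebra_simps)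
      finally show ?thesis using iy by (simp add: field_simps)
    qed
    then have "cnj (C' + L) = cnj ((z * (C' - C)) / (2 * \<i> * y))" by simp
    then show ?thesis using iy by (simp add: field_simps)
  qed
  define Dd where "Dd = (1 - Q) + X + 2 * Re (\<rho> * (cnj C' + cnj L))"
  have rho: "\<rho> * (1 - cnj C') = 1 + K" using nzc by (simp add: \<rho>_def)
  have gram: "(norm (Q + K + \<rho> * cnj C'))\<^sup>2 \<le> (X + 2 * Re (\<rho> * (cnj C' + cnj L)) + (norm \<rho>)\<^sup>2 * P) * Q"
    using gr[of \<rho>] unfolding gram_ineq_def Let_def K_def L_def X_def y_def v_def .
  have "Q + K + \<rho> * cnj C' = \<rho> - (1 - Q)" using rho by (simp add: algebra_simps)
  then have gram2: "(norm (\<rho> - of_real (1 - Q)))\<^sup>2 \<le> (Dd - (1 - Q) + (norm \<rho>)\<^sup>2 * P) * Q"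
  proof -
    have "X + 2 * Re (\<rho> * (cnj C' + cnj L)) = Dd - (1 - Q)" by (simp add: Dd_def)
    then show ?thesis using gram \<open>Q + K + \<rho> * cnj C' = \<rho> - (1 - Q)\<close> by (simp only: of_real_diff of_real_1)
  qed
  have Dpos: "0 \<le> Dd"
  proof -
    define r where "r = (norm \<rho>)\<^sup>2"
    have n1: "(norm (\<rho> - of_real (1 - Q)))\<^sup>2 = r - 2 * (1 - Q) * Re \<rho> + (1 - Q)\<^sup>2"
      unfolding r_def cmod_power2 by (simp add: power2_eq_square algebra_simps)
    have n2: "0 \<le> r - 2 * Re \<rho> + 1"
    proof -
      have "r - 2 * Re \<rho> + 1 = (norm (\<rho> - 1))\<^sup>2" unfolding r_def cmod_power2 by (simp add: power2_eq_square algebra_simps)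
      then show ?thesis by simp
    qed
    show "0 \<le> Dd"
    proof (cases "Q = 0")
      case True
      then have "C = 0" "C' = 0" using CQ by auto
      then show ?thesis using True by (simp add: Dd_def X_def K_def L_def)
    next
      case False
      then have Qp: "Q > 0" using Q by simp
      \<comment> \<open>Rearranged, the Gram inequality says (1 - Q) |\<rho> - 1|^2 \<le> Q (Dd - (1
        - P) |\<rho>|^2), so \<open>Dd\<close> is at least (1 - P) |\<rho>|^2.\<close>
      have "0 \<le> (1 - Q) * (r - 2 * Re \<rho> + 1)" using n2 Q by (intro mult_nonneg_nonneg) auto
      also have "\<dots> \<le> Q * (Dd + r * P - r)"
        using gram2 unfolding n1 r_def[symmetric] by (simp add: power2_eq_square algebra_simps)
      finally have "0 \<le> Dd + r * P - r" using Qp by (simp add: zero_le_mult_iff)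
      then have "(1 - P) * r \<le> Dd" by (simp add: algebra_simps)
      moreover have "0 \<le> (1 - P) * r" using P by (simp add: r_def)
      ultimately show ?thesis by simp
    qed
  qed
  \<comment> \<open>2 \<i> v times \<rho> (1 - cnj C), with the numerator of \<rho> inserted. It
    links \<open>Dd\<close> with the target, since Re (cnj z M) is both 2 v y times
    \<open>Dd\<close> and the real part with cleared denominators.\<close>
  define M where "M = (w * (1 - C) / (1 - cnj C') - cnj w) * (1 - cnj C)"
  have Re2: "2 * Re (x / (2 * \<i> * y)) = Im x / y" for x
    using yv by (simp add: Re_divide power2_eq_square)
  have yD: "y * Dd = - Im (cnj z * (\<rho> * (1 - cnj C)))"
  proof -
    have "\<rho> * (cnj C' + cnj L) = (cnj z * (\<rho> * (cnj C - cnj C'))) / (2 * \<i> * y)"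
      unfolding L1 by simp
    also have "\<rho> * (cnj C - cnj C') = (1 + K) - \<rho> * (1 - cnj C)"
      unfolding rho[symmetric] by (simp add: algebra_simps)
    finally have "2 * Re (\<rho> * (cnj C' + cnj L)) = Im (cnj z * ((1 + K) - \<rho> * (1 - cnj C))) / y"
      by (simp only: Re2)
    also have "cnj z * ((1 + K) - \<rho> * (1 - cnj C)) = cnj z + cnj z * K - cnj z * (\<rho> * (1 - cnj C))"
      by (simp add: algebra_simps)
    also have "Im (cnj z + cnj z * K - cnj z * (\<rho> * (1 - cnj C))) = - y + Im (cnj z * K) - Im (cnj z * (\<rho> * (1 - cnj C)))"
      by (simp only: plus_complex.sel minus_complex.sel cnj.sel y_def)
    finally have e: "2 * Re (\<rho> * (cnj C' + cnj L)) = (- y + Im (cnj z * K) - Im (cnj z * (\<rho> * (1 - cnj C)))) / y" .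
    have "X = Q - Im (cnj z * K) / y" using yv by (simp add: X_def y_def diff_divide_distrib)
    then have "y * Dd = y * (1 - Im (cnj z * K) / y + (- y + Im (cnj z * K) - Im (cnj z * (\<rho> * (1 - cnj C)))) / y)"
      unfolding Dd_def e by simp
    also have "\<dots> = - Im (cnj z * (\<rho> * (1 - cnj C)))"
      using yv by (simp only: distrib_left right_diff_distrib) simp
    finally show ?thesis .
  qed
  have "\<rho> * (1 - cnj C) = M / (2 * \<i> * v)"
  proof -
    have "\<rho> = (w * (1 - C) / (1 - cnj C') - cnj w) / (2 * \<i> * v)"
      unfolding \<rho>_def K1 using nzc iy by (simp add: field_simps)
    then show ?thesis by (simp add: M_def)
  qed
  then have "cnj z * (\<rho> * (1 - cnj C)) = (cnj z * M) / (2 * \<i> * v)" by simp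
  moreover have "- Im (x / (2 * \<i> * v)) = Re x / (2 * v)" for x
    using yv by (simp add: Im_divide power2_eq_square)
  ultimately have yD2: "y * Dd = Re (cnj z * M) / (2 * v)" using yD by simp
  have ReM: "0 \<le> Re (cnj z * M)"
  proof -
    have "Re (cnj z * M) = 2 * v * (y * Dd)" unfolding yD2 using yv by simp
    then show ?thesis using Dpos yv by simp
  qed
  define N where "N = (norm z)\<^sup>2 * (norm w)\<^sup>2 * (norm (1 - C))\<^sup>2"
  have N: "N > 0" using nz nz0 by (simp add: N_def)
  have Nc: "of_real N = z * cnj z * (w * cnj w) * ((1 - C) * (1 - cnj C))"
    unfolding N_def of_real_mult complex_norm_square by simp
  have "of_real N * (1 / (z * w * (1 - C))) = cnj z * cnj w * (1 - cnj C)"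
    unfolding Nc using nz nz0 by (simp add: field_simps)
  moreover have "of_real N * (1 / (cnj z * w * (1 - C'))) = cnj (cnj z * (w * (1 - C) / (1 - cnj C') * (1 - cnj C)))"
    unfolding Nc using nz nzc nz0 by (simp add: field_simps)
  ultimately have "of_real N * (1 / (cnj z * w * (1 - C')) - 1 / (z * w * (1 - C))) =
     cnj (cnj z * (w * (1 - C) / (1 - cnj C') * (1 - cnj C))) - cnj z * cnj w * (1 - cnj C)"
    by (simp only: right_diff_distrib)
  then have "Re (of_real N * (1 / (cnj z * w * (1 - C')) - 1 / (z * w * (1 - C)))) =
     Re (cnj z * (w * (1 - C) / (1 - cnj C') * (1 - cnj C))) - Re (cnj z * cnj w * (1 - cnj C))"
    by (simp only: minus_complex.sel cnj.sel)
  also have "\<dots> = Re (cnj z * M)"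
    unfolding M_def minus_complex.sel(1)[symmetric] by (simp add: algebra_simps)
  finally have NRe: "N * Re (1 / (cnj z * w * (1 - C')) - 1 / (z * w * (1 - C))) = Re (cnj z * M)"
    by (simp only: Re_complex_of_real Im_complex_of_real times_complex.sel mult_zero_left diff_zero)
  have "0 \<le> x" if "0 \<le> N * x" for x using that N by (simp add: zero_le_mult_iff)
  then show ?thesis using ReM unfolding NRe[symmetric] .
qed

section \<open>The prospective Cauchy transform at time t: bounds, positivity, marginals and
  mass\<close>

locale levy_flow =
  fixes \<phi>1 \<phi>2 :: "complex \<Rightarrow> complex" and c :: "complex \<Rightarrow> complex \<Rightarrow> complex" and t :: real
  assumes lp: "levy_pair \<phi>1 \<phi>2 c" and t: "0 \<le> t"

sublocale levy_flow \<subseteq> A: pick_flow \<phi>1 t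
  using lp t unfolding levy_pair_def by unfold_locales blast+

sublocale levy_flow \<subseteq> B: pick_flow \<phi>2 t
  using lp t unfolding levy_pair_def by unfold_locales blast+

context levy_flow
begin

lemma c_hol: "w \<notin> \<real> \<Longrightarrow> (\<lambda>z. c z w) holomorphic_on - \<real>" "z \<notin> \<real> \<Longrightarrow> (\<lambda>w. c z w) holomorphic_on - \<real>"
  using lp unfolding levy_pair_def by blast+

lemma c_cnj: "z \<notin> \<real> \<Longrightarrow> w \<notin> \<real> \<Longrightarrow> c (cnj z) (cnj w) = cnj (c z w)"
  using lp unfolding levy_pair_def by blast

lemma c_bound: "z \<notin> \<real> \<Longrightarrow> w \<notin> \<real> \<Longrightarrow> (norm (c z w))\<^sup>2 \<le> pick_slope \<phi>1 z * pick_slope \<phi>2 w"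
  using lp unfolding levy_pair_def by blast

lemma gram: "z \<notin> \<real> \<Longrightarrow> w \<notin> \<real> \<Longrightarrow>
    gram_ineq z w z w (pick_slope \<phi>1 z) (pick_slope \<phi>2 w) (c z w) (c (cnj z) w) \<rho>"
  using lp unfolding levy_pair_def by blast

lemma cnj_notin_Reals: "z \<notin> \<real> \<Longrightarrow> cnj z \<notin> \<real>"
  by (simp add: complex_is_Real_iff)

lemma slope_bounded:
  assumes K: "compact K" "K \<subseteq> - \<real>" and \<phi>: "continuous_on (- \<real>) \<phi>"
  shows "\<exists>B. \<forall>z\<in>K. norm (\<phi> z) \<le> B \<and> \<bar>pick_slope \<phi> z\<bar> \<le> B"
proof -
  have \<phi>K: "continuous_on K \<phi>" by (rule continuous_on_subset[OF \<phi> K(2)])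
  have "continuous_on K (\<lambda>z. norm (\<phi> z) + \<bar>pick_slope \<phi> z\<bar>)"
    unfolding pick_slope_def using K by (intro continuous_intros \<phi>K) (auto simp: complex_is_Real_iff)
  then have "bounded ((\<lambda>z. norm (\<phi> z) + \<bar>pick_slope \<phi> z\<bar>) ` K)"
    by (intro compact_imp_bounded compact_continuous_image K)
  then obtain B where B: "\<And>z. z \<in> K \<Longrightarrow> norm (norm (\<phi> z) + \<bar>pick_slope \<phi> z\<bar>) \<le> B" unfolding bounded_iff by auto
  have "norm (\<phi> z) \<le> B \<and> \<bar>pick_slope \<phi> z\<bar> \<le> B" if "z \<in> K" for z
    using B[OF that] norm_ge_zero[of "\<phi> z"] abs_ge_zero[of "pick_slope \<phi> z"] unfolding real_norm_def by linarith
  then show ?thesis by blast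
qed

lemma c_bounded:
  assumes K: "compact K" "K \<subseteq> - \<real>" and L: "compact L" "L \<subseteq> - \<real>"
  shows "\<exists>B. \<forall>z\<in>K. \<forall>w\<in>L. norm (c z w) \<le> B"
proof -
  obtain B1 where B1: "\<And>z. z \<in> K \<Longrightarrow> \<bar>pick_slope \<phi>1 z\<bar> \<le> B1" using slope_bounded[OF K A.cont] by blast
  obtain B2 where B2: "\<And>z. z \<in> L \<Longrightarrow> \<bar>pick_slope \<phi>2 z\<bar> \<le> B2" using slope_bounded[OF L B.cont] by blast
  have "norm (c z w) \<le> sqrt (\<bar>B1\<bar> * \<bar>B2\<bar>)" if zw: "z \<in> K" "w \<in> L" for z w
  proof (rule real_le_rsqrt)
    have zR: "z \<notin> \<real>" "w \<notin> \<real>" using K L zw by auto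
    have "(norm (c z w))\<^sup>2 \<le> pick_slope \<phi>1 z * pick_slope \<phi>2 w" by (rule c_bound[OF zR])
    also have "\<dots> \<le> \<bar>B1\<bar> * \<bar>B2\<bar>"
      using B1[OF zw(1)] B2[OF zw(2)] pick_functionD(3)[OF B.pick zR(2)] by (intro mult_mono) auto
    finally show "(norm (c z w))\<^sup>2 \<le> \<bar>B1\<bar> * \<bar>B2\<bar>" .
  qed
  then show ?thesis by blast
qed

lemma c_continuous: "continuous_on ((- \<real>) \<times> (- \<real>)) (\<lambda>p. c (fst p) (snd p))"
proof (rule holomorphic2_on_imp_continuous_on, rule separately_holomorphic_imp_holomorphic2_on)
  fix K L :: "complex set" assume "compact K" "compact L" "K \<subseteq> - \<real>" "L \<subseteq> - \<real>"
  then show "\<exists>B. \<forall>z\<in>K. \<forall>w\<in>L. norm (c (fst (z, w)) (snd (z, w))) \<le> B" using c_bounded by simp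
qed (use c_hol open_compl_Reals in auto)

lemma levy_R_holomorphic: "holomorphic2_on (levy_R \<phi>1 \<phi>2 c) ((- \<real>) \<times> (- \<real>))"
proof (rule separately_holomorphic_imp_holomorphic2_on)
  have inv: "(\<lambda>z. 1 / z) ` S \<subseteq> - \<real>" if "S \<subseteq> - \<real>" for S :: "complex set"
  proof (rule image_subsetI)
    fix z assume "z \<in> S"
    then have "Im z \<noteq> 0" using that by (auto simp: complex_is_Real_iff)
    then show "1 / z \<in> - \<real>" by (auto simp: complex_is_Real_iff Im_divide)
  qed
  have hinv: "(\<lambda>z. 1 / z) holomorphic_on - \<real>" by (intro holomorphic_intros) auto
  have invR: "1 / w \<notin> \<real>" if "w \<in> - \<real>" for w :: complex using inv[of "{w}"] that by auto
  have comp: "(\<lambda>z. f (1 / z)) holomorphic_on - \<real>" if "f holomorphic_on - \<real>" for f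
    using holomorphic_on_compose_gen[OF hinv that inv[OF order_refl]] by (simp add: o_def)
  show "(\<lambda>z. levy_R \<phi>1 \<phi>2 c (z, w)) holomorphic_on - \<real>" if "w \<in> - \<real>" for w
    unfolding levy_R_def fst_conv snd_conv
    by (intro holomorphic_on_add holomorphic_on_mult holomorphic_on_ident holomorphic_on_const comp A.hol
        comp[of "\<lambda>z. c z (1 / w)"] c_hol invR that)
  show "(\<lambda>w. levy_R \<phi>1 \<phi>2 c (z, w)) holomorphic_on - \<real>" if "z \<in> - \<real>" for z
    unfolding levy_R_def fst_conv snd_conv
    by (intro holomorphic_on_add holomorphic_on_mult holomorphic_on_ident holomorphic_on_const comp B.hol
        comp[of "\<lambda>w. c (1 / z) w"] c_hol invR that)
  fix K L :: "complex set" assume K: "compact K" and L: "compact L" and KR: "K \<subseteq> - \<real>" and LR: "L \<subseteq> - \<real>"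
  have ci: "compact ((\<lambda>z. 1 / z) ` S)" if "compact S" "S \<subseteq> - \<real>" for S :: "complex set"
    using that by (intro compact_continuous_image continuous_on_divide continuous_on_const continuous_on_id) auto
  obtain B1 where B1: "\<And>z. z \<in> (\<lambda>z. 1 / z) ` K \<Longrightarrow> norm (\<phi>1 z) \<le> B1"
    using slope_bounded[OF ci[OF K KR] inv[OF KR] A.cont] by blast
  obtain B2 where B2: "\<And>z. z \<in> (\<lambda>z. 1 / z) ` L \<Longrightarrow> norm (\<phi>2 z) \<le> B2"
    using slope_bounded[OF ci[OF L LR] inv[OF LR] B.cont] by blast
  obtain B3 where B3: "\<And>z w. z \<in> (\<lambda>z. 1 / z) ` K \<Longrightarrow> w \<in> (\<lambda>z. 1 / z) ` L \<Longrightarrow> norm (c z w) \<le> B3"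
    using c_bounded[OF ci[OF K KR] inv[OF KR] ci[OF L LR] inv[OF LR]] by blast
  obtain A1 where A1: "\<And>z. z \<in> K \<Longrightarrow> norm z \<le> A1" using compact_imp_bounded[OF K] unfolding bounded_iff by blast
  obtain A2 where A2: "\<And>z. z \<in> L \<Longrightarrow> norm z \<le> A2" using compact_imp_bounded[OF L] unfolding bounded_iff by blast
  have "norm (levy_R \<phi>1 \<phi>2 c (z, w)) \<le> \<bar>A1\<bar> * \<bar>B1\<bar> + \<bar>A2\<bar> * \<bar>B2\<bar> + B3" if zw: "z \<in> K" "w \<in> L" for z w
  proof -
    have "norm (z * \<phi>1 (1 / z)) \<le> \<bar>A1\<bar> * \<bar>B1\<bar>"
      unfolding norm_mult using A1[OF zw(1)] B1[of "1 / z"] zw by (intro mult_mono) fastforce+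
    moreover have "norm (w * \<phi>2 (1 / w)) \<le> \<bar>A2\<bar> * \<bar>B2\<bar>"
      unfolding norm_mult using A2[OF zw(2)] B2[of "1 / w"] zw by (intro mult_mono) fastforce+
    moreover have "norm (c (1 / z) (1 / w)) \<le> B3" using B3 zw by blast
    ultimately show ?thesis unfolding levy_R_def fst_conv snd_conv
      by (intro norm_triangle_le add_mono)
  qed
  then show "\<exists>B. \<forall>z\<in>K. \<forall>w\<in>L. norm (levy_R \<phi>1 \<phi>2 c (z, w)) \<le> B" by blast
qed (rule open_compl_Reals)+

text \<open>The Cauchy-Schwarz bound for c multiplied by t^2. By the arithmetic-geometric mean |t c|
  stays below 1 by at least the average of the two contraction factors, which keeps the denominator
  of G away from 0.\<close>

lemma tc_bound:
  assumes z: "z \<notin> \<real>" "w \<notin> \<real>" and e: "0 < A.e z" "0 < B.e w"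
  shows "(norm (of_real t * c z w))\<^sup>2 \<le> (1 - A.e z) * (1 - B.e w)"
    and "(A.e z + B.e w) / 2 \<le> norm (1 - of_real t * c z w)"
proof -
  have "(norm (of_real t * c z w))\<^sup>2 = t\<^sup>2 * (norm (c z w))\<^sup>2" using t by (simp add: norm_mult power_mult_distrib)
  also have "\<dots> \<le> t\<^sup>2 * (pick_slope \<phi>1 z * pick_slope \<phi>2 w)" by (intro mult_left_mono c_bound z) auto
  also have "\<dots> = (1 - A.e z) * (1 - B.e w)" by (simp add: pick_contraction_def power2_eq_square)
  finally show 1: "(norm (of_real t * c z w))\<^sup>2 \<le> (1 - A.e z) * (1 - B.e w)" .
  define a b where "a = 1 - A.e z" and "b = 1 - B.e w"
  have ab: "0 \<le> a" "0 \<le> b" using A.e_le_1[OF z(1)] B.e_le_1[OF z(2)] by (simp_all add: a_def b_def)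
  have "a * b \<le> ((a + b) / 2)\<^sup>2" using sum_squares_bound[of a b] by (simp add: power2_eq_square algebra_simps)
  with 1 have "(norm (of_real t * c z w))\<^sup>2 \<le> ((a + b) / 2)\<^sup>2" unfolding a_def b_def by linarith
  then have "norm (of_real t * c z w) \<le> (a + b) / 2" by (rule power2_le_imp_le) (use ab in simp)
  moreover have "1 - norm (of_real t * c z w) \<le> norm (1 - of_real t * c z w)"
    using norm_triangle_ineq2[of 1 "of_real t * c z w"] by simp
  ultimately show "(A.e z + B.e w) / 2 \<le> norm (1 - of_real t * c z w)" by (simp add: a_def b_def)
qed

lemma denominator_nonzero:
  assumes "z \<notin> \<real>" "w \<notin> \<real>" "0 < A.e z" "0 < B.e w"
  shows "1 - of_real t * c z w \<noteq> 0"
proof -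
  have "0 < norm (1 - of_real t * c z w)" by (rule less_le_trans[OF _ tc_bound(2)[OF assms]]) (use assms(3,4) in simp)
  then show ?thesis by simp
qed

abbreviation "G \<equiv> levy_cauchy \<phi>1 \<phi>2 c t"

lemma F_nonzero: "Z \<notin> \<real> \<Longrightarrow> A.F Z \<noteq> 0" "Z \<notin> \<real> \<Longrightarrow> B.F Z \<noteq> 0"
  using A.F_notin_Reals[of Z] B.F_notin_Reals[of Z] by auto

lemma F_den_nonzero: "Z \<notin> \<real> \<Longrightarrow> W \<notin> \<real> \<Longrightarrow> 1 - of_real t * c (A.F Z) (B.F W) \<noteq> 0"
  by (intro denominator_nonzero A.F_notin_Reals B.F_notin_Reals A.e_F_pos B.e_F_pos)

text \<open>With contraction factors a, b at the subordinated points, |Im Z| = a |Im z| and |Im W| =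
  b |Im w|, while the denominator has modulus at least (a + b)/2. As a, b \<le> 1, a + b dominates
  the product a b that appears on passing back to Z and W.\<close>

lemma G_bound:
  assumes Z: "Z \<notin> \<real>" "W \<notin> \<real>"
  shows "norm (G Z W) \<le> 2 / (\<bar>Im Z\<bar> * \<bar>Im W\<bar>)"
proof -
  define z w where "z = A.F Z" and "w = B.F W"
  define a b where "a = A.e z" and "b = B.e w"
  have R: "z \<notin> \<real>" "w \<notin> \<real>" and e: "0 < a" "0 < b"
    using A.F_notin_Reals B.F_notin_Reals A.e_F_pos B.e_F_pos Z by (simp_all add: z_def w_def a_def b_def)
  have ab1: "a \<le> 1" "b \<le> 1" using A.e_le_1[OF R(1)] B.e_le_1[OF R(2)] by (simp_all add: a_def b_def)
  have im: "\<bar>Im Z\<bar> = \<bar>Im z\<bar> * a" "\<bar>Im W\<bar> = \<bar>Im w\<bar> * b"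
    using A.Im_F[OF Z(1)] B.Im_F[OF Z(2)] e by (simp_all add: z_def w_def a_def b_def abs_mult)
  have pos: "0 < \<bar>Im z\<bar>" "0 < \<bar>Im w\<bar>" using R by (simp_all add: complex_is_Real_iff)
  have d: "(a + b) / 2 \<le> norm (1 - of_real t * c z w)" using tc_bound(2)[OF R] e by (simp add: a_def b_def)
  have "\<bar>Im z\<bar> * \<bar>Im w\<bar> * ((a + b) / 2) \<le> norm z * norm w * norm (1 - of_real t * c z w)"
    using d e abs_Im_le_cmod by (intro mult_mono) auto
  then have "1 / (norm z * norm w * norm (1 - of_real t * c z w)) \<le> 1 / (\<bar>Im z\<bar> * \<bar>Im w\<bar> * ((a + b) / 2))"
  proof (intro divide_left_mono mult_pos_pos)
    show "0 < norm (1 - of_real t * c z w)" by (rule less_le_trans[OF _ d]) (use e in simp)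
    show "0 < norm z" "0 < norm w" using R by auto
  qed (use pos e in auto)
  also have "\<dots> \<le> 2 / (\<bar>Im Z\<bar> * \<bar>Im W\<bar>)"
  proof -
    have "a * b \<le> a * 1" using ab1 e by (intro mult_left_mono) auto
    then have "a * b \<le> a + b" using e by linarith
    then have "1 / (a + b) \<le> 1 / (a * b)" using e by (intro divide_left_mono) auto
    then have "1 / (\<bar>Im z\<bar> * \<bar>Im w\<bar>) * (2 * (1 / (a + b))) \<le> 1 / (\<bar>Im z\<bar> * \<bar>Im w\<bar>) * (2 * (1 / (a * b)))"
      by (intro mult_left_mono) auto
    then show ?thesis unfolding im by (simp add: mult_ac)
  qed
  finally show ?thesis by (simp add: levy_cauchy_def z_def w_def norm_divide norm_mult)
qed

lemma G_holomorphic: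
  "W \<notin> \<real> \<Longrightarrow> (\<lambda>Z. G Z W) holomorphic_on - \<real>" "Z \<notin> \<real> \<Longrightarrow> (\<lambda>W. G Z W) holomorphic_on - \<real>"
proof -
  have im: "A.F ` (- \<real>) \<subseteq> - \<real>" "B.F ` (- \<real>) \<subseteq> - \<real>"
    using A.F_notin_Reals B.F_notin_Reals by blast+
  have 1: "(\<lambda>Z. c (A.F Z) (B.F W)) holomorphic_on - \<real>" if "W \<notin> \<real>" for W
    using holomorphic_on_compose_gen[OF A.F_holomorphic c_hol(1)[OF B.F_notin_Reals[OF that]] im(1)]
    unfolding o_def .
  have 2: "(\<lambda>W. c (A.F Z) (B.F W)) holomorphic_on - \<real>" if "Z \<notin> \<real>" for Z
    using holomorphic_on_compose_gen[OF B.F_holomorphic c_hol(2)[OF A.F_notin_Reals[OF that]] im(2)]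
    unfolding o_def .
  show "(\<lambda>Z. G Z W) holomorphic_on - \<real>" if "W \<notin> \<real>"
    unfolding levy_cauchy_def
    by (intro holomorphic_on_divide holomorphic_on_mult holomorphic_on_diff holomorphic_on_const 1 that A.F_holomorphic)
       (use F_nonzero F_den_nonzero that in simp)
  show "(\<lambda>W. G Z W) holomorphic_on - \<real>" if "Z \<notin> \<real>"
    unfolding levy_cauchy_def
    by (intro holomorphic_on_divide holomorphic_on_mult holomorphic_on_diff holomorphic_on_const 2 that B.F_holomorphic)
       (use F_nonzero F_den_nonzero that in simp)
qed

lemma G_continuous: "continuous_on ((- \<real>) \<times> (- \<real>)) (\<lambda>p. G (fst p) (snd p))"
proof -
  let ?S = "(- \<real>) \<times> (- \<real>) :: (complex \<times> complex) set"
  have 1: "continuous_on ?S (\<lambda>p. A.F (fst p))"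
    by (rule continuous_on_compose2[OF holomorphic_on_imp_continuous_on[OF A.F_holomorphic]])
       (auto intro!: continuous_intros)
  have 2: "continuous_on ?S (\<lambda>p. B.F (snd p))"
    by (rule continuous_on_compose2[OF holomorphic_on_imp_continuous_on[OF B.F_holomorphic]])
       (auto intro!: continuous_intros)
  have im: "(\<lambda>p. (A.F (fst p), B.F (snd p))) ` ?S \<subseteq> ?S"
    using A.F_notin_Reals B.F_notin_Reals by (simp add: image_subset_iff)
  from continuous_on_compose2[OF c_continuous continuous_on_Pair[OF 1 2] im]
  have 3: "continuous_on ?S (\<lambda>p. c (A.F (fst p)) (B.F (snd p)))" by simp
  have "A.F (fst p) * B.F (snd p) * (1 - of_real t * c (A.F (fst p)) (B.F (snd p))) \<noteq> 0" if "p \<in> ?S" for p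
  proof -
    have "fst p \<notin> \<real>" "snd p \<notin> \<real>" using that by auto
    then show ?thesis using F_nonzero F_den_nonzero by simp
  qed
  then show ?thesis unfolding levy_cauchy_def
    by (intro continuous_on_divide continuous_on_mult continuous_on_diff continuous_on_const 1 2 3) blast
qed

lemma G_cnj: "Z \<notin> \<real> \<Longrightarrow> W \<notin> \<real> \<Longrightarrow> G (cnj Z) (cnj W) = cnj (G Z W)"
  unfolding levy_cauchy_def by (simp add: A.F_cnj B.F_cnj c_cnj A.F_notin_Reals B.F_notin_Reals)

text \<open>The Gram inequality is scaled by t at the subordinated points; their positive
  contraction factors say precisely that t times each slope is below 1. Passing from z to cnj z
  leaves the slope unchanged and turns C into C'.\<close>

lemma G_positive:
  assumes Z: "0 < Im Z" "0 < Im W"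
  shows "0 \<le> Re (G (cnj Z) W - G Z W)"
proof -
  have R: "Z \<notin> \<real>" "W \<notin> \<real>" using Z by (auto simp: complex_is_Real_iff)
  define z w where "z = A.F Z" and "w = B.F W"
  have zR: "z \<notin> \<real>" "w \<notin> \<real>" "cnj z \<notin> \<real>" and e: "0 < A.e z" "0 < B.e w"
    using A.F_notin_Reals B.F_notin_Reals A.e_F_pos B.e_F_pos R cnj_notin_Reals by (simp_all add: z_def w_def)
  have ec: "A.e (cnj z) = A.e z"
    using pick_functionD(2)[OF A.pick zR(1)] by (simp add: pick_contraction_def pick_slope_def)
  have im: "0 < Im z" "0 < Im w"
    using A.Im_F[OF R(1)] B.Im_F[OF R(2)] e Z by (auto simp: z_def w_def zero_less_mult_iff)
  define C C' where "C = of_real t * c z w" and "C' = of_real t * c (cnj z) w"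
  define P Q where "P = t * pick_slope \<phi>1 z" and "Q = t * pick_slope \<phi>2 w"
  have eP: "A.e z = 1 - P" "B.e w = 1 - Q" by (simp_all add: P_def Q_def pick_contraction_def)
  have PQ: "0 \<le> P" "P < 1" "0 \<le> Q" "Q < 1" using A.e_le_1[OF zR(1)] B.e_le_1[OF zR(2)] e eP by auto
  have "(norm C)\<^sup>2 \<le> P * Q" "(norm C')\<^sup>2 \<le> P * Q"
    using tc_bound(1)[OF zR(1,2) e] tc_bound(1)[OF zR(3,2) e[folded ec]] e eP ec by (simp_all add: C_def C'_def)
  then have CQ: "Q = 0 \<Longrightarrow> C = 0 \<and> C' = 0" by simp
  have nz: "1 - C \<noteq> 0" "1 - C' \<noteq> 0"
    using denominator_nonzero[OF zR(1,2) e] denominator_nonzero[OF zR(3,2)] e ec by (simp_all add: C_def C'_def)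
  have "0 \<le> Re (1 / (cnj z * w * (1 - C')) - 1 / (z * w * (1 - C)))"
  proof (rule positivity_algebra[OF im nz PQ CQ])
    show "gram_ineq z w z w P Q C C' \<rho>" for \<rho>
      unfolding P_def Q_def C_def C'_def by (rule gram_ineq_scale[OF gram[OF zR(1,2)]])
  qed
  then show ?thesis
    unfolding levy_cauchy_def A.F_cnj[OF R(1)] z_def[symmetric] w_def[symmetric] C_def C'_def .
qed

text \<open>From y = Im F(\<i> y) times the factor, the factor is 1 / Re (F(\<i> y) / (\<i> y)), and
  F(\<i> y) / (\<i> y) tends to 1.\<close>

lemma F_contraction_axis:
  "((\<lambda>y. A.e (A.F (\<i> * of_real y))) \<longlongrightarrow> 1) at_top" "((\<lambda>y. B.e (B.F (\<i> * of_real y))) \<longlongrightarrow> 1) at_top"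
proof -
  have gen: "((\<lambda>y. pick_contraction \<phi> t (pick_inverse \<phi> t (\<i> * of_real y))) \<longlongrightarrow> 1) at_top" if "pick_flow \<phi> t" for \<phi>
  proof -
    interpret pick_flow \<phi> t by fact
    have "((\<lambda>y. 1 / Re (F (\<i> * of_real y) / (\<i> * of_real y))) \<longlongrightarrow> 1 / Re 1) at_top"
      by (intro tendsto_intros F_asymptotics) simp
    moreover have "\<forall>\<^sub>F y in at_top. 1 / Re (F (\<i> * of_real y) / (\<i> * of_real y)) = e (F (\<i> * of_real y))"
      using eventually_gt_at_top[of "0::real"]
    proof eventually_elim
      case (elim y)
      then have R: "\<i> * complex_of_real y \<notin> \<real>" by (simp add: complex_is_Real_iff)
      have "y = Im (F (\<i> * of_real y)) * e (F (\<i> * of_real y))" using Im_F[OF R] by simp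
      moreover have "Im (F (\<i> * of_real y)) \<noteq> 0" using F_notin_Reals[OF R] by (simp add: complex_is_Real_iff)
      moreover have "Re (F (\<i> * of_real y) / (\<i> * of_real y)) = Im (F (\<i> * of_real y)) / y"
        using elim by (simp add: Re_divide power2_eq_square)
      ultimately show ?case by (simp add: field_simps)
    qed
    ultimately show ?thesis using tendsto_cong by force
  qed
  show "((\<lambda>y. A.e (A.F (\<i> * of_real y))) \<longlongrightarrow> 1) at_top" by (rule gen) unfold_locales
  show "((\<lambda>y. B.e (B.F (\<i> * of_real y))) \<longlongrightarrow> 1) at_top" by (rule gen) unfold_locales
qed

text \<open>As W goes up the axis its contraction factor tends to 1, so by Cauchy-Schwarz t c tends
  to 0 and G splits asymptotically into 1/F(Z) times 1/W.\<close>

lemma G_marginal1: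
  assumes Z: "Z \<notin> \<real>"
  shows "((\<lambda>y. \<i> * of_real y * G Z (\<i> * of_real y)) \<longlongrightarrow> 1 / A.F Z) at_top"
proof -
  let ?W = "\<lambda>y. \<i> * complex_of_real y"
  have evR: "\<forall>\<^sub>F y in at_top. ?W y \<notin> \<real> \<and> y > 0"
    using eventually_gt_at_top[of "0::real"] by eventually_elim (simp add: complex_is_Real_iff)
  have "((\<lambda>y. of_real t * c (A.F Z) (B.F (?W y))) \<longlongrightarrow> 0) at_top"
  proof (rule Lim_null_comparison)
    show "\<forall>\<^sub>F y in at_top. norm (of_real t * c (A.F Z) (B.F (?W y))) \<le> sqrt ((1 - A.e (A.F Z)) * (1 - B.e (B.F (?W y))))"
      using evR
    proof eventually_elim
      case (elim y)
      then show ?case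
        by (intro real_le_rsqrt tc_bound(1) A.F_notin_Reals B.F_notin_Reals A.e_F_pos B.e_F_pos Z) auto
    qed
    have "((\<lambda>y. sqrt ((1 - A.e (A.F Z)) * (1 - B.e (B.F (?W y))))) \<longlongrightarrow> sqrt ((1 - A.e (A.F Z)) * (1 - 1))) at_top"
      by (intro tendsto_intros F_contraction_axis)
    then show "((\<lambda>y. sqrt ((1 - A.e (A.F Z)) * (1 - B.e (B.F (?W y))))) \<longlongrightarrow> 0) at_top" by simp
  qed
  then have "((\<lambda>y. 1 / (A.F Z * (B.F (?W y) / ?W y) * (1 - of_real t * c (A.F Z) (B.F (?W y))))) \<longlongrightarrow> 1 / (A.F Z * 1 * (1 - 0))) at_top"
    using F_nonzero(1)[OF Z] by (intro tendsto_intros B.F_asymptotics) auto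
  moreover have "\<forall>\<^sub>F y in at_top. 1 / (A.F Z * (B.F (?W y) / ?W y) * (1 - of_real t * c (A.F Z) (B.F (?W y)))) = ?W y * G Z (?W y)"
    using evR by eventually_elim (simp add: levy_cauchy_def)
  ultimately show ?thesis using tendsto_cong by force
qed

lemma G_marginal2:
  assumes W: "W \<notin> \<real>"
  shows "((\<lambda>y. \<i> * of_real y * G (\<i> * of_real y) W) \<longlongrightarrow> 1 / B.F W) at_top"
proof -
  let ?Z = "\<lambda>y. \<i> * complex_of_real y"
  have evR: "\<forall>\<^sub>F y in at_top. ?Z y \<notin> \<real> \<and> y > 0"
    using eventually_gt_at_top[of "0::real"] by eventually_elim (simp add: complex_is_Real_iff)
  have "((\<lambda>y. of_real t * c (A.F (?Z y)) (B.F W)) \<longlongrightarrow> 0) at_top"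
  proof (rule Lim_null_comparison)
    show "\<forall>\<^sub>F y in at_top. norm (of_real t * c (A.F (?Z y)) (B.F W)) \<le> sqrt ((1 - A.e (A.F (?Z y))) * (1 - B.e (B.F W)))"
      using evR
    proof eventually_elim
      case (elim y)
      then show ?case
        by (intro real_le_rsqrt tc_bound(1) A.F_notin_Reals B.F_notin_Reals A.e_F_pos B.e_F_pos W) auto
    qed
    have "((\<lambda>y. sqrt ((1 - A.e (A.F (?Z y))) * (1 - B.e (B.F W)))) \<longlongrightarrow> sqrt ((1 - 1) * (1 - B.e (B.F W)))) at_top"
      by (intro tendsto_intros F_contraction_axis)
    then show "((\<lambda>y. sqrt ((1 - A.e (A.F (?Z y))) * (1 - B.e (B.F W)))) \<longlongrightarrow> 0) at_top" by simp
  qed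
  then have "((\<lambda>y. 1 / ((A.F (?Z y) / ?Z y) * B.F W * (1 - of_real t * c (A.F (?Z y)) (B.F W)))) \<longlongrightarrow> 1 / (1 * B.F W * (1 - 0))) at_top"
    using F_nonzero(2)[OF W] by (intro tendsto_intros A.F_asymptotics) auto
  moreover have "\<forall>\<^sub>F y in at_top. 1 / ((A.F (?Z y) / ?Z y) * B.F W * (1 - of_real t * c (A.F (?Z y)) (B.F W))) = ?Z y * G (?Z y) W"
    using evR by eventually_elim (simp add: levy_cauchy_def)
  ultimately show ?thesis using tendsto_cong by force
qed

text \<open>For Z = \<i> y the weights cnj(Z) Z and Z Z are y^2 and -y^2, so each of the two terms
  contributes 1 in the limit.\<close>

lemma G_total_mass:
  "((\<lambda>y. y\<^sup>2 * Re (G (cnj (\<i> * of_real y)) (\<i> * of_real y) - G (\<i> * of_real y) (\<i> * of_real y))) \<longlongrightarrow> 2) at_top"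
proof -
  let ?Z = "\<lambda>y. \<i> * complex_of_real y"
  have evR: "\<forall>\<^sub>F y in at_top. ?Z y \<notin> \<real> \<and> y > 0"
    using eventually_gt_at_top[of "0::real"] by eventually_elim (simp add: complex_is_Real_iff)
  \<comment> \<open>f stands for F(\<i> y) or for its conjugate; the bound sees only the contraction
    factor, which is the same for both.\<close>
  have tc: "((\<lambda>y. of_real t * c (f y) (B.F (?Z y))) \<longlongrightarrow> 0) at_top"
    if f: "\<And>y. ?Z y \<notin> \<real> \<Longrightarrow> f y \<notin> \<real> \<and> A.e (f y) = A.e (A.F (?Z y))" for f
  proof (rule Lim_null_comparison)
    show "\<forall>\<^sub>F y in at_top. norm (of_real t * c (f y) (B.F (?Z y))) \<le> sqrt ((1 - A.e (A.F (?Z y))) * (1 - B.e (B.F (?Z y))))"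
      using evR
    proof eventually_elim
      case (elim y)
      then have R: "?Z y \<notin> \<real>" by blast
      have "(norm (of_real t * c (f y) (B.F (?Z y))))\<^sup>2 \<le> (1 - A.e (f y)) * (1 - B.e (B.F (?Z y)))"
        using f[OF R] A.e_F_pos[OF R] by (intro tc_bound(1) B.F_notin_Reals B.e_F_pos R) auto
      then show ?case using f[OF R] by (intro real_le_rsqrt) simp
    qed
    have "((\<lambda>y. sqrt ((1 - A.e (A.F (?Z y))) * (1 - B.e (B.F (?Z y))))) \<longlongrightarrow> sqrt ((1 - 1) * (1 - 1))) at_top"
      by (intro tendsto_intros F_contraction_axis)
    then show "((\<lambda>y. sqrt ((1 - A.e (A.F (?Z y))) * (1 - B.e (B.F (?Z y))))) \<longlongrightarrow> 0) at_top" by simp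
  qed
  have tc1: "((\<lambda>y. of_real t * c (A.F (?Z y)) (B.F (?Z y))) \<longlongrightarrow> 0) at_top"
    by (rule tc) (simp add: A.F_notin_Reals)
  have tc2: "((\<lambda>y. of_real t * c (cnj (A.F (?Z y))) (B.F (?Z y))) \<longlongrightarrow> 0) at_top"
  proof (rule tc)
    fix y assume R: "?Z y \<notin> \<real>"
    show "cnj (A.F (?Z y)) \<notin> \<real> \<and> A.e (cnj (A.F (?Z y))) = A.e (A.F (?Z y))"
      using cnj_notin_Reals[OF A.F_notin_Reals[OF R]] pick_functionD(2)[OF A.pick A.F_notin_Reals[OF R]]
      by (simp add: pick_contraction_def pick_slope_def)
  qed
  have l1: "((\<lambda>y. 1 / ((A.F (?Z y) / ?Z y) * (B.F (?Z y) / ?Z y) * (1 - of_real t * c (A.F (?Z y)) (B.F (?Z y))))) \<longlongrightarrow> 1 / (1 * 1 * (1 - 0))) at_top"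
    by (intro tendsto_intros A.F_asymptotics B.F_asymptotics tc1) auto
  have l2: "((\<lambda>y. 1 / (cnj (A.F (?Z y) / ?Z y) * (B.F (?Z y) / ?Z y) * (1 - of_real t * c (cnj (A.F (?Z y))) (B.F (?Z y))))) \<longlongrightarrow> 1 / (cnj 1 * 1 * (1 - 0))) at_top"
    by (intro tendsto_intros A.F_asymptotics B.F_asymptotics tc2) auto
  have "((\<lambda>y. Re (1 / (cnj (A.F (?Z y) / ?Z y) * (B.F (?Z y) / ?Z y) * (1 - of_real t * c (cnj (A.F (?Z y))) (B.F (?Z y))))
      + 1 / ((A.F (?Z y) / ?Z y) * (B.F (?Z y) / ?Z y) * (1 - of_real t * c (A.F (?Z y)) (B.F (?Z y))))))
      \<longlongrightarrow> Re (1 / (cnj 1 * 1 * (1 - 0)) + 1 / (1 * 1 * (1 - 0)))) at_top"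
    by (intro tendsto_Re tendsto_add l1 l2)
  moreover have "\<forall>\<^sub>F y in at_top. Re (1 / (cnj (A.F (?Z y) / ?Z y) * (B.F (?Z y) / ?Z y) * (1 - of_real t * c (cnj (A.F (?Z y))) (B.F (?Z y))))
      + 1 / ((A.F (?Z y) / ?Z y) * (B.F (?Z y) / ?Z y) * (1 - of_real t * c (A.F (?Z y)) (B.F (?Z y)))))
      = y\<^sup>2 * Re (G (cnj (?Z y)) (?Z y) - G (?Z y) (?Z y))"
    using evR
  proof eventually_elim
    case (elim y)
    define f g a b where "f = A.F (?Z y)" and "g = B.F (?Z y)"
      and "a = 1 - of_real t * c (cnj f) g" and "b = 1 - of_real t * c f g"
    have G: "G (?Z y) (?Z y) = 1 / (f * g * b)" "G (cnj (?Z y)) (?Z y) = 1 / (cnj f * g * a)"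
      using elim A.F_cnj[of "?Z y"] by (simp_all add: levy_cauchy_def f_def g_def a_def b_def)
    have "1 / (cnj (f / ?Z y) * (g / ?Z y) * a) + 1 / ((f / ?Z y) * (g / ?Z y) * b)
       = of_real (y\<^sup>2) * (1 / (cnj f * g * a) - 1 / (f * g * b))"
      using elim by (simp add: field_simps power2_eq_square)
    then show ?case unfolding f_def[symmetric] g_def[symmetric] a_def[symmetric] b_def[symmetric] G
      by (simp only: Re_complex_of_real Im_complex_of_real times_complex.sel mult_zero_left diff_zero)
  qed
  ultimately show ?thesis using tendsto_cong by force
qed

end

section \<open>The Poisson formula in a half-plane\<close>

text \<open>Without the usual factor 1/\<pi>, so the total integral is \<pi>. In this form it is -Im
  (1/(Z - x)).\<close>

definition poisson_kernel :: "complex \<Rightarrow> real \<Rightarrow> real" where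
  "poisson_kernel Z x = Im Z / (norm (Z - of_real x))\<^sup>2"

lemma poisson_kernel_nonneg: "0 < Im Z \<Longrightarrow> 0 \<le> poisson_kernel Z x"
  by (simp add: poisson_kernel_def)

lemma upper_minus_real_nonzero: "0 < Im Z \<Longrightarrow> Z - complex_of_real x \<noteq> 0"
  by (auto simp: complex_eq_iff)

lemma continuous_poisson_kernel: "0 < Im Z \<Longrightarrow> continuous_on S (poisson_kernel Z)"
  unfolding poisson_kernel_def[abs_def]
  by (intro continuous_intros) (use upper_minus_real_nonzero in auto)

lemma poisson_kernel_measurable [measurable]: "poisson_kernel Z \<in> borel_measurable borel"
  unfolding poisson_kernel_def[abs_def] by measurable

lemma poisson_kernel_integral:
  assumes Z: "0 < Im Z"
  shows "integrable lborel (poisson_kernel Z)" "(\<integral>x. poisson_kernel Z x \<partial>lborel) = pi"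
proof -
  define a y where "a = Re Z" and "y = Im Z"
  have y: "y > 0" using Z by (simp add: y_def)
  let ?F = "\<lambda>x. arctan ((x - a) / y)"
  have k: "poisson_kernel Z x = y / ((x - a)\<^sup>2 + y\<^sup>2)" for x
    unfolding poisson_kernel_def cmod_power2 by (simp add: a_def y_def power2_commute)
  have D: "(?F has_real_derivative poisson_kernel Z x) (at x)" for x
  proof -
    have "(?F has_real_derivative inverse (1 + ((x - a) / y)\<^sup>2) * (1 / y)) (at x)"
      using y by (auto intro!: derivative_eq_intros)
    moreover have "inverse (1 + ((x - a) / y)\<^sup>2) * (1 / y) = poisson_kernel Z x"
    proof -
      have "1 + ((x - a) / y)\<^sup>2 = ((x - a)\<^sup>2 + y\<^sup>2) / y\<^sup>2" using y by (simp add: field_simps)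
      then show ?thesis unfolding k using y by (simp add: power2_eq_square)
    qed
    ultimately show ?thesis by simp
  qed
  have lt: "(-\<infinity>::ereal) < \<infinity>" by simp
  have c: "isCont (poisson_kernel Z) x" for x
    using continuous_poisson_kernel[OF Z, of UNIV] by (simp add: continuous_on_eq_continuous_at)
  have A: "((?F \<circ> real_of_ereal) \<longlongrightarrow> - (pi/2)) (at_right (-\<infinity>))"
  proof -
    have "filterlim (\<lambda>x. (x - a) / y) at_bot at_bot" using y by real_asymp
    then have "(?F \<longlongrightarrow> - (pi/2)) at_bot" using tendsto_arctan_at_bot filterlim_compose by blast
    then show ?thesis by (simp only: ereal_tendsto_simps)
  qed
  have B: "((?F \<circ> real_of_ereal) \<longlongrightarrow> pi/2) (at_left \<infinity>)"
  proof -
    have "filterlim (\<lambda>x. (x - a) / y) at_top at_top" using y by real_asymp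
    then have "(?F \<longlongrightarrow> pi/2) at_top" using tendsto_arctan_at_top filterlim_compose by blast
    then show ?thesis by (simp only: ereal_tendsto_simps)
  qed
  have nn: "AE x in lborel. -\<infinity> < ereal x \<longrightarrow> ereal x < \<infinity> \<longrightarrow> 0 \<le> poisson_kernel Z x"
    using poisson_kernel_nonneg[OF Z] by simp
  note I = interval_integral_FTC_nonneg[OF lt D c nn A B]
  have e: "einterval (-\<infinity>) \<infinity> = UNIV" by (auto simp: einterval_def)
  show "integrable lborel (poisson_kernel Z)"
    using I(1) by (simp add: set_integrable_def e)
  show "(\<integral>x. poisson_kernel Z x \<partial>lborel) = pi"
    using I(2) by (simp add: interval_lebesgue_integral_def set_lebesgue_integral_def e)
qed

text \<open>A primitive Q exists on the convex half-plane. Its difference between T and -T is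
  estimated through the point \<i> T: along both segments |q| is O(1/T^2) and their length is
  O(T).\<close>

lemma integral_quadratic_decay_zero:
  fixes q :: "complex \<Rightarrow> complex"
  assumes \<delta>: "\<delta> > 0" and q: "q holomorphic_on {z. - \<delta> < Im z}"
    and decay: "\<And>z. - \<delta> < Im z \<Longrightarrow> r \<le> norm z \<Longrightarrow> norm (q z) \<le> C / (norm z)\<^sup>2"
    and int: "integrable lborel (\<lambda>x. q (of_real x))"
  shows "(\<integral>x. q (of_real x) \<partial>lborel) = 0"
proof -
  let ?S = "{z. - \<delta> < Im z}"
  have S: "open ?S" "convex ?S" using open_halfspace_Im_gt convex_halfspace_Im_gt by auto
  obtain Q where Q: "\<And>z. z \<in> ?S \<Longrightarrow> (Q has_field_derivative q z) (at z within ?S)"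
    using holomorphic_convex_primitive'[OF S(2,1) q] by metis
  have QD: "(Q has_field_derivative q z) (at z)" if "z \<in> ?S" for z
    using Q[OF that] at_within_open[OF that S(1)] by simp
  have FTC: "(\<integral>x. indicator {- real n .. real n} x *\<^sub>R q (of_real x) \<partial>lborel) = Q (of_real (real n)) - Q (of_real (- real n))" for n
  proof -
    have "((\<lambda>x. Q (complex_of_real x)) has_vector_derivative q (of_real x)) (at x within {- real n..real n})" for x
    proof -
      have "((\<lambda>x. Q (complex_of_real x)) has_vector_derivative (of_real 1 * q (of_real x))) (at x within {- real n..real n})"
        using has_vector_derivative_real_field[OF QD] \<delta> has_vector_derivative_at_within by fastforce
      then show ?thesis by simp
    qed
    moreover have "continuous_on {- real n..real n} (\<lambda>x. q (of_real x))"
      by (intro continuous_on_compose2[OF holomorphic_on_imp_continuous_on[OF q]] continuous_intros) (use \<delta> in auto)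
    ultimately show ?thesis by (intro integral_FTC_Icc) auto
  qed
  have lim1: "(\<lambda>n. \<integral>x. indicator {- real n .. real n} x *\<^sub>R q (of_real x) \<partial>lborel) \<longlonglongrightarrow> (\<integral>x. q (of_real x) \<partial>lborel)"
  proof (rule integral_dominated_convergence[where w="\<lambda>x. norm (q (of_real x))"])
    show "(\<lambda>x. q (complex_of_real x)) \<in> borel_measurable lborel" using int by (rule borel_measurable_integrable)
    then show "(\<lambda>x. indicator {- real n .. real n} x *\<^sub>R q (of_real x)) \<in> borel_measurable lborel" for n by measurable
    show "integrable lborel (\<lambda>x. norm (q (of_real x)))" using int by (rule integrable_norm)
    show "AE x in lborel. (\<lambda>n. indicator {- real n .. real n} x *\<^sub>R q (of_real x)) \<longlonglongrightarrow> q (of_real x)"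
    proof (rule AE_I2)
      fix x :: real
      obtain N :: nat where N: "\<bar>x\<bar> \<le> real N" using real_arch_simple by blast
      have "\<forall>\<^sub>F n in sequentially. indicator {- real n .. real n} x *\<^sub>R q (of_real x) = q (of_real x)"
        using eventually_ge_at_top[of N] by eventually_elim (use N in \<open>auto simp: indicator_def\<close>)
      then show "(\<lambda>n. indicator {- real n .. real n} x *\<^sub>R q (of_real x)) \<longlonglongrightarrow> q (of_real x)"
        by (rule tendsto_eventually)
    qed
    show "AE x in lborel. norm (indicator {- real n .. real n} x *\<^sub>R q (of_real x)) \<le> norm (q (of_real x))" for n
      by (simp add: indicator_def)
  qed
  have lim2: "(\<lambda>n. Q (of_real (real n)) - Q (of_real (- real n))) \<longlonglongrightarrow> 0"
  proof (rule Lim_null_comparison)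
    have C: "norm (Q (of_real \<tau>) - Q (\<i> * of_real T)) \<le> 4 * \<bar>C\<bar> / T\<^sup>2 * (2 * T)"
      if T: "T > 0" "T \<ge> 2 * r" "\<tau> = T \<or> \<tau> = - T" for T \<tau>
    proof -
      let ?L = "closed_segment (complex_of_real \<tau>) (\<i> * of_real T)"
      have pt: "Im z \<ge> 0 \<and> norm z \<ge> T / 2" if "z \<in> ?L" for z
      proof -
        obtain u where u: "0 \<le> u" "u \<le> 1" "z = (1 - u) *\<^sub>R complex_of_real \<tau> + u *\<^sub>R (\<i> * of_real T)"
          using \<open>z \<in> ?L\<close> unfolding closed_segment_def by blast
        have im: "Im z = u * T" and re: "\<bar>Re z\<bar> = (1 - u) * T" using u T by (auto simp: abs_mult)
        \<comment> \<open>The segments are sides of the square where |Re z| + |Im z| = T, so |z|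
          \<ge> T/2 on them.\<close>
        have "T = \<bar>Re z\<bar> + \<bar>Im z\<bar>" unfolding re im using u T by (simp add: abs_mult algebra_simps)
        then have "T \<le> 2 * norm z" using abs_Re_le_cmod[of z] abs_Im_le_cmod[of z] by simp
        then show ?thesis using im u T by simp
      qed
      have "norm (Q (of_real \<tau>) - Q (\<i> * of_real T)) \<le> 4 * \<bar>C\<bar> / T\<^sup>2 * norm (complex_of_real \<tau> - \<i> * of_real T)"
      proof (rule field_differentiable_bound[of ?L])
        show "(Q has_field_derivative q z) (at z within ?L)" if "z \<in> ?L" for z
          by (rule has_field_derivative_at_within[OF QD]) (use pt[OF that] \<delta> in auto)
        show "norm (q z) \<le> 4 * \<bar>C\<bar> / T\<^sup>2" if "z \<in> ?L" for z
        proof -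
          have n: "norm z \<ge> T / 2" "Im z \<ge> 0" using pt[OF that] by auto
          have "norm (q z) \<le> C / (norm z)\<^sup>2" using n \<delta> T by (intro decay) auto
          also have "\<dots> \<le> \<bar>C\<bar> / (norm z)\<^sup>2" by (intro divide_right_mono) auto
          also have "\<dots> \<le> \<bar>C\<bar> / (T / 2)\<^sup>2" using n T by (intro divide_left_mono power_mono mult_pos_pos) (auto intro!: zero_less_power)
          finally show ?thesis by (simp add: power_divide mult.commute)
        qed
      qed (auto simp: convex_closed_segment)
      also have "\<dots> \<le> 4 * \<bar>C\<bar> / T\<^sup>2 * (2 * T)"
      proof (intro mult_left_mono)
        have "norm (complex_of_real \<tau> - \<i> * of_real T) \<le> \<bar>\<tau>\<bar> + \<bar>T\<bar>"
          by (rule order_trans[OF norm_triangle_ineq4]) (simp add: norm_mult)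
        then show "norm (complex_of_real \<tau> - \<i> * of_real T) \<le> 2 * T" using T by auto
      qed auto
      finally show ?thesis .
    qed
    have "\<forall>\<^sub>F n in sequentially. real n > max 0 (2 * r)" by real_asymp
    then show "\<forall>\<^sub>F n in sequentially. norm (Q (of_real (real n)) - Q (of_real (- real n))) \<le> 16 * \<bar>C\<bar> / real n"
    proof eventually_elim
      case (elim n)
      then have n: "real n > 0" "real n \<ge> 2 * r" by auto
      have "norm (Q (of_real (real n)) - Q (of_real (- real n))) \<le>
          norm (Q (of_real (real n)) - Q (\<i> * of_real (real n))) + norm (Q (of_real (- real n)) - Q (\<i> * of_real (real n)))"
        using norm_triangle_ineq4[of "Q (of_real (real n)) - Q (\<i> * of_real (real n))" "Q (of_real (- real n)) - Q (\<i> * of_real (real n))"] by simp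
      also have "\<dots> \<le> 4 * \<bar>C\<bar> / (real n)\<^sup>2 * (2 * real n) + 4 * \<bar>C\<bar> / (real n)\<^sup>2 * (2 * real n)"
        by (intro add_mono C n) auto
      also have "\<dots> = 16 * \<bar>C\<bar> / real n" using n by (simp add: field_simps power2_eq_square)
      finally show ?case .
    qed
    show "(\<lambda>n. 16 * \<bar>C\<bar> / real n) \<longlonglongrightarrow> 0" by real_asymp
  qed
  show ?thesis using LIMSEQ_unique[OF lim1] lim2 unfolding FTC by blast
qed

text \<open>The quotient (g(w) - g(Z)) / ((w - Z)(w - cnj Z)) has a removable singularity at Z and
  decays quadratically, so its integral over the real line is 0. On that line it equals the Poisson
  kernel times g(x) - g(Z), divided by Im Z.\<close>

lemma poisson_formula:
  fixes g :: "complex \<Rightarrow> complex"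
  assumes \<delta>: "\<delta> > 0" and g: "g holomorphic_on {z. - \<delta> < Im z}"
    and M: "\<And>z. - \<delta> < Im z \<Longrightarrow> norm (g z) \<le> M" and Z: "0 < Im Z"
  shows "integrable lborel (\<lambda>x. poisson_kernel Z x *\<^sub>R g (of_real x))"
    and "(\<integral>x. poisson_kernel Z x *\<^sub>R g (of_real x) \<partial>lborel) = pi *\<^sub>R g Z"
proof -
  \<comment> \<open>Staying above -Im Z/2 keeps the pole at cnj Z out of the domain.\<close>
  define d where "d = min \<delta> (Im Z / 2)"
  have d: "d > 0" "d \<le> \<delta>" "d < Im Z" using \<delta> Z by (auto simp: d_def)
  let ?S = "{z. - d < Im z}"
  have S: "open ?S" using open_halfspace_Im_gt by auto
  have gS: "g holomorphic_on ?S" by (rule holomorphic_on_subset[OF g]) (use d in auto)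
  have M0: "0 \<le> M" using M[of 0] \<delta> norm_ge_zero[of "g 0"] by (simp del: norm_ge_zero)
  have gc: "(\<lambda>x. g (complex_of_real x)) \<in> borel_measurable lborel"
  proof -
    have "(\<lambda>x. g (complex_of_real x)) \<in> borel_measurable borel"
      using \<delta> by (intro borel_measurable_continuous_onI
        continuous_on_compose2[OF holomorphic_on_imp_continuous_on[OF g]] continuous_intros) auto
    then show ?thesis by simp
  qed
  show int: "integrable lborel (\<lambda>x. poisson_kernel Z x *\<^sub>R g (of_real x))"
  proof (rule Bochner_Integration.integrable_bound)
    show "integrable lborel (\<lambda>x. poisson_kernel Z x * M)" using poisson_kernel_integral(1)[OF Z] by simp
    show "(\<lambda>x. poisson_kernel Z x *\<^sub>R g (of_real x)) \<in> borel_measurable lborel" using gc by measurable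
    show "AE x in lborel. norm (poisson_kernel Z x *\<^sub>R g (of_real x)) \<le> norm (poisson_kernel Z x * M)"
      using M \<delta> M0 by (auto simp: abs_mult intro!: mult_left_mono)
  qed
  define q where "q w = (if w = Z then deriv g Z else (g w - g Z) / (w - Z)) / (w - cnj Z)" for w
  have hq: "q holomorphic_on ?S"
    unfolding q_def by (intro holomorphic_intros pole_lemma_open[OF gS S]) (use d in auto)
  have decay: "norm (q w) \<le> 8 * M / (norm w)\<^sup>2" if w: "- d < Im w" "2 * norm Z + 1 \<le> norm w" for w
  proof -
    have n: "norm w / 2 \<le> norm (w - Z)" "norm w / 2 \<le> norm (w - cnj Z)"
      using norm_triangle_ineq2[of w Z] norm_triangle_ineq2[of w "cnj Z"] w norm_ge_zero[of Z] by auto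
    have wp: "norm w > 0" using w norm_ge_zero[of Z] by linarith
    have wZ: "w \<noteq> Z" using w(2) norm_ge_zero[of Z] by (auto simp del: norm_ge_zero)
    then have "norm (q w) = norm (g w - g Z) / (norm (w - Z) * norm (w - cnj Z))" by (simp add: q_def norm_divide norm_mult)
    also have "\<dots> \<le> (2 * M) / ((norm w / 2) * (norm w / 2))"
    proof (intro frac_le mult_mono n)
      have "norm (g w) \<le> M" "norm (g Z) \<le> M" using M w d Z by auto
      then show "norm (g w - g Z) \<le> 2 * M" using norm_triangle_ineq4[of "g w" "g Z"] by simp
    qed (use M0 wp in auto)
    also have "\<dots> = 8 * M / (norm w)\<^sup>2" by (simp add: power2_eq_square)
    finally show ?thesis .
  qed
  have qx: "q (of_real x) = (poisson_kernel Z x *\<^sub>R g (of_real x) - poisson_kernel Z x *\<^sub>R g Z) /\<^sub>R Im Z" for x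
  proof -
    have ne: "complex_of_real x \<noteq> Z" using Z by auto
    have "(of_real x - Z) * (of_real x - cnj Z) = complex_of_real ((norm (Z - of_real x))\<^sup>2)"
      unfolding complex_norm_square by (simp add: algebra_simps)
    then have "q (of_real x) = (g (of_real x) - g Z) / complex_of_real ((norm (Z - of_real x))\<^sup>2)"
      using ne by (simp add: q_def)
    also have "\<dots> = (1 / (norm (Z - of_real x))\<^sup>2) *\<^sub>R (g (of_real x) - g Z)"
      by (simp add: scaleR_conv_of_real)
    also have "1 / (norm (Z - of_real x))\<^sup>2 = poisson_kernel Z x / Im Z" using Z by (simp add: poisson_kernel_def)
    finally show ?thesis by (simp add: scaleR_diff_right divide_inverse_commute algebra_simps)
  qed
  note hb = has_bochner_integral_integrable[OF int]
  have hc: "has_bochner_integral lborel (\<lambda>x. poisson_kernel Z x *\<^sub>R g Z) (pi *\<^sub>R g Z)"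
    using has_bochner_integral_scaleR_left[of "g Z" lborel "poisson_kernel Z" pi] poisson_kernel_integral[OF Z]
    by (simp add: has_bochner_integral_iff)
  have hqq: "has_bochner_integral lborel (\<lambda>x. q (of_real x))
      (((\<integral>x. poisson_kernel Z x *\<^sub>R g (of_real x) \<partial>lborel) - pi *\<^sub>R g Z) /\<^sub>R Im Z)"
    unfolding qx by (intro has_bochner_integral_scaleR_right has_bochner_integral_diff hb hc)
  have "(\<integral>x. q (of_real x) \<partial>lborel) = 0"
    by (rule integral_quadratic_decay_zero[OF d(1) hq decay]) (use hqq in \<open>auto simp: has_bochner_integral_iff\<close>)
  then have "((\<integral>x. poisson_kernel Z x *\<^sub>R g (of_real x) \<partial>lborel) - pi *\<^sub>R g Z) /\<^sub>R Im Z = 0"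
    using hqq by (simp add: has_bochner_integral_iff)
  then show "(\<integral>x. poisson_kernel Z x *\<^sub>R g (of_real x) \<partial>lborel) = pi *\<^sub>R g Z"
    using Z by simp
qed

text \<open>The bound M / Im z blows up at the real axis, so g is shifted upwards by \<epsilon>; it
  is then bounded by 2 M / \<epsilon> on Im z > -\<epsilon>/2. The nonnegative extended form is what
  Tonelli's theorem in two variables takes.\<close>

lemma poisson_formula_Re:
  fixes g :: "complex \<Rightarrow> complex"
  assumes g: "g holomorphic_on {z. 0 < Im z}" and M: "\<And>z. 0 < Im z \<Longrightarrow> norm (g z) \<le> M / Im z"
    and \<epsilon>: "\<epsilon> > 0" and Z: "0 < Im Z" and pos: "\<And>z. 0 < Im z \<Longrightarrow> 0 \<le> Re (g z)"
  shows "(\<integral>\<^sup>+x. ennreal (poisson_kernel Z x * Re (g (of_real x + \<i> * of_real \<epsilon>))) \<partial>lborel) = ennreal (pi * Re (g (Z + \<i> * of_real \<epsilon>)))"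
proof -
  define h where "h z = g (z + \<i> * of_real \<epsilon>)" for z
  have M0: "0 \<le> M"
  proof -
    have "norm (g \<i>) \<le> M" using M[of \<i>] by simp
    then show ?thesis by (rule order_trans[OF norm_ge_zero])
  qed
  have hol: "h holomorphic_on {z. - (\<epsilon>/2) < Im z}"
  proof -
    have "(g \<circ> (\<lambda>z. z + \<i> * of_real \<epsilon>)) holomorphic_on {z. - (\<epsilon>/2) < Im z}"
      by (rule holomorphic_on_compose_gen[OF _ g]) (use \<epsilon> in \<open>auto intro!: holomorphic_intros\<close>)
    then show ?thesis by (simp add: o_def h_def[abs_def])
  qed
  have bd: "norm (h z) \<le> M / (\<epsilon>/2)" if "- (\<epsilon>/2) < Im z" for z
  proof -
    have "norm (h z) \<le> M / Im (z + \<i> * of_real \<epsilon>)" unfolding h_def using that \<epsilon> by (intro M) simp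
    also have "\<dots> \<le> M / (\<epsilon>/2)" using that \<epsilon> M0 by (intro divide_left_mono mult_pos_pos) auto
    finally show ?thesis .
  qed
  have e2: "\<epsilon>/2 > 0" using \<epsilon> by simp
  note P = poisson_formula[OF e2 hol bd Z]
  have I: "integrable lborel (\<lambda>x. poisson_kernel Z x * Re (h (of_real x)))"
    using integrable_Re[OF P(1)] by simp
  have "(\<integral>x. poisson_kernel Z x * Re (h (of_real x)) \<partial>lborel) = pi * Re (h Z)"
    using integral_Re[OF P(1)] P(2) by simp
  moreover have "(\<integral>\<^sup>+x. ennreal (poisson_kernel Z x * Re (h (of_real x))) \<partial>lborel) = ennreal (\<integral>x. poisson_kernel Z x * Re (h (of_real x)) \<partial>lborel)"
    using I pos \<epsilon> poisson_kernel_nonneg[OF Z] by (intro nn_integral_eq_integral) (auto simp: h_def intro!: AE_I2 mult_nonneg_nonneg)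
  ultimately show ?thesis by (simp add: h_def)
qed

section \<open>Weak limits of measures on the plane\<close>

text \<open>An even continuous function of period 2 that is 0 on [0, 1/3] and 1 on [2/3, 1]: it
  reads the leading ternary digit, 0 or 2, as a bit.\<close>

definition schoenberg_step :: "real \<Rightarrow> real" where
  "schoenberg_step x = min 1 (max 0 (1/2 - cos (pi * x)))"

lemma schoenberg_step_bounds: "0 \<le> schoenberg_step x" "schoenberg_step x \<le> 1"
  by (simp_all add: schoenberg_step_def)

lemma schoenberg_step_continuous: "continuous_on S schoenberg_step"
  unfolding schoenberg_step_def[abs_def] by (intro continuous_intros)

lemma schoenberg_step_value:
  assumes a: "a = 0 \<or> a = (1::real)" and r: "0 \<le> r" "r \<le> 1/3"
  shows "schoenberg_step (2 * of_int m + 2 * a / 3 + r) = a"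
proof -
  let ?y = "2 * a / 3 + r"
  have "cos (pi * (2 * of_int m + 2 * a / 3 + r)) = cos (pi * ?y + of_int m * (2 * pi))"
    by (simp add: algebra_simps)
  also have "\<dots> = cos (pi * ?y)" using cos.plus_of_int[of "pi * ?y" m] by (simp add: mult_ac)
  finally have c: "cos (pi * (2 * of_int m + 2 * a / 3 + r)) = cos (pi * ?y)" .
  show ?thesis
  proof (cases "a = 0")
    case True
    have "pi * r \<le> pi / 3" using r by (simp add: field_simps)
    then have "cos (pi / 3) \<le> cos (pi * r)" using r by (intro cos_monotone_0_pi_le) auto
    then show ?thesis using True c by (simp add: schoenberg_step_def cos_60)
  next
    case False
    then have a1: "a = 1" using a by simp
    have l: "2 / 3 \<le> ?y" "?y \<le> 1" using a1 r by auto
    have "pi * (2/3) \<le> pi * ?y" using l by (intro mult_left_mono) auto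
    moreover have "pi * ?y \<le> pi * 1" using l by (intro mult_left_mono) auto
    ultimately have "cos (pi * ?y) \<le> cos (pi * (2 / 3))"
      by (intro cos_monotone_0_pi_le) auto
    also have "cos (pi * (2 / 3)) = - cos (pi / 3)" using cos_minus_pi[of "pi/3"] cos_periodic_pi2[of "- (pi/3)"] by (simp add: algebra_simps)
    finally show ?thesis using a1 c by (simp add: schoenberg_step_def cos_60)
  qed
qed

text \<open>Schoenberg's space-filling curve. Ternary digits in even positions of the parameter give
  the binary digits of the first coordinate, those in odd positions the second.\<close>

definition schoenberg_curve :: "real \<Rightarrow> real \<times> real" where
  "schoenberg_curve x = (\<Sum>k. schoenberg_step (3 ^ (2 * k) * x) / 2 ^ Suc k, \<Sum>k. schoenberg_step (3 ^ (2 * k + 1) * x) / 2 ^ Suc k)"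

lemma half_powers_sums: "(\<lambda>k. 1 / 2 ^ Suc k :: real) sums 1"
  using power_half_series by (simp add: power_divide)

lemma schoenberg_component_continuous: "continuous_on UNIV (\<lambda>x. \<Sum>k. schoenberg_step (3 ^ g k * x) / 2 ^ Suc k)"
proof (rule uniform_limit_theorem)
  show "uniform_limit UNIV (\<lambda>n x. \<Sum>k<n. schoenberg_step (3 ^ g k * x) / 2 ^ Suc k)
      (\<lambda>x. \<Sum>k. schoenberg_step (3 ^ g k * x) / 2 ^ Suc k) sequentially"
    by (rule Weierstrass_m_test[where M="\<lambda>k. 1 / 2 ^ Suc k"])
       (use schoenberg_step_bounds half_powers_sums in \<open>auto simp: sums_iff intro!: divide_right_mono\<close>)
  show "\<forall>\<^sub>F n in sequentially. continuous_on UNIV (\<lambda>x. \<Sum>k<n. schoenberg_step (3 ^ g k * x) / 2 ^ Suc k)"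
    by (intro always_eventually allI continuous_intros continuous_on_compose2[OF schoenberg_step_continuous]) auto
qed simp

lemma schoenberg_component_bounds:
  "0 \<le> (\<Sum>k. schoenberg_step (3 ^ g k * x) / 2 ^ Suc k)" "(\<Sum>k. schoenberg_step (3 ^ g k * x) / 2 ^ Suc k) \<le> 1"
proof -
  have s: "summable (\<lambda>k. schoenberg_step (3 ^ g k * x) / 2 ^ Suc k)"
    by (rule summable_comparison_test'[OF sums_summable[OF half_powers_sums]])
       (use schoenberg_step_bounds in \<open>auto intro!: divide_right_mono\<close>)
  show "0 \<le> (\<Sum>k. schoenberg_step (3 ^ g k * x) / 2 ^ Suc k)"
    by (intro suminf_nonneg s divide_nonneg_nonneg schoenberg_step_bounds) auto
  have "(\<Sum>k. schoenberg_step (3 ^ g k * x) / 2 ^ Suc k) \<le> (\<Sum>k. 1 / 2 ^ Suc k)"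
    by (intro suminf_le s sums_summable[OF half_powers_sums] divide_right_mono schoenberg_step_bounds) auto
  then show "(\<Sum>k. schoenberg_step (3 ^ g k * x) / 2 ^ Suc k) \<le> 1" using half_powers_sums by (simp add: sums_iff)
qed

lemma binary_expansion:
  fixes x :: real
  assumes x: "0 \<le> x" "x < 1"
  obtains a :: "nat \<Rightarrow> int" where "\<And>k. a k = 0 \<or> a k = 1" "(\<lambda>k. of_int (a k) / 2 ^ Suc k) sums x"
proof
  define a where "a k = \<lfloor>2 ^ Suc k * x\<rfloor> - 2 * \<lfloor>2 ^ k * x\<rfloor>" for k
  show "a k = 0 \<or> a k = 1" for k
  proof -
    have "2 ^ Suc k * x = 2 * (2 ^ k * x)" by simp
    then show ?thesis unfolding a_def by linarith
  qed
  have part: "(\<Sum>k<n. real_of_int (a k) / 2 ^ Suc k) = of_int \<lfloor>2 ^ n * x\<rfloor> / 2 ^ n" for n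
  proof (induction n)
    case 0
    then show ?case using x by (simp add: floor_eq_iff)
  next
    case (Suc n)
    then show ?case by (simp add: a_def field_simps)
  qed
  have "(\<lambda>n. of_int \<lfloor>2 ^ n * x\<rfloor> / 2 ^ n) \<longlonglongrightarrow> x"
  proof (rule tendsto_sandwich)
    show "\<forall>\<^sub>F n in sequentially. x - 1 / 2 ^ n \<le> of_int \<lfloor>2 ^ n * x\<rfloor> / 2 ^ n"
    proof (intro always_eventually allI)
      fix n :: nat
      have "2 ^ n * x - 1 \<le> of_int \<lfloor>2 ^ n * x\<rfloor>" by linarith
      then have "(2 ^ n * x - 1) / 2 ^ n \<le> of_int \<lfloor>2 ^ n * x\<rfloor> / 2 ^ n" by (intro divide_right_mono) auto
      then show "x - 1 / 2 ^ n \<le> of_int \<lfloor>2 ^ n * x\<rfloor> / 2 ^ n" by (simp add: diff_divide_distrib)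
    qed
    show "\<forall>\<^sub>F n in sequentially. of_int \<lfloor>2 ^ n * x\<rfloor> / 2 ^ n \<le> x"
    proof (intro always_eventually allI)
      fix n :: nat
      have "of_int \<lfloor>2 ^ n * x\<rfloor> / 2 ^ n \<le> (2 ^ n * x) / 2 ^ n" by (intro divide_right_mono) auto
      then show "of_int \<lfloor>2 ^ n * x\<rfloor> / 2 ^ n \<le> x" by simp
    qed
    show "(\<lambda>n. x - 1 / 2 ^ n) \<longlonglongrightarrow> x" by real_asymp
  qed simp
  then show "(\<lambda>k. of_int (a k) / 2 ^ Suc k) sums x" unfolding sums_def part .
qed

text \<open>The binary digits of x and y are interleaved to bits c n, and t gets the ternary digits
  2 c n. Then 3^n t is an even integer plus 2 c(n)/3 plus a tail in [0, 1/3], so the step function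
  returns c n.\<close>

lemma schoenberg_curve_surj:
  assumes x: "0 \<le> x" "x < 1" and y: "0 \<le> y" "y < 1"
  shows "\<exists>t\<in>{0..1}. schoenberg_curve t = (x, y)"
proof -
  obtain a where a: "\<And>k. a k = 0 \<or> a k = 1" "(\<lambda>k. of_int (a k) / 2 ^ Suc k) sums x" using binary_expansion[OF x] by blast
  obtain b where b: "\<And>k. b k = 0 \<or> b k = 1" "(\<lambda>k. of_int (b k) / 2 ^ Suc k) sums y" using binary_expansion[OF y] by blast
  define c where "c n = (if even n then a (n div 2) else b (n div 2))" for n
  have c: "c n = 0 \<or> c n = 1" for n using a(1) b(1) by (auto simp: c_def)
  define d where "d n = 2 * real_of_int (c n) / 3 ^ Suc n" for n
  have third: "(\<lambda>n. 2 / 3 ^ Suc n :: real) sums 1"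
  proof -
    have "(\<lambda>n. (2/3) * (1/3) ^ n :: real) sums ((2/3) * (1 / (1 - 1/3)))" by (intro sums_mult geometric_sums) simp
    then show ?thesis by (simp add: power_divide)
  qed
  have dle: "0 \<le> d n" "d n \<le> 2 / 3 ^ Suc n" for n using c[of n] by (auto simp: d_def)
  have sd: "summable d"
    by (rule summable_comparison_test'[OF sums_summable[OF third]]) (use dle in auto)
  define t where "t = suminf d"
  have "t \<le> 1" unfolding t_def using suminf_le[OF dle(2) sd sums_summable[OF third]] third by (simp add: sums_iff)
  moreover have "0 \<le> t" unfolding t_def by (intro suminf_nonneg sd dle)
  moreover have val: "schoenberg_step (3 ^ n * t) = of_int (c n)" for n
  proof -
    have sn: "summable (\<lambda>i. d (i + Suc n))" using sd summable_iff_shift by blast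
    define r where "r = 3 ^ n * (\<Sum>i. d (i + Suc n))"
    have "0 \<le> (\<Sum>i. d (i + Suc n))" by (intro suminf_nonneg sn dle)
    then have r0: "0 \<le> r" by (simp add: r_def)
    have r1: "r \<le> 1/3"
    proof -
      have s3: "(\<lambda>i. (1 / 3 ^ Suc n) * (2 / 3 ^ Suc i :: real)) sums ((1 / 3 ^ Suc n) * 1)" by (intro sums_mult third)
      have "(\<Sum>i. d (i + Suc n)) \<le> (\<Sum>i. (1 / 3 ^ Suc n) * (2 / 3 ^ Suc i))"
      proof (intro suminf_le sn sums_summable[OF s3])
        show "d (i + Suc n) \<le> (1 / 3 ^ Suc n) * (2 / 3 ^ Suc i)" for i using dle(2)[of "i + Suc n"] by (simp add: power_add mult_ac)
      qed
      also have "\<dots> = 1 / 3 ^ Suc n" using s3 by (simp add: sums_iff)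
      finally have "r \<le> 3 ^ n * (1 / 3 ^ Suc n)" unfolding r_def by (intro mult_left_mono) auto
      then show ?thesis by simp
    qed
    \<comment> \<open>The digits are 0 or 2, which makes the integer part even, a multiple of the
      period of the step function.\<close>
    have init: "3 ^ n * (\<Sum>i<n. d i) = 2 * of_int (\<Sum>i<n. c i * 3 ^ (n - Suc i))"
    proof -
      have "3 ^ n * d i = 2 * of_int (c i * 3 ^ (n - Suc i))" if "i < n" for i
      proof -
        have "(3::real) ^ n = 3 ^ Suc i * 3 ^ (n - Suc i)" using that by (simp only: power_add[symmetric]) simp
        then show ?thesis by (simp add: d_def)
      qed
      then show ?thesis by (simp add: sum_distrib_left)
    qed
    have "t = (\<Sum>i. d (i + Suc n)) + (\<Sum>i<Suc n. d i)"
      unfolding t_def by (rule suminf_split_initial_segment[OF sd])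
    then have "3 ^ n * t = 3 ^ n * (\<Sum>i<n. d i) + 3 ^ n * d n + r" by (simp add: r_def algebra_simps)
    also have "3 ^ n * d n = 2 * of_int (c n) / 3" by (simp add: d_def)
    finally have "3 ^ n * t = 2 * of_int (\<Sum>i<n. c i * 3 ^ (n - Suc i)) + 2 * of_int (c n) / 3 + r" unfolding init .
    moreover have "real_of_int (c n) = 0 \<or> real_of_int (c n) = 1" using c[of n] by auto
    ultimately show ?thesis using schoenberg_step_value[OF _ r0 r1] by (simp only:)
  qed
  have "schoenberg_curve t = (x, y)"
    unfolding schoenberg_curve_def val using a(2) b(2) by (simp add: c_def sums_iff)
  ultimately show ?thesis by auto
qed

text \<open>The smallest parameter of a point on the space-filling curve is a Borel function, so measures on
  the plane lift to measures on the interval, where Helly's theorem applies.\<close>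

lemma plane_weak_limit:
  fixes \<mu> :: "nat \<Rightarrow> (real \<times> real) measure"
  assumes \<mu>: "\<And>n. borel_prob (\<mu> n)"
  shows "\<exists>r \<nu>. strict_mono (r :: nat \<Rightarrow> nat) \<and> finite_measure \<nu> \<and> sets \<nu> = sets (borel :: (real \<times> real) measure) \<and>
    (\<forall>(h :: real \<times> real \<Rightarrow> real) B. continuous_on UNIV h \<longrightarrow> (\<forall>p. \<bar>h p\<bar> \<le> B) \<longrightarrow>
       (\<forall>a b. cos a = 0 \<or> cos b = 0 \<longrightarrow> h (a, b) = 0) \<longrightarrow>
       (\<lambda>n. \<integral>q. h (arctan (fst q), arctan (snd q)) \<partial>\<mu> (r n)) \<longlonglongrightarrow> (\<integral>q. h (arctan (fst q), arctan (snd q)) \<partial>\<nu>))"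
proof -
  define p1 p2 where "p1 x = pi * fst (schoenberg_curve x) - pi/2" and "p2 x = pi * snd (schoenberg_curve x) - pi/2" for x
  define p where "p x = (p1 x, p2 x)" for x
  \<comment> \<open>Maps the plane onto an open square whose closure is the image of the curve
    \<open>p\<close> on [0, 1]; the boundary represents points at infinity.\<close>
  define \<theta> where "\<theta> q = (arctan (fst q), arctan (snd q))" for q :: "real \<times> real"
  have cont: "continuous_on UNIV p1" "continuous_on UNIV p2"
    unfolding p1_def[abs_def] p2_def[abs_def] schoenberg_curve_def fst_conv snd_conv
    by (intro continuous_intros schoenberg_component_continuous)+
  then have contp: "continuous_on UNIV p" unfolding p_def[abs_def] by (rule continuous_on_Pair)
  have pb: "- (pi/2) \<le> p1 x" "p1 x \<le> pi/2" "- (pi/2) \<le> p2 x" "p2 x \<le> pi/2" for x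
  proof -
    have "0 \<le> fst (schoenberg_curve x)" "fst (schoenberg_curve x) \<le> 1" "0 \<le> snd (schoenberg_curve x)" "snd (schoenberg_curve x) \<le> 1"
      unfolding schoenberg_curve_def fst_conv snd_conv by (rule schoenberg_component_bounds)+
    then show "- (pi/2) \<le> p1 x" "p1 x \<le> pi/2" "- (pi/2) \<le> p2 x" "p2 x \<le> pi/2"
      by (simp_all add: p1_def p2_def)
  qed
  have cont\<theta>: "continuous_on UNIV \<theta>" unfolding \<theta>_def[abs_def] by (intro continuous_intros)
  have surj: "\<exists>x\<in>{0..1}. p x = \<theta> q" for q
  proof -
    have in01: "0 \<le> arctan s / pi + 1/2" "arctan s / pi + 1/2 < 1" for s
      using arctan_bounded[of s] by (auto simp: field_simps)
    obtain x where "x \<in> {0..1}" "schoenberg_curve x = (arctan (fst q) / pi + 1/2, arctan (snd q) / pi + 1/2)"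
      using schoenberg_curve_surj[OF in01 in01] by blast
    then show ?thesis by (intro bexI[of _ x]) (simp_all add: p_def p1_def p2_def \<theta>_def distrib_left)
  qed
  define A where "A q = {x \<in> {0..1}. p x = \<theta> q}" for q
  define \<sigma> where "\<sigma> q = Inf (A q)" for q
  \<comment> \<open>Closedness means that the infimum \<sigma> q is attained, so \<sigma> is a right
    inverse of the curve over the open square.\<close>
  have A: "A q \<noteq> {}" "bdd_below (A q)" "closed (A q)" for q
  proof -
    show "A q \<noteq> {}" using surj[of q] by (auto simp: A_def)
    show "bdd_below (A q)" by (intro bdd_belowI[of _ 0]) (auto simp: A_def)
    have "A q = {0..1} \<inter> p -` {\<theta> q}" by (auto simp: A_def)
    moreover have "closed ({0..1} \<inter> p -` {\<theta> q})"
      by (rule continuous_closed_preimage[OF continuous_on_subset[OF contp]]) auto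
    ultimately show "closed (A q)" by simp
  qed
  have \<sigma>A: "\<sigma> q \<in> A q" for q unfolding \<sigma>_def by (rule closed_contains_Inf[OF A])
  have meas\<sigma>: "\<sigma> \<in> borel_measurable borel"
  proof (rule borel_measurable_iff_le[THEN iffD2], intro allI)
    fix a :: real
    \<comment> \<open>Choosing the smallest parameter makes sublevel sets preimages of images of
      compact sets, hence closed; this is where measurability comes from.\<close>
    have "{q. \<sigma> q \<le> a} = \<theta> -` (p ` ({0..1} \<inter> {..a}))"
    proof (intro set_eqI iffI)
      fix q assume "q \<in> {q. \<sigma> q \<le> a}"
      then have "\<sigma> q \<in> {0..1} \<inter> {..a}" "p (\<sigma> q) = \<theta> q" using \<sigma>A[of q] by (auto simp: A_def)
      then have "\<theta> q \<in> p ` ({0..1} \<inter> {..a})" by (metis image_eqI)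
      then show "q \<in> \<theta> -` (p ` ({0..1} \<inter> {..a}))" by simp
    next
      fix q assume "q \<in> \<theta> -` (p ` ({0..1} \<inter> {..a}))"
      then have "\<theta> q \<in> p ` ({0..1} \<inter> {..a})" by simp
      then obtain x where x: "\<theta> q = p x" "x \<in> {0..1} \<inter> {..a}" by (rule imageE)
      then have "x \<in> A q" by (simp add: A_def)
      then have "\<sigma> q \<le> x" unfolding \<sigma>_def using A(2) by (rule cInf_lower)
      then show "q \<in> {q. \<sigma> q \<le> a}" using x by simp
    qed
    moreover have "compact ({0..1} \<inter> {..a})" by (rule compact_Int_closed) auto
    then have "closed (p ` ({0..1} \<inter> {..a}))"
      by (intro compact_imp_closed compact_continuous_image continuous_on_subset[OF contp]) auto
    ultimately have "closed {q. \<sigma> q \<le> a}" using closed_vimage[OF _ cont\<theta>] by simp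
    then show "{w \<in> space borel. \<sigma> w \<le> a} \<in> sets borel" by simp
  qed
  define \<Lambda> where "\<Lambda> n = distr (\<mu> n) borel \<sigma>" for n
  have m\<sigma>: "\<sigma> \<in> borel_measurable (\<mu> n)" for n using meas\<sigma> borel_probD(2)[OF \<mu>] by (simp cong: measurable_cong_sets)
  have rd: "real_distribution (\<Lambda> n)" for n
    unfolding \<Lambda>_def real_distribution_def real_distribution_axioms_def
    using prob_space.prob_space_distr[OF borel_probD(1)[OF \<mu>] m\<sigma>] by simp
  have tight: "tight \<Lambda>"
    unfolding tight_def
  proof (intro conjI allI impI rd)
    fix \<epsilon> :: real assume \<epsilon>: "\<epsilon> > 0"
    have "measure (\<Lambda> n) {-1<..1} = 1" for n
    proof -
      interpret M: prob_space "\<mu> n" by (rule borel_probD(1)[OF \<mu>])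
      have "\<sigma> -` {-1<..1} \<inter> space (\<mu> n) = space (\<mu> n)" using \<sigma>A by (force simp: A_def)
      then show ?thesis unfolding \<Lambda>_def by (subst measure_distr[OF m\<sigma>]) (auto simp: M.prob_space)
    qed
    then show "\<exists>a b. a < b \<and> (\<forall>n. measure (\<Lambda> n) {a<..b} > 1 - \<epsilon>)"
      using \<epsilon> by (intro exI[of _ "-1"] exI[of _ 1]) auto
  qed
  obtain r L where r: "strict_mono (r :: nat \<Rightarrow> nat)" and L: "real_distribution L" and wc: "weak_conv_m (\<Lambda> \<circ> id \<circ> r) L"
    using tight_imp_convergent_subsubsequence[OF tight strict_mono_id] by blast
  interpret L: real_distribution L by fact
  note [measurable] = borel_measurable_continuous_onI[OF cont(1)] borel_measurable_continuous_onI[OF cont(2)]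
  have [measurable]: "(cos :: real \<Rightarrow> real) \<in> borel_measurable borel" "(tan :: real \<Rightarrow> real) \<in> borel_measurable borel"
    unfolding tan_def[abs_def] by (measurable; fail)+
  \<comment> \<open>The parameters mapped into the open square. Mass of the limit L outside E sits
    at infinity.\<close>
  define E where "E = {x. cos (p1 x) \<noteq> 0 \<and> cos (p2 x) \<noteq> 0}"
  have [measurable]: "E \<in> sets borel" unfolding E_def by measurable
  define \<tau> where "\<tau> x = (tan (p1 x), tan (p2 x))" for x
  have m\<tau>: "\<tau> \<in> borel_measurable borel" unfolding \<tau>_def[abs_def] borel_prod[symmetric] by measurable
  \<comment> \<open>The mass at infinity is discarded, so \<nu> is only known to be finite, and the
    test functions have to vanish where a cosine does.\<close>
  define D where "D = density L (indicator E)"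
  have mD: "\<tau> \<in> borel_measurable D" unfolding D_def using m\<tau> by (simp cong: measurable_cong_sets)
  define \<nu> where "\<nu> = distr D borel \<tau>"
  have fD: "finite_measure D"
  proof (rule finite_measureI)
    have "space D = UNIV" by (simp add: D_def)
    then have "emeasure D (space D) = (\<integral>\<^sup>+x. indicator E x * indicator UNIV x \<partial>L)"
      unfolding D_def by (simp only:) (rule emeasure_density, simp_all)
    also have "\<dots> = emeasure L E" by simp
    finally show "emeasure D (space D) \<noteq> \<infinity>" using L.emeasure_finite[of E] by simp
  qed
  have fin: "finite_measure \<nu>" unfolding \<nu>_def by (rule finite_measure.finite_measure_distr[OF fD mD])
  have main: "(\<lambda>n. \<integral>q. h (arctan (fst q), arctan (snd q)) \<partial>\<mu> (r n)) \<longlonglongrightarrow> (\<integral>q. h (arctan (fst q), arctan (snd q)) \<partial>\<nu>)"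
    if h: "continuous_on UNIV h" "\<And>p. \<bar>h p\<bar> \<le> B" "\<And>a b. cos a = 0 \<or> cos b = 0 \<Longrightarrow> h (a, b) = 0"
    for h :: "real \<times> real \<Rightarrow> real" and B
  proof -
    have hp: "continuous_on UNIV (\<lambda>x. h (p x))" by (rule continuous_on_compose2[OF h(1) contp]) auto
    have mh: "h \<in> borel_measurable borel" by (rule borel_measurable_continuous_onI[OF h(1)])
    have mh\<theta>: "(\<lambda>q. h (\<theta> q)) \<in> borel_measurable borel"
      by (intro borel_measurable_continuous_onI continuous_on_compose2[OF h(1) cont\<theta>]) auto
    have mhp: "(\<lambda>x. h (p x)) \<in> borel_measurable borel" by (rule borel_measurable_continuous_onI[OF hp])
    have "(\<lambda>n. \<integral>x. h (p x) \<partial>(\<Lambda> \<circ> id \<circ> r) n) \<longlonglongrightarrow> (\<integral>x. h (p x) \<partial>L)"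
      using hp h(2) rd
      by (intro weak_conv_imp_integral_bdd_continuous_conv[OF _ L wc, where B=B])
         (simp_all add: continuous_on_eq_continuous_at)
    moreover have "(\<integral>x. h (p x) \<partial>(\<Lambda> \<circ> id \<circ> r) n) = (\<integral>q. h (\<theta> q) \<partial>\<mu> (r n))" for n
    proof -
      have "(\<integral>x. h (p x) \<partial>\<Lambda> (r n)) = (\<integral>q. h (p (\<sigma> q)) \<partial>\<mu> (r n))"
        unfolding \<Lambda>_def by (rule integral_distr[OF m\<sigma> mhp])
      moreover have "p (\<sigma> q) = \<theta> q" for q using \<sigma>A[of q] by (simp add: A_def)
      ultimately show ?thesis by simp
    qed
    moreover have "(\<integral>x. h (p x) \<partial>L) = (\<integral>q. h (\<theta> q) \<partial>\<nu>)"
    proof -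
      have "(\<integral>q. h (\<theta> q) \<partial>\<nu>) = (\<integral>x. h (\<theta> (\<tau> x)) \<partial>D)"
        unfolding \<nu>_def by (rule integral_distr[OF mD mh\<theta>])
      also have "\<dots> = (\<integral>x. indicator E x *\<^sub>R h (\<theta> (\<tau> x)) \<partial>L)"
      proof -
        have D': "D = density L (\<lambda>x. ennreal (indicator E x))" unfolding D_def by (simp add: ennreal_indicator)
        have "(\<lambda>x. h (\<theta> (\<tau> x))) \<in> borel_measurable borel" using measurable_compose[OF m\<tau> mh\<theta>] .
        then show ?thesis unfolding D' by (intro integral_density) simp_all
      qed
      also have "\<dots> = (\<integral>x. h (p x) \<partial>L)"
      proof (rule Bochner_Integration.integral_cong[OF refl])
        fix x
        show "indicator E x *\<^sub>R h (\<theta> (\<tau> x)) = h (p x)"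
        proof (cases "x \<in> E")
          case True
          have arc: "arctan (tan y) = y" if "cos y \<noteq> 0" "- (pi/2) \<le> y" "y \<le> pi/2" for y
          proof (rule arctan_tan)
            have "y \<noteq> pi/2" "y \<noteq> - (pi/2)" using that(1) by (metis cos_pi_half, metis cos_minus cos_pi_half)
            then show "- (pi/2) < y" "y < pi/2" using that by auto
          qed
          have "\<theta> (\<tau> x) = p x" using True pb[of x] arc by (simp add: E_def \<theta>_def \<tau>_def p_def)
          then show ?thesis using True by simp
        next
          case False
          then have "h (p x) = 0" using h(3) by (auto simp: E_def p_def)
          then show ?thesis using False by simp
        qed
      qed
      finally show ?thesis by simp
    qed
    ultimately show ?thesis by (simp add: \<theta>_def)
  qed
  have s: "sets \<nu> = sets borel" by (simp add: \<nu>_def)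
  have all: "\<forall>(h :: real \<times> real \<Rightarrow> real) B. continuous_on UNIV h \<longrightarrow> (\<forall>p. \<bar>h p\<bar> \<le> B) \<longrightarrow>
       (\<forall>a b. cos a = 0 \<or> cos b = 0 \<longrightarrow> h (a, b) = 0) \<longrightarrow>
       (\<lambda>n. \<integral>q. h (arctan (fst q), arctan (snd q)) \<partial>\<mu> (r n)) \<longlonglongrightarrow> (\<integral>q. h (arctan (fst q), arctan (snd q)) \<partial>\<nu>)"
  proof (intro allI impI)
    fix h :: "real \<times> real \<Rightarrow> real" and B
    assume h: "continuous_on UNIV h" "\<forall>p. \<bar>h p\<bar> \<le> B" "\<forall>a b. cos a = 0 \<or> cos b = 0 \<longrightarrow> h (a, b) = 0"
    show "(\<lambda>n. \<integral>q. h (arctan (fst q), arctan (snd q)) \<partial>\<mu> (r n)) \<longlonglongrightarrow> (\<integral>q. h (arctan (fst q), arctan (snd q)) \<partial>\<nu>)"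
      by (rule main[OF h(1) spec[OF h(2)]]) (use h(3) in auto)
  qed
  show ?thesis by (intro exI[of _ r] exI[of _ \<nu>] conjI r fin s all)
qed

section \<open>Functions representable as Cauchy transforms\<close>

lemma poisson_kernel_le: "0 < Im Z \<Longrightarrow> poisson_kernel Z x \<le> 1 / Im Z"
proof -
  assume Z: "0 < Im Z"
  have "(Im Z)\<^sup>2 \<le> (norm (Z - of_real x))\<^sup>2"
    using norm_diff_of_real_ge[of Z x] Z by (intro power_mono) auto
  then have "Im Z / (norm (Z - of_real x))\<^sup>2 \<le> Im Z / (Im Z)\<^sup>2"
    using Z upper_minus_real_nonzero[OF Z] by (intro divide_left_mono mult_pos_pos zero_less_power) auto
  then show ?thesis using Z by (simp add: poisson_kernel_def power2_eq_square)
qed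

lemma poisson_kernel_axis:
  "y > 0 \<Longrightarrow> y * poisson_kernel (\<i> * of_real y) x = y\<^sup>2 / (y\<^sup>2 + x\<^sup>2)"
  unfolding poisson_kernel_def cmod_power2 by (simp add: power2_eq_square)

text \<open>A holomorphic function with values on the imaginary axis is not open, hence constant;
  the decay along the axis makes the constant 0.\<close>

lemma zero_of_Re_zero:
  assumes f: "f holomorphic_on {z. 0 < Im z}" and Re: "\<And>z. 0 < Im z \<Longrightarrow> Re (f z) = 0"
    and C: "\<And>z. 0 < Im z \<Longrightarrow> norm (f z) \<le> C / Im z" and z: "0 < Im z"
  shows "f z = 0"
proof -
  let ?S = "{z. 0 < Im z}"
  have S: "open ?S" "connected ?S" "?S \<noteq> {}"
    using open_halfspace_Im_gt convex_connected[OF convex_halfspace_Im_gt] by (auto intro!: exI[of _ \<i>])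
  have "f constant_on ?S"
  proof (rule ccontr)
    assume "\<not> f constant_on ?S"
    then have "open (f ` ?S)" by (intro open_mapping_thm[OF f S(1,2) S(1)]) auto
    moreover have "f \<i> \<in> f ` ?S" by (intro imageI) simp
    ultimately obtain e where e: "e > 0" "cball (f \<i>) e \<subseteq> f ` ?S" using open_contains_cball by blast
    have "f \<i> + of_real e \<in> cball (f \<i>) e" using e(1) by (simp add: dist_norm)
    then obtain v where v: "f \<i> + of_real e = f v" "0 < Im v" using e(2) by (metis (mono_tags) imageE mem_Collect_eq subsetD)
    then have "Re (f \<i> + of_real e) = 0" using Re by simp
    then show False using Re[of \<i>] e(1) by simp
  qed
  then obtain c where c: "\<And>z. 0 < Im z \<Longrightarrow> f z = c" unfolding constant_on_def by blast
  have "norm c \<le> C / real (Suc n)" for n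
    using c[of "\<i> * of_real (real (Suc n))"] C[of "\<i> * of_real (real (Suc n))"] by simp
  moreover have "(\<lambda>n. C / real (Suc n)) \<longlonglongrightarrow> 0" by real_asymp
  ultimately have "norm c \<le> 0" by (intro LIMSEQ_le_const) auto
  then show ?thesis using c[OF z] by simp
qed

text \<open>y times the kernel at \<i> y is y^2 / (y^2 + x^2), which increases to 1, so monotone
  convergence computes the total mass without assuming it finite.\<close>

lemma emeasure_one_by_kernels:
  assumes M: "sets M = sets (borel :: (real \<times> real) measure)"
    and lim: "(\<lambda>n. (\<integral>\<^sup>+q. ennreal ((real (Suc n) * poisson_kernel (\<i> * of_real (real (Suc n))) (fst q)) *
        (real (Suc n) * poisson_kernel (\<i> * of_real (real (Suc n))) (snd q))) \<partial>M)) \<longlonglongrightarrow> 1"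
  shows "prob_space M"
proof -
  define f where "f n x = (real (Suc n))\<^sup>2 / ((real (Suc n))\<^sup>2 + x\<^sup>2)" for n x
  have fe: "real (Suc n) * poisson_kernel (\<i> * of_real (real (Suc n))) x = f n x" for n x
    unfolding f_def by (rule poisson_kernel_axis) simp
  have f0: "0 \<le> f n x" for n x by (simp add: f_def)
  have mono: "f m x \<le> f n x" if "m \<le> n" for m n x
  proof -
    define a b where "a = (real (Suc m))\<^sup>2" and "b = (real (Suc n))\<^sup>2"
    have ab: "0 < a" "a \<le> b" unfolding a_def b_def using that by (simp_all add: power_mono)
    have "a * (b + x\<^sup>2) \<le> b * (a + x\<^sup>2)" using ab by (simp add: algebra_simps mult_right_mono)
    moreover have "0 < a + x\<^sup>2" "0 < b + x\<^sup>2" using ab by (simp_all add: add_pos_nonneg)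
    ultimately have "a / (a + x\<^sup>2) \<le> b / (b + x\<^sup>2)" by (simp add: frac_le_eq divide_simps)
    then show ?thesis by (simp only: f_def a_def b_def)
  qed
  have flim: "(\<lambda>n. f n x) \<longlonglongrightarrow> 1" for x unfolding f_def by real_asymp
  note [measurable_cong] = M
  have [measurable]: "fst \<in> borel_measurable (borel :: (real \<times> real) measure)" "snd \<in> borel_measurable (borel :: (real \<times> real) measure)"
    by (intro borel_measurable_continuous_onI continuous_intros)+
  have "(\<lambda>n. (\<integral>\<^sup>+q. ennreal (f n (fst q) * f n (snd q)) \<partial>M)) \<longlonglongrightarrow> (\<integral>\<^sup>+q. 1 \<partial>M)"
  proof (rule nn_integral_LIMSEQ)
    show "incseq (\<lambda>n q. ennreal (f n (fst q) * f n (snd q)))"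
      unfolding incseq_def le_fun_def using mono f0 by (auto intro!: ennreal_leI mult_mono)
    show "(\<lambda>q. ennreal (f n (fst q) * f n (snd q))) \<in> borel_measurable M" for n
      unfolding f_def by measurable
    show "(\<lambda>n. ennreal (f n (fst q) * f n (snd q))) \<longlonglongrightarrow> 1" for q :: "real \<times> real"
      using tendsto_ennrealI[OF tendsto_mult[OF flim[of "fst q"] flim[of "snd q"]]] by simp
  qed
  with lim have "(\<integral>\<^sup>+q. 1 \<partial>M) = 1" unfolding fe using LIMSEQ_unique by blast
  then show ?thesis by (intro prob_spaceI) simp
qed

text \<open>The Poisson kernel in the coordinate \<open>arctan\<close>; it extends continuously by 0 to the points at infinity.\<close>

definition angular_kernel :: "complex \<Rightarrow> real \<Rightarrow> real" where
  "angular_kernel Z a = Im Z * (cos a)\<^sup>2 / (norm (Z * of_real (cos a) - of_real (sin a)))\<^sup>2"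

lemma angular_kernel_denominator: "0 < Im Z \<Longrightarrow> Z * of_real (cos a) - of_real (sin a) \<noteq> 0"
proof
  assume Z: "0 < Im Z" and z: "Z * of_real (cos a) - of_real (sin a) = 0"
  have "Im Z * cos a = 0" using arg_cong[OF z, of Im] by simp
  then have c: "cos a = 0" using Z by simp
  then have "sin a = 0" using arg_cong[OF z, of Re] by simp
  then show False using c sin_cos_squared_add[of a] by simp
qed

lemma angular_kernel_continuous: "0 < Im Z \<Longrightarrow> continuous_on S (angular_kernel Z)"
  unfolding angular_kernel_def[abs_def]
  by (intro continuous_intros) (use angular_kernel_denominator in auto)

lemma angular_kernel_tan: "cos a \<noteq> 0 \<Longrightarrow> angular_kernel Z a = poisson_kernel Z (tan a)"
proof -
  assume c: "cos a \<noteq> 0"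
  have "Z * of_real (cos a) - of_real (sin a) = of_real (cos a) * (Z - of_real (tan a))"
    using c by (simp add: tan_def field_simps)
  then show ?thesis using c by (simp add: angular_kernel_def poisson_kernel_def norm_mult power_mult_distrib)
qed

lemma angular_kernel_arctan: "angular_kernel Z (arctan s) = poisson_kernel Z s"
  using angular_kernel_tan[of "arctan s" Z] cos_arctan_not_zero[of s] by (simp add: tan_arctan)

lemma angular_kernel_bounds: "0 < Im Z \<Longrightarrow> 0 \<le> angular_kernel Z a \<and> angular_kernel Z a \<le> 1 / Im Z"
proof (cases "cos a = 0")
  case False
  then show "0 < Im Z \<Longrightarrow> ?thesis" using angular_kernel_tan[OF False, of Z] poisson_kernel_le poisson_kernel_nonneg by simp
qed (simp add: angular_kernel_def)

text \<open>A characterisation of Cauchy transforms of probability measures on the plane: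
  \<open>pos\<close> corresponds to positivity of the measure and \<open>mass\<close> to total mass
  1, as Re (G(cnj z, w) - G(z, w)) is to be twice the double Poisson integral.\<close>

locale plane_nevanlinna =
  fixes G :: "complex \<Rightarrow> complex \<Rightarrow> complex" and B :: real
  assumes holz: "\<And>w. w \<notin> \<real> \<Longrightarrow> (\<lambda>z. G z w) holomorphic_on - \<real>"
    and holw: "\<And>z. z \<notin> \<real> \<Longrightarrow> (\<lambda>w. G z w) holomorphic_on - \<real>"
    and cont: "continuous_on ((- \<real>) \<times> (- \<real>)) (\<lambda>p. G (fst p) (snd p))"
    and bound: "\<And>z w. z \<notin> \<real> \<Longrightarrow> w \<notin> \<real> \<Longrightarrow> norm (G z w) \<le> B / (\<bar>Im z\<bar> * \<bar>Im w\<bar>)"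
    and sym: "\<And>z w. z \<notin> \<real> \<Longrightarrow> w \<notin> \<real> \<Longrightarrow> G (cnj z) (cnj w) = cnj (G z w)"
    and pos: "\<And>z w. 0 < Im z \<Longrightarrow> 0 < Im w \<Longrightarrow> 0 \<le> Re (G (cnj z) w - G z w)"
    and mass: "((\<lambda>y. y\<^sup>2 * Re (G (cnj (\<i> * of_real y)) (\<i> * of_real y) - G (\<i> * of_real y) (\<i> * of_real y))) \<longlongrightarrow> 2) at_top"
begin

definition u :: "complex \<Rightarrow> complex \<Rightarrow> real" where
  "u z w = Re ((G (cnj z) w - G z w) / 2)"

lemma upper_notin_Reals: "0 < Im z \<Longrightarrow> z \<notin> \<real>" "0 < Im z \<Longrightarrow> cnj z \<notin> \<real>"
  by (auto simp: complex_is_Real_iff)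

text \<open>As defined, u is the real part of a holomorphic function of w. By the symmetry of G it
  is also the real part of a holomorphic function of z, so the Poisson formula is available in
  either variable.\<close>

lemma u_alt: "0 < Im z \<Longrightarrow> 0 < Im w \<Longrightarrow> u z w = Re ((G z (cnj w) - G z w) / 2)"
  using sym[of z "cnj w"] upper_notin_Reals[of z] upper_notin_Reals[of w] by (simp add: u_def)

lemma u_nonneg: "0 < Im z \<Longrightarrow> 0 < Im w \<Longrightarrow> 0 \<le> u z w"
  using pos[of z w] by (simp add: u_def)

lemma half_sub: "{z. 0 < Im z} \<subseteq> - \<real>" using upper_notin_Reals by auto

lemma poisson_z:
  assumes W: "0 < Im W" and \<epsilon>: "\<epsilon> > 0" and Z: "0 < Im Z"
  shows "(\<integral>\<^sup>+x. ennreal (poisson_kernel Z x * u (of_real x + \<i> * of_real \<epsilon>) W) \<partial>lborel) = ennreal (pi * u (Z + \<i> * of_real \<epsilon>) W)"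
proof -
  define g where "g z = (G z (cnj W) - G z W) / 2" for z
  have "(\<integral>\<^sup>+x. ennreal (poisson_kernel Z x * Re (g (of_real x + \<i> * of_real \<epsilon>))) \<partial>lborel) = ennreal (pi * Re (g (Z + \<i> * of_real \<epsilon>)))"
  proof (rule poisson_formula_Re[OF _ _ \<epsilon> Z])
    show "g holomorphic_on {z. 0 < Im z}"
      unfolding g_def by (intro holomorphic_intros holomorphic_on_subset[OF holz half_sub] upper_notin_Reals W) auto
    show "norm (g z) \<le> (B / Im W) / Im z" if z: "0 < Im z" for z
    proof -
      have "norm (G z (cnj W)) \<le> B / (Im z * Im W)" "norm (G z W) \<le> B / (Im z * Im W)"
        using bound[of z "cnj W"] bound[of z W] z W upper_notin_Reals by simp_all
      then have "norm (G z (cnj W) - G z W) \<le> 2 * (B / (Im z * Im W))"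
        using norm_triangle_ineq4[of "G z (cnj W)" "G z W"] by linarith
      then show ?thesis by (simp add: g_def norm_divide mult.commute)
    qed
    show "0 \<le> Re (g z)" if "0 < Im z" for z
      using u_nonneg[OF that W] u_alt[OF that W] by (simp add: g_def)
  qed
  moreover have "Re (g (of_real x + \<i> * of_real \<epsilon>)) = u (of_real x + \<i> * of_real \<epsilon>) W" for x
    using u_alt[of "of_real x + \<i> * of_real \<epsilon>" W] W \<epsilon> by (simp add: g_def)
  moreover have "Re (g (Z + \<i> * of_real \<epsilon>)) = u (Z + \<i> * of_real \<epsilon>) W"
    using u_alt[of "Z + \<i> * of_real \<epsilon>" W] W Z \<epsilon> by (simp add: g_def)
  ultimately show ?thesis by simp
qed

lemma poisson_w:
  assumes Z: "0 < Im Z" and \<epsilon>: "\<epsilon> > 0" and W: "0 < Im W"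
  shows "(\<integral>\<^sup>+y. ennreal (poisson_kernel W y * u Z (of_real y + \<i> * of_real \<epsilon>)) \<partial>lborel) = ennreal (pi * u Z (W + \<i> * of_real \<epsilon>))"
proof -
  define g where "g w = (G (cnj Z) w - G Z w) / 2" for w
  have "(\<integral>\<^sup>+x. ennreal (poisson_kernel W x * Re (g (of_real x + \<i> * of_real \<epsilon>))) \<partial>lborel) = ennreal (pi * Re (g (W + \<i> * of_real \<epsilon>)))"
  proof (rule poisson_formula_Re[OF _ _ \<epsilon> W])
    show "g holomorphic_on {z. 0 < Im z}"
      unfolding g_def by (intro holomorphic_intros holomorphic_on_subset[OF holw half_sub] upper_notin_Reals Z) auto
    show "norm (g w) \<le> (B / Im Z) / Im w" if w: "0 < Im w" for w
    proof -
      have "norm (G (cnj Z) w) \<le> B / (Im Z * Im w)" "norm (G Z w) \<le> B / (Im Z * Im w)"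
        using bound[of "cnj Z" w] bound[of Z w] w Z upper_notin_Reals by simp_all
      then have "norm (G (cnj Z) w - G Z w) \<le> 2 * (B / (Im Z * Im w))"
        using norm_triangle_ineq4[of "G (cnj Z) w" "G Z w"] by linarith
      then show ?thesis by (simp add: g_def norm_divide mult.commute)
    qed
    show "0 \<le> Re (g w)" if "0 < Im w" for w
      using u_nonneg[OF Z that] by (simp add: g_def u_def)
  qed
  then show ?thesis by (simp add: g_def u_def)
qed

lemma u_continuous: 
  assumes "continuous_on S f" "continuous_on S g" "\<And>x. x \<in> S \<Longrightarrow> 0 < Im (f x)" "\<And>x. x \<in> S \<Longrightarrow> 0 < Im (g x)"
  shows "continuous_on S (\<lambda>x. u (f x) (g x))"
proof -
  have 1: "continuous_on S (\<lambda>x. G (f x) (g x))"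
    using continuous_on_compose2[OF cont continuous_on_Pair[OF assms(1,2)]] assms(3,4) upper_notin_Reals by auto
  have "continuous_on S (\<lambda>x. cnj (f x))" by (intro continuous_intros assms)
  from continuous_on_compose2[OF cont continuous_on_Pair[OF this assms(2)]]
  have 2: "continuous_on S (\<lambda>x. G (cnj (f x)) (g x))" using assms(3,4) upper_notin_Reals by auto
  show ?thesis unfolding u_def by (intro continuous_intros 1 2) auto
qed

text \<open>Two-dimensional Stieltjes inversion: the values of u at height \<epsilon> in both
  variables, divided by \<pi>^2, are taken as a density.\<close>

definition approx :: "real \<Rightarrow> (real \<times> real) measure" where
  "approx \<epsilon> = density lborel (\<lambda>q. ennreal (u (of_real (fst q) + \<i> * of_real \<epsilon>) (of_real (snd q) + \<i> * of_real \<epsilon>) / pi\<^sup>2))"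

lemma approx_measurable:
  "\<epsilon> > 0 \<Longrightarrow> (\<lambda>q :: real \<times> real. u (of_real (fst q) + \<i> * of_real \<epsilon>) (of_real (snd q) + \<i> * of_real \<epsilon>)) \<in> borel_measurable borel"
  by (intro borel_measurable_continuous_onI u_continuous continuous_intros) auto

text \<open>Tonelli reduces the double integral to the half-plane Poisson formula in w and then in
  z. Each application produces a factor \<pi>, and the two cancel the normalisation of the
  density.\<close>

lemma approx_kernel:
  assumes \<epsilon>: "\<epsilon> > 0" and Z: "0 < Im Z" and W: "0 < Im W"
  shows "(\<integral>\<^sup>+q. ennreal (poisson_kernel Z (fst q) * poisson_kernel W (snd q)) \<partial>approx \<epsilon>) =
    ennreal (u (Z + \<i> * of_real \<epsilon>) (W + \<i> * of_real \<epsilon>))"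
proof -
  have [measurable]: "fst \<in> borel_measurable (borel :: (real \<times> real) measure)" "snd \<in> borel_measurable (borel :: (real \<times> real) measure)"
    by (intro borel_measurable_continuous_onI continuous_intros)+
  note [measurable] = approx_measurable[OF \<epsilon>]
  let ?e = "\<i> * complex_of_real \<epsilon>"
  define f where "f q = ennreal (poisson_kernel Z (fst q) * poisson_kernel W (snd q) * u (of_real (fst q) + ?e) (of_real (snd q) + ?e) / pi\<^sup>2)" for q :: "real \<times> real"
  have [measurable]: "f \<in> borel_measurable borel" unfolding f_def[abs_def] by measurable
  have un: "0 \<le> u (of_real x + ?e) (of_real y + ?e)" for x y using \<epsilon> by (intro u_nonneg) auto
  have "(\<integral>\<^sup>+q. ennreal (poisson_kernel Z (fst q) * poisson_kernel W (snd q)) \<partial>approx \<epsilon>) = (\<integral>\<^sup>+q. f q \<partial>lborel)"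
    unfolding approx_def
    by (subst nn_integral_density)
       (auto simp: f_def un poisson_kernel_nonneg Z W ennreal_mult'[symmetric] mult_ac intro!: nn_integral_cong)
  also have "\<dots> = (\<integral>\<^sup>+x. (\<integral>\<^sup>+y. f (x, y) \<partial>lborel) \<partial>lborel)"
    unfolding lborel_prod[symmetric] by (rule lborel.nn_integral_fst[symmetric]) (simp add: lborel_prod)
  also have "\<dots> = (\<integral>\<^sup>+x. ennreal (1 / pi) * ennreal (poisson_kernel Z x * u (of_real x + ?e) (W + ?e)) \<partial>lborel)"
  proof (rule nn_integral_cong)
    fix x :: real
    have x: "0 < Im (of_real x + ?e)" using \<epsilon> by simp
    have c0: "0 \<le> poisson_kernel Z x / pi\<^sup>2" using poisson_kernel_nonneg[OF Z] by simp
    have uW: "0 \<le> u (of_real x + ?e) (W + ?e)" using \<epsilon> W by (intro u_nonneg) auto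
    have "(\<integral>\<^sup>+y. f (x, y) \<partial>lborel) = (\<integral>\<^sup>+y. ennreal (poisson_kernel Z x / pi\<^sup>2) * ennreal (poisson_kernel W y * u (of_real x + ?e) (of_real y + ?e)) \<partial>lborel)"
      by (intro nn_integral_cong) (simp add: f_def ennreal_mult'[symmetric] c0 mult_ac)
    also have "\<dots> = ennreal (poisson_kernel Z x / pi\<^sup>2) * ennreal (pi * u (of_real x + ?e) (W + ?e))"
    proof (subst nn_integral_cmult)
      have "(\<lambda>y. u (of_real x + ?e) (of_real y + ?e)) \<in> borel_measurable borel"
        using \<epsilon> by (intro borel_measurable_continuous_onI u_continuous continuous_intros) auto
      then show "(\<lambda>y. ennreal (poisson_kernel W y * u (of_real x + ?e) (of_real y + ?e))) \<in> borel_measurable lborel" by measurable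
    qed (simp add: poisson_w[OF x \<epsilon> W])
    also have "\<dots> = ennreal (1 / pi) * ennreal (poisson_kernel Z x * u (of_real x + ?e) (W + ?e))"
      using c0 uW by (simp add: ennreal_mult'[symmetric] power2_eq_square)
    finally show "(\<integral>\<^sup>+y. f (x, y) \<partial>lborel) = ennreal (1 / pi) * ennreal (poisson_kernel Z x * u (of_real x + ?e) (W + ?e))" .
  qed
  also have "\<dots> = ennreal (1 / pi) * ennreal (pi * u (Z + ?e) (W + ?e))"
  proof (subst nn_integral_cmult)
    have W': "0 < Im (W + ?e)" using \<epsilon> W by simp
    have "(\<lambda>x. u (of_real x + ?e) (W + ?e)) \<in> borel_measurable borel"
      using \<epsilon> W by (intro borel_measurable_continuous_onI u_continuous continuous_intros) auto
    then show "(\<lambda>x. ennreal (poisson_kernel Z x * u (of_real x + ?e) (W + ?e))) \<in> borel_measurable lborel" by measurable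
    show "ennreal (1 / pi) * (\<integral>\<^sup>+x. ennreal (poisson_kernel Z x * u (of_real x + ?e) (W + ?e)) \<partial>lborel) = ennreal (1 / pi) * ennreal (pi * u (Z + ?e) (W + ?e))"
      by (simp only: poisson_z[OF W' \<epsilon> Z])
  qed
  also have "\<dots> = ennreal (u (Z + ?e) (W + ?e))" by (simp add: ennreal_mult'[symmetric])
  finally show ?thesis .
qed

lemma mass_u: "((\<lambda>y. y\<^sup>2 * u (\<i> * of_real y) (\<i> * of_real y)) \<longlongrightarrow> 1) at_top"
  using tendsto_mult_left[OF mass, of "1/2"] by (simp add: u_def)

text \<open>Formulated for \<epsilon> \<ge> 0 so that it yields total mass 1 both for the
  approximating measures and, with \<epsilon> = 0, for their weak limit.\<close>

lemma prob_space_by_kernels: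
  assumes M: "sets M = sets (borel :: (real \<times> real) measure)" and \<epsilon>: "\<epsilon> \<ge> 0"
    and k: "\<And>Z W. 0 < Im Z \<Longrightarrow> 0 < Im W \<Longrightarrow> (\<integral>\<^sup>+q. ennreal (poisson_kernel Z (fst q) * poisson_kernel W (snd q)) \<partial>M) =
       ennreal (u (Z + \<i> * of_real \<epsilon>) (W + \<i> * of_real \<epsilon>))"
  shows "prob_space M"
proof (rule emeasure_one_by_kernels[OF M])
  note [measurable_cong] = M
  have [measurable]: "fst \<in> borel_measurable (borel :: (real \<times> real) measure)" "snd \<in> borel_measurable (borel :: (real \<times> real) measure)"
    by (intro borel_measurable_continuous_onI continuous_intros)+
  \<comment> \<open>The kernels at height y give u at height y + \<epsilon>; the ratio y^2 / (y +
    \<epsilon>)^2 adapts the normalisation and tends to 1.\<close>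
  have e: "(\<integral>\<^sup>+q. ennreal ((real (Suc n) * poisson_kernel (\<i> * of_real (real (Suc n))) (fst q)) *
        (real (Suc n) * poisson_kernel (\<i> * of_real (real (Suc n))) (snd q))) \<partial>M) =
      ennreal ((real (Suc n))\<^sup>2 / (real (Suc n) + \<epsilon>)\<^sup>2 * ((real (Suc n) + \<epsilon>)\<^sup>2 * u (\<i> * of_real (real (Suc n) + \<epsilon>)) (\<i> * of_real (real (Suc n) + \<epsilon>))))" for n
  proof -
    define y where "y = real (Suc n)"
    have y: "y > 0" by (simp add: y_def)
    have "(\<integral>\<^sup>+q. ennreal ((y * poisson_kernel (\<i> * of_real y) (fst q)) * (y * poisson_kernel (\<i> * of_real y) (snd q))) \<partial>M) =
       (\<integral>\<^sup>+q. ennreal (y\<^sup>2) * ennreal (poisson_kernel (\<i> * of_real y) (fst q) * poisson_kernel (\<i> * of_real y) (snd q)) \<partial>M)"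
      by (intro nn_integral_cong) (simp add: ennreal_mult'[symmetric] power2_eq_square mult_ac)
    also have "\<dots> = ennreal (y\<^sup>2) * ennreal (u (\<i> * of_real y + \<i> * of_real \<epsilon>) (\<i> * of_real y + \<i> * of_real \<epsilon>))"
      using y by (subst nn_integral_cmult) (measurable, simp add: k)
    also have "\<dots> = ennreal (y\<^sup>2 * u (\<i> * of_real (y + \<epsilon>)) (\<i> * of_real (y + \<epsilon>)))"
      by (simp add: ennreal_mult'[symmetric] distrib_left)
    also have "y\<^sup>2 * u (\<i> * of_real (y + \<epsilon>)) (\<i> * of_real (y + \<epsilon>)) = y\<^sup>2 / (y + \<epsilon>)\<^sup>2 * ((y + \<epsilon>)\<^sup>2 * u (\<i> * of_real (y + \<epsilon>)) (\<i> * of_real (y + \<epsilon>)))"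
      using y \<epsilon> by simp
    finally show ?thesis unfolding y_def .
  qed
  have "filterlim (\<lambda>n. real (Suc n) + \<epsilon>) at_top sequentially" by real_asymp
  from filterlim_compose[OF mass_u this]
  have "(\<lambda>n. (real (Suc n) + \<epsilon>)\<^sup>2 * u (\<i> * of_real (real (Suc n) + \<epsilon>)) (\<i> * of_real (real (Suc n) + \<epsilon>))) \<longlonglongrightarrow> 1" .
  moreover have "(\<lambda>n. (real (Suc n))\<^sup>2 / (real (Suc n) + \<epsilon>)\<^sup>2) \<longlonglongrightarrow> 1" by real_asymp
  ultimately have "(\<lambda>n. (real (Suc n))\<^sup>2 / (real (Suc n) + \<epsilon>)\<^sup>2 * ((real (Suc n) + \<epsilon>)\<^sup>2 * u (\<i> * of_real (real (Suc n) + \<epsilon>)) (\<i> * of_real (real (Suc n) + \<epsilon>)))) \<longlonglongrightarrow> 1 * 1"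
    by (intro tendsto_mult)
  then show "(\<lambda>n. (\<integral>\<^sup>+q. ennreal ((real (Suc n) * poisson_kernel (\<i> * of_real (real (Suc n))) (fst q)) *
        (real (Suc n) * poisson_kernel (\<i> * of_real (real (Suc n))) (snd q))) \<partial>M)) \<longlonglongrightarrow> 1"
    unfolding e using tendsto_ennrealI by fastforce
qed

text \<open>The measures at heights 1/(n + 1) have a weak limit along a subsequence. Products of
  kernels vanish at infinity, so their integrals converge even if mass escapes; that none does is
  then deduced from those very integrals.\<close>

theorem representing_measure:
  obtains \<mu> where "borel_prob \<mu>"
    "\<And>Z W. 0 < Im Z \<Longrightarrow> 0 < Im W \<Longrightarrow> (\<integral>q. poisson_kernel Z (fst q) * poisson_kernel W (snd q) \<partial>\<mu>) = u Z W"
proof -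
  have [measurable]: "fst \<in> borel_measurable (borel :: (real \<times> real) measure)" "snd \<in> borel_measurable (borel :: (real \<times> real) measure)"
    by (intro borel_measurable_continuous_onI continuous_intros)+
  define \<epsilon> where "\<epsilon> n = 1 / real (Suc n)" for n
  have \<epsilon>: "\<epsilon> n > 0" for n by (simp add: \<epsilon>_def)
  have \<epsilon>lim: "\<epsilon> \<longlonglongrightarrow> 0" unfolding \<epsilon>_def by real_asymp
  have bp: "borel_prob (approx (\<epsilon> n))" for n
    unfolding borel_prob_def
  proof
    show s: "sets (approx (\<epsilon> n)) = sets borel" by (simp add: approx_def)
    show "prob_space (approx (\<epsilon> n))"
      by (rule prob_space_by_kernels[OF s less_imp_le[OF \<epsilon>] approx_kernel[OF \<epsilon>]])
  qed
  obtain r \<nu> where r: "strict_mono (r :: nat \<Rightarrow> nat)" and fin: "finite_measure \<nu>" and sets: "sets \<nu> = sets (borel :: (real \<times> real) measure)"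
    and lim: "\<And>(h :: real \<times> real \<Rightarrow> real) B. continuous_on UNIV h \<Longrightarrow> (\<And>p. \<bar>h p\<bar> \<le> B) \<Longrightarrow>
       (\<And>a b. cos a = 0 \<or> cos b = 0 \<Longrightarrow> h (a, b) = 0) \<Longrightarrow>
       (\<lambda>n. \<integral>q. h (arctan (fst q), arctan (snd q)) \<partial>approx (\<epsilon> (r n))) \<longlonglongrightarrow> (\<integral>q. h (arctan (fst q), arctan (snd q)) \<partial>\<nu>)"
  proof -
    obtain r \<nu> where rn: "strict_mono (r :: nat \<Rightarrow> nat) \<and> finite_measure \<nu> \<and> sets \<nu> = sets (borel :: (real \<times> real) measure) \<and>
      (\<forall>(h :: real \<times> real \<Rightarrow> real) B. continuous_on UNIV h \<longrightarrow> (\<forall>p. \<bar>h p\<bar> \<le> B) \<longrightarrow>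
       (\<forall>a b. cos a = 0 \<or> cos b = 0 \<longrightarrow> h (a, b) = 0) \<longrightarrow>
       (\<lambda>n. \<integral>q. h (arctan (fst q), arctan (snd q)) \<partial>approx (\<epsilon> (r n))) \<longlonglongrightarrow> (\<integral>q. h (arctan (fst q), arctan (snd q)) \<partial>\<nu>))"
      using plane_weak_limit[of "\<lambda>n. approx (\<epsilon> n)", OF bp] by (elim exE)
    show thesis
    proof (rule that)
      show "strict_mono r" "finite_measure \<nu>" "sets \<nu> = sets borel" using rn by blast+
    next
      fix h :: "real \<times> real \<Rightarrow> real" and B
      assume h: "continuous_on UNIV h" "\<And>p. \<bar>h p\<bar> \<le> B" "\<And>a b. cos a = 0 \<or> cos b = 0 \<Longrightarrow> h (a, b) = 0"
      show "(\<lambda>n. \<integral>q. h (arctan (fst q), arctan (snd q)) \<partial>approx (\<epsilon> (r n))) \<longlonglongrightarrow> (\<integral>q. h (arctan (fst q), arctan (snd q)) \<partial>\<nu>)"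
        by (rule rn[THEN conjunct2, THEN conjunct2, THEN conjunct2, rule_format, of h B]; rule h; assumption)
    qed
  qed
  interpret \<nu>: finite_measure \<nu> by fact
  note [measurable_cong] = sets
  have val: "(\<integral>q. poisson_kernel Z (fst q) * poisson_kernel W (snd q) \<partial>\<nu>) = u Z W"
    if Z: "0 < Im Z" and W: "0 < Im W" for Z W
  proof -
    \<comment> \<open>In angular coordinates the kernels are continuous on the closed square and
      vanish on its boundary, as the weak limit requires of a test function.\<close>
    define h where "h p = angular_kernel Z (fst p) * angular_kernel W (snd p)" for p :: "real \<times> real"
    have "continuous_on UNIV h" unfolding h_def[abs_def]
      by (intro continuous_on_mult continuous_on_compose2[OF angular_kernel_continuous[OF Z, of UNIV]]
          continuous_on_compose2[OF angular_kernel_continuous[OF W, of UNIV]] continuous_intros) auto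
    moreover have "\<bar>h p\<bar> \<le> (1 / Im Z) * (1 / Im W)" for p
      using angular_kernel_bounds[OF Z, of "fst p"] angular_kernel_bounds[OF W, of "snd p"] Z W
      unfolding h_def abs_mult by (intro mult_mono) auto
    moreover have "h (a, b) = 0" if "cos a = 0 \<or> cos b = 0" for a b
      using that by (auto simp: h_def angular_kernel_def)
    ultimately have "(\<lambda>n. \<integral>q. h (arctan (fst q), arctan (snd q)) \<partial>approx (\<epsilon> (r n))) \<longlonglongrightarrow> (\<integral>q. h (arctan (fst q), arctan (snd q)) \<partial>\<nu>)"
      by (rule lim)
    moreover have hq: "h (arctan (fst q), arctan (snd q)) = poisson_kernel Z (fst q) * poisson_kernel W (snd q)" for q
      by (simp add: h_def angular_kernel_arctan)
    moreover have "(\<integral>q. poisson_kernel Z (fst q) * poisson_kernel W (snd q) \<partial>approx (\<epsilon> n)) = u (Z + \<i> * of_real (\<epsilon> n)) (W + \<i> * of_real (\<epsilon> n))" for n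
    proof (rule integral_eq_nn_integral[THEN trans])
      have "0 \<le> u (Z + \<i> * of_real (\<epsilon> n)) (W + \<i> * of_real (\<epsilon> n))" using Z W \<epsilon>[of n] by (intro u_nonneg) auto
      then show "enn2real (\<integral>\<^sup>+q. ennreal (poisson_kernel Z (fst q) * poisson_kernel W (snd q)) \<partial>approx (\<epsilon> n)) = u (Z + \<i> * of_real (\<epsilon> n)) (W + \<i> * of_real (\<epsilon> n))"
        by (simp add: approx_kernel[OF \<epsilon> Z W])
      have "sets (approx (\<epsilon> n)) = sets borel" by (simp add: approx_def)
      note [measurable_cong] = this
      show "(\<lambda>q. poisson_kernel Z (fst q) * poisson_kernel W (snd q)) \<in> borel_measurable (approx (\<epsilon> n))" by measurable
      show "AE q in approx (\<epsilon> n). 0 \<le> poisson_kernel Z (fst q) * poisson_kernel W (snd q)"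
        using poisson_kernel_nonneg Z W by simp
    qed
    ultimately have l: "(\<lambda>n. u (Z + \<i> * of_real (\<epsilon> (r n))) (W + \<i> * of_real (\<epsilon> (r n)))) \<longlonglongrightarrow> (\<integral>q. poisson_kernel Z (fst q) * poisson_kernel W (snd q) \<partial>\<nu>)"
      by simp
    have "continuous_on {0..} (\<lambda>e. u (Z + \<i> * of_real e) (W + \<i> * of_real e))"
      using Z W by (intro u_continuous continuous_intros) auto
    moreover have "(\<lambda>n. \<epsilon> (r n)) \<longlonglongrightarrow> 0" using LIMSEQ_subseq_LIMSEQ[OF \<epsilon>lim r] by (simp add: o_def)
    ultimately have "(\<lambda>n. u (Z + \<i> * of_real (\<epsilon> (r n))) (W + \<i> * of_real (\<epsilon> (r n)))) \<longlonglongrightarrow> u (Z + \<i> * of_real 0) (W + \<i> * of_real 0)"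
      by (rule continuous_on_tendsto_compose) (use \<epsilon> in \<open>auto intro!: always_eventually less_imp_le\<close>)
    from LIMSEQ_unique[OF l this] show ?thesis by simp
  qed
  have int: "integrable \<nu> (\<lambda>q. poisson_kernel Z (fst q) * poisson_kernel W (snd q))" if Z: "0 < Im Z" and W: "0 < Im W" for Z W
  proof (rule \<nu>.integrable_const_bound[of _ "(1 / Im Z) * (1 / Im W)"])
    have "\<bar>poisson_kernel Z a * poisson_kernel W b\<bar> \<le> (1 / Im Z) * (1 / Im W)" for a b
      unfolding abs_mult using poisson_kernel_nonneg poisson_kernel_le Z W by (intro mult_mono) auto
    then show "AE q in \<nu>. norm (poisson_kernel Z (fst q) * poisson_kernel W (snd q)) \<le> (1 / Im Z) * (1 / Im W)" by simp
  qed measurable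
  have "prob_space \<nu>"
  proof (rule prob_space_by_kernels[OF sets order_refl])
    fix Z W assume Z: "0 < Im Z" and W: "0 < Im W"
    have "(\<integral>\<^sup>+q. ennreal (poisson_kernel Z (fst q) * poisson_kernel W (snd q)) \<partial>\<nu>) = ennreal (u Z W)"
      unfolding val[OF Z W, symmetric] using int[OF Z W] poisson_kernel_nonneg Z W
      by (intro nn_integral_eq_integral) auto
    then show "(\<integral>\<^sup>+q. ennreal (poisson_kernel Z (fst q) * poisson_kernel W (snd q)) \<partial>\<nu>) = ennreal (u (Z + \<i> * of_real 0) (W + \<i> * of_real 0))"
      by simp
  qed
  then have "borel_prob \<nu>" using sets by (simp add: borel_prob_def)
  then show thesis using that val by blast
qed

text \<open>Pointwise, 1/(cnj a b) - 1/(a b) equals (a - cnj a) cnj b / |a b|^2, and the real part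
  of this numerator is 2 Im a Im b.\<close>

lemma cauchy_transform2_kernel:
  assumes \<mu>: "borel_prob \<mu>" and Z: "0 < Im Z" and W: "0 < Im W"
  shows "Re (cauchy_transform2 \<mu> (cnj Z) W - cauchy_transform2 \<mu> Z W) = 2 * (\<integral>q. poisson_kernel Z (fst q) * poisson_kernel W (snd q) \<partial>\<mu>)"
proof -
  interpret prob_space \<mu> using borel_probD(1)[OF \<mu>] .
  note [measurable] = measurable_fst_snd[OF \<mu>]
  have int: "integrable \<mu> (\<lambda>p. 1 / ((z - complex_of_real (fst p)) * (w - complex_of_real (snd p))))" if "z \<notin> \<real>" "w \<notin> \<real>" for z w
  proof (rule integrable_const_bound[of _ "(1 / \<bar>Im z\<bar>) * (1 / \<bar>Im w\<bar>)"])
    have "norm (1 / (z - complex_of_real a)) * norm (1 / (w - complex_of_real b)) \<le> (1 / \<bar>Im z\<bar>) * (1 / \<bar>Im w\<bar>)" for a b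
      using norm_inverse_diff_of_real_le that by (intro mult_mono) auto
    then show "AE p in \<mu>. norm (1 / ((z - complex_of_real (fst p)) * (w - complex_of_real (snd p)))) \<le> (1 / \<bar>Im z\<bar>) * (1 / \<bar>Im w\<bar>)"
      by (simp add: norm_divide norm_mult)
  qed measurable
  have pt: "Re (1 / ((cnj Z - complex_of_real s) * (W - complex_of_real t)) - 1 / ((Z - complex_of_real s) * (W - complex_of_real t))) = 2 * (poisson_kernel Z s * poisson_kernel W t)" for s t
  proof -
    define a b where "a = Z - complex_of_real s" and "b = W - complex_of_real t"
    have ab: "a \<noteq> 0" "b \<noteq> 0" using upper_minus_real_nonzero Z W by (simp_all add: a_def b_def)
    have ac: "cnj Z - complex_of_real s = cnj a" by (simp add: a_def)
    have "1 / (cnj a * b) - 1 / (a * b) = (a - cnj a) * cnj b / ((a * cnj a) * (b * cnj b))"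
      using ab by (simp add: field_simps)
    also have "\<dots> = (a - cnj a) * cnj b / of_real ((norm a)\<^sup>2 * (norm b)\<^sup>2)"
      by (simp only: complex_norm_square of_real_mult)
    finally have "Re (1 / (cnj a * b) - 1 / (a * b)) = Re ((a - cnj a) * cnj b) / ((norm a)\<^sup>2 * (norm b)\<^sup>2)"
      by (simp only: Re_divide_of_real)
    moreover have "Re ((a - cnj a) * cnj b) = 2 * Im Z * Im W" by (simp add: a_def b_def)
    ultimately show ?thesis unfolding ac a_def[symmetric] b_def[symmetric] poisson_kernel_def by simp
  qed
  note I = int[OF upper_notin_Reals(2)[OF Z] upper_notin_Reals(1)[OF W]] int[OF upper_notin_Reals(1)[OF Z] upper_notin_Reals(1)[OF W]]
  have "Re (cauchy_transform2 \<mu> (cnj Z) W - cauchy_transform2 \<mu> Z W) =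
    (\<integral>p. Re (1 / ((cnj Z - complex_of_real (fst p)) * (W - complex_of_real (snd p))) - 1 / ((Z - complex_of_real (fst p)) * (W - complex_of_real (snd p)))) \<partial>\<mu>)"
    unfolding cauchy_transform2_def Bochner_Integration.integral_diff[OF I, symmetric]
    by (rule integral_Re[symmetric, OF Bochner_Integration.integrable_diff[OF I]])
  then show ?thesis unfolding pt by simp
qed

text \<open>The measure reproduces only a real part of G, so the difference H of the two transforms
  has to be shown to vanish. This uses holomorphy in each variable, the decay of H, and its symmetry
  under simultaneous conjugation.\<close>

theorem plane_cauchy_representation:
  obtains \<mu> where "borel_prob \<mu>" "\<And>z w. z \<notin> \<real> \<Longrightarrow> w \<notin> \<real> \<Longrightarrow> cauchy_transform2 \<mu> z w = G z w"
proof -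
  obtain \<mu> where \<mu>: "borel_prob \<mu>"
    and val: "\<And>Z W. 0 < Im Z \<Longrightarrow> 0 < Im W \<Longrightarrow> (\<integral>q. poisson_kernel Z (fst q) * poisson_kernel W (snd q) \<partial>\<mu>) = u Z W"
    by (rule representing_measure) blast
  define H where "H z w = cauchy_transform2 \<mu> z w - G z w" for z w
  have Hz: "(\<lambda>z. H z w) holomorphic_on - \<real>" if "w \<notin> \<real>" for w
    unfolding H_def by (intro holomorphic_on_diff cauchy_transform2_holomorphic \<mu> holz that)
  have Hw: "(\<lambda>w. H z w) holomorphic_on - \<real>" if "z \<notin> \<real>" for z
    unfolding H_def by (intro holomorphic_on_diff cauchy_transform2_holomorphic \<mu> holw that)
  have Hc: "H (cnj z) (cnj w) = cnj (H z w)" if "z \<notin> \<real>" "w \<notin> \<real>" for z w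
    by (simp add: H_def cauchy_transform2_cnj sym that)
  have Hb: "norm (H z w) \<le> (1 + B) / (\<bar>Im z\<bar> * \<bar>Im w\<bar>)" if "z \<notin> \<real>" "w \<notin> \<real>" for z w
    using norm_triangle_ineq4[of "cauchy_transform2 \<mu> z w" "G z w"] cauchy_transform2_norm_le[OF \<mu> that] bound[OF that]
    by (simp add: H_def add_divide_distrib)
  note uR = upper_notin_Reals
  have Hpos: "norm (H z w) \<le> ((1 + B) / Im z) / Im w \<and> norm (H (cnj z) w) \<le> ((1 + B) / Im z) / Im w \<and> norm (H z (cnj w)) \<le> ((1 + B) / Im z) / Im w"
    if "0 < Im z" "0 < Im w" for z w
    using Hb[of z w] Hb[of "cnj z" w] Hb[of z "cnj w"] that uR by simp
  have two: "2 * x / y = x / y + x / y" for x y :: real by (metis add_divide_distrib mult_2)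
  \<comment> \<open>For fixed Z the difference is holomorphic in W with zero real part and decays,
    hence it is 0.\<close>
  have D: "H (cnj Z) W = H Z W" if Z: "0 < Im Z" and W: "0 < Im W" for Z W
  proof -
    have "H (cnj Z) W - H Z W = 0"
    proof (rule zero_of_Re_zero[where f="\<lambda>w. H (cnj Z) w - H Z w" and C="2 * ((1 + B) / Im Z)", OF _ _ _ W])
      show "(\<lambda>w. H (cnj Z) w - H Z w) holomorphic_on {z. 0 < Im z}"
        by (intro holomorphic_on_diff holomorphic_on_subset[OF Hw half_sub] uR Z)
      show "Re (H (cnj Z) w - H Z w) = 0" if w: "0 < Im w" for w
        using cauchy_transform2_kernel[OF \<mu> Z w] val[OF Z w] by (simp add: H_def u_def)
      show "norm (H (cnj Z) w - H Z w) \<le> 2 * ((1 + B) / Im Z) / Im w" if w: "0 < Im w" for w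
        using Hpos[OF Z w] norm_triangle_ineq4[of "H (cnj Z) w" "H Z w"] unfolding two by linarith
    qed
    then show ?thesis by simp
  qed
  have zero: "H Z W = 0 \<and> H Z (cnj W) = 0" if Z: "0 < Im Z" and W: "0 < Im W" for Z W
  proof -
    \<comment> \<open>H z W and H z (cnj W) are conjugate to each other, yet both are holomorphic in
      z. So their difference, and \<i> times their sum, are holomorphic with zero real part and
      vanish by decay.\<close>
    have AB: "H z W = cnj (H z (cnj W))" if z: "0 < Im z" for z
      using D[OF z W] Hc[of z "cnj W"] uR z W by simp
    have bd: "norm (H z W) \<le> ((1 + B) / Im W) / Im z" "norm (H z (cnj W)) \<le> ((1 + B) / Im W) / Im z" if z: "0 < Im z" for z
      using Hpos[OF z W] by (simp_all add: mult.commute)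
    have hol: "(\<lambda>z. H z W) holomorphic_on {z. 0 < Im z}" "(\<lambda>z. H z (cnj W)) holomorphic_on {z. 0 < Im z}"
      by (intro holomorphic_on_subset[OF Hz half_sub] uR W)+
    have m: "H Z W - H Z (cnj W) = 0"
    proof (rule zero_of_Re_zero[where f="\<lambda>z. H z W - H z (cnj W)" and C="2 * ((1 + B) / Im W)", OF _ _ _ Z])
      show "Re (H z W - H z (cnj W)) = 0" if "0 < Im z" for z using AB[OF that] by simp
      show "norm (H z W - H z (cnj W)) \<le> 2 * ((1 + B) / Im W) / Im z" if "0 < Im z" for z
        using bd[OF that] norm_triangle_ineq4[of "H z W" "H z (cnj W)"] unfolding two by linarith
    qed (intro holomorphic_on_diff hol)
    have p: "\<i> * (H Z W + H Z (cnj W)) = 0"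
    proof (rule zero_of_Re_zero[where f="\<lambda>z. \<i> * (H z W + H z (cnj W))" and C="2 * ((1 + B) / Im W)", OF _ _ _ Z])
      show "Re (\<i> * (H z W + H z (cnj W))) = 0" if "0 < Im z" for z using AB[OF that] by simp
      show "norm (\<i> * (H z W + H z (cnj W))) \<le> 2 * ((1 + B) / Im W) / Im z" if "0 < Im z" for z
        using bd[OF that] norm_triangle_ineq[of "H z W" "H z (cnj W)"] unfolding two norm_mult norm_ii by linarith
    qed (intro holomorphic_on_mult holomorphic_on_add holomorphic_on_const hol)
    from m p show ?thesis by (simp add: add_eq_0_iff)
  qed
  have all: "H z w = 0" if z: "z \<notin> \<real>" and w: "w \<notin> \<real>" for z w
  proof -
    have zw: "Im z \<noteq> 0" "Im w \<noteq> 0" using z w by (simp_all add: complex_is_Real_iff)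
    have "H z w = 0" if "0 < Im z"
      using zero[OF that, of w] zero[OF that, of "cnj w"] zw by (cases "0 < Im w") auto
    moreover have "H z w = 0" if "Im z < 0"
    proof -
      have "cnj (H z w) = H (cnj z) (cnj w)" using Hc[OF z w] by simp
      also have "\<dots> = 0" using zero[of "cnj z" w] zero[of "cnj z" "cnj w"] that zw by (cases "0 < Im w") auto
      finally show ?thesis by simp
    qed
    ultimately show ?thesis using zw by linarith
  qed
  show thesis by (rule that[OF \<mu>]) (use all in \<open>simp add: H_def\<close>)
qed

end

section \<open>The semigroup\<close>

definition levy_measure ::
  "(complex \<Rightarrow> complex) \<Rightarrow> (complex \<Rightarrow> complex) \<Rightarrow> (complex \<Rightarrow> complex \<Rightarrow> complex) \<Rightarrow> real \<Rightarrow> (real \<times> real) measure \<Rightarrow> bool" where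
  "levy_measure \<phi>1 \<phi>2 c t \<mu> \<longleftrightarrow> borel_prob \<mu> \<and>
     (\<forall>z w. z \<notin> \<real> \<longrightarrow> w \<notin> \<real> \<longrightarrow> cauchy_transform2 \<mu> z w = levy_cauchy \<phi>1 \<phi>2 c t z w)"

text \<open>In a Stolz angle |z| / |Im z| is bounded, so the slope of \<phi> at 1/z is at most a
  constant times |z R(z)|, which tends to 0 at the vertex.\<close>

lemma (in pick_flow) stolz_in_D:
  assumes R: "R_transform_on m \<alpha> \<beta> R" and ab: "\<alpha> > 0" "\<beta> > 0"
    and \<phi>R: "\<And>z. z \<in> stolz_pair \<alpha> \<beta> \<Longrightarrow> \<phi> (1 / z) = R z"
  shows "\<exists>\<beta>'>0. \<beta>' \<le> \<beta> \<and> (\<forall>z \<in> stolz_pair \<alpha> \<beta>'. 1 / z \<in> D)"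
proof -
  \<comment> \<open>Since |z| \<le> (1 + \<alpha>) |Im z|, this threshold bounds the slope by 1/(1 +
    t), and t/(1 + t) < 1.\<close>
  define \<eta> where "\<eta> = 1 / ((1 + t) * (1 + \<alpha>))"
  have \<eta>: "\<eta> > 0" using t ab by (simp add: \<eta>_def)
  have "((\<lambda>z. z * R z) \<longlongrightarrow> 0) (at 0 within stolz_pair \<alpha> \<beta>)" using R unfolding R_transform_on_def by blast
  from tendstoD[OF this \<eta>] obtain d where d: "d > 0"
    "\<And>z. z \<in> stolz_pair \<alpha> \<beta> \<Longrightarrow> z \<noteq> 0 \<Longrightarrow> dist z 0 < d \<Longrightarrow> dist (z * R z) 0 < \<eta>"
    unfolding eventually_at by blast
  define \<beta>' where "\<beta>' = min \<beta> (d / (1 + \<alpha>))"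
  have b: "\<beta>' > 0" "\<beta>' \<le> \<beta>" using d ab by (simp_all add: \<beta>'_def)
  have "1 / z \<in> D" if z: "z \<in> stolz_pair \<alpha> \<beta>'" for z
  proof -
    have zs: "z \<in> stolz_pair \<alpha> \<beta>" using z stolz_pair_mono[OF order_refl b(2)] by blast
    have im: "\<bar>Im z\<bar> > 0" "z \<noteq> 0" and re: "\<bar>Re z\<bar> < \<alpha> * \<bar>Im z\<bar>" and imb: "\<bar>Im z\<bar> < \<beta>'"
      using z by (auto simp: stolz_pair_iff)
    have nz: "norm z \<le> (1 + \<alpha>) * \<bar>Im z\<bar>" using cmod_le[of z] re by (simp add: algebra_simps)
    also have "\<dots> < (1 + \<alpha>) * (d / (1 + \<alpha>))" using imb ab by (intro mult_strict_left_mono) (simp_all add: \<beta>'_def)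
    also have "\<dots> = d" using ab by simp
    finally have "dist z 0 < d" by simp
    from d(2)[OF zs im(2) this] have s: "norm (z * \<phi> (1 / z)) < \<eta>" by (simp add: \<phi>R[OF zs])
    have R: "1 / z \<notin> \<real>" using im by (auto simp: complex_is_Real_iff Im_divide)
    have i: "\<bar>Im (1 / z)\<bar> = \<bar>Im z\<bar> / (norm z)\<^sup>2" unfolding cmod_power2 by (simp add: Im_divide abs_divide)
    have "pick_slope \<phi> (1 / z) \<le> norm (\<phi> (1 / z)) / \<bar>Im (1 / z)\<bar>" by (rule pick_slope_le[OF R])
    also have "\<dots> = norm (z * \<phi> (1 / z)) * (norm z / \<bar>Im z\<bar>)" unfolding i by (simp add: norm_mult power2_eq_square)
    also have "\<dots> \<le> \<eta> * (1 + \<alpha>)"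
      using s nz im \<eta> by (intro mult_mono) (simp_all add: divide_le_eq)
    also have "\<dots> = 1 / (1 + t)" using ab by (simp add: \<eta>_def)
    finally have "t * pick_slope \<phi> (1 / z) \<le> t * (1 / (1 + t))" using t by (intro mult_left_mono)
    also have "\<dots> < 1" using t by simp
    finally show ?thesis using R by (simp add: D_def pick_contraction_def)
  qed
  then show ?thesis using b by blast
qed

context levy_flow
begin

lemma levy_measure_exists: "\<exists>\<mu>. levy_measure \<phi>1 \<phi>2 c t \<mu>"
proof -
  interpret plane_nevanlinna G 2
    by unfold_locales (use G_holomorphic G_continuous G_bound G_cnj G_positive G_total_mass in auto)
  obtain \<mu> where "borel_prob \<mu>" "\<And>z w. z \<notin> \<real> \<Longrightarrow> w \<notin> \<real> \<Longrightarrow> cauchy_transform2 \<mu> z w = G z w"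
    by (rule plane_cauchy_representation) blast
  then show ?thesis unfolding levy_measure_def by blast
qed

lemma levy_measure_marginals:
  assumes \<mu>: "levy_measure \<phi>1 \<phi>2 c t \<mu>" and z: "z \<notin> \<real>"
  shows "cauchy_transform (marginal1 \<mu>) z = 1 / A.F z" "cauchy_transform (marginal2 \<mu>) z = 1 / B.F z"
proof -
  have bp: "borel_prob \<mu>" and G: "\<And>z w. z \<notin> \<real> \<Longrightarrow> w \<notin> \<real> \<Longrightarrow> cauchy_transform2 \<mu> z w = G z w"
    using \<mu> unfolding levy_measure_def by blast+
  define W where "W k = \<i> * complex_of_real (real (Suc k))" for k
  have W: "W k \<notin> \<real>" "W k \<noteq> 0" for k by (auto simp: W_def complex_is_Real_iff complex_eq_iff)
  have Winf: "filterlim (\<lambda>k. real (Suc k)) at_top sequentially" by real_asymp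
  have "(\<lambda>k. 1 / real (Suc k)) \<longlonglongrightarrow> 0" by real_asymp
  from tendsto_mult_left[OF tendsto_of_real[OF this], of "- \<i>"]
  moreover have "- \<i> * of_real (1 / real (Suc k)) = 1 / W k" for k
    unfolding W_def using of_nat_neq_0[of k, where 'a = complex] by (simp add: divide_simps del: of_nat_Suc)
  ultimately have 1: "(\<lambda>k. 1 / W k) \<longlonglongrightarrow> 0" by (simp del: of_nat_Suc)
  have 2: "(\<lambda>k. 1 / W k * W k) \<longlonglongrightarrow> 1" using W(2) by simp
  have 3: "1 \<le> 1 * (norm (1 / W k) * \<bar>Im (W k)\<bar>)" for k
    using W(2)[of k] by (simp add: W_def norm_mult norm_divide del: of_nat_Suc)
  note lims = cauchy_transform2_tendsto_marginal[OF bp z 1 2 3]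
  have "(\<lambda>k. W k * G z (W k)) \<longlonglongrightarrow> 1 / A.F z"
    using filterlim_compose[OF G_marginal1[OF z] Winf] by (simp only: W_def)
  then have "(\<lambda>k. cauchy_transform2 \<mu> z (W k) / (1 / W k)) \<longlonglongrightarrow> 1 / A.F z" using G[OF z W(1)] by (simp add: mult.commute)
  then show "cauchy_transform (marginal1 \<mu>) z = 1 / A.F z" by (rule LIMSEQ_unique[OF lims(1)])
  have "(\<lambda>k. W k * G (W k) z) \<longlonglongrightarrow> 1 / B.F z"
    using filterlim_compose[OF G_marginal2[OF z] Winf] by (simp only: W_def)
  then have "(\<lambda>k. cauchy_transform2 \<mu> (W k) z / (1 / W k)) \<longlonglongrightarrow> 1 / B.F z" using G[OF W(1) z] by (simp add: mult.commute)
  then show "cauchy_transform (marginal2 \<mu>) z = 1 / B.F z" by (rule LIMSEQ_unique[OF lims(2)])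
qed

text \<open>Close to the vertex 1/z is itself the solution of u + t \<phi>(u) = Z for Z = 1/z + t
  \<phi>(1/z). Hence t \<phi>(1/z) satisfies the functional equation of the marginal R-transform,
  and h reduces to 1 / (1 - t c).\<close>

lemma levy_measure_R_transform:
  assumes \<mu>: "levy_measure \<phi>1 \<phi>2 c t \<mu>" and ab: "\<alpha> > 0" "\<beta> > 0"
    and R1: "R_transform_on m1 \<alpha> \<beta> R1" and R2: "R_transform_on m2 \<alpha> \<beta> R2"
    and \<phi>1: "\<And>z. z \<in> stolz_pair \<alpha> \<beta> \<Longrightarrow> \<phi>1 (1 / z) = R1 z" and \<phi>2: "\<And>z. z \<in> stolz_pair \<alpha> \<beta> \<Longrightarrow> \<phi>2 (1 / z) = R2 z"
  shows "\<exists>\<beta>'>0. \<beta>' \<le> \<beta> \<and> bifree_R_transform_on \<mu> \<alpha> \<beta>' (\<lambda>p. of_real t * levy_R \<phi>1 \<phi>2 c p)"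
proof -
  have bp: "borel_prob \<mu>" and G: "\<And>z w. z \<notin> \<real> \<Longrightarrow> w \<notin> \<real> \<Longrightarrow> cauchy_transform2 \<mu> z w = G z w"
    using \<mu> unfolding levy_measure_def by blast+
  obtain \<beta>1 where b1: "\<beta>1 > 0" "\<beta>1 \<le> \<beta>" "\<forall>z \<in> stolz_pair \<alpha> \<beta>1. 1 / z \<in> A.D" using A.stolz_in_D[OF R1 ab \<phi>1] by blast
  obtain \<beta>2 where b2: "\<beta>2 > 0" "\<beta>2 \<le> \<beta>" "\<forall>z \<in> stolz_pair \<alpha> \<beta>2. 1 / z \<in> B.D" using B.stolz_in_D[OF R2 ab \<phi>2] by blast
  define \<beta>' where "\<beta>' = min \<beta>1 \<beta>2"
  have b: "\<beta>' > 0" "\<beta>' \<le> \<beta>" "\<beta>' \<le> \<beta>1" "\<beta>' \<le> \<beta>2" using b1 b2 by (auto simp: \<beta>'_def)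
  have D: "1 / z \<in> A.D" "1 / z \<in> B.D" "z \<in> stolz_pair \<alpha> \<beta>" if "z \<in> stolz_pair \<alpha> \<beta>'" for z
    using that b1(3) b2(3) stolz_pair_mono[OF order_refl b(3)] stolz_pair_mono[OF order_refl b(4)] stolz_pair_mono[OF order_refl b(2)] by blast+
  define S1 S2 where "S1 z = of_real t * \<phi>1 (1 / z)" and "S2 z = of_real t * \<phi>2 (1 / z)" for z
  have HR: "1 / z + S1 z \<notin> \<real>" "1 / z + S2 z \<notin> \<real>" if "z \<in> stolz_pair \<alpha> \<beta>'" for z
  proof -
    have "A.H (1 / z) \<in> - \<real>" using D(1)[OF that] A.H_image by blast
    then show "1 / z + S1 z \<notin> \<real>" by (simp add: S1_def)
    have "B.H (1 / z) \<in> - \<real>" using D(2)[OF that] B.H_image by blast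
    then show "1 / z + S2 z \<notin> \<real>" by (simp add: S2_def)
  qed
  have FH: "A.F (1 / z + S1 z) = 1 / z" "B.F (1 / z + S2 z) = 1 / z" if "z \<in> stolz_pair \<alpha> \<beta>'" for z
    using A.F_H[OF D(1)[OF that]] B.F_H[OF D(2)[OF that]] by (simp_all add: S1_def S2_def)
  have sub: "stolz_pair \<alpha> \<beta>' \<subseteq> stolz_pair \<alpha> \<beta>" by (rule stolz_pair_mono[OF order_refl b(2)])
  have Rt: "R_transform_on m \<alpha> \<beta>' S"
    if S: "\<And>z. S z = of_real t * \<phi> (1 / z)" and R: "R_transform_on m0 \<alpha> \<beta> R"
      and \<phi>: "\<And>z. z \<in> stolz_pair \<alpha> \<beta> \<Longrightarrow> \<phi> (1 / z) = R z"
      and HS: "\<And>z. z \<in> stolz_pair \<alpha> \<beta>' \<Longrightarrow> 1 / z + S z \<notin> \<real>"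
      and cS: "\<And>z. z \<in> stolz_pair \<alpha> \<beta>' \<Longrightarrow> cauchy_transform m (1 / z + S z) = z" for m m0 S R \<phi>
  proof -
    have SR: "S z = of_real t * R z" if "z \<in> stolz_pair \<alpha> \<beta>'" for z using S[of z] \<phi>[OF subsetD[OF sub that]] by simp
    have hR: "R holomorphic_on stolz_pair \<alpha> \<beta>'"
      by (rule holomorphic_on_subset[OF _ sub]) (use R in \<open>simp add: R_transform_on_def\<close>)
    have "(\<lambda>z. of_real t * R z) holomorphic_on stolz_pair \<alpha> \<beta>'" by (intro holomorphic_intros hR)
    then have "S holomorphic_on stolz_pair \<alpha> \<beta>'"
      by (subst holomorphic_cong[OF refl SR])
    moreover have "((\<lambda>z. z * S z) \<longlongrightarrow> 0) (at 0 within stolz_pair \<alpha> \<beta>')"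
    proof -
      have "((\<lambda>z. z * R z) \<longlongrightarrow> 0) (at 0 within stolz_pair \<alpha> \<beta>')"
        by (rule tendsto_within_subset[OF _ sub]) (use R in \<open>simp add: R_transform_on_def\<close>)
      from tendsto_mult_left[OF this, of "of_real t"]
      have l: "((\<lambda>z. of_real t * (z * R z)) \<longlongrightarrow> 0) (at 0 within stolz_pair \<alpha> \<beta>')" by simp
      have "\<forall>\<^sub>F z in at 0 within stolz_pair \<alpha> \<beta>'. of_real t * (z * R z) = z * S z"
        unfolding eventually_at_filter by (rule always_eventually) (simp add: SR)
      from Lim_transform_eventually[OF l this] show ?thesis .
    qed
    ultimately show ?thesis unfolding R_transform_on_def by (intro conjI ballI HS cS)
  qed
  have T1: "R_transform_on (marginal1 \<mu>) \<alpha> \<beta>' S1"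
    by (rule Rt[OF S1_def R1 \<phi>1 HR(1)]) (simp_all add: levy_measure_marginals[OF \<mu> HR(1)] FH)
  have T2: "R_transform_on (marginal2 \<mu>) \<alpha> \<beta>' S2"
    by (rule Rt[OF S2_def R2 \<phi>2 HR(2)]) (simp_all add: levy_measure_marginals[OF \<mu> HR(2)] FH)
  have "h_fun \<mu> S1 S2 z w \<noteq> 0 \<and> of_real t * levy_R \<phi>1 \<phi>2 c (z, w) = z * S1 z + w * S2 w + (1 - 1 / h_fun \<mu> S1 S2 z w)"
    if z: "z \<in> stolz_pair \<alpha> \<beta>'" and w: "w \<in> stolz_pair \<alpha> \<beta>'" for z w
  proof -
    have nz: "z \<noteq> 0" "w \<noteq> 0" using z w stolz_pair_nonzero by blast+
    have den: "1 - of_real t * c (1 / z) (1 / w) \<noteq> 0"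
      using D(1)[OF z] D(2)[OF w] by (intro denominator_nonzero) (simp_all add: A.D_def B.D_def)
    have "h_fun \<mu> S1 S2 z w = 1 / (1 - of_real t * c (1 / z) (1 / w))"
      unfolding h_fun_def G[OF HR(1)[OF z] HR(2)[OF w]] levy_cauchy_def FH(1)[OF z] FH(2)[OF w]
      using nz by simp
    then show ?thesis using den by (simp add: levy_R_def S1_def S2_def algebra_simps)
  qed
  then have "bifree_R_transform_on \<mu> \<alpha> \<beta>' (\<lambda>p. of_real t * levy_R \<phi>1 \<phi>2 c p)"
    unfolding bifree_R_transform_on_def stolz_domain_def
    by (intro exI[of _ S1] exI[of _ S2] conjI T1 T2) auto
  then show ?thesis using b by blast
qed

end

section \<open>Behaviour at time 0, and assembly of the semigroup\<close>

lemma pick_inverse_zero: "z \<notin> \<real> \<Longrightarrow> pick_inverse \<phi> 0 z = z"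
  unfolding pick_inverse_def by (rule the_equality) (auto simp: pick_contraction_def)

lemma levy_measure_zero: "levy_measure \<phi>1 \<phi>2 c 0 (return borel (0, 0))"
proof -
  have "borel_prob (return borel (0 :: real, 0 :: real))"
    by (simp add: borel_prob_def prob_space_return)
  moreover have "cauchy_transform2 (return borel (0, 0)) z w = 1 / (z * w)" if "z \<notin> \<real>" "w \<notin> \<real>" for z w
  proof -
    have "continuous_on UNIV (\<lambda>p :: real \<times> real. 1 / ((z - complex_of_real (fst p)) * (w - complex_of_real (snd p))))"
      using that by (intro continuous_intros) auto
    then have "(\<lambda>p :: real \<times> real. 1 / ((z - complex_of_real (fst p)) * (w - complex_of_real (snd p)))) \<in> borel_measurable borel"
      by (rule borel_measurable_continuous_onI)
    then show ?thesis unfolding cauchy_transform2_def by (subst integral_return) simp_all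
  qed
  ultimately show ?thesis by (simp add: levy_measure_def levy_cauchy_def pick_inverse_zero)
qed

text \<open>Im (1/(\<i> - s)) = -1/(1 + s^2): a single value of the Cauchy transform controls how
  much of the law lies away from 0.\<close>

lemma (in prob_space) integral_squash:
  assumes X: "X \<in> borel_measurable M"
  shows "(\<integral>x. (X x)\<^sup>2 / (1 + (X x)\<^sup>2) \<partial>M) = 1 + Im (cauchy_transform (distr M borel X) \<i>)"
proof -
  note [measurable] = X
  have i: "\<i> \<notin> \<real>" by (simp add: complex_is_Real_iff)
  note I = resolvent_integrable[OF X i]
  have "Im (1 / (\<i> - complex_of_real s)) = - 1 / (1 + s\<^sup>2)" for s
    by (simp add: Im_divide power2_eq_square)
  moreover have "s\<^sup>2 / (1 + s\<^sup>2) = 1 + - 1 / (1 + s\<^sup>2)" for s :: real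
  proof -
    have "1 + s\<^sup>2 \<noteq> 0" by (metis add.commute add_nonneg_eq_0_iff zero_le_one zero_le_power2 zero_neq_one)
    then show ?thesis by (simp add: field_simps)
  qed
  ultimately have "(\<integral>x. (X x)\<^sup>2 / (1 + (X x)\<^sup>2) \<partial>M) = (\<integral>x. 1 + Im (1 / (\<i> - complex_of_real (X x))) \<partial>M)" by simp
  also have "\<dots> = 1 + (\<integral>x. Im (1 / (\<i> - complex_of_real (X x))) \<partial>M)"
    using integrable_Im[OF I] by (subst Bochner_Integration.integral_add) (simp_all add: prob_space)
  also have "(\<integral>x. Im (1 / (\<i> - complex_of_real (X x))) \<partial>M) = Im (cauchy_transform (distr M borel X) \<i>)"
    unfolding cauchy_transform_distr[OF X] by (rule integral_Im[OF I])
  finally show ?thesis .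
qed

text \<open>A Chebyshev argument with the bounded function s^2/(1 + s^2), whose mean under each
  marginal is 1 + Im G(\<i>) and tends to 0.\<close>

lemma weakly_converges_origin:
  fixes N :: "real \<Rightarrow> (real \<times> real) measure"
  assumes bp: "\<And>t. 0 < t \<Longrightarrow> borel_prob (N t)"
    and lim: "((\<lambda>t. cauchy_transform (marginal1 (N t)) \<i>) \<longlongrightarrow> - \<i>) (at_right 0)"
      "((\<lambda>t. cauchy_transform (marginal2 (N t)) \<i>) \<longlongrightarrow> - \<i>) (at_right 0)"
  shows "weakly_converges N (return borel (0, 0)) (at_right 0)"
  unfolding weakly_converges_def
proof (intro allI impI)
  fix f :: "real \<times> real \<Rightarrow> real" assume f: "continuous_on UNIV f \<and> bounded (range f)"
  then obtain M where M: "\<And>p. \<bar>f p\<bar> \<le> M" by (auto simp: bounded_iff)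
  have M0: "0 \<le> M" using M[of "(0,0)"] by linarith
  have mf: "f \<in> borel_measurable borel" using f by (intro borel_measurable_continuous_onI) auto
  define g where "g s = s\<^sup>2 / (1 + s\<^sup>2)" for s :: real
  have g: "0 \<le> g s" "g s \<le> 1" for s
  proof -
    have p: "0 < 1 + s\<^sup>2" by (simp add: add_pos_nonneg)
    then show "0 \<le> g s" "g s \<le> 1" by (simp_all add: g_def divide_le_eq)
  qed
  have gmono: "g a \<le> g s" if "a\<^sup>2 \<le> s\<^sup>2" for a s
  proof -
    have p: "0 < 1 + s\<^sup>2" "0 < 1 + a\<^sup>2" by (simp_all add: add_pos_nonneg)
    have "a\<^sup>2 * (1 + s\<^sup>2) \<le> s\<^sup>2 * (1 + a\<^sup>2)" using that by (simp add: algebra_simps)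
    then show ?thesis using p by (simp add: g_def frac_le_eq divide_simps)
  qed
  have Vlim: "((\<lambda>t. 1 + Im (cauchy_transform (marginal1 (N t)) \<i>) + (1 + Im (cauchy_transform (marginal2 (N t)) \<i>))) \<longlongrightarrow> 1 + Im (- \<i>) + (1 + Im (- \<i>))) (at_right 0)"
    by (intro tendsto_intros lim)
  have int0: "(\<integral>p. f p \<partial>return borel (0, 0)) = f (0, 0)" using mf by (simp add: integral_return)
  show "((\<lambda>t. \<integral>p. f p \<partial>N t) \<longlongrightarrow> (\<integral>p. f p \<partial>return borel (0, 0))) (at_right 0)"
    unfolding int0
  proof (rule tendstoI)
    fix \<epsilon> :: real assume \<epsilon>: "\<epsilon> > 0"
    have "isCont f (0, 0)" using f by (simp add: continuous_on_eq_continuous_at)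
    then obtain d where d: "d > 0" "\<And>p. dist p (0, 0) < d \<Longrightarrow> dist (f p) (f (0, 0)) < \<epsilon> / 2"
      unfolding continuous_at_eps_delta using \<epsilon> by (metis half_gt_zero)
    \<comment> \<open>Outside the ball of radius d one coordinate has modulus at least d/2, so the
      two squash functions add up to at least \<kappa> there, while f differs from its value at the
      origin by at most 2 M.\<close>
    define \<kappa> where "\<kappa> = g (d / 2)"
    have \<kappa>: "\<kappa> > 0" using d(1) by (simp add: \<kappa>_def g_def add_pos_nonneg)
    have pt: "\<bar>f p - f (0, 0)\<bar> \<le> \<epsilon> / 2 + 2 * M / \<kappa> * (g (fst p) + g (snd p))" for p
    proof (cases "dist p (0, 0) < d")
      case True
      have "0 \<le> 2 * M / \<kappa> * (g (fst p) + g (snd p))" using M0 \<kappa> g by (intro mult_nonneg_nonneg divide_nonneg_nonneg add_nonneg_nonneg) auto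
      then show ?thesis using d(2)[OF True] by (simp add: dist_real_def)
    next
      case False
      have "d \<le> \<bar>fst p\<bar> + \<bar>snd p\<bar>"
      proof -
        have "dist p (0, 0) = norm p" by (simp add: zero_prod_def[symmetric])
        then show ?thesis using False norm_Pair_le[of "fst p" "snd p"] by simp
      qed
      then have "d / 2 \<le> \<bar>fst p\<bar> \<or> d / 2 \<le> \<bar>snd p\<bar>" by linarith
      then have "(d / 2)\<^sup>2 \<le> (fst p)\<^sup>2 \<or> (d / 2)\<^sup>2 \<le> (snd p)\<^sup>2"
        using d(1) by (simp add: abs_le_square_iff[symmetric])
      then have "\<kappa> \<le> g (fst p) + g (snd p)"
        unfolding \<kappa>_def using gmono[of "d / 2" "fst p"] gmono[of "d / 2" "snd p"] g(1)[of "fst p"] g(1)[of "snd p"] by linarith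
      then have "2 * M / \<kappa> * \<kappa> \<le> 2 * M / \<kappa> * (g (fst p) + g (snd p))"
        using M0 \<kappa> by (intro mult_left_mono) auto
      moreover have "\<bar>f p - f (0, 0)\<bar> \<le> 2 * M" using M[of p] M[of "(0, 0)"] by linarith
      ultimately show ?thesis using \<kappa> \<epsilon> by simp
    qed
    have est: "\<bar>(\<integral>p. f p \<partial>N t) - f (0, 0)\<bar> \<le> \<epsilon> / 2 + 2 * M / \<kappa> * (1 + Im (cauchy_transform (marginal1 (N t)) \<i>) + (1 + Im (cauchy_transform (marginal2 (N t)) \<i>)))"
      if t: "0 < t" for t
    proof -
      interpret prob_space "N t" using borel_probD(1)[OF bp[OF t]] .
      note m [measurable] = measurable_fst_snd[OF bp[OF t]]
      have [measurable]: "f \<in> borel_measurable (N t)" using mf borel_probD(2)[OF bp[OF t]] by (simp cong: measurable_cong_sets)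
      have intf: "integrable (N t) f" using M by (intro integrable_bounded[of _ M]) auto
      have ig: "integrable (N t) (\<lambda>p. g (fst p))" "integrable (N t) (\<lambda>p. g (snd p))"
        using g unfolding g_def by (intro integrable_bounded[of _ 1]; simp)+
      have "\<bar>(\<integral>p. f p \<partial>N t) - f (0, 0)\<bar> = \<bar>\<integral>p. f p - f (0, 0) \<partial>N t\<bar>"
        using intf by (simp add: prob_space)
      also have "\<dots> \<le> (\<integral>p. \<bar>f p - f (0, 0)\<bar> \<partial>N t)" by simp
      also have "\<dots> \<le> (\<integral>p. \<epsilon> / 2 + 2 * M / \<kappa> * (g (fst p) + g (snd p)) \<partial>N t)"
        using intf ig pt by (intro integral_mono) auto
      also have "\<dots> = \<epsilon> / 2 + 2 * M / \<kappa> * ((\<integral>p. g (fst p) \<partial>N t) + (\<integral>p. g (snd p) \<partial>N t))"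
        using ig by (simp add: prob_space)
      finally show ?thesis unfolding g_def integral_squash[OF m(1)] integral_squash[OF m(2)] marginal1_def marginal2_def .
    qed
    have "((\<lambda>t. \<epsilon> / 2 + 2 * M / \<kappa> * (1 + Im (cauchy_transform (marginal1 (N t)) \<i>) + (1 + Im (cauchy_transform (marginal2 (N t)) \<i>)))) \<longlongrightarrow> \<epsilon> / 2 + 2 * M / \<kappa> * (1 + Im (- \<i>) + (1 + Im (- \<i>)))) (at_right 0)"
      by (intro tendsto_add tendsto_mult tendsto_const Vlim)
    then have "\<forall>\<^sub>F t in at_right 0. \<epsilon> / 2 + 2 * M / \<kappa> * (1 + Im (cauchy_transform (marginal1 (N t)) \<i>) + (1 + Im (cauchy_transform (marginal2 (N t)) \<i>))) < \<epsilon>"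
      by (rule order_tendstoD(2)) (use \<epsilon> in simp)
    moreover have "\<forall>\<^sub>F t in at_right (0::real). 0 < t" by (rule eventually_at_right_less)
    ultimately show "\<forall>\<^sub>F t in at_right 0. dist (\<integral>p. f p \<partial>N t) (f (0, 0)) < \<epsilon>"
    proof eventually_elim
      case (elim t)
      then show ?case using est[OF elim(2)] by (simp add: dist_real_def)
    qed
  qed
qed

text \<open>\<i> solves the equation at \<i> up to the error t \<phi>(\<i>), and for small t its
  contraction factor exceeds 1/2.\<close>

lemma pick_inverse_tendsto:
  assumes pick: "pick_function \<phi>" and asym: "((\<lambda>y. \<phi> (\<i> * of_real y) / of_real y) \<longlongrightarrow> 0) at_top"
  shows "((\<lambda>t. pick_inverse \<phi> t \<i>) \<longlongrightarrow> \<i>) (at_right 0)"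
proof -
  have i: "\<i> \<notin> \<real>" by (simp add: complex_is_Real_iff)
  have "((\<lambda>t. t * pick_slope \<phi> \<i>) \<longlongrightarrow> 0 * pick_slope \<phi> \<i>) (at_right 0)" by (intro tendsto_intros)
  then have ev: "\<forall>\<^sub>F t in at_right 0. t * pick_slope \<phi> \<i> < 1/2" by (intro order_tendstoD(2)) auto
  have "((\<lambda>t. \<i> - pick_inverse \<phi> t \<i>) \<longlongrightarrow> 0) (at_right 0)"
  proof (rule Lim_null_comparison)
    show "\<forall>\<^sub>F t in at_right 0. norm (\<i> - pick_inverse \<phi> t \<i>) \<le> 4 * norm (\<phi> \<i>) * t"
      using ev eventually_at_right_less[of "0::real"]
    proof eventually_elim
      case (elim t)
      interpret pick_flow \<phi> t using pick asym elim by unfold_locales auto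
      have "norm (\<i> - F \<i>) * (1/2) \<le> norm (\<i> - F \<i>) * e \<i>"
        using elim by (intro mult_left_mono) (simp_all add: pick_contraction_def)
      also have "\<dots> \<le> 2 * norm (of_real t * \<phi> \<i>)" using F_near[OF i i] by simp
      finally show ?case using elim by (simp add: norm_mult mult.commute mult.left_commute)
    qed
    have "((\<lambda>t. 4 * norm (\<phi> \<i>) * t) \<longlongrightarrow> 4 * norm (\<phi> \<i>) * 0) (at_right 0)" by (intro tendsto_intros)
    then show "((\<lambda>t. 4 * norm (\<phi> \<i>) * t) \<longlongrightarrow> 0) (at_right 0)" by simp
  qed
  from tendsto_diff[OF tendsto_const this, of \<i>] show ?thesis by simp
qed

lemma BID_imp_bifree_semigroup:
  assumes \<nu>: "\<nu> \<in> BID"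
  shows "\<exists>N. bifree_semigroup N \<and> N 1 = \<nu> \<and>
      (\<exists>F. bifree_R_extension \<nu> F \<and>
        (\<forall>t\<ge>0. \<exists>Ft. bifree_R_extension (N t) Ft \<and>
          (\<forall>z w. z \<notin> \<real> \<and> w \<notin> \<real> \<longrightarrow> Ft (z, w) = complex_of_real t * F (z, w))))"
proof -
  have \<nu>p: "borel_prob \<nu>" using \<nu> by (simp add: BID_def)
  obtain \<alpha> \<beta> R1 R2 \<phi>1 \<phi>2 c where ab: "\<alpha> > 0" "\<beta> > 0"
    and R: "R_transform_on (marginal1 \<nu>) \<alpha> \<beta> R1" "R_transform_on (marginal2 \<nu>) \<alpha> \<beta> R2"
    and \<phi>: "\<And>z. z \<in> stolz_pair \<alpha> \<beta> \<Longrightarrow> \<phi>1 (1 / z) = R1 z" "\<And>z. z \<in> stolz_pair \<alpha> \<beta> \<Longrightarrow> \<phi>2 (1 / z) = R2 z"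
    and h: "\<And>z w. z \<in> stolz_pair \<alpha> \<beta> \<Longrightarrow> w \<in> stolz_pair \<alpha> \<beta> \<Longrightarrow> h_fun \<nu> R1 R2 z w \<noteq> 0"
    and c: "\<And>z w. z \<in> stolz_pair \<alpha> \<beta> \<Longrightarrow> w \<in> stolz_pair \<alpha> \<beta> \<Longrightarrow> c (1 / z) (1 / w) = 1 - 1 / h_fun \<nu> R1 R2 z w"
    and lp: "levy_pair \<phi>1 \<phi>2 c"
    by (rule BID_imp_levy_pair[OF \<nu>]) blast
  have flow: "levy_flow \<phi>1 \<phi>2 c t" if "0 \<le> t" for t using lp that by unfold_locales
  define F where "F = levy_R \<phi>1 \<phi>2 c"
  have Fhol: "holomorphic2_on F ((- \<real>) \<times> (- \<real>))"
    unfolding F_def by (rule levy_flow.levy_R_holomorphic[OF flow[of 0]]) simp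
  have F\<nu>: "bifree_R_transform_on \<nu> \<alpha> \<beta> F"
    unfolding bifree_R_transform_on_def stolz_domain_def
    by (intro exI[of _ R1] exI[of _ R2] conjI R) (auto simp: h c F_def levy_R_def \<phi>)
  \<comment> \<open>Times 0 and 1 are prescribed so that \<open>N 0\<close> is the point mass and
    \<open>N 1 = \<nu>\<close> by definition; at every other t \<ge> 0 a measure with Cauchy
    transform \<open>levy_cauchy\<close> is chosen.\<close>
  define N where "N t = (if t = 0 then return borel (0, 0) else if t = 1 then \<nu> else (SOME \<mu>. levy_measure \<phi>1 \<phi>2 c t \<mu>))" for t :: real
  have lev: "levy_measure \<phi>1 \<phi>2 c t (N t)" if "0 \<le> t" "t \<noteq> 1" for t
    using that levy_measure_zero someI_ex[OF levy_flow.levy_measure_exists[OF flow[OF that(1)]]] by (simp add: N_def)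
  have bp: "borel_prob (N t)" if "0 \<le> t" for t
  proof (cases "t = 1")
    case True then show ?thesis using \<nu>p by (simp add: N_def)
  next
    case False then show ?thesis using lev[OF that] by (simp add: levy_measure_def)
  qed
  have RN: "\<exists>\<beta>'>0. \<beta>' \<le> \<beta> \<and> bifree_R_transform_on (N t) \<alpha> \<beta>' (\<lambda>p. of_real t * F p)" if t: "0 \<le> t" for t
  proof (cases "t = 1")
    case True then show ?thesis using F\<nu> ab by (intro exI[of _ \<beta>]) (simp add: N_def)
  next
    case False
    show ?thesis unfolding F_def
      by (rule levy_flow.levy_measure_R_transform[OF flow[OF t] lev[OF t False] ab R \<phi>])
  qed
  have hol: "holomorphic2_on (\<lambda>p. of_real t * F p) ((- \<real>) \<times> (- \<real>))" for t :: real
    unfolding holomorphic2_on_def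
  proof
    fix p :: "complex \<times> complex" assume "p \<in> (- \<real>) \<times> (- \<real>)"
    then obtain a b where "(F has_derivative (\<lambda>v. a * fst v + b * snd v)) (at p within (- \<real>) \<times> (- \<real>))"
      using Fhol unfolding holomorphic2_on_def by blast
    then have "((\<lambda>p. of_real t * F p) has_derivative (\<lambda>v. of_real t * (a * fst v + b * snd v))) (at p within (- \<real>) \<times> (- \<real>))"
      by (rule has_derivative_mult_right)
    then show "\<exists>a b. ((\<lambda>p. of_real t * F p) has_derivative (\<lambda>v. a * fst v + b * snd v)) (at p within (- \<real>) \<times> (- \<real>))"
      by (intro exI[of _ "of_real t * a"] exI[of _ "of_real t * b"]) (simp add: algebra_simps)
  qed
  have ext: "bifree_R_extension (N t) (\<lambda>p. of_real t * F p)" if "0 \<le> t" for t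
    using hol RN[OF that] ab unfolding bifree_R_extension_def by blast
  \<comment> \<open>The R-transforms at times s, t, s + t come on Stolz angles of the same opening
    but possibly different heights; the smallest height gives the common domain, where additivity is
    linearity in time.\<close>
  have conv: "is_bifree_convolution (N s) (N t) (N (s + t))" if st: "0 \<le> s" "0 \<le> t" for s t
  proof -
    have st': "0 \<le> s + t" using st by simp
    obtain b1 where b1: "b1 > 0" "bifree_R_transform_on (N s) \<alpha> b1 (\<lambda>p. of_real s * F p)" using RN[OF st(1)] by blast
    obtain b2 where b2: "b2 > 0" "bifree_R_transform_on (N t) \<alpha> b2 (\<lambda>p. of_real t * F p)" using RN[OF st(2)] by blast
    obtain b3 where b3: "b3 > 0" "bifree_R_transform_on (N (s + t)) \<alpha> b3 (\<lambda>p. of_real (s + t) * F p)" using RN[OF st'] by blast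
    define b where "b = min b1 (min b2 b3)"
    have b: "b > 0" "b \<le> b1" "b \<le> b2" "b \<le> b3" using b1 b2 b3 by (auto simp: b_def)
    note T = bifree_R_transform_on_mono[OF b1(2) order_refl b(2)] bifree_R_transform_on_mono[OF b2(2) order_refl b(3)]
      bifree_R_transform_on_mono[OF b3(2) order_refl b(4)]
    have "\<forall>p \<in> stolz_domain \<alpha> b. of_real (s + t) * F p = of_real s * F p + of_real t * F p"
      by (simp add: distrib_right)
    then show ?thesis unfolding is_bifree_convolution_def using bp st st' ab b(1) T by blast
  qed
  have N0: "N 0 = return borel (0, 0)" by (simp add: N_def)
  have marg: "((\<lambda>t. cauchy_transform (marginal1 (N t)) \<i>) \<longlongrightarrow> - \<i>) (at_right 0)"
    "((\<lambda>t. cauchy_transform (marginal2 (N t)) \<i>) \<longlongrightarrow> - \<i>) (at_right 0)"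
  proof -
    have i: "\<i> \<notin> \<real>" by (simp add: complex_is_Real_iff)
    have ev: "\<forall>\<^sub>F t in at_right (0::real). 0 < t \<and> t < 1" by (auto simp: eventually_at_right_field intro!: exI[of _ 1])
    have p: "pick_function \<phi>1" "pick_function \<phi>2" "((\<lambda>y. \<phi>1 (\<i> * of_real y) / of_real y) \<longlongrightarrow> 0) at_top"
      "((\<lambda>y. \<phi>2 (\<i> * of_real y) / of_real y) \<longlongrightarrow> 0) at_top" using lp unfolding levy_pair_def by blast+
    have l: "((\<lambda>t. 1 / pick_inverse \<phi>1 t \<i>) \<longlongrightarrow> 1 / \<i>) (at_right 0)" "((\<lambda>t. 1 / pick_inverse \<phi>2 t \<i>) \<longlongrightarrow> 1 / \<i>) (at_right 0)"
      by (intro tendsto_intros pick_inverse_tendsto p; simp)+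
    have e1: "\<forall>\<^sub>F t in at_right 0. 1 / pick_inverse \<phi>1 t \<i> = cauchy_transform (marginal1 (N t)) \<i>"
      using ev by eventually_elim (simp add: levy_flow.levy_measure_marginals(1)[OF flow lev i])
    have e2: "\<forall>\<^sub>F t in at_right 0. 1 / pick_inverse \<phi>2 t \<i> = cauchy_transform (marginal2 (N t)) \<i>"
      using ev by eventually_elim (simp add: levy_flow.levy_measure_marginals(2)[OF flow lev i])
    show "((\<lambda>t. cauchy_transform (marginal1 (N t)) \<i>) \<longlongrightarrow> - \<i>) (at_right 0)"
      using Lim_transform_eventually[OF l(1) e1] by simp
    show "((\<lambda>t. cauchy_transform (marginal2 (N t)) \<i>) \<longlongrightarrow> - \<i>) (at_right 0)"
      using Lim_transform_eventually[OF l(2) e2] by simp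
  qed
  have "weakly_converges N (N 0) (at_right 0)"
    unfolding N0 by (rule weakly_converges_origin[OF _ marg]) (simp add: bp)
  then have sg: "bifree_semigroup N" unfolding bifree_semigroup_def using bp conv N0 by blast
  have N1: "N 1 = \<nu>" by (simp add: N_def)
  have F: "bifree_R_extension \<nu> F" unfolding bifree_R_extension_def using Fhol F\<nu> ab by blast
  have R: "\<forall>t\<ge>0. \<exists>Ft. bifree_R_extension (N t) Ft \<and>
          (\<forall>z w. z \<notin> \<real> \<and> w \<notin> \<real> \<longrightarrow> Ft (z, w) = complex_of_real t * F (z, w))"
  proof (intro allI impI)
    fix t :: real assume t: "0 \<le> t"
    show "\<exists>Ft. bifree_R_extension (N t) Ft \<and>
          (\<forall>z w. z \<notin> \<real> \<and> w \<notin> \<real> \<longrightarrow> Ft (z, w) = complex_of_real t * F (z, w))"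
      by (intro exI[of _ "\<lambda>p. of_real t * F p"] conjI ext[OF t]) simp
  qed
  show ?thesis by (rule exI[of _ N], intro conjI sg N1, rule exI[of _ F], intro conjI F R)
qed

theorem proposition3p13:
  fixes \<nu> :: "(real \<times> real) measure"
  assumes "prob_space \<nu>" and "sets \<nu> = sets borel"
  shows "\<nu> \<in> BID \<longleftrightarrow>
    (\<exists>N. bifree_semigroup N \<and> N 1 = \<nu> \<and>
      (\<exists>F. bifree_R_extension \<nu> F \<and>
        (\<forall>t\<ge>0. \<exists>Ft. bifree_R_extension (N t) Ft \<and>
          (\<forall>z w. z \<notin> \<real> \<and> w \<notin> \<real> \<longrightarrow> Ft (z, w) = complex_of_real t * F (z, w)))))"
proof
  assume "\<nu> \<in> BID"
  then show "\<exists>N. bifree_semigroup N \<and> N 1 = \<nu> \<and>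
      (\<exists>F. bifree_R_extension \<nu> F \<and>
        (\<forall>t\<ge>0. \<exists>Ft. bifree_R_extension (N t) Ft \<and>
          (\<forall>z w. z \<notin> \<real> \<and> w \<notin> \<real> \<longrightarrow> Ft (z, w) = complex_of_real t * F (z, w))))"
    by (rule BID_imp_bifree_semigroup)
next
  have \<nu>: "borel_prob \<nu>" using assms by (simp add: borel_prob_def)
  assume "\<exists>N. bifree_semigroup N \<and> N 1 = \<nu> \<and>
      (\<exists>F. bifree_R_extension \<nu> F \<and>
        (\<forall>t\<ge>0. \<exists>Ft. bifree_R_extension (N t) Ft \<and>
          (\<forall>z w. z \<notin> \<real> \<and> w \<notin> \<real> \<longrightarrow> Ft (z, w) = complex_of_real t * F (z, w))))"
  then obtain N F where N: "bifree_semigroup N" and F: "bifree_R_extension \<nu> F"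
    and Ft: "\<forall>t\<ge>0. \<exists>Ft. bifree_R_extension (N t) Ft \<and>
          (\<forall>z w. z \<notin> \<real> \<and> w \<notin> \<real> \<longrightarrow> Ft (z, w) = complex_of_real t * F (z, w))"
    by (elim exE conjE)
  show "\<nu> \<in> BID" by (rule bifree_semigroup_imp_BID[OF \<nu> N F]) (use Ft in simp)
qed

end
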